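(* Let $\Omega\subset\mathbb{R}^n$ ($n\ge2$) be a bounded domain, let $1<p\le q<\infty$, let $\omega\in A_p$, and let $\varphi\in\Phi_{\mathrm c}(\Omega)$ satisfy (A1)$_\omega$, (aInc)$_p$ and (aDec)$_q$. Put $\psi(x,t):=\varphi(x,t)\omega(x)$ and $I_\psi(v):=\int_\Omega\psi(x,|\nabla v|)\,dx$. Let $z\in W^{1,\psi}(\Omega)$. Then there exists a function $u\in z+W^{1,\psi}_0(\Omega)$ such that $$I_\psi(u)=\inf_{v\in z+W^{1,\psi}_0(\Omega)}I_\psi(v).$$
   Context: Weights. A weight $\omega$ is a non-negative locally integrable function on $\mathbb{R}^n$; $\omega(E):=\int_E\omega\,dx$. For $1<\gamma<\infty$, $\omega\in A_\gamma$ means $[\omega]_{A_\gamma}:=\sup_B\left(\frac1{|B|}\int_B\omega\,dx\right)\left(\frac1{|B|}\int_B\omega^{-\frac1{\gamma-1}}dx\right)^{\gamma-1}<\infty$, the supremum over all balls $B\subset\mathbb{R}^n$. $f$ is almost increasing with constant $L\ge1$ if $f(s)\le Lf(t)$ whenever $s\le t$; increasing if $L=1$; almost decreasing is analogous. $\Phi$-functions. A $\Phi$-prefunction on $\Omega$ is a function $\varphi:\Omega\times[0,\infty)\to[0,\infty]$ such that $x\mapsto\varphi(x,|f(x)|)$ is measurable for every measurable $f$ on $\Omega$, and, for every $x\in\Omega$, $t\mapsto\varphi(x,t)$ is increasing, $\varphi(x,0)=\lim_{t\to0^+}\varphi(x,t)=0$ and $\lim_{t\to\infty}\varphi(x,t)=\infty$.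 $\Phi_{\mathrm c}(\Omega)$ is the set of $\Phi$-prefunctions for which $t\mapsto\varphi(x,t)$ is left-continuous and convex for every $x\in\Omega$. Conditions (for every $x\in\Omega$, with a constant $L\ge1$ independent of $x$): (aInc)$_\gamma$: $t\mapsto t^{-\gamma}\varphi(x,t)$ is almost increasing on $(0,\infty)$ with constant $L$. (aDec)$_\gamma$: $t\mapsto t^{-\gamma}\varphi(x,t)$ is almost decreasing on $(0,\infty)$ with constant $L$. (A1)$_\omega$: with $\varphi^{-1}(x,t):=\inf\{\tau\ge0:\varphi(x,\tau)\ge t\}$, there is $\beta_1\in(0,1]$ such that $\beta_1\varphi^{-1}(x,t)\le\varphi^{-1}(y,t)$ for every $t\in[1,\frac1{\omega(B)}]$, almost every $x,y\in B\cap\Omega$ and every ball $B$ with $\omega(B)\le1$. Spaces. $L^\psi(\Omega)$ is the set of measurable $f$ with $\|f\|_{L^\psi(\Omega)}:=\inf\{\lambda>0:\int_\Omega\psi(x,|f|/\lambda)\,dx\le1\}<\infty$. $W^{1,\psi}(\Omega)$ is the set of $f\in L^\psi(\Omega)\cap L^1_{\mathrm{loc}}(\Omega)$ with weak gradient satisfying $\|f\|_{W^{1,\psi}(\Omega)}:=\|f\|_{L^\psi(\Omega)}+\||\nabla f|\|_{L^\psi(\Omega)}<\infty$, and $W^{1,\psi}_0(\Omega)$ is the closure of $C_0^\infty(\Omega)$ in $W^{1,\psi}(\Omega)$. *)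

theory Defs
  imports "HOL-Analysis.Analysis"
begin

subsection \<open>Weights\<close>

definition locally_integrable_on :: "('a::euclidean_space \<Rightarrow> 'b::euclidean_space) \<Rightarrow> 'a set \<Rightarrow> bool"
    (infixr \<open>locally'_integrable'_on\<close> 46)
  where "f locally_integrable_on \<Omega> \<longleftrightarrow>
    (\<forall>K. compact K \<and> K \<subseteq> \<Omega> \<longrightarrow> f absolutely_integrable_on K)"

definition weight :: "('a::euclidean_space \<Rightarrow> real) \<Rightarrow> bool"
  where "weight \<omega> \<longleftrightarrow> (\<forall>x. 0 \<le> \<omega> x) \<and> \<omega> locally_integrable_on UNIV"

definition weight_measure :: "('a::euclidean_space \<Rightarrow> real) \<Rightarrow> 'a set \<Rightarrow> ennreal"
  where "weight_measure \<omega> E = (\<integral>\<^sup>+x\<in>E. ennreal (\<omega> x) \<partial>lebesgue)"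

text \<open>Real powers on \<open>[0,\<infinity>]\<close>, with \<open>0\<close> to a negative power being \<open>\<infinity>\<close>
  (whereas \<open>0 powr a = 0\<close> for all \<open>a\<close> on the reals).\<close>

definition ennpowr :: "ennreal \<Rightarrow> real \<Rightarrow> ennreal"
  where "ennpowr x a =
    (if x = 0 then (if 0 < a then 0 else if a = 0 then 1 else \<infinity>)
     else if x = \<infinity> then (if 0 < a then \<infinity> else if a = 0 then 1 else 0)
     else ennreal (enn2real x powr a))"

definition average :: "'a::euclidean_space set \<Rightarrow> ('a \<Rightarrow> ennreal) \<Rightarrow> ennreal"
  where "average B g = (\<integral>\<^sup>+x\<in>B. g x \<partial>lebesgue) / emeasure lebesgue B"

definition Muckenhoupt_const :: "real \<Rightarrow> ('a::euclidean_space \<Rightarrow> real) \<Rightarrow> ennreal"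
  where "Muckenhoupt_const \<gamma> \<omega> =
    (SUP B \<in> {ball c r |c r. 0 < r}.
       average B (\<lambda>x. ennreal (\<omega> x)) *
       ennpowr (average B (\<lambda>x. ennpowr (ennreal (\<omega> x)) (- 1 / (\<gamma> - 1)))) (\<gamma> - 1))"

definition Muckenhoupt :: "real \<Rightarrow> ('a::euclidean_space \<Rightarrow> real) set"
  where "Muckenhoupt \<gamma> = {\<omega>. weight \<omega> \<and> Muckenhoupt_const \<gamma> \<omega> < \<infinity>}"

subsection \<open>Generalized \<open>\<Phi>\<close>-functions\<close>

text \<open>A function \<open>\<Omega> \<times> [0,\<infinity>) \<rightarrow> [0,\<infinity>]\<close> is represented by a total function
  of which only the values at \<open>x \<in> \<Omega>\<close> and \<open>t \<ge> 0\<close> matter.\<close>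

definition Phi_prefunctions :: "'a::euclidean_space set \<Rightarrow> ('a \<Rightarrow> real \<Rightarrow> ennreal) set"
  where "Phi_prefunctions \<Omega> = {\<phi>.
    (\<forall>f \<in> borel_measurable (lebesgue_on \<Omega>).
       (\<lambda>x. \<phi> x \<bar>f x :: real\<bar>) \<in> borel_measurable (lebesgue_on \<Omega>)) \<and>
    (\<forall>x\<in>\<Omega>. mono_on {0..} (\<phi> x) \<and> \<phi> x 0 = 0 \<and>
       (\<phi> x \<longlongrightarrow> 0) (at_right 0) \<and> (\<phi> x \<longlongrightarrow> \<infinity>) at_top)}"

definition Phi_convex :: "'a::euclidean_space set \<Rightarrow> ('a \<Rightarrow> real \<Rightarrow> ennreal) set"
  where "Phi_convex \<Omega> = {\<phi> \<in> Phi_prefunctions \<Omega>. \<forall>x\<in>\<Omega>.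
    (\<forall>t>0. continuous (at_left t) (\<phi> x)) \<and>
    (\<forall>s\<ge>0. \<forall>t\<ge>0. \<forall>a\<in>{0..1}.
       \<phi> x (a * s + (1 - a) * t) \<le> ennreal a * \<phi> x s + ennreal (1 - a) * \<phi> x t)}"

definition almost_increasing_on :: "real set \<Rightarrow> real \<Rightarrow> (real \<Rightarrow> ennreal) \<Rightarrow> bool"
  where "almost_increasing_on S L g \<longleftrightarrow>
    (\<forall>s\<in>S. \<forall>t\<in>S. s \<le> t \<longrightarrow> g s \<le> ennreal L * g t)"

definition almost_decreasing_on :: "real set \<Rightarrow> real \<Rightarrow> (real \<Rightarrow> ennreal) \<Rightarrow> bool"
  where "almost_decreasing_on S L g \<longleftrightarrow>
    (\<forall>s\<in>S. \<forall>t\<in>S. s \<le> t \<longrightarrow> g t \<le> ennreal L * g s)"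

definition aInc :: "'a set \<Rightarrow> real \<Rightarrow> ('a \<Rightarrow> real \<Rightarrow> ennreal) \<Rightarrow> bool"
  where "aInc \<Omega> \<gamma> \<phi> \<longleftrightarrow>
    (\<exists>L\<ge>1. \<forall>x\<in>\<Omega>. almost_increasing_on {0<..} L (\<lambda>t. ennreal (t powr (- \<gamma>)) * \<phi> x t))"

definition aDec :: "'a set \<Rightarrow> real \<Rightarrow> ('a \<Rightarrow> real \<Rightarrow> ennreal) \<Rightarrow> bool"
  where "aDec \<Omega> \<gamma> \<phi> \<longleftrightarrow>
    (\<exists>L\<ge>1. \<forall>x\<in>\<Omega>. almost_decreasing_on {0<..} L (\<lambda>t. ennreal (t powr (- \<gamma>)) * \<phi> x t))"

text \<open>For \<open>\<Phi>\<close>-prefunctions the set below is nonempty for every real \<open>t\<close>, because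
  \<open>\<phi> x \<tau>\<close> tends to \<open>\<infinity>\<close> as \<open>\<tau>\<close> does; so the real infimum is the intended one.\<close>

definition left_inverse :: "('a \<Rightarrow> real \<Rightarrow> ennreal) \<Rightarrow> 'a \<Rightarrow> real \<Rightarrow> real"
  where "left_inverse \<phi> x t = Inf {\<tau>. 0 \<le> \<tau> \<and> ennreal t \<le> \<phi> x \<tau>}"

definition A1 :: "'a::euclidean_space set \<Rightarrow> ('a \<Rightarrow> real) \<Rightarrow> ('a \<Rightarrow> real \<Rightarrow> ennreal) \<Rightarrow> bool"
  where "A1 \<Omega> \<omega> \<phi> \<longleftrightarrow>
    (\<exists>\<beta>. 0 < \<beta> \<and> \<beta> \<le> 1 \<and>
      (\<forall>B \<in> {ball c r |c r. 0 < r}. weight_measure \<omega> B \<le> 1 \<longrightarrow>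
        (\<forall>t. 1 \<le> t \<and> ennreal t \<le> 1 / weight_measure \<omega> B \<longrightarrow>
          (AE x in lebesgue_on (B \<inter> \<Omega>). AE y in lebesgue_on (B \<inter> \<Omega>).
             \<beta> * left_inverse \<phi> x t \<le> left_inverse \<phi> y t))))"

subsection \<open>Test functions and weak gradients\<close>

definition partial_deriv :: "'a::euclidean_space \<Rightarrow> ('a \<Rightarrow> real) \<Rightarrow> 'a \<Rightarrow> real"
  where "partial_deriv i f x = frechet_derivative f (at x) i"

primrec times_cont_differentiable :: "nat \<Rightarrow> ('a::euclidean_space \<Rightarrow> real) \<Rightarrow> bool"
  where
    "times_cont_differentiable 0 f \<longleftrightarrow> continuous_on UNIV f"
  | "times_cont_differentiable (Suc k) f \<longleftrightarrow>
       (\<forall>x. f differentiable (at x)) \<and>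
       (\<forall>i\<in>Basis. times_cont_differentiable k (partial_deriv i f))"

text \<open>\<open>C\<^sub>0\<^sup>\<infinity>(\<Omega>)\<close>, with its elements extended by zero to the whole space.\<close>

definition test_functions :: "'a::euclidean_space set \<Rightarrow> ('a \<Rightarrow> real) set"
  where "test_functions \<Omega> = {\<eta>. (\<forall>k. times_cont_differentiable k \<eta>) \<and>
    compact (closure {x. \<eta> x \<noteq> 0}) \<and> closure {x. \<eta> x \<noteq> 0} \<subseteq> \<Omega>}"

definition has_weak_gradient ::
    "'a::euclidean_space set \<Rightarrow> ('a \<Rightarrow> real) \<Rightarrow> ('a \<Rightarrow> 'a) \<Rightarrow> bool"
  where "has_weak_gradient \<Omega> f G \<longleftrightarrow> G locally_integrable_on \<Omega> \<and>
    (\<forall>\<eta>\<in>test_functions \<Omega>. \<forall>i\<in>Basis.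
       (LINT x:\<Omega>|lebesgue. f x * partial_deriv i \<eta> x) =
       - (LINT x:\<Omega>|lebesgue. (G x \<bullet> i) * \<eta> x))"

text \<open>The weak gradient is unique only up to null sets. Everything below is insensitive
  to the choice of representative.\<close>

definition weak_gradient :: "'a::euclidean_space set \<Rightarrow> ('a \<Rightarrow> real) \<Rightarrow> 'a \<Rightarrow> 'a"
  where "weak_gradient \<Omega> f = (SOME G. has_weak_gradient \<Omega> f G)"

subsection \<open>Musielak--Orlicz and Musielak--Orlicz--Sobolev spaces\<close>

text \<open>Elements of the spaces are functions rather than classes modulo null sets, and they are
  total functions whose values outside \<open>\<Omega>\<close> are irrelevant. The Luxemburg norm takes values in
  \<open>[0,\<infinity>]\<close>; the infimum of the empty set is \<open>\<infinity>\<close>.\<close>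

definition luxemburg_norm ::
    "'a::euclidean_space set \<Rightarrow> ('a \<Rightarrow> real \<Rightarrow> ennreal) \<Rightarrow> ('a \<Rightarrow> real) \<Rightarrow> ennreal"
  where "luxemburg_norm \<Omega> \<psi> f =
    Inf {ennreal l |l. 0 < l \<and> (\<integral>\<^sup>+x\<in>\<Omega>. \<psi> x (\<bar>f x\<bar> / l) \<partial>lebesgue) \<le> 1}"

definition orlicz_space ::
    "'a::euclidean_space set \<Rightarrow> ('a \<Rightarrow> real \<Rightarrow> ennreal) \<Rightarrow> ('a \<Rightarrow> real) set"
  where "orlicz_space \<Omega> \<psi> =
    {f \<in> borel_measurable (lebesgue_on \<Omega>). luxemburg_norm \<Omega> \<psi> f < \<infinity>}"

definition sobolev_norm ::
    "'a::euclidean_space set \<Rightarrow> ('a \<Rightarrow> real \<Rightarrow> ennreal) \<Rightarrow> ('a \<Rightarrow> real) \<Rightarrow> ennreal"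
  where "sobolev_norm \<Omega> \<psi> f =
    luxemburg_norm \<Omega> \<psi> f + luxemburg_norm \<Omega> \<psi> (\<lambda>x. norm (weak_gradient \<Omega> f x))"

definition sobolev_space ::
    "'a::euclidean_space set \<Rightarrow> ('a \<Rightarrow> real \<Rightarrow> ennreal) \<Rightarrow> ('a \<Rightarrow> real) set"
  where "sobolev_space \<Omega> \<psi> = {f \<in> orlicz_space \<Omega> \<psi>. f locally_integrable_on \<Omega> \<and>
    (\<exists>G. has_weak_gradient \<Omega> f G) \<and> sobolev_norm \<Omega> \<psi> f < \<infinity>}"

definition sobolev_space_0 ::
    "'a::euclidean_space set \<Rightarrow> ('a \<Rightarrow> real \<Rightarrow> ennreal) \<Rightarrow> ('a \<Rightarrow> real) set"
  where "sobolev_space_0 \<Omega> \<psi> = {f \<in> sobolev_space \<Omega> \<psi>.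
    \<forall>\<epsilon>>0. \<exists>\<eta> \<in> test_functions \<Omega> \<inter> sobolev_space \<Omega> \<psi>. sobolev_norm \<Omega> \<psi> (\<lambda>x. f x - \<eta> x) < \<epsilon>}"

definition dirichlet_class ::
    "'a::euclidean_space set \<Rightarrow> ('a \<Rightarrow> real \<Rightarrow> ennreal) \<Rightarrow> ('a \<Rightarrow> real) \<Rightarrow> ('a \<Rightarrow> real) set"
  where "dirichlet_class \<Omega> \<psi> z = {\<lambda>x. z x + w x |w. w \<in> sobolev_space_0 \<Omega> \<psi>}"

definition energy ::
    "'a::euclidean_space set \<Rightarrow> ('a \<Rightarrow> real \<Rightarrow> ennreal) \<Rightarrow> ('a \<Rightarrow> real) \<Rightarrow> ennreal"
  where "energy \<Omega> \<psi> v = (\<integral>\<^sup>+x\<in>\<Omega>. \<psi> x (norm (weak_gradient \<Omega> v x)) \<partial>lebesgue)"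

end

theory Submission
  imports Defs
begin

text \<open>The direct approach, with the two heavy ingredients (the maximal theorem and the reflexivity of
  the space) replaced by elementary ones. Write \<open>\<rho> f\<close> for the integral of \<open>\<phi> x \<bar>f x\<bar> \<omega> x\<close> over \<open>\<Omega>\<close>.

  \<^item> Poincare inequality. Telescoping over dyadic cubes \<open>Q\<^sub>k x\<close> bounds \<open>\<bar>\<eta> x\<bar>\<close>, for a test function
    \<open>\<eta>\<close>, by a constant plus the sum of \<open>2\<^sup>-\<^sup>k\<close> times the averages of \<open>\<bar>\<nabla> \<eta>\<bar>\<close> over \<open>Q\<^sub>k x\<close>. A single
    averaging operator is bounded for \<open>\<rho>\<close>, uniformly in \<open>k\<close>, by (A1), (aInc) and the \<open>A\<^sub>p\<close> condition, and
    the geometric weights make the sum harmless by convexity of \<open>\<phi>\<close>.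
  \<^item> Compactness. By (aInc) with \<open>p > 1\<close>, \<open>\<rho>\<close> is comparable with a uniformly convex functional.
    Choose \<open>v\<^sub>j\<close> almost minimizing the latter among the functions of energy at most \<open>inf + 1 / (j + 1)\<close>:
    these sets are convex and decreasing, so uniform convexity makes \<open>\<nabla> v\<^sub>j\<close> a Cauchy sequence for \<open>\<rho>\<close>,
    the Poincare inequality does the same for \<open>v\<^sub>j\<close>, and Fatou's lemma shows that the limit is a minimizer.

  An \<open>A\<^sub>p\<close> weight in the present sense (with \<open>0 \<cdot> \<infinity> = 0\<close>) may also vanish almost everywhere; then
  all energies are \<open>0\<close>.\<close>

subsection \<open>Smooth functions of compact support\<close>

text \<open>The energy need not be strictly convex, since (aInc) holds only up to a constant;
  nothing forces the gradients of an arbitrary minimizing sequence to converge. Hence the second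
  functional, which only selects a sequence: its infima over the shrinking sets increase and are
  bounded, and their convergence yields the Cauchy estimate, whereas minimality of the limit is
  checked for the energy alone. (A1) compares the values of \<phi> only at levels between 1 and the
  reciprocal of the weight of a ball. This dictates the form of the averaging estimate: the modular
  is normalised to be at most 1, the cubes start at a scale where the surrounding balls have weight
  at most 1, and an additive constant survives. The first Poincare inequality is therefore a mere
  bound. Smallness is recovered by scaling: (aDec) controls the gradient of a large multiple A
  \<eta>, and convexity with \<phi>(x,0) = 0 gives back a factor of order 1/A.\<close>

lemma times_cont_differentiable_Suc_imp:
  "times_cont_differentiable (Suc k) f \<Longrightarrow> times_cont_differentiable k f"
proof (induction k arbitrary: f)
  case 0
  then show ?case
    by (auto intro!: continuous_at_imp_continuous_on differentiable_imp_continuous_within)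
next
  case (Suc k)
  then show ?case by auto
qed

lemma partial_deriv_eq:
  "(f has_derivative D) (at x) \<Longrightarrow> partial_deriv i f x = D i"
  unfolding partial_deriv_def by (metis frechet_derivative_at)

lemma partial_deriv_add:
  assumes "\<And>x. f differentiable (at x)" "\<And>x. g differentiable (at x)"
  shows "partial_deriv i (\<lambda>x. f x + g x) = (\<lambda>x. partial_deriv i f x + partial_deriv i g x)"
proof
  fix x
  show "partial_deriv i (\<lambda>x. f x + g x) x = partial_deriv i f x + partial_deriv i g x"
    using partial_deriv_eq[OF has_derivative_add[OF assms[of x, unfolded frechet_derivative_works]]]
    by (simp add: partial_deriv_def)
qed

lemma partial_deriv_mult:
  assumes "\<And>x. f differentiable (at x)" "\<And>x. g differentiable (at x)"
  shows "partial_deriv i (\<lambda>x. f x * g x) = (\<lambda>x. f x * partial_deriv i g x + partial_deriv i f x * g x)"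
proof
  fix x
  show "partial_deriv i (\<lambda>x. f x * g x) x = f x * partial_deriv i g x + partial_deriv i f x * g x"
    using partial_deriv_eq[OF has_derivative_mult[OF assms[of x, unfolded frechet_derivative_works]]]
    by (simp add: partial_deriv_def)
qed

lemma times_cont_differentiable_add:
  "times_cont_differentiable k f \<Longrightarrow> times_cont_differentiable k g \<Longrightarrow>
   times_cont_differentiable k (\<lambda>x. f x + g x)"
proof (induction k arbitrary: f g)
  case 0
  then show ?case by (auto intro: continuous_on_add)
next
  case (Suc k)
  then show ?case by (auto simp: partial_deriv_add)
qed

lemma times_cont_differentiable_mult:
  "times_cont_differentiable k f \<Longrightarrow> times_cont_differentiable k g \<Longrightarrow>
   times_cont_differentiable k (\<lambda>x. f x * g x)"
proof (induction k arbitrary: f g)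
  case 0
  then show ?case by (auto intro: continuous_on_mult)
next
  case (Suc k)
  have "times_cont_differentiable k f" "times_cont_differentiable k g"
    using Suc.prems times_cont_differentiable_Suc_imp by blast+
  with Suc show ?case
    by (auto simp: partial_deriv_mult intro!: times_cont_differentiable_add)
qed

lemma times_cont_differentiable_const: "times_cont_differentiable k (\<lambda>x. c)"
proof (induction k arbitrary: c)
  case 0
  then show ?case by simp
next
  case (Suc k)
  have "partial_deriv i (\<lambda>x. c) = (\<lambda>x. 0)" for i :: 'a
    using partial_deriv_eq[OF has_derivative_const] by auto
  with Suc show ?case by simp
qed

lemma times_cont_differentiable_prod:
  "finite I \<Longrightarrow> (\<And>i. i \<in> I \<Longrightarrow> times_cont_differentiable k (f i)) \<Longrightarrow>
   times_cont_differentiable k (\<lambda>x. \<Prod>i\<in>I. f i x)"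
  by (induction rule: finite_induct)
     (auto intro: times_cont_differentiable_const times_cont_differentiable_mult)

section \<open>Smooth bumps built from exp (-1/t)\<close>

text \<open>The polynomial in 1/t is carried along to make the family closed under differentiation;
  smoothness of every order is then a single induction.\<close>

definition exp_bump :: "real poly \<Rightarrow> real \<Rightarrow> real"
  where "exp_bump p t = (if 0 < t then poly p (inverse t) * exp (- inverse t) else 0)"

lemma poly_exp_bump_tendsto_0:
  fixes p :: "real poly"
  shows "((\<lambda>t. poly p (inverse t) * exp (- inverse t)) \<longlongrightarrow> 0) (at_right 0)"
proof -
  have "((\<lambda>t. coeff p i * (t ^ i / exp t)) \<longlongrightarrow> coeff p i * 0) at_top" for i
    by (intro tendsto_mult tendsto_const tendsto_power_div_exp_0)
  then have "((\<lambda>t. \<Sum>i\<le>degree p. coeff p i * (t ^ i / exp t)) \<longlongrightarrow> (\<Sum>i\<le>degree p. 0)) at_top"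
    by (intro tendsto_sum) simp
  then have "((\<lambda>t. poly p t * exp (- t)) \<longlongrightarrow> 0) at_top"
    by (simp add: poly_altdef sum_distrib_right exp_minus divide_inverse mult.assoc)
  then show ?thesis
    by (rule filterlim_compose) (rule filterlim_inverse_at_top_right)
qed

text \<open>In the variable s = 1/t the derivative of p(s) exp(-s) is s^2 (p(s) - p'(s)) exp(-s),
  and \<open>monom 1 2\<close> is s^2.\<close>

lemma DERIV_exp_bump:
  "(exp_bump p has_real_derivative exp_bump (monom 1 2 * (p - pderiv p)) t) (at t)"
proof -
  consider "t < 0" | "t = 0" | "0 < t" by linarith
  then show ?thesis
  proof cases
    case 1
    have "((\<lambda>t. 0) has_real_derivative 0) (at t)" by simp
    moreover have "eventually (\<lambda>s. s < 0) (nhds t)"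
      using 1 by (rule eventually_nhds_in_open[OF open_lessThan, of t 0, simplified])
    then have "eventually (\<lambda>s. 0 = exp_bump p s) (nhds t)"
      by eventually_elim (simp add: exp_bump_def)
    ultimately show ?thesis
      using 1 by (subst (asm) DERIV_cong_ev[OF refl _ refl, of _ "exp_bump p"]) (auto simp: exp_bump_def)
  next
    case 2
    \<comment> \<open>Dividing by h replaces p(s) by s p(s), so the difference quotient at 0 is an
      expression of the same kind.\<close>
    have "((\<lambda>h. exp_bump p h / h) \<longlongrightarrow> 0) (at_right 0)"
    proof (rule Lim_transform_eventually[OF poly_exp_bump_tendsto_0[of "monom 1 1 * p"]])
      show "\<forall>\<^sub>F x in at_right 0. poly (monom 1 1 * p) (inverse x) * exp (- inverse x) = exp_bump p x / x"
        by (rule eventually_at_rightI[of _ 1]) (auto simp: exp_bump_def poly_monom field_simps)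
    qed
    moreover have "((\<lambda>h. exp_bump p h / h) \<longlongrightarrow> 0) (at_left 0)"
    proof (rule Lim_transform_eventually[OF tendsto_const])
      show "\<forall>\<^sub>F x in at_left 0. 0 = exp_bump p x / x"
        by (rule eventually_at_leftI[of "-1"]) (auto simp: exp_bump_def)
    qed
    ultimately have "((\<lambda>h. exp_bump p h / h) \<longlongrightarrow> 0) (at 0)"
      by (simp add: filterlim_split_at)
    then show ?thesis using 2
      by (simp add: DERIV_def exp_bump_def)
  next
    case 3
    have "((\<lambda>t. poly p (inverse t) * exp (- inverse t)) has_real_derivative
       exp_bump (monom 1 2 * (p - pderiv p)) t) (at t)"
      using 3 by (auto intro!: derivative_eq_intros simp: exp_bump_def poly_monom field_simps power2_eq_square)
    moreover have "eventually (\<lambda>s. 0 < s) (nhds t)"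
      using 3 by (rule eventually_nhds_in_open[OF open_greaterThan, of t 0, simplified])
    then have "eventually (\<lambda>s. poly p (inverse s) * exp (- inverse s) = exp_bump p s) (nhds t)"
      by eventually_elim (simp add: exp_bump_def)
    ultimately show ?thesis
      by (subst (asm) DERIV_cong_ev[OF refl _ refl, of _ "exp_bump p"]) auto
  qed
qed

text \<open>A partial derivative changes only the factor \<alpha> and the polynomial; hence the
  induction generalizes over these two.\<close>

lemma times_cont_differentiable_exp_bump:
  "times_cont_differentiable k (\<lambda>x. \<alpha> * exp_bump p (c * (x \<bullet> v) + d))"
proof (induction k arbitrary: \<alpha> p)
  case 0
  have "continuous_on UNIV (exp_bump p)" for p
    by (rule DERIV_continuous_on) (rule DERIV_exp_bump[THEN has_field_derivative_at_within])
  then have "continuous_on UNIV (\<lambda>x. exp_bump p (c * (x \<bullet> v) + d))"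
    by (rule continuous_on_compose2) (auto intro!: continuous_intros)
  then show ?case
    by (auto intro!: continuous_intros)
next
  case (Suc k)
  have D: "((\<lambda>x. \<alpha> * exp_bump p (c * (x \<bullet> v) + d)) has_derivative
      (\<lambda>h. \<alpha> * (exp_bump (monom 1 2 * (p - pderiv p)) (c * (x \<bullet> v) + d) * (c * (h \<bullet> v))))) (at x)" for x
    by (intro has_derivative_mult_right
        DERIV_exp_bump[unfolded has_field_derivative_def, THEN has_derivative_compose[rotated]])
       (auto intro!: derivative_eq_intros)
  have "partial_deriv i (\<lambda>x. \<alpha> * exp_bump p (c * (x \<bullet> v) + d)) =
     (\<lambda>x. (\<alpha> * c * (i \<bullet> v)) * exp_bump (monom 1 2 * (p - pderiv p)) (c * (x \<bullet> v) + d))" for i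
    using partial_deriv_eq[OF D, of i] by (auto simp: mult_ac)
  with Suc D show ?case
    by (auto simp: differentiable_def)
qed

lemma exp_bump_bounds: "0 \<le> exp_bump 1 t" "exp_bump 1 t \<le> 1"
  by (auto simp: exp_bump_def)

text \<open>Smooth approximations of \<open>indicator (box a b)\<close>: for c > 0 the factor exp
  (-1/(k c)) tends to 1 as k grows, and all values stay in [0,1], which is what dominated
  convergence asks for.\<close>

definition box_bump :: "'a::euclidean_space \<Rightarrow> 'a \<Rightarrow> nat \<Rightarrow> 'a \<Rightarrow> real"
  where "box_bump a b k x = (\<Prod>i\<in>Basis. exp_bump 1 (real k * (x \<bullet> i - a \<bullet> i)) *
     exp_bump 1 (real k * (b \<bullet> i - x \<bullet> i)))"

lemma box_bump_bounds: "0 \<le> box_bump a b k x" "box_bump a b k x \<le> 1"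
  unfolding box_bump_def using exp_bump_bounds
  by (auto intro!: prod_nonneg prod_le_1 mult_le_one)

lemma box_bump_eq_0: "x \<notin> box a b \<Longrightarrow> box_bump a b k x = 0"
proof -
  assume "x \<notin> box a b"
  then obtain i where i: "i \<in> Basis" "x \<bullet> i \<le> a \<bullet> i \<or> b \<bullet> i \<le> x \<bullet> i"
    by (auto simp: mem_box not_less)
  then have "exp_bump 1 (real k * (x \<bullet> i - a \<bullet> i)) * exp_bump 1 (real k * (b \<bullet> i - x \<bullet> i)) = 0"
    by (auto simp: exp_bump_def zero_less_mult_iff)
  then show ?thesis
    unfolding box_bump_def using i(1) by (intro prod_zero) auto
qed

lemma tendsto_box_bump: "(\<lambda>k. box_bump a b k x) \<longlonglongrightarrow> indicator (box a b) x"
proof (cases "x \<in> box a b")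
  case False
  then show ?thesis by (simp add: box_bump_eq_0)
next
  case True
  have *: "(\<lambda>k. exp_bump 1 (real k * c)) \<longlonglongrightarrow> 1" if "c > 0" for c
  proof -
    have "(\<lambda>k. exp (- (inverse c * inverse (real k)))) \<longlonglongrightarrow> exp (- (inverse c * 0))"
      by (intro tendsto_intros lim_inverse_n)
    then have "(\<lambda>k. exp (- (inverse c * inverse (real k)))) \<longlonglongrightarrow> 1" by simp
    then show ?thesis
    proof (rule Lim_transform_eventually)
      show "\<forall>\<^sub>F k in sequentially. exp (- (inverse c * inverse (real k))) = exp_bump 1 (real k * c)"
        using eventually_gt_at_top[of "0::nat"]
        by eventually_elim (use that in \<open>simp add: exp_bump_def field_simps\<close>)
    qed
  qed
  have "(\<lambda>k. box_bump a b k x) \<longlonglongrightarrow> (\<Prod>i\<in>(Basis::'a set). 1 * 1)"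
    unfolding box_bump_def using True
    by (intro tendsto_prod tendsto_mult *) (auto simp: mem_box)
  with True show ?thesis by simp
qed

lemma times_cont_differentiable_box_bump: "times_cont_differentiable m (box_bump a b k)"
proof -
  have "box_bump a b k = (\<lambda>x. \<Prod>i\<in>Basis. (1 * exp_bump 1 (real k * (x \<bullet> i) + (- real k * (a \<bullet> i)))) *
     (1 * exp_bump 1 ((- real k) * (x \<bullet> i) + (real k * (b \<bullet> i)))))"
    by (auto simp: box_bump_def algebra_simps)
  then show ?thesis
    by (simp only:) (intro times_cont_differentiable_prod times_cont_differentiable_mult
        times_cont_differentiable_exp_bump finite_Basis)
qed

lemma box_bump_test_function:
  assumes "cbox a b \<subseteq> \<Omega>"
  shows "box_bump a b k \<in> test_functions \<Omega>"
proof -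
  have "{x. box_bump a b k x \<noteq> 0} \<subseteq> cbox a b"
    using box_bump_eq_0 box_subset_cbox by blast
  then have *: "closure {x. box_bump a b k x \<noteq> 0} \<subseteq> cbox a b"
    by (intro closure_minimal) auto
  moreover have "compact (closure {x. box_bump a b k x \<noteq> 0})"
    using * compact_eq_bounded_closed bounded_subset[OF bounded_cbox] by blast
  ultimately show ?thesis
    using assms by (auto simp: test_functions_def times_cont_differentiable_box_bump)
qed

lemma test_functions_times_cont: "\<eta> \<in> test_functions \<Omega> \<Longrightarrow> times_cont_differentiable k \<eta>"
  by (simp add: test_functions_def)

lemma test_functions_continuous: "\<eta> \<in> test_functions \<Omega> \<Longrightarrow> continuous_on UNIV \<eta>"
  using test_functions_times_cont[of \<eta> \<Omega> 0] by simp

lemma test_functions_differentiable: "\<eta> \<in> test_functions \<Omega> \<Longrightarrow> \<eta> differentiable (at x)"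
  using test_functions_times_cont[of \<eta> \<Omega> 1] by simp

lemma test_functions_continuous_partial:
  "\<eta> \<in> test_functions \<Omega> \<Longrightarrow> i \<in> Basis \<Longrightarrow> continuous_on UNIV (partial_deriv i \<eta>)"
  using test_functions_times_cont[of \<eta> \<Omega> 1] by simp

lemma test_functionsI_support:
  assumes "\<And>k. times_cont_differentiable k \<eta>" "compact K" "K \<subseteq> \<Omega>" "\<And>x. x \<notin> K \<Longrightarrow> \<eta> x = 0"
  shows "\<eta> \<in> test_functions \<Omega>"
proof -
  have *: "closure {x. \<eta> x \<noteq> 0} \<subseteq> K"
    using assms by (intro closure_minimal) (auto simp: compact_imp_closed)
  then have "compact (closure {x. \<eta> x \<noteq> 0})"
    using assms(2) by (metis closed_closure compact_Int_closed inf.absorb_iff2)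
  with * assms show ?thesis by (auto simp: test_functions_def)
qed

lemma test_functions_supportE:
  assumes "\<eta> \<in> test_functions \<Omega>"
  obtains K where "compact K" "K \<subseteq> \<Omega>" "\<And>x. x \<notin> K \<Longrightarrow> \<eta> x = 0"
    "\<And>x i. x \<notin> K \<Longrightarrow> partial_deriv i \<eta> x = 0"
proof -
  define K where "K = closure {x. \<eta> x \<noteq> 0}"
  have K: "compact K" "K \<subseteq> \<Omega>" "open (- K)"
    using assms by (auto simp: test_functions_def K_def)
  have z: "\<eta> x = 0" if "x \<notin> K" for x
    using that closure_subset[of "{x. \<eta> x \<noteq> 0}"] by (auto simp: K_def)
  have "partial_deriv i \<eta> x = 0" if "x \<notin> K" for x i
  proof -
    have "(\<eta> has_derivative (\<lambda>h. 0)) (at x)"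
      by (rule has_derivative_transform_within_open[OF has_derivative_const K(3)])
         (simp_all add: that z)
    then show ?thesis by (rule partial_deriv_eq)
  qed
  with K z that show thesis by blast
qed

lemma test_functions_zero: "(\<lambda>x. 0) \<in> test_functions \<Omega>"
  by (rule test_functionsI_support[of _ "{}"]) (auto intro: times_cont_differentiable_const)

lemma test_functions_add:
  assumes "\<eta> \<in> test_functions \<Omega>" "\<theta> \<in> test_functions \<Omega>"
  shows "(\<lambda>x. \<eta> x + \<theta> x) \<in> test_functions \<Omega>"
proof -
  obtain K where K: "compact K" "K \<subseteq> \<Omega>" "\<And>x. x \<notin> K \<Longrightarrow> \<eta> x = 0"
    using assms(1) by (rule test_functions_supportE) blast
  obtain K' where K': "compact K'" "K' \<subseteq> \<Omega>" "\<And>x. x \<notin> K' \<Longrightarrow> \<theta> x = 0"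
    using assms(2) by (rule test_functions_supportE) blast
  show ?thesis
    using assms K K'
    by (intro test_functionsI_support[of _ "K \<union> K'"])
       (auto intro: times_cont_differentiable_add test_functions_times_cont)
qed

lemma test_functions_mult_tcd:
  assumes "\<eta> \<in> test_functions \<Omega>" "\<And>k. times_cont_differentiable k \<theta>"
  shows "(\<lambda>x. \<theta> x * \<eta> x) \<in> test_functions \<Omega>"
proof -
  obtain K where K: "compact K" "K \<subseteq> \<Omega>" "\<And>x. x \<notin> K \<Longrightarrow> \<eta> x = 0"
    using assms(1) by (rule test_functions_supportE) blast
  then show ?thesis
    using assms
    by (intro test_functionsI_support[of _ "K"])
       (auto intro: times_cont_differentiable_mult test_functions_times_cont)
qed

lemma test_functions_scale:
  "\<eta> \<in> test_functions \<Omega> \<Longrightarrow> (\<lambda>x. c * \<eta> x) \<in> test_functions \<Omega>"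
  by (rule test_functions_mult_tcd) (auto intro: times_cont_differentiable_const)

subsection \<open>Weak gradients\<close>

definition gradient :: "('a::euclidean_space \<Rightarrow> real) \<Rightarrow> 'a \<Rightarrow> 'a"
  where "gradient f x = (\<Sum>i\<in>Basis. partial_deriv i f x *\<^sub>R i)"

lemma gradient_inner: "i \<in> Basis \<Longrightarrow> gradient f x \<bullet> i = partial_deriv i f x"
  by (simp add: gradient_def inner_sum_left_Basis)

lemma has_derivative_gradient:
  assumes "f differentiable (at x)"
  shows "(f has_derivative (\<lambda>h. gradient f x \<bullet> h)) (at x)"
proof -
  let ?D = "frechet_derivative f (at x)"
  have D: "(f has_derivative ?D) (at x)"
    using assms by (simp add: frechet_derivative_works)
  interpret bounded_linear ?D using D by (rule has_derivative_bounded_linear)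
  have "?D h = gradient f x \<bullet> h" for h
  proof -
    have "?D h = ?D (\<Sum>i\<in>Basis. (h \<bullet> i) *\<^sub>R i)" by (simp add: euclidean_representation)
    also have "\<dots> = (\<Sum>i\<in>Basis. (h \<bullet> i) * ?D i)" by (simp add: sum scaleR)
    also have "\<dots> = gradient f x \<bullet> h"
      by (simp add: gradient_def inner_sum_left partial_deriv_def inner_commute[of h] mult.commute)
    finally show ?thesis .
  qed
  then have "?D = (\<lambda>h. gradient f x \<bullet> h)" by auto
  with D show ?thesis by simp
qed

lemma test_functions_has_derivative:
  "\<eta> \<in> test_functions \<Omega> \<Longrightarrow> (\<eta> has_derivative (\<lambda>h. gradient \<eta> x \<bullet> h)) (at x)"
  by (intro has_derivative_gradient test_functions_differentiable)

lemma test_functions_continuous_gradient: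
  "\<eta> \<in> test_functions \<Omega> \<Longrightarrow> continuous_on UNIV (gradient \<eta>)"
  unfolding gradient_def by (auto intro!: continuous_intros test_functions_continuous_partial)

lemma gradient_add:
  assumes "\<eta> \<in> test_functions \<Omega>" "\<theta> \<in> test_functions \<Omega>"
  shows "gradient (\<lambda>x. \<eta> x + \<theta> x) x = gradient \<eta> x + gradient \<theta> x"
  using assms
  by (simp add: gradient_def partial_deriv_add test_functions_differentiable scaleR_add_left sum.distrib)

lemma gradient_scale:
  assumes "\<eta> \<in> test_functions \<Omega>"
  shows "gradient (\<lambda>x. c * \<eta> x) x = c *\<^sub>R gradient \<eta> x"
proof -
  have "partial_deriv i (\<lambda>x. c * \<eta> x) x = c * partial_deriv i \<eta> x" for i
    using partial_deriv_eq[OF has_derivative_mult_right[OF test_functions_has_derivative[OF assms]]]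
      partial_deriv_eq[OF test_functions_has_derivative[OF assms]] by simp
  then show ?thesis by (simp add: gradient_def scaleR_sum_right)
qed

lemma test_functions_bounded_gradient:
  assumes "\<eta> \<in> test_functions \<Omega>"
  obtains M where "0 < M" "\<And>x. norm (gradient \<eta> x) \<le> M"
proof -
  obtain K where K: "compact K" "\<And>x i. x \<notin> K \<Longrightarrow> partial_deriv i \<eta> x = 0"
    using assms by (rule test_functions_supportE) blast
  have "compact (gradient \<eta> ` K)"
    using K(1) test_functions_continuous_gradient[OF assms]
    by (meson compact_continuous_image continuous_on_subset subset_UNIV)
  then obtain M where M: "0 < M" "\<And>y. y \<in> gradient \<eta> ` K \<Longrightarrow> norm y \<le> M"
    using bounded_pos compact_imp_bounded by metis
  have "norm (gradient \<eta> x) \<le> M" for x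
  proof (cases "x \<in> K")
    case True then show ?thesis using M(2) by blast
  next
    case False
    then have "gradient \<eta> x = 0" by (simp add: gradient_def K)
    with M show ?thesis by simp
  qed
  with M(1) that show thesis by blast
qed

lemma test_functions_bounded:
  assumes "\<eta> \<in> test_functions \<Omega>"
  obtains M where "0 < M" "\<And>x. \<bar>\<eta> x\<bar> \<le> M"
proof -
  obtain K where K: "compact K" "\<And>x. x \<notin> K \<Longrightarrow> \<eta> x = 0"
    using assms by (rule test_functions_supportE) blast
  have "compact (\<eta> ` K)"
    using K(1) test_functions_continuous[OF assms]
    by (meson compact_continuous_image continuous_on_subset subset_UNIV)
  then obtain M where M: "0 < M" "\<And>y. y \<in> \<eta> ` K \<Longrightarrow> norm y \<le> M"
    using bounded_pos compact_imp_bounded by metis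
  have "\<bar>\<eta> x\<bar> \<le> M" for x
    using M K(2)[of x] by (cases "x \<in> K") auto
  with M(1) that show thesis by blast
qed

lemma test_functions_lipschitz:
  assumes \<eta>: "\<eta> \<in> test_functions \<Omega>"
  obtains M where "0 < M" "\<And>x y. \<bar>\<eta> x - \<eta> y\<bar> \<le> M * norm (x - y)"
proof -
  obtain M where M: "0 < M" "\<And>x. norm (gradient \<eta> x) \<le> M"
    using test_functions_bounded_gradient[OF \<eta>] by blast
  have "\<bar>\<eta> x - \<eta> y\<bar> \<le> M * norm (x - y)" for x y
  proof -
    have "onorm (\<lambda>h. gradient \<eta> x \<bullet> h) \<le> M" for x
    proof (rule onorm_bound)
      fix h
      have "\<bar>gradient \<eta> x \<bullet> h\<bar> \<le> norm (gradient \<eta> x) * norm h" by (rule Cauchy_Schwarz_ineq2)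
      also have "\<dots> \<le> M * norm h" by (intro mult_right_mono M) simp
      finally show "norm (gradient \<eta> x \<bullet> h) \<le> M * norm h" by simp
    qed (use M in simp)
    then have "norm (\<eta> x - \<eta> y) \<le> M * norm (x - y)"
      by (intro differentiable_bound[of UNIV \<eta> "\<lambda>x h. gradient \<eta> x \<bullet> h"])
         (auto intro: test_functions_has_derivative[OF \<eta>])
    then show ?thesis by simp
  qed
  with M(1) that show thesis by blast
qed

section \<open>Integration by parts for test functions\<close>

lemma integrable_lborel_compact_support:
  fixes f :: "'a::euclidean_space \<Rightarrow> real"
  assumes "continuous_on UNIV f" "compact K" "\<And>x. x \<notin> K \<Longrightarrow> f x = 0"
  shows "integrable lborel f"
proof -
  have "integrable lborel (\<lambda>x. indicator K x *\<^sub>R f x)"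
    by (rule borel_integrable_compact[OF assms(2)]) (rule continuous_on_subset[OF assms(1)], simp)
  also have "(\<lambda>x. indicator K x *\<^sub>R f x) = f"
    using assms(3) by (force simp: indicator_def)
  finally show ?thesis .
qed

text \<open>Difference quotients have integral 0 by translation invariance. They are dominated by
  the Lipschitz constant on a fixed ball, so the limit inherits the value 0.\<close>

lemma integral_partial_deriv_eq_0:
  fixes \<eta> :: "'a::euclidean_space \<Rightarrow> real"
  assumes \<eta>: "\<eta> \<in> test_functions \<Omega>" and i: "i \<in> Basis"
  shows "(LINT x|lborel. partial_deriv i \<eta> x) = 0"
proof -
  obtain K where K: "compact K" "\<And>x. x \<notin> K \<Longrightarrow> \<eta> x = 0" "\<And>x i. x \<notin> K \<Longrightarrow> partial_deriv i \<eta> x = 0"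
    using \<eta> by (rule test_functions_supportE) blast
  obtain R where R: "\<And>x. x \<in> K \<Longrightarrow> norm x \<le> R"
    using compact_imp_bounded[OF K(1)] by (auto simp: bounded_iff)
  obtain M where M: "0 < M" and lip: "\<And>x y. \<bar>\<eta> x - \<eta> y\<bar> \<le> M * norm (x - y)"
    using test_functions_lipschitz[OF \<eta>] by blast
  have int: "integrable lborel \<eta>"
    by (rule integrable_lborel_compact_support[OF test_functions_continuous[OF \<eta>] K(1,2)])
  have [measurable]: "\<eta> \<in> borel_measurable borel"
    using test_functions_continuous[OF \<eta>] by (rule borel_measurable_continuous_onI)
  have [measurable]: "partial_deriv i \<eta> \<in> borel_measurable borel"
    using test_functions_continuous_partial[OF \<eta> i] by (rule borel_measurable_continuous_onI)
  have int2: "integrable lborel (\<lambda>x. \<eta> (c + x))" for c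
    using int integrable_distr_eq[of "(+) c" lborel borel \<eta>] by (simp add: lborel_distr_plus)
  have eq2: "(LINT x|lborel. \<eta> (c + x)) = integral\<^sup>L lborel \<eta>" for c
    using integral_distr[of "(+) c" lborel borel \<eta>] by (simp add: lborel_distr_plus)
  define s where "s n x = real (Suc n) * (\<eta> (inverse (real (Suc n)) *\<^sub>R i + x) - \<eta> x)" for n x
  have s0: "integral\<^sup>L lborel (s n) = 0" for n
    unfolding s_def by (subst integral_mult_right_zero, subst Bochner_Integration.integral_diff)
      (use int int2 eq2 in auto)
  have "(\<lambda>n. integral\<^sup>L lborel (s n)) \<longlonglongrightarrow> integral\<^sup>L lborel (partial_deriv i \<eta>)"
  proof (rule integral_dominated_convergence)
    show "integrable lborel (\<lambda>x. M * indicator (cball (0::'a) (R + 1)) x :: real)"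
      using emeasure_lborel_cball_finite[of "0::'a" "R + 1"]
      by (intro integrable_mult_right integrable_real_indicator) simp_all
    show "AE x in lborel. (\<lambda>n. s n x) \<longlonglongrightarrow> partial_deriv i \<eta> x"
    proof (intro AE_I2)
      fix x
      have "((\<lambda>t. \<eta> (t *\<^sub>R i + x)) has_derivative (\<lambda>h. gradient \<eta> (0 *\<^sub>R i + x) \<bullet> (h *\<^sub>R i))) (at 0)"
        by (rule has_derivative_compose[OF _ test_functions_has_derivative[OF \<eta>]])
           (auto intro!: derivative_eq_intros)
      moreover have "(\<lambda>h. gradient \<eta> (0 *\<^sub>R i + x) \<bullet> (h *\<^sub>R i)) = (*) (partial_deriv i \<eta> x)"
        by (auto simp: gradient_inner[OF i])
      ultimately have "((\<lambda>t. \<eta> (t *\<^sub>R i + x)) has_real_derivative partial_deriv i \<eta> x) (at 0)"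
        by (simp only: has_field_derivative_def)
      then have "((\<lambda>t. (\<eta> (t *\<^sub>R i + x) - \<eta> x) / t) \<longlongrightarrow> partial_deriv i \<eta> x) (at 0)"
        by (simp add: DERIV_def)
      moreover have "filterlim (\<lambda>n. inverse (real (Suc n))) (at 0) sequentially"
        using LIMSEQ_inverse_real_of_nat by (simp add: filterlim_at)
      ultimately have "(\<lambda>n. (\<eta> (inverse (real (Suc n)) *\<^sub>R i + x) - \<eta> x) / inverse (real (Suc n)))
         \<longlonglongrightarrow> partial_deriv i \<eta> x"
        by (rule filterlim_compose)
      then show "(\<lambda>n. s n x) \<longlonglongrightarrow> partial_deriv i \<eta> x"
        by (simp add: s_def divide_inverse mult.commute)
    qed
    show "AE x in lborel. norm (s n x) \<le> M * indicator (cball 0 (R + 1)) x" for n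
    proof (intro AE_I2)
      fix x
      define h where "h = inverse (real (Suc n)) *\<^sub>R i"
      have h: "norm h = inverse (real (Suc n))" using i by (simp add: h_def)
      show "norm (s n x) \<le> M * indicator (cball 0 (R + 1)) x"
      proof (cases "norm x \<le> R + 1")
        case True
        have "real (Suc n) * \<bar>\<eta> (h + x) - \<eta> x\<bar> \<le> real (Suc n) * (M * norm (h + x - x))"
          by (intro mult_left_mono lip) simp
        also have "\<dots> = M" using h by simp
        finally show ?thesis using True by (simp add: s_def abs_mult h_def)
      next
        case False
        \<comment> \<open>Step lengths are at most 1, so outside the ball of radius R + 1 neither x
          nor its translate meets the support.\<close>
        have "norm h \<le> 1" unfolding h by (simp add: inverse_le_1_iff)
        moreover have "norm x \<le> norm (h + x) + norm h"
          using norm_triangle_ineq4[of "h + x" h] by simp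
        ultimately have "h + x \<notin> K" "x \<notin> K" using False R[of "h + x"] R[of x] by linarith+
        then show ?thesis using False K by (simp add: s_def h_def)
      qed
    qed
  qed (auto simp: s_def[abs_def])
  with s0 show ?thesis by (simp add: LIMSEQ_const_iff)
qed

lemma set_integral_lebesgue_eq_lborel:
  fixes f :: "'a::euclidean_space \<Rightarrow> real"
  assumes "f \<in> borel_measurable borel" "\<And>x. x \<notin> \<Omega> \<Longrightarrow> f x = 0"
  shows "(LINT x:\<Omega>|lebesgue. f x) = (LINT x|lborel. f x)"
proof -
  have "(\<lambda>x. indicator \<Omega> x *\<^sub>R f x) = f"
    using assms(2) by (force simp: indicator_def)
  then show ?thesis
    using assms(1) by (simp add: set_lebesgue_integral_def integral_completion)
qed

lemma locally_integrable_on_mult_compact_support: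
  fixes h g :: "'a::euclidean_space \<Rightarrow> real"
  assumes h: "h locally_integrable_on \<Omega>"
    and g: "continuous_on UNIV g" "compact K" "K \<subseteq> \<Omega>" "\<And>x. x \<notin> K \<Longrightarrow> g x = 0"
  shows "set_integrable lebesgue \<Omega> (\<lambda>x. h x * g x)"
proof -
  have hK: "integrable lebesgue (\<lambda>x. indicator K x *\<^sub>R h x)"
    using h g by (auto simp: locally_integrable_on_def set_integrable_def)
  have "compact (g ` K)"
    using g by (meson compact_continuous_image continuous_on_subset subset_UNIV)
  then obtain M where M: "0 < M" "\<And>y. y \<in> g ` K \<Longrightarrow> norm y \<le> M"
    using bounded_pos compact_imp_bounded by metis
  have [measurable]: "g \<in> borel_measurable lebesgue"
    using borel_measurable_continuous_onI[OF g(1)] by (simp add: measurable_completion)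
  have "integrable lebesgue (\<lambda>x. (indicator K x *\<^sub>R h x) * g x)"
  proof (rule Bochner_Integration.integrable_bound)
    show "integrable lebesgue (\<lambda>x. M * (indicator K x *\<^sub>R h x))"
      using hK by simp
    show "(\<lambda>x. indicator K x *\<^sub>R h x * g x) \<in> borel_measurable lebesgue"
      using borel_measurable_integrable[OF hK] by measurable
    show "AE x in lebesgue. norm (indicator K x *\<^sub>R h x * g x) \<le> norm (M * (indicator K x *\<^sub>R h x))"
    proof (intro AE_I2)
      fix x
      have "norm (g x) \<le> M" if "x \<in> K" using M(2) that by blast
      then show "norm (indicator K x *\<^sub>R h x * g x) \<le> norm (M * (indicator K x *\<^sub>R h x))"
        using M(1) by (auto simp: indicator_def abs_mult mult.commute intro!: mult_right_mono)
    qed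
  qed
  moreover have "(\<lambda>x. (indicator K x *\<^sub>R h x) * g x) = (\<lambda>x. indicator \<Omega> x *\<^sub>R (h x * g x))"
    using g by (auto simp: indicator_def fun_eq_iff)
  ultimately show ?thesis by (simp add: set_integrable_def)
qed

lemma locally_integrable_on_inner:
  fixes G :: "'a::euclidean_space \<Rightarrow> 'b::euclidean_space"
  assumes "G locally_integrable_on \<Omega>"
  shows "(\<lambda>x. G x \<bullet> i) locally_integrable_on \<Omega>"
  unfolding locally_integrable_on_def set_integrable_def
proof (intro allI impI)
  fix K assume "compact K \<and> K \<subseteq> \<Omega>"
  then have "integrable lebesgue (\<lambda>x. (indicator K x *\<^sub>R G x) \<bullet> i)"
    using assms unfolding locally_integrable_on_def set_integrable_def
    by (intro integrable_inner_left) auto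
  then show "integrable lebesgue (\<lambda>x. indicator K x *\<^sub>R (G x \<bullet> i))"
    by simp
qed

lemma locally_integrable_on_continuous:
  fixes f :: "'a::euclidean_space \<Rightarrow> 'b::euclidean_space"
  assumes "continuous_on UNIV f"
  shows "f locally_integrable_on \<Omega>"
  unfolding locally_integrable_on_def
proof (intro allI impI)
  fix K :: "'a set" assume "compact K \<and> K \<subseteq> \<Omega>"
  then have "integrable lborel (\<lambda>x. indicator K x *\<^sub>R f x)"
    using continuous_on_subset[OF assms] by (intro borel_integrable_compact) auto
  then show "f absolutely_integrable_on K"
    unfolding set_integrable_def by (subst integrable_completion) auto
qed

lemma locally_integrable_on_add:
  fixes f g :: "'a::euclidean_space \<Rightarrow> 'b::euclidean_space"
  assumes "f locally_integrable_on \<Omega>" "g locally_integrable_on \<Omega>"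
  shows "(\<lambda>x. f x + g x) locally_integrable_on \<Omega>"
  using assms unfolding locally_integrable_on_def by (auto intro!: set_integral_add)

lemma locally_integrable_on_scaleR:
  fixes f :: "'a::euclidean_space \<Rightarrow> 'b::euclidean_space"
  assumes "f locally_integrable_on \<Omega>"
  shows "(\<lambda>x. c *\<^sub>R f x) locally_integrable_on \<Omega>"
  using assms unfolding locally_integrable_on_def
  by (auto intro!: absolutely_integrable_scaleR_left)

text \<open>The partial derivative of the product \<open>\<eta> x * \<theta> x\<close> has integral
  0, and the product rule splits it into the two sides.\<close>

lemma has_weak_gradient_test_function:
  assumes \<eta>: "\<eta> \<in> test_functions \<Omega>"
  shows "has_weak_gradient \<Omega> \<eta> (gradient \<eta>)"
  unfolding has_weak_gradient_def
proof (intro conjI ballI)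
  show "gradient \<eta> locally_integrable_on \<Omega>"
    by (intro locally_integrable_on_continuous test_functions_continuous_gradient[OF \<eta>])
  fix \<theta> and i :: 'a assume \<theta>: "\<theta> \<in> test_functions \<Omega>" and i: "i \<in> Basis"
  obtain K where K: "compact K" "K \<subseteq> \<Omega>" "\<And>x. x \<notin> K \<Longrightarrow> \<theta> x = 0" "\<And>x i. x \<notin> K \<Longrightarrow> partial_deriv i \<theta> x = 0"
    using \<theta> by (rule test_functions_supportE) blast
  have c: "continuous_on UNIV \<eta>" "continuous_on UNIV \<theta>"
     "continuous_on UNIV (partial_deriv i \<eta>)" "continuous_on UNIV (partial_deriv i \<theta>)"
    using \<eta> \<theta> i by (auto intro: test_functions_continuous test_functions_continuous_partial)
  have 1: "integrable lborel (\<lambda>x. \<eta> x * partial_deriv i \<theta> x)"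
    by (rule integrable_lborel_compact_support[OF _ K(1)]) (use c K in \<open>auto intro!: continuous_intros\<close>)
  have 2: "integrable lborel (\<lambda>x. partial_deriv i \<eta> x * \<theta> x)"
    by (rule integrable_lborel_compact_support[OF _ K(1)]) (use c K in \<open>auto intro!: continuous_intros\<close>)
  have "(LINT x|lborel. partial_deriv i (\<lambda>x. \<eta> x * \<theta> x) x) = 0"
    by (rule integral_partial_deriv_eq_0[OF _ i, of _ \<Omega>])
       (rule test_functions_mult_tcd[OF \<theta>], rule test_functions_times_cont[OF \<eta>])
  then have "(LINT x|lborel. \<eta> x * partial_deriv i \<theta> x + partial_deriv i \<eta> x * \<theta> x) = 0"
    using \<eta> \<theta> by (simp add: partial_deriv_mult test_functions_differentiable)
  then have "(LINT x|lborel. \<eta> x * partial_deriv i \<theta> x) = - (LINT x|lborel. partial_deriv i \<eta> x * \<theta> x)"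
    using 1 2 by simp
  moreover have "(LINT x:\<Omega>|lebesgue. \<eta> x * partial_deriv i \<theta> x) = (LINT x|lborel. \<eta> x * partial_deriv i \<theta> x)"
    by (rule set_integral_lebesgue_eq_lborel)
       (use K c in \<open>auto intro!: borel_measurable_continuous_onI continuous_intros\<close>)
  moreover have "(LINT x:\<Omega>|lebesgue. (gradient \<eta> x \<bullet> i) * \<theta> x) = (LINT x|lborel. partial_deriv i \<eta> x * \<theta> x)"
    unfolding gradient_inner[OF i]
    by (rule set_integral_lebesgue_eq_lborel)
       (use K c in \<open>auto intro!: borel_measurable_continuous_onI continuous_intros\<close>)
  ultimately show "(LINT x:\<Omega>|lebesgue. \<eta> x * partial_deriv i \<theta> x) = - (LINT x:\<Omega>|lebesgue. (gradient \<eta> x \<bullet> i) * \<theta> x)"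
    by simp
qed

section \<open>The fundamental lemma of the calculus of variations and uniqueness of weak
  gradients\<close>

text \<open>Open boxes are stable under intersection and generate the Borel sets, and the sets with
  vanishing integral are closed under complements and disjoint unions. The complement case needs the
  integral over the whole space, obtained by exhausting it with boxes.\<close>

lemma AE_eq_0_if_box_integrals_0:
  fixes f :: "'a::euclidean_space \<Rightarrow> real"
  assumes f: "integrable lborel f" and box0: "\<And>a b. (LINT x:box a b|lborel. f x) = 0"
  shows "AE x in lborel. f x = 0"
proof (rule sigma_finite_measure.density_zero[OF sigma_finite_lborel f])
  have si: "set_integrable lborel A f" if "A \<in> sets borel" for A
    unfolding set_integrable_def using f that by (intro integrable_mult_indicator) auto
  have UNIV0: "(LINT x:UNIV|lborel. f x) = 0"
  proof -
    have "(\<lambda>n::nat. LINT x:box (- real n *\<^sub>R One) (real n *\<^sub>R One)|lborel. f x)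
       \<longlonglongrightarrow> (LINT x:(\<Union>n::nat. box (- real n *\<^sub>R One) (real n *\<^sub>R One))|lborel. f x)"
    proof (rule set_integral_cont_up)
      show "incseq (\<lambda>n::nat. box (- real n *\<^sub>R One :: 'a) (real n *\<^sub>R One))"
        by (auto simp: incseq_def mem_box) (smt (verit) of_nat_mono)+
    qed (use si in auto)
    with box0 show ?thesis by (simp add: UN_box_eq_UNIV LIMSEQ_const_iff)
  qed
  fix A :: "'a set" assume "A \<in> sets lborel"
  then have A: "A \<in> sigma_sets UNIV (range (\<lambda>(a, b). box a b))"
    using borel_eq_box[where 'a='a] by (metis sets_lborel sets_measure_of subset_UNIV Pow_UNIV)
  have sb: "sigma_sets UNIV (range (\<lambda>(a, b). box a b)) = sets (borel :: 'a measure)"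
    using borel_eq_box[where 'a='a] by (metis sets_measure_of subset_UNIV Pow_UNIV)
  have Int: "Int_stable (range (\<lambda>(a, b). box a b :: 'a set))"
    by (auto simp: Int_stable_def box_Int_box)
  have "range (\<lambda>(a, b). box a b :: 'a set) \<subseteq> Pow UNIV" by simp
  from Int this A show "(LINT x:A|lborel. f x) = 0"
  proof (induction rule: sigma_sets_induct_disjoint)
    case empty
    then show ?case by (simp add: set_lebesgue_integral_def)
  next
    case (basic A)
    then show ?case using box0 by auto
  next
    case (compl A)
    then have A: "A \<in> sets borel" using sb by simp
    have "(LINT x:UNIV|lborel. f x) = (LINT x:A \<union> (UNIV - A)|lborel. f x)" by simp
    also have "\<dots> = (LINT x:A|lborel. f x) + (LINT x:UNIV - A|lborel. f x)"
      using A by (intro set_integral_Un si) auto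
    finally show ?case using UNIV0 compl by simp
  next
    case (union A)
    then have A: "A i \<in> sets borel" for i using sb by auto
    have "(LINT x:(\<Union>i. A i)|lborel. f x) = (\<Sum>i. (LINT x:(A i)|lborel. f x))"
      using union(1) A by (intro lebesgue_integral_countable_add si) (auto simp: disjoint_family_on_def)
    then show ?case using union by simp
  qed
qed

text \<open>Testing with box bumps makes the integral over every box with closure in \<Omega>
  vanish. The previous lemma then applies to the restriction of h to a closed box, and countably
  many closed boxes fill \<Omega>.\<close>

lemma fundamental_lemma_calculus_of_variations:
  fixes h :: "'a::euclidean_space \<Rightarrow> real"
  assumes \<Omega>: "open \<Omega>" and h: "h locally_integrable_on \<Omega>"
    and zero: "\<And>\<eta>. \<eta> \<in> test_functions \<Omega> \<Longrightarrow> (LINT x:\<Omega>|lebesgue. h x * \<eta> x) = 0"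
  shows "AE x in lebesgue. x \<in> \<Omega> \<longrightarrow> h x = 0"
proof -
  have box0: "(LINT x:box a b|lebesgue. h x) = 0" if ab: "cbox a b \<subseteq> \<Omega>" for a b
  proof -
    have hK: "integrable lebesgue (\<lambda>x. indicator (cbox a b) x *\<^sub>R h x)"
      using h ab by (auto simp: locally_integrable_on_def set_integrable_def)
    have [measurable]: "box_bump a b k \<in> borel_measurable borel" for k
      using times_cont_differentiable_box_bump[of 0 a b k]
      by (auto intro: borel_measurable_continuous_onI)
    have eq: "(indicator (cbox a b) x *\<^sub>R h x) * box_bump a b k x = indicator \<Omega> x *\<^sub>R (h x * box_bump a b k x)" for k x
      using ab box_bump_eq_0[of x a b k] box_subset_cbox[of a b] by (auto simp: indicator_def)
    have [measurable]: "(\<lambda>x. indicator (cbox a b) x *\<^sub>R h x) \<in> borel_measurable lebesgue"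
      using hK by auto
    have m2: "(\<lambda>x. indicator (box a b) x *\<^sub>R h x) \<in> borel_measurable lebesgue"
    proof -
      have "(\<lambda>x. indicator (box a b) x *\<^sub>R h x) = (\<lambda>x. indicator (box a b) x *\<^sub>R (indicator (cbox a b) x *\<^sub>R h x))"
        using box_subset_cbox[of a b] by (force simp: indicator_def)
      also have "\<dots> \<in> borel_measurable lebesgue"
        by (rule borel_measurable_scaleR[OF borel_measurable_indicator borel_measurable_integrable[OF hK]]) auto
      finally show ?thesis .
    qed
    have "(\<lambda>k. LINT x|lebesgue. (indicator (cbox a b) x *\<^sub>R h x) * box_bump a b k x)
        \<longlonglongrightarrow> (LINT x|lebesgue. indicator (box a b) x *\<^sub>R h x)"
    proof (rule integral_dominated_convergence)
      show "integrable lebesgue (\<lambda>x. norm (indicator (cbox a b) x *\<^sub>R h x))"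
        using hK by (rule integrable_norm)
      show "AE x in lebesgue. (\<lambda>k. (indicator (cbox a b) x *\<^sub>R h x) * box_bump a b k x)
         \<longlonglongrightarrow> indicator (box a b) x *\<^sub>R h x"
      proof (intro AE_I2)
        fix x
        have "(\<lambda>k. (indicator (cbox a b) x *\<^sub>R h x) * box_bump a b k x)
         \<longlonglongrightarrow> (indicator (cbox a b) x *\<^sub>R h x) * indicator (box a b) x"
          by (intro tendsto_mult tendsto_const tendsto_box_bump)
        also have "(indicator (cbox a b) x *\<^sub>R h x) * indicator (box a b) x = indicator (box a b) x *\<^sub>R h x"
          using box_subset_cbox[of a b] by (auto simp: indicator_def)
        finally show "(\<lambda>k. (indicator (cbox a b) x *\<^sub>R h x) * box_bump a b k x)
           \<longlonglongrightarrow> indicator (box a b) x *\<^sub>R h x" .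
      qed
      show "AE x in lebesgue. norm (indicator (cbox a b) x *\<^sub>R h x * box_bump a b k x)
          \<le> norm (indicator (cbox a b) x *\<^sub>R h x)" for k
        using box_bump_bounds[of a b k] by (auto intro!: AE_I2 mult_left_le simp: abs_mult)
      show "(\<lambda>x. indicator (cbox a b) x *\<^sub>R h x * box_bump a b k x) \<in> borel_measurable lebesgue" for k
        by (rule borel_measurable_times[OF borel_measurable_integrable[OF hK]]) (simp add: measurable_completion)
    qed (rule m2)
    moreover have "(LINT x|lebesgue. (indicator (cbox a b) x *\<^sub>R h x) * box_bump a b k x) = 0" for k
      using zero[OF box_bump_test_function[OF ab, of k]]
      unfolding set_lebesgue_integral_def eq .
    ultimately show ?thesis
      by (simp add: set_lebesgue_integral_def LIMSEQ_const_iff)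
  qed
  have cbox: "AE x in lebesgue. x \<in> cbox a b \<longrightarrow> h x = 0" if ab: "cbox a b \<subseteq> \<Omega>" for a b
  proof -
    define f where "f x = indicator (cbox a b) x *\<^sub>R h x" for x
    have f: "integrable lebesgue f"
      using h ab by (auto simp: locally_integrable_on_def set_integrable_def f_def[abs_def])
    \<comment> \<open>The box lemma lives on \<open>lborel\<close>, whereas h is only Lebesgue
      measurable; a Borel version bridges the gap.\<close>
    then obtain f' where f'[measurable]: "f' \<in> borel_measurable lborel" and ff': "AE x in lborel. f x = f' x"
      using completion_ex_borel_measurable_real by blast
    have ffl: "AE x in lebesgue. f x = f' x"
      using ff' by (rule AE_completion)
    have [measurable]: "f \<in> borel_measurable lebesgue" using f by auto
    have f'm: "f' \<in> borel_measurable lebesgue" using f' by (simp add: measurable_completion)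
    have "integrable lebesgue f'"
      using f integrable_cong_AE[OF _ f'm ffl] by simp
    then have intf': "integrable lborel f'"
      by (subst (asm) integrable_completion) (rule f')
    have "AE x in lborel. f' x = 0"
    proof (rule AE_eq_0_if_box_integrals_0[OF intf'])
      fix c d
      \<comment> \<open>The closure of a box is known to be the closed box only if the box is
        nonempty; an empty intersection is therefore represented by a box whose closed box is empty
        as well.\<close>
      obtain u v where uv: "box c d \<inter> box a b = box u v" "cbox u v \<subseteq> \<Omega>"
      proof (cases "box c d \<inter> box a b = {}")
        case True
        have e: "cbox (0::'a) (- One) = {}"
          by (simp add: box_eq_empty ex_in_conv)
        then have "box (0::'a) (- One) = {}"
          using box_subset_cbox[of "0::'a" "- One"] by simp
        with True e show thesis using that[of 0 "- One"] by simp
      next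
        case False
        obtain u v where uv: "box c d \<inter> box a b = box u v"
          using box_Int_box[of c d a b] by blast
        with False have "closure (box u v) = cbox u v" by (simp add: closure_box)
        moreover have "closure (box u v) \<subseteq> closure (box a b)"
          using uv by (intro closure_mono) auto
        moreover have "closure (box a b) \<subseteq> cbox a b"
          by (intro closure_minimal box_subset_cbox closed_cbox)
        ultimately have "cbox u v \<subseteq> \<Omega>" using ab by simp
        then show thesis by (rule that[OF uv])
      qed
      \<comment> \<open>The function lives on the closed box but the test integrals see only the
        open one; their difference is a null set.\<close>
      have nn: "AE x in lebesgue. x \<notin> cbox a b - box a b"
        by (rule AE_not_in) (use negligible_frontier_interval negligible_iff_null_sets in blast)
      have "(LINT x:box c d|lborel. f' x) = (LINT x|lebesgue. indicator (box c d) x *\<^sub>R f' x)"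
        unfolding set_lebesgue_integral_def by (subst integral_completion) auto
      also have "\<dots> = (LINT x|lebesgue. indicator (box u v) x *\<^sub>R f x)"
      proof (rule integral_cong_AE)
        show "AE x in lebesgue. indicator (box c d) x *\<^sub>R f' x = indicator (box u v) x *\<^sub>R f x"
          using ffl nn
        proof eventually_elim
          case (elim x)
          have bx: "x \<in> box u v \<longleftrightarrow> x \<in> box c d \<and> x \<in> box a b"
            unfolding uv(1)[symmetric] by simp
          show ?case
          proof (cases "x \<in> box a b")
            case True
            then show ?thesis using elim bx by (simp add: indicator_def)
          next
            case False
            then have "x \<notin> cbox a b" using elim by blast
            then show ?thesis using False elim bx by (simp add: indicator_def f_def)
          qed
        qed
        show "(\<lambda>x. indicator (box c d) x *\<^sub>R f' x) \<in> borel_measurable lebesgue"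
          by (rule borel_measurable_scaleR[OF borel_measurable_indicator f'm]) simp
        show "(\<lambda>x. indicator (box u v) x *\<^sub>R f x) \<in> borel_measurable lebesgue"
          by (rule borel_measurable_scaleR[OF borel_measurable_indicator borel_measurable_integrable[OF f]]) simp
      qed
      also have "\<dots> = (LINT x|lebesgue. indicator (box u v) x *\<^sub>R h x)"
      proof -
        have "box u v \<subseteq> cbox a b" using uv(1) box_subset_cbox[of a b] by blast
        then have "(\<lambda>x. indicator (box u v) x *\<^sub>R f x) = (\<lambda>x. indicator (box u v) x *\<^sub>R h x)"
          by (force simp: f_def indicator_def)
        then show ?thesis by simp
      qed
      also have "\<dots> = 0" using box0[OF uv(2)] by (simp add: set_lebesgue_integral_def)
      finally show "(LINT x:box c d|lborel. f' x) = 0" .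
    qed
    then have "AE x in lebesgue. f' x = 0" by (rule AE_completion)
    with ffl show ?thesis
      by eventually_elim (auto simp: f_def indicator_def)
  qed
  obtain D where D: "countable D" "D \<subseteq> Pow \<Omega>" "\<And>X. X \<in> D \<Longrightarrow> \<exists>a b. X = cbox a b" "\<Union>D = \<Omega>"
    using open_countable_Union_open_cbox[OF \<Omega>] by blast
  have "AE x in lebesgue. \<forall>X\<in>D. x \<in> X \<longrightarrow> h x = 0"
  proof (subst AE_ball_countable[OF D(1)], intro ballI)
    fix X assume "X \<in> D"
    then show "AE x in lebesgue. x \<in> X \<longrightarrow> h x = 0"
      using D(2,3) cbox by (metis PowD subsetD)
  qed
  then show ?thesis
    by eventually_elim (use D(4) in blast)
qed

lemma has_weak_gradient_unique:
  fixes f :: "'a::euclidean_space \<Rightarrow> real"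
  assumes \<Omega>: "open \<Omega>" and G: "has_weak_gradient \<Omega> f G" and G': "has_weak_gradient \<Omega> f G'"
  shows "AE x in lebesgue. x \<in> \<Omega> \<longrightarrow> G x = G' x"
proof -
  have li: "G locally_integrable_on \<Omega>" "G' locally_integrable_on \<Omega>"
    using G G' by (auto simp: has_weak_gradient_def)
  have "AE x in lebesgue. \<forall>i\<in>Basis. x \<in> \<Omega> \<longrightarrow> (G x - G' x) \<bullet> i = 0"
  proof (subst AE_ball_countable, simp add: countable_finite, intro ballI)
    fix i :: 'a assume i: "i \<in> Basis"
    have li': "(\<lambda>x. (G x - G' x) \<bullet> i) locally_integrable_on \<Omega>"
      using locally_integrable_on_inner[OF locally_integrable_on_add[OF li(1) locally_integrable_on_scaleR[OF li(2), of "-1"]], of i]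
      by simp
    show "AE x in lebesgue. x \<in> \<Omega> \<longrightarrow> (G x - G' x) \<bullet> i = 0"
    proof (rule fundamental_lemma_calculus_of_variations[OF \<Omega> li'])
      fix \<eta> assume \<eta>: "\<eta> \<in> test_functions \<Omega>"
      then obtain K where K: "compact K" "K \<subseteq> \<Omega>" "\<And>x. x \<notin> K \<Longrightarrow> \<eta> x = 0"
        by (rule test_functions_supportE) blast
      have "set_integrable lebesgue \<Omega> (\<lambda>x. (G x \<bullet> i) * \<eta> x)" "set_integrable lebesgue \<Omega> (\<lambda>x. (G' x \<bullet> i) * \<eta> x)"
        using li by (auto intro!: locally_integrable_on_mult_compact_support[OF _ test_functions_continuous[OF \<eta>] K]
            locally_integrable_on_inner)
      then have "(LINT x:\<Omega>|lebesgue. (G x \<bullet> i) * \<eta> x - (G' x \<bullet> i) * \<eta> x) =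
        (LINT x:\<Omega>|lebesgue. (G x \<bullet> i) * \<eta> x) - (LINT x:\<Omega>|lebesgue. (G' x \<bullet> i) * \<eta> x)"
        by (rule set_integral_diff(2))
      also have "\<dots> = 0"
      proof -
        have "(LINT x:\<Omega>|lebesgue. f x * partial_deriv i \<eta> x) = - (LINT x:\<Omega>|lebesgue. (G x \<bullet> i) * \<eta> x)"
          "(LINT x:\<Omega>|lebesgue. f x * partial_deriv i \<eta> x) = - (LINT x:\<Omega>|lebesgue. (G' x \<bullet> i) * \<eta> x)"
          using G G' \<eta> i unfolding has_weak_gradient_def by blast+
        then show ?thesis by simp
      qed
      finally show "(LINT x:\<Omega>|lebesgue. (G x - G' x) \<bullet> i * \<eta> x) = 0"
        by (simp add: inner_diff_left left_diff_distrib)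
    qed
  qed
  then show ?thesis
  proof eventually_elim
    case (elim x)
    show ?case
    proof
      assume "x \<in> \<Omega>"
      then have "(G x - G' x) \<bullet> i = 0" if "i \<in> Basis" for i using elim that by blast
      then have "G x - G' x = 0" by - (rule euclidean_eqI, simp)
      then show "G x = G' x" by simp
    qed
  qed
qed

subsection \<open>Averages over dyadic cubes\<close>

text \<open>The Jacobian of the dilation is at least 2^(-n) because c is at least 1/2.\<close>

lemma nn_integral_lborel_dilation_le:
  fixes h :: "'a::euclidean_space \<Rightarrow> ennreal"
  assumes h[measurable]: "h \<in> borel_measurable borel" and c: "1 / 2 \<le> c"
  shows "(\<integral>\<^sup>+y. h (v + c *\<^sub>R y) \<partial>lborel) \<le> 2 ^ DIM('a) * (\<integral>\<^sup>+y. h y \<partial>lborel)"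
proof -
  have "(\<integral>\<^sup>+y. h y \<partial>lborel) = (\<integral>\<^sup>+y. h y \<partial>density (distr lborel borel (\<lambda>x. v + c *\<^sub>R x)) (\<lambda>_. ennreal (\<bar>c\<bar> ^ DIM('a))))"
    using c by (subst lborel_affine[of c v]) auto
  also have "\<dots> = ennreal (c ^ DIM('a)) * (\<integral>\<^sup>+y. h (v + c *\<^sub>R y) \<partial>lborel)"
    using c by (simp add: nn_integral_density nn_integral_distr nn_integral_cmult)
  finally have eq: "(\<integral>\<^sup>+y. h y \<partial>lborel) = ennreal (c ^ DIM('a)) * (\<integral>\<^sup>+y. h (v + c *\<^sub>R y) \<partial>lborel)" .
  have "1 \<le> (2 * c) ^ DIM('a)" using c by (intro one_le_power) simp
  then have "ennreal 1 \<le> ennreal (2 ^ DIM('a) * c ^ DIM('a))"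
    by (intro ennreal_leI) (simp add: power_mult_distrib)
  also have "\<dots> = 2 ^ DIM('a) * ennreal (c ^ DIM('a))"
    by (simp add: ennreal_mult' flip: ennreal_power)
  finally have "1 * (\<integral>\<^sup>+y. h (v + c *\<^sub>R y) \<partial>lborel) \<le>
      2 ^ DIM('a) * ennreal (c ^ DIM('a)) * (\<integral>\<^sup>+y. h (v + c *\<^sub>R y) \<partial>lborel)"
    by (intro mult_right_mono) simp_all
  with eq show ?thesis by (simp add: mult.assoc)
qed

text \<open>One of the coefficients t and 1 - t is at least 1/2. Integrating first in the variable
  that carries it costs at most 2^n, uniformly in t, and convexity keeps the combination inside
  S.\<close>

lemma nn_integral_convex_combination_le:
  fixes g :: "'a::euclidean_space \<Rightarrow> ennreal"
  assumes g[measurable]: "g \<in> borel_measurable borel" and S[measurable]: "S \<in> sets borel"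
    and convex: "convex S" and t: "0 \<le> t" "t \<le> 1"
  shows "(\<integral>\<^sup>+x\<in>S. (\<integral>\<^sup>+y\<in>S. g ((1 - t) *\<^sub>R y + t *\<^sub>R x) \<partial>lborel) \<partial>lborel)
    \<le> 2 ^ DIM('a) * emeasure lborel S * (\<integral>\<^sup>+y\<in>S. g y \<partial>lborel)"
proof -
  have inner: "(\<integral>\<^sup>+y\<in>S. g (c *\<^sub>R y + d *\<^sub>R x) \<partial>lborel) \<le> 2 ^ DIM('a) * (\<integral>\<^sup>+y\<in>S. g y \<partial>lborel)"
    if "x \<in> S" "1 / 2 \<le> c" "0 \<le> d" "c + d = 1" for x c d
  proof -
    have "(\<integral>\<^sup>+y\<in>S. g (c *\<^sub>R y + d *\<^sub>R x) \<partial>lborel) \<le>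
      (\<integral>\<^sup>+y. g (d *\<^sub>R x + c *\<^sub>R y) * indicator S (d *\<^sub>R x + c *\<^sub>R y) \<partial>lborel)"
    proof (intro nn_integral_mono)
      fix y
      show "g (c *\<^sub>R y + d *\<^sub>R x) * indicator S y \<le> g (d *\<^sub>R x + c *\<^sub>R y) * indicator S (d *\<^sub>R x + c *\<^sub>R y)"
        using convexD[OF convex, of x y d c] that by (auto simp: indicator_def add.commute)
    qed
    also have "\<dots> \<le> 2 ^ DIM('a) * (\<integral>\<^sup>+y\<in>S. g y \<partial>lborel)"
      by (rule nn_integral_lborel_dilation_le) (use that in auto)
    finally show ?thesis .
  qed
  have outer: "(\<integral>\<^sup>+x\<in>S. F x \<partial>lborel) \<le> 2 ^ DIM('a) * emeasure lborel S * (\<integral>\<^sup>+y\<in>S. g y \<partial>lborel)"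
    if "\<And>x. x \<in> S \<Longrightarrow> F x \<le> 2 ^ DIM('a) * (\<integral>\<^sup>+y\<in>S. g y \<partial>lborel)" for F
  proof -
    have "(\<integral>\<^sup>+x\<in>S. F x \<partial>lborel) \<le> (\<integral>\<^sup>+x\<in>S. 2 ^ DIM('a) * (\<integral>\<^sup>+y\<in>S. g y \<partial>lborel) \<partial>lborel)"
      using that by (intro nn_integral_mono) (auto simp: indicator_def)
    also have "\<dots> = 2 ^ DIM('a) * emeasure lborel S * (\<integral>\<^sup>+y\<in>S. g y \<partial>lborel)"
      by (subst nn_integral_cmult) (auto simp: mult_ac)
    finally show ?thesis .
  qed
  show ?thesis
  proof (cases "t \<le> 1 / 2")
    case True
    with t show ?thesis by (intro outer inner) auto
  next
    case False
    \<comment> \<open>Now x carries the large coefficient, so the order of integration is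
      exchanged.\<close>
    have "(\<integral>\<^sup>+x\<in>S. (\<integral>\<^sup>+y\<in>S. g ((1 - t) *\<^sub>R y + t *\<^sub>R x) \<partial>lborel) \<partial>lborel) =
      (\<integral>\<^sup>+x. (\<integral>\<^sup>+y. g ((1 - t) *\<^sub>R y + t *\<^sub>R x) * indicator S y * indicator S x \<partial>lborel) \<partial>lborel)"
      by (intro nn_integral_cong nn_integral_multc[symmetric]) auto
    also have "\<dots> = (\<integral>\<^sup>+y. (\<integral>\<^sup>+x. g ((1 - t) *\<^sub>R y + t *\<^sub>R x) * indicator S y * indicator S x \<partial>lborel) \<partial>lborel)"
      by (rule lborel_pair.Fubini'[symmetric]) measurable
    also have "\<dots> = (\<integral>\<^sup>+y\<in>S. (\<integral>\<^sup>+x\<in>S. g (t *\<^sub>R x + (1 - t) *\<^sub>R y) \<partial>lborel) \<partial>lborel)"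
      by (subst nn_integral_multc[symmetric]) (auto intro!: nn_integral_cong simp: mult_ac add.commute)
    also have "\<dots> \<le> 2 ^ DIM('a) * emeasure lborel S * (\<integral>\<^sup>+y\<in>S. g y \<partial>lborel)"
      using t False by (intro outer inner) auto
    finally show ?thesis .
  qed
qed

lemma increment_le_segment_integral:
  fixes f :: "'a::euclidean_space \<Rightarrow> real"
  assumes f: "\<And>x. (f has_derivative (\<lambda>h. G x \<bullet> h)) (at x)" and G: "continuous_on UNIV G"
    and d: "norm (x - y) \<le> d"
  shows "ennreal \<bar>f x - f y\<bar> \<le> ennreal d * (\<integral>\<^sup>+t\<in>{0..1}. ennreal (norm (G ((1 - t) *\<^sub>R y + t *\<^sub>R x))) \<partial>lborel)"
proof -
  define \<gamma> where "\<gamma> t = (1 - t) *\<^sub>R y + t *\<^sub>R x" for t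
  have Gc: "continuous_on A (\<lambda>t. G (\<gamma> t))" for A
    unfolding \<gamma>_def by (intro continuous_on_compose2[OF G] continuous_intros) auto
  have "((\<lambda>t. G (\<gamma> t) \<bullet> (x - y)) has_integral f (\<gamma> 1) - f (\<gamma> 0)) {0..1}"
  proof (rule fundamental_theorem_of_calculus)
    fix t :: real
    have "(\<gamma> has_derivative (\<lambda>h. h *\<^sub>R (x - y))) (at t within {0..1})"
      unfolding \<gamma>_def by (auto intro!: derivative_eq_intros simp: algebra_simps)
    then have "((\<lambda>t. f (\<gamma> t)) has_derivative (\<lambda>h. G (\<gamma> t) \<bullet> (h *\<^sub>R (x - y)))) (at t within {0..1})"
      by (rule has_derivative_compose[OF _ f])
    then show "((\<lambda>t. f (\<gamma> t)) has_vector_derivative G (\<gamma> t) \<bullet> (x - y)) (at t within {0..1})"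
      by (simp add: has_vector_derivative_def)
  qed simp
  then have 1: "((\<lambda>t. G (\<gamma> t) \<bullet> (x - y)) has_integral f x - f y) {0..1}"
    by (simp add: \<gamma>_def)
  have "continuous_on {0..1} (\<lambda>t. norm (G (\<gamma> t)))" by (intro continuous_intros Gc)
  then have "(\<lambda>t. norm (G (\<gamma> t))) integrable_on {0..1}"
    by (rule integrable_continuous_real)
  then obtain I where I: "((\<lambda>t. norm (G (\<gamma> t))) has_integral I) {0..1}" by blast
  have I0: "0 \<le> I" by (rule has_integral_nonneg[OF I]) simp
  have d0: "0 \<le> d" using d norm_ge_zero order_trans by blast
  have "norm (f x - f y) \<le> d * I"
  proof -
    have "norm (integral {0..1} (\<lambda>t. G (\<gamma> t) \<bullet> (x - y))) \<le> integral {0..1} (\<lambda>t. d * norm (G (\<gamma> t)))"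
    proof (rule integral_norm_bound_integral)
      show "(\<lambda>t. G (\<gamma> t) \<bullet> (x - y)) integrable_on {0..1}" using 1 by blast
      show "(\<lambda>t. d * norm (G (\<gamma> t))) integrable_on {0..1}"
        using has_integral_mult_right[OF I, of d] by blast
      fix t
      have "\<bar>G (\<gamma> t) \<bullet> (x - y)\<bar> \<le> norm (G (\<gamma> t)) * norm (x - y)" by (rule Cauchy_Schwarz_ineq2)
      also have "\<dots> \<le> norm (G (\<gamma> t)) * d" by (intro mult_left_mono d) simp
      finally show "norm (G (\<gamma> t) \<bullet> (x - y)) \<le> d * norm (G (\<gamma> t))" by (simp add: mult.commute)
    qed
    moreover have "integral {0..1} (\<lambda>t. d * norm (G (\<gamma> t))) = d * I"
      by (rule integral_unique[OF has_integral_mult_right[OF I]])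
    ultimately show ?thesis using integral_unique[OF 1] by (simp only:)
  qed
  then have "ennreal \<bar>f x - f y\<bar> \<le> ennreal (d * I)" by (intro ennreal_leI) simp
  also have "\<dots> = ennreal d * ennreal I" using d0 by (rule ennreal_mult')
  also have "ennreal I = (\<integral>\<^sup>+t\<in>{0..1}. ennreal (norm (G (\<gamma> t))) \<partial>lborel)"
    by (rule nn_integral_has_integral_lebesgue'[OF _ I, symmetric]) simp
  finally show ?thesis by (simp add: \<gamma>_def)
qed

text \<open>The increment is bounded by the integral of the gradient along the segment, which stays
  in S. With the segment parameter t moved outermost, every slice is bounded by
  \<open>nn_integral_convex_combination_le\<close>.\<close>

lemma Poincare_convex_L1:
  fixes f :: "'a::euclidean_space \<Rightarrow> real"
  assumes f: "\<And>x. (f has_derivative (\<lambda>h. G x \<bullet> h)) (at x)" and G: "continuous_on UNIV G"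
    and S[measurable]: "S \<in> sets borel" and convex: "convex S"
    and d: "\<And>x y. x \<in> S \<Longrightarrow> y \<in> S \<Longrightarrow> norm (x - y) \<le> d"
  shows "(\<integral>\<^sup>+x\<in>S. (\<integral>\<^sup>+y\<in>S. ennreal \<bar>f x - f y\<bar> \<partial>lborel) \<partial>lborel)
    \<le> ennreal d * (2 ^ DIM('a) * emeasure lborel S * (\<integral>\<^sup>+y\<in>S. ennreal (norm (G y)) \<partial>lborel))"
proof -
  have [measurable]: "G \<in> borel_measurable borel"
    by (rule borel_measurable_continuous_onI[OF G])
  have "continuous_on UNIV f"
    using f by (meson continuous_at_imp_continuous_on has_derivative_continuous)
  then have [measurable]: "f \<in> borel_measurable borel"
    by (rule borel_measurable_continuous_onI)
  define P where "P t x y = ennreal (norm (G ((1 - t) *\<^sub>R y + t *\<^sub>R x))) * indicator {0..1} t * indicator S y * indicator S x" for t :: real and x y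
  have [measurable]: "(\<lambda>z. P (fst z) (fst (snd z)) (snd (snd z))) \<in> borel_measurable (lborel \<Otimes>\<^sub>M (lborel \<Otimes>\<^sub>M lborel))"
    unfolding P_def by measurable
  have "(\<integral>\<^sup>+x\<in>S. (\<integral>\<^sup>+y\<in>S. ennreal \<bar>f x - f y\<bar> \<partial>lborel) \<partial>lborel)
    \<le> (\<integral>\<^sup>+x\<in>S. (\<integral>\<^sup>+y\<in>S. ennreal d * (\<integral>\<^sup>+t\<in>{0..1}. ennreal (norm (G ((1 - t) *\<^sub>R y + t *\<^sub>R x))) \<partial>lborel) \<partial>lborel) \<partial>lborel)"
  proof (intro nn_integral_mono)
    fix x
    have "(\<integral>\<^sup>+y\<in>S. ennreal \<bar>f x - f y\<bar> \<partial>lborel) \<le>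
       (\<integral>\<^sup>+y\<in>S. ennreal d * (\<integral>\<^sup>+t\<in>{0..1}. ennreal (norm (G ((1 - t) *\<^sub>R y + t *\<^sub>R x))) \<partial>lborel) \<partial>lborel)" if "x \<in> S"
      using that d increment_le_segment_integral[OF f G]
      by (intro nn_integral_mono) (auto simp: indicator_def)
    then show "(\<integral>\<^sup>+y\<in>S. ennreal \<bar>f x - f y\<bar> \<partial>lborel) * indicator S x \<le>
       (\<integral>\<^sup>+y\<in>S. ennreal d * (\<integral>\<^sup>+t\<in>{0..1}. ennreal (norm (G ((1 - t) *\<^sub>R y + t *\<^sub>R x))) \<partial>lborel) \<partial>lborel) * indicator S x"
      by (auto simp: indicator_def)
  qed
  also have "\<dots> = ennreal d * (\<integral>\<^sup>+x\<in>S. (\<integral>\<^sup>+y\<in>S. (\<integral>\<^sup>+t\<in>{0..1}. ennreal (norm (G ((1 - t) *\<^sub>R y + t *\<^sub>R x))) \<partial>lborel) \<partial>lborel) \<partial>lborel)"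
    by (simp add: nn_integral_cmult mult.assoc)
  also have "(\<integral>\<^sup>+x\<in>S. (\<integral>\<^sup>+y\<in>S. (\<integral>\<^sup>+t\<in>{0..1}. ennreal (norm (G ((1 - t) *\<^sub>R y + t *\<^sub>R x))) \<partial>lborel) \<partial>lborel) \<partial>lborel)
    = (\<integral>\<^sup>+x. (\<integral>\<^sup>+y. (\<integral>\<^sup>+t. P t x y \<partial>lborel) \<partial>lborel) \<partial>lborel)"
    unfolding P_def by (simp add: nn_integral_multc)
  also have "(\<integral>\<^sup>+x. (\<integral>\<^sup>+y. (\<integral>\<^sup>+t. P t x y \<partial>lborel) \<partial>lborel) \<partial>lborel) = (\<integral>\<^sup>+x. (\<integral>\<^sup>+t. (\<integral>\<^sup>+y. P t x y \<partial>lborel) \<partial>lborel) \<partial>lborel)"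
    by (intro nn_integral_cong lborel_pair.Fubini') (simp add: P_def)
  also have "\<dots> = (\<integral>\<^sup>+t. (\<integral>\<^sup>+x. (\<integral>\<^sup>+y. P t x y \<partial>lborel) \<partial>lborel) \<partial>lborel)"
    by (rule lborel_pair.Fubini') (simp add: P_def)
  also have "\<dots> = (\<integral>\<^sup>+t\<in>{0..1}. (\<integral>\<^sup>+x\<in>S. (\<integral>\<^sup>+y\<in>S. ennreal (norm (G ((1 - t) *\<^sub>R y + t *\<^sub>R x))) \<partial>lborel) \<partial>lborel) \<partial>lborel)"
  proof (rule nn_integral_cong)
    fix t :: real
    show "(\<integral>\<^sup>+x. (\<integral>\<^sup>+y. P t x y \<partial>lborel) \<partial>lborel) =
      (\<integral>\<^sup>+x\<in>S. (\<integral>\<^sup>+y\<in>S. ennreal (norm (G ((1 - t) *\<^sub>R y + t *\<^sub>R x))) \<partial>lborel) \<partial>lborel) * indicator {0..1} t"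
      by (cases "t \<in> {0..1}") (simp_all add: P_def nn_integral_multc)
  qed
  also have "\<dots> \<le> (\<integral>\<^sup>+t\<in>{0..1::real}. 2 ^ DIM('a) * emeasure lborel S * (\<integral>\<^sup>+y\<in>S. ennreal (norm (G y)) \<partial>lborel) \<partial>lborel)"
    using nn_integral_convex_combination_le[of "\<lambda>x. ennreal (norm (G x))", OF _ S convex]
    by (intro nn_integral_mono) (auto simp: indicator_def)
  also have "\<dots> = 2 ^ DIM('a) * emeasure lborel S * (\<integral>\<^sup>+y\<in>S. ennreal (norm (G y)) \<partial>lborel)"
    by (simp add: nn_integral_cmult_indicator)
  finally show ?thesis by (simp add: mult_left_mono)
qed

section \<open>Dyadic cubes and telescoping of averages\<close>

text \<open>The half-open dyadic cube of side 2^(-k) around x. In terms of floors, cubes of one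
  generation are classes of an equivalence relation, and nesting is integer division by 2.\<close>

definition cube :: "nat \<Rightarrow> 'a::euclidean_space \<Rightarrow> 'a set"
  where "cube k x = {y. \<forall>i\<in>Basis. \<lfloor>2 ^ k * (y \<bullet> i)\<rfloor> = \<lfloor>2 ^ k * (x \<bullet> i)\<rfloor>}"

lemma cube_self: "x \<in> cube k x"
  by (simp add: cube_def)

lemma cube_eq: "y \<in> cube k x \<Longrightarrow> cube k y = cube k x"
  by (auto simp: cube_def)

lemma cube_Suc_subset: "cube (Suc k) x \<subseteq> cube k x"
proof -
  have "\<lfloor>2 ^ k * r\<rfloor> = \<lfloor>2 ^ Suc k * r\<rfloor> div 2" for r :: real
    using floor_divide_real_eq_div[of 2 "2 ^ Suc k * r"] by simp
  then show ?thesis by (auto simp: cube_def)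
qed

lemma cube_measurable[measurable]: "cube k x \<in> sets borel"
  unfolding cube_def by measurable

lemma convex_cube: "convex (cube k x)"
proof -
  have "cube k x = (\<Inter>i\<in>Basis. {y. i \<bullet> y < (of_int \<lfloor>2 ^ k * (x \<bullet> i)\<rfloor> + 1) / 2 ^ k} \<inter> {y. i \<bullet> y \<ge> of_int \<lfloor>2 ^ k * (x \<bullet> i)\<rfloor> / 2 ^ k})"
    by (auto simp: cube_def floor_eq_iff field_simps inner_commute)
  then show ?thesis
    by (auto intro!: convex_INT convex_Int convex_halfspace_lt convex_halfspace_ge)
qed

lemma cube_coordinate_diff:
  assumes "y \<in> cube k x" "z \<in> cube k x" "i \<in> Basis"
  shows "\<bar>(y - z) \<bullet> i\<bar> \<le> 1 / 2 ^ k"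
proof -
  have "\<lfloor>2 ^ k * (y \<bullet> i)\<rfloor> = \<lfloor>2 ^ k * (z \<bullet> i)\<rfloor>"
    using assms by (auto simp: cube_def)
  then have "\<bar>2 ^ k * (y \<bullet> i) - 2 ^ k * (z \<bullet> i)\<bar> \<le> 1" by linarith
  then have "2 ^ k * \<bar>(y - z) \<bullet> i\<bar> \<le> 1"
    by (simp add: inner_diff_left abs_mult flip: right_diff_distrib)
  then show ?thesis by (simp add: field_simps)
qed

lemma cube_diameter:
  fixes x :: "'a::euclidean_space"
  assumes "y \<in> cube k x" "z \<in> cube k x"
  shows "norm (y - z) \<le> real DIM('a) / 2 ^ k"
proof -
  have "norm (y - z) \<le> (\<Sum>i\<in>Basis. \<bar>(y - z) \<bullet> i\<bar>)" by (rule norm_le_l1)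
  also have "\<dots> \<le> (\<Sum>i\<in>(Basis::'a set). 1 / 2 ^ k)"
    by (intro sum_mono cube_coordinate_diff[OF assms])
  finally show ?thesis by simp
qed

lemma emeasure_cube:
  fixes x :: "'a::euclidean_space"
  shows "emeasure lborel (cube k x) = ennreal ((1 / 2 ^ k) ^ DIM('a))"
proof -
  define m where "m i = (of_int \<lfloor>2 ^ k * (x \<bullet> i)\<rfloor> :: real)" for i
  define a b :: 'a where "a = (\<Sum>i\<in>Basis. (m i / 2 ^ k) *\<^sub>R i)" and "b = (\<Sum>i\<in>Basis. ((m i + 1) / 2 ^ k) *\<^sub>R i)"
  have ab: "a \<bullet> i = m i / 2 ^ k" "b \<bullet> i = (m i + 1) / 2 ^ k" if "i \<in> Basis" for i
    using that by (simp_all add: a_def b_def inner_sum_left_Basis)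
  have eq: "cube k x = {y. \<forall>i\<in>Basis. a \<bullet> i \<le> y \<bullet> i \<and> y \<bullet> i < b \<bullet> i}"
    by (auto simp: cube_def ab m_def floor_eq_iff field_simps)
  have le: "\<forall>i\<in>Basis. a \<bullet> i \<le> b \<bullet> i"
    by (simp add: ab divide_right_mono)
  have prod: "(\<Prod>i\<in>Basis. (b - a) \<bullet> i) = (1 / 2 ^ k) ^ DIM('a)"
    by (simp add: inner_diff_left ab diff_divide_distrib[symmetric])
  have "emeasure lborel (box a b) \<le> emeasure lborel (cube k x)"
    by (intro emeasure_mono) (auto simp: eq mem_box less_imp_le)
  moreover have "emeasure lborel (cube k x) \<le> emeasure lborel (cbox a b)"
    by (intro emeasure_mono) (auto simp: eq mem_box less_imp_le)
  ultimately show ?thesis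
    using le prod by (auto simp: emeasure_lborel_box_eq emeasure_lborel_cbox_eq)
qed

definition cube_average :: "nat \<Rightarrow> ('a::euclidean_space \<Rightarrow> ennreal) \<Rightarrow> 'a \<Rightarrow> ennreal"
  where "cube_average k g x = ennreal ((2 ^ k) ^ DIM('a)) * (\<integral>\<^sup>+y\<in>cube k x. g y \<partial>lborel)"

lemma ennreal_power_mult_inverse_power:
  "0 < c \<Longrightarrow> ennreal (c ^ n) * ennreal ((1 / c) ^ n) = 1"
  by (simp add: ennreal_mult'[symmetric] power_mult_distrib[symmetric])

lemma cube_average_const:
  fixes x :: "'a::euclidean_space"
  shows "cube_average k (\<lambda>_. c) x = c"
proof -
  have "ennreal ((2 ^ k) ^ DIM('a)) * ennreal ((1 / 2 ^ k) ^ DIM('a)) = 1"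
    by (rule ennreal_power_mult_inverse_power) simp
  then show ?thesis
    by (simp add: cube_average_def nn_integral_cmult_indicator emeasure_cube mult.left_commute)
qed

text \<open>The two averages differ by at most the double average of |f y - f z| over the small
  times the large cube. Enlarging the small cube costs 2^n, the Poincare inequality on the large one
  costs another 2^n and the diameter n/2^k; hence the constant.\<close>

lemma cube_average_step:
  fixes f :: "'a::euclidean_space \<Rightarrow> real"
  assumes f: "\<And>x. (f has_derivative (\<lambda>h. G x \<bullet> h)) (at x)" and G: "continuous_on UNIV G"
  shows "cube_average (Suc k) (\<lambda>y. ennreal \<bar>f y\<bar>) x \<le> cube_average k (\<lambda>y. ennreal \<bar>f y\<bar>) x
    + ennreal (real DIM('a) * 4 ^ DIM('a) / 2 ^ k) * cube_average k (\<lambda>y. ennreal (norm (G y))) x"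
proof -
  let ?Q = "cube k x" and ?Q' = "cube (Suc k) x"
  define V where "V = ennreal ((2 ^ k) ^ DIM('a))"
  define W where "W = ennreal ((2 ^ Suc k) ^ DIM('a))"
  have W: "W = 2 ^ DIM('a) * V"
    by (simp add: W_def V_def power_mult_distrib ennreal_mult' flip: ennreal_power)
  have VQ: "V * emeasure lborel ?Q = 1" "W * emeasure lborel ?Q' = 1"
    unfolding V_def W_def emeasure_cube by (rule ennreal_power_mult_inverse_power, simp)+
  have "continuous_on UNIV f"
    using f by (meson continuous_at_imp_continuous_on has_derivative_continuous)
  then have [measurable]: "f \<in> borel_measurable borel"
    by (rule borel_measurable_continuous_onI)
  define D where "D = (\<integral>\<^sup>+y\<in>?Q'. (\<integral>\<^sup>+z\<in>?Q. ennreal \<bar>f y - f z\<bar> \<partial>lborel) \<partial>lborel)"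
  have "W * (\<integral>\<^sup>+y\<in>?Q'. ennreal \<bar>f y\<bar> \<partial>lborel) = W * (\<integral>\<^sup>+y\<in>?Q'. V * (\<integral>\<^sup>+z\<in>?Q. ennreal \<bar>f y\<bar> \<partial>lborel) \<partial>lborel)"
  proof -
    have "V * (\<integral>\<^sup>+z\<in>?Q. c \<partial>lborel) = c * (V * emeasure lborel ?Q)" for c
      by (simp add: nn_integral_cmult_indicator mult.left_commute)
    then show ?thesis using VQ by simp
  qed
  also have "\<dots> \<le> W * (\<integral>\<^sup>+y\<in>?Q'. V * ((\<integral>\<^sup>+z\<in>?Q. ennreal \<bar>f z\<bar> \<partial>lborel) + (\<integral>\<^sup>+z\<in>?Q. ennreal \<bar>f y - f z\<bar> \<partial>lborel)) \<partial>lborel)"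
  proof (intro mult_left_mono nn_integral_mono mult_right_mono)
    fix y
    have "(\<integral>\<^sup>+z\<in>?Q. ennreal \<bar>f y\<bar> \<partial>lborel) \<le> (\<integral>\<^sup>+z. ennreal \<bar>f z\<bar> * indicator ?Q z + ennreal \<bar>f y - f z\<bar> * indicator ?Q z \<partial>lborel)"
      by (intro nn_integral_mono) (auto simp: indicator_def ennreal_plus[symmetric] simp del: ennreal_plus intro!: ennreal_leI)
    also have "\<dots> = (\<integral>\<^sup>+z\<in>?Q. ennreal \<bar>f z\<bar> \<partial>lborel) + (\<integral>\<^sup>+z\<in>?Q. ennreal \<bar>f y - f z\<bar> \<partial>lborel)"
      by (rule nn_integral_add) measurable
    finally show "(\<integral>\<^sup>+z\<in>?Q. ennreal \<bar>f y\<bar> \<partial>lborel) \<le> \<dots>" .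
  qed simp_all
  also have "\<dots> = V * (\<integral>\<^sup>+z\<in>?Q. ennreal \<bar>f z\<bar> \<partial>lborel) + W * V * D"
  proof -
    have "(\<integral>\<^sup>+y\<in>?Q'. V * ((\<integral>\<^sup>+z\<in>?Q. ennreal \<bar>f z\<bar> \<partial>lborel) + (\<integral>\<^sup>+z\<in>?Q. ennreal \<bar>f y - f z\<bar> \<partial>lborel)) \<partial>lborel)
      = (\<integral>\<^sup>+y. V * (\<integral>\<^sup>+z\<in>?Q. ennreal \<bar>f z\<bar> \<partial>lborel) * indicator ?Q' y + V * ((\<integral>\<^sup>+z\<in>?Q. ennreal \<bar>f y - f z\<bar> \<partial>lborel) * indicator ?Q' y) \<partial>lborel)"
      by (intro nn_integral_cong) (simp add: distrib_left distrib_right mult_ac)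
    also have "\<dots> = V * (\<integral>\<^sup>+z\<in>?Q. ennreal \<bar>f z\<bar> \<partial>lborel) * emeasure lborel ?Q' + V * D"
      unfolding D_def by (subst nn_integral_add) (auto simp: nn_integral_cmult nn_integral_cmult_indicator)
    finally have e: "(\<integral>\<^sup>+y\<in>?Q'. V * ((\<integral>\<^sup>+z\<in>?Q. ennreal \<bar>f z\<bar> \<partial>lborel) + (\<integral>\<^sup>+z\<in>?Q. ennreal \<bar>f y - f z\<bar> \<partial>lborel)) \<partial>lborel)
      = V * (\<integral>\<^sup>+z\<in>?Q. ennreal \<bar>f z\<bar> \<partial>lborel) * emeasure lborel ?Q' + V * D" .
    have "W * (V * A * E + V * D) = (W * E) * (V * A) + W * V * D" for A E
      by (simp add: distrib_left mult_ac)
    then show ?thesis unfolding e VQ by (simp only: VQ mult_1_left)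
  qed
  also have "W * V * D \<le> W * V * (\<integral>\<^sup>+y\<in>?Q. (\<integral>\<^sup>+z\<in>?Q. ennreal \<bar>f y - f z\<bar> \<partial>lborel) \<partial>lborel)"
    unfolding D_def using cube_Suc_subset[of k x]
    by (intro mult_left_mono nn_integral_mono) (auto simp: indicator_def)
  also have "\<dots> \<le> W * V * (ennreal (real DIM('a) / 2 ^ k) * (2 ^ DIM('a) * emeasure lborel ?Q * (\<integral>\<^sup>+y\<in>?Q. ennreal (norm (G y)) \<partial>lborel)))"
    by (intro mult_left_mono Poincare_convex_L1[OF f G] convex_cube cube_diameter[of _ k x]) auto
  also have "\<dots> = 2 ^ DIM('a) * ennreal (real DIM('a) / 2 ^ k) * 2 ^ DIM('a) * (V * emeasure lborel ?Q) * (V * (\<integral>\<^sup>+y\<in>?Q. ennreal (norm (G y)) \<partial>lborel))"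
    by (simp add: W mult_ac)
  also have "2 ^ DIM('a) * ennreal (real DIM('a) / 2 ^ k) * 2 ^ DIM('a) = ennreal (real DIM('a) * 4 ^ DIM('a) / 2 ^ k)"
  proof -
    have "(2::ennreal) ^ DIM('a) = ennreal (2 ^ DIM('a))" by (simp flip: ennreal_power)
    moreover have "(4::real) ^ DIM('a) = 2 ^ DIM('a) * 2 ^ DIM('a)"
      by (simp flip: power_mult_distrib)
    ultimately show ?thesis
      by (simp add: mult_ac flip: ennreal_mult')
  qed
  finally show ?thesis
    by (simp only: cube_average_def V_def[symmetric] W_def[symmetric] VQ mult_1_right add_left_mono simp_thms)
qed

lemma cube_average_telescope:
  fixes f :: "'a::euclidean_space \<Rightarrow> real"
  assumes f: "\<And>x. (f has_derivative (\<lambda>h. G x \<bullet> h)) (at x)" and G: "continuous_on UNIV G"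
  shows "cube_average (k + N) (\<lambda>y. ennreal \<bar>f y\<bar>) x \<le> cube_average k (\<lambda>y. ennreal \<bar>f y\<bar>) x
    + (\<Sum>j<N. ennreal (real DIM('a) * 4 ^ DIM('a) / 2 ^ (k + j)) * cube_average (k + j) (\<lambda>y. ennreal (norm (G y))) x)"
proof (induction N)
  case 0
  then show ?case by simp
next
  case (Suc N)
  have "cube_average (k + Suc N) (\<lambda>y. ennreal \<bar>f y\<bar>) x \<le> cube_average (k + N) (\<lambda>y. ennreal \<bar>f y\<bar>) x
    + ennreal (real DIM('a) * 4 ^ DIM('a) / 2 ^ (k + N)) * cube_average (k + N) (\<lambda>y. ennreal (norm (G y))) x"
    using cube_average_step[OF f G, of "k + N" x] by simp
  also have "\<dots> \<le> (cube_average k (\<lambda>y. ennreal \<bar>f y\<bar>) x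
    + (\<Sum>j<N. ennreal (real DIM('a) * 4 ^ DIM('a) / 2 ^ (k + j)) * cube_average (k + j) (\<lambda>y. ennreal (norm (G y))) x))
    + ennreal (real DIM('a) * 4 ^ DIM('a) / 2 ^ (k + N)) * cube_average (k + N) (\<lambda>y. ennreal (norm (G y))) x"
    using Suc.IH by (rule add_right_mono)
  finally show ?case by (simp add: add.assoc)
qed

text \<open>On the shell between the radii R and R + 1 the function vanishes, so |f x| = |f x - f y|
  for every y in the shell; integrating over y gives the factor on the left.\<close>

lemma compact_support_L1_Poincare:
  fixes f :: "'a::euclidean_space \<Rightarrow> real"
  assumes f: "\<And>x. (f has_derivative (\<lambda>h. G x \<bullet> h)) (at x)" and G: "continuous_on UNIV G"
    and R: "0 < R" and supp: "\<And>x. R \<le> norm x \<Longrightarrow> f x = 0"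
  shows "emeasure lborel (ball (0::'a) (R + 1) - ball 0 R) * (\<integral>\<^sup>+x. ennreal \<bar>f x\<bar> \<partial>lborel)
    \<le> ennreal (2 * (R + 1)) * (2 ^ DIM('a) * emeasure lborel (ball (0::'a) (R + 1)) * (\<integral>\<^sup>+y. ennreal (norm (G y)) \<partial>lborel))"
proof -
  let ?S = "ball (0::'a) (R + 1)" and ?T = "ball (0::'a) (R + 1) - ball 0 R"
  have "continuous_on UNIV f"
    using f by (meson continuous_at_imp_continuous_on has_derivative_continuous)
  then have [measurable]: "f \<in> borel_measurable borel"
    by (rule borel_measurable_continuous_onI)
  have "emeasure lborel ?T * (\<integral>\<^sup>+x. ennreal \<bar>f x\<bar> \<partial>lborel) = (\<integral>\<^sup>+x. (\<integral>\<^sup>+y\<in>?T. ennreal \<bar>f x\<bar> \<partial>lborel) \<partial>lborel)"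
    by (simp add: nn_integral_cmult_indicator nn_integral_multc mult.commute)
  also have "\<dots> \<le> (\<integral>\<^sup>+x\<in>?S. (\<integral>\<^sup>+y\<in>?S. ennreal \<bar>f x - f y\<bar> \<partial>lborel) \<partial>lborel)"
  proof (rule nn_integral_mono)
    fix x
    show "(\<integral>\<^sup>+y\<in>?T. ennreal \<bar>f x\<bar> \<partial>lborel) \<le> (\<integral>\<^sup>+y\<in>?S. ennreal \<bar>f x - f y\<bar> \<partial>lborel) * indicator ?S x"
    proof (cases "x \<in> ?S")
      case True
      have "(\<integral>\<^sup>+y\<in>?T. ennreal \<bar>f x\<bar> \<partial>lborel) \<le> (\<integral>\<^sup>+y\<in>?S. ennreal \<bar>f x - f y\<bar> \<partial>lborel)"
        using supp by (intro nn_integral_mono) (auto simp: indicator_def)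
      with True show ?thesis by simp
    next
      case False
      then have "f x = 0" by (intro supp) (simp add: not_less)
      then show ?thesis by simp
    qed
  qed
  also have "\<dots> \<le> ennreal (2 * (R + 1)) * (2 ^ DIM('a) * emeasure lborel ?S * (\<integral>\<^sup>+y\<in>?S. ennreal (norm (G y)) \<partial>lborel))"
  proof (rule Poincare_convex_L1[OF f G])
    fix x y assume "x \<in> ?S" "y \<in> ?S"
    then show "norm (x - y) \<le> 2 * (R + 1)"
      using norm_triangle_ineq4[of x y] by simp
  qed auto
  also have "\<dots> \<le> ennreal (2 * (R + 1)) * (2 ^ DIM('a) * emeasure lborel ?S * (\<integral>\<^sup>+y. ennreal (norm (G y)) \<partial>lborel))"
    by (intro mult_left_mono nn_integral_mono) (auto simp: indicator_def)
  finally show ?thesis .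
qed

lemma test_functions_L1_Poincare:
  fixes \<Omega> :: "'a::euclidean_space set"
  assumes "bounded \<Omega>"
  shows "\<exists>C>0. \<forall>\<eta>\<in>test_functions \<Omega>. (\<integral>\<^sup>+x. ennreal \<bar>\<eta> x\<bar> \<partial>lborel) \<le> ennreal C * (\<integral>\<^sup>+x. ennreal (norm (gradient \<eta> x)) \<partial>lborel)"
proof -
  obtain R where R: "0 < R" "\<And>x. x \<in> \<Omega> \<Longrightarrow> norm x < R"
    using assms by (metis bounded_pos_less)
  let ?S = "ball (0::'a) (R + 1)" and ?T = "ball (0::'a) (R + 1) - ball 0 R"
  have Sfin: "emeasure lborel ?S < \<infinity>" by (rule emeasure_lborel_ball_finite)
  have "emeasure lborel ?T \<le> emeasure lborel ?S" by (intro emeasure_mono) auto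
  with Sfin have Tfin: "emeasure lborel ?T < \<infinity>" by (rule order.strict_trans1[rotated])
  have Tpos: "emeasure lborel ?T \<noteq> 0"
  proof
    assume "emeasure lborel ?T = 0"
    then have "negligible ?T"
      by (simp add: negligible_iff_emeasure0)
    then have "negligible (?S - cball 0 R)"
      by (rule negligible_subset) auto
    moreover have "open (?S - cball 0 R)" by (intro open_Diff) auto
    moreover have "?S - cball 0 R \<noteq> {}"
    proof -
      obtain i :: 'a where "i \<in> Basis" using nonempty_Basis by blast
      then have "(R + 1 / 2) *\<^sub>R i \<in> ?S - cball 0 R" using R by simp
      then show ?thesis by blast
    qed
    ultimately show False using open_not_negligible by blast
  qed
  obtain s t where st: "emeasure lborel ?S = ennreal s" "emeasure lborel ?T = ennreal t" "0 \<le> s" "0 < t"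
    using Sfin Tfin Tpos by (metis ennreal_0 less_eq_real_def less_infinityE ennreal_cases infinity_ennreal_def order_less_irrefl)
  \<comment> \<open>The summand 1 secures \<open>0 < C\<close>, since s is only recorded to be
    nonnegative.\<close>
  define C where "C = 2 * (R + 1) * (2 ^ DIM('a) * s) / t + 1"
  have Cpos: "0 < C" using R st by (auto simp: C_def intro!: add_nonneg_pos divide_nonneg_pos)
  have "(\<integral>\<^sup>+x. ennreal \<bar>\<eta> x\<bar> \<partial>lborel) \<le> ennreal C * (\<integral>\<^sup>+x. ennreal (norm (gradient \<eta> x)) \<partial>lborel)"
    if \<eta>: "\<eta> \<in> test_functions \<Omega>" for \<eta>
  proof -
    obtain K where K: "K \<subseteq> \<Omega>" "\<And>x. x \<notin> K \<Longrightarrow> \<eta> x = 0"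
      using \<eta> by (rule test_functions_supportE) blast
    have "\<eta> x = 0" if "R \<le> norm x" for x
      using K R(2) that by (metis linorder_not_le subsetD)
    from compact_support_L1_Poincare[OF test_functions_has_derivative[OF \<eta>] test_functions_continuous_gradient[OF \<eta>] R(1) this]
    have *: "ennreal t * (\<integral>\<^sup>+x. ennreal \<bar>\<eta> x\<bar> \<partial>lborel) \<le>
      ennreal (2 * (R + 1)) * (2 ^ DIM('a) * ennreal s * (\<integral>\<^sup>+y. ennreal (norm (gradient \<eta> y)) \<partial>lborel))"
      unfolding st by simp
    have "(\<integral>\<^sup>+x. ennreal \<bar>\<eta> x\<bar> \<partial>lborel) = ennreal (1 / t) * (ennreal t * (\<integral>\<^sup>+x. ennreal \<bar>\<eta> x\<bar> \<partial>lborel))"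
      using st by (simp add: mult.assoc[symmetric] flip: ennreal_mult')
    also have "\<dots> \<le> ennreal (1 / t) * (ennreal (2 * (R + 1)) * (2 ^ DIM('a) * ennreal s * (\<integral>\<^sup>+y. ennreal (norm (gradient \<eta> y)) \<partial>lborel)))"
      by (intro mult_left_mono *) simp
    also have "\<dots> = ennreal (2 * (R + 1) * (2 ^ DIM('a) * s) / t) * (\<integral>\<^sup>+y. ennreal (norm (gradient \<eta> y)) \<partial>lborel)"
    proof -
      have e1: "ennreal (2 * (R + 1) * (2 ^ DIM('a) * s) / t) = ennreal (1 / t) * ennreal (2 * (R + 1) * (2 ^ DIM('a) * s))"
        using st by (simp flip: ennreal_mult')
      have e2: "ennreal (2 * (R + 1) * (2 ^ DIM('a) * s)) = ennreal (2 * (R + 1)) * ennreal (2 ^ DIM('a) * s)"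
        using R by (intro ennreal_mult') simp
      have e3: "ennreal (2 ^ DIM('a) * s) = 2 ^ DIM('a) * ennreal s"
        by (simp add: ennreal_mult' flip: ennreal_power)
      show ?thesis unfolding e1 e2 e3 by (simp only: mult.assoc)
    qed
    also have "\<dots> \<le> ennreal C * (\<integral>\<^sup>+y. ennreal (norm (gradient \<eta> y)) \<partial>lborel)"
      by (intro mult_right_mono ennreal_leI) (simp_all add: C_def)
    finally show ?thesis .
  qed
  with Cpos show ?thesis by blast
qed

text \<open>A substitute for Lebesgue differentiation: once the cubes are so small that \<eta>
  oscillates by at most 1 on them, the finest average determines |\<eta> x| up to 1. This number N
  of generations depends on \<eta>, the constant C does not. The coarsest average is bounded by the
  L^1 Poincare inequality. The first generation k stays free, because (A1) will be available only on
  small cubes.\<close>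

lemma test_functions_pointwise_bound:
  fixes \<Omega> :: "'a::euclidean_space set"
  assumes "bounded \<Omega>"
  shows "\<exists>C>0. \<forall>\<eta>\<in>test_functions \<Omega>. \<forall>k. \<exists>N. \<forall>x. ennreal \<bar>\<eta> x\<bar> \<le>
     1 + ennreal (C * (2 ^ k) ^ DIM('a)) * (\<integral>\<^sup>+y. ennreal (norm (gradient \<eta> y)) \<partial>lborel)
     + (\<Sum>j<N. ennreal (C / 2 ^ (k + j)) * cube_average (k + j) (\<lambda>y. ennreal (norm (gradient \<eta> y))) x)"
proof -
  obtain C1 where C1: "0 < C1" "\<And>\<eta>. \<eta> \<in> test_functions \<Omega> \<Longrightarrow> (\<integral>\<^sup>+x. ennreal \<bar>\<eta> x\<bar> \<partial>lborel) \<le> ennreal C1 * (\<integral>\<^sup>+x. ennreal (norm (gradient \<eta> x)) \<partial>lborel)"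
    using test_functions_L1_Poincare[OF assms] by blast
  define C where "C = max C1 (real DIM('a) * 4 ^ DIM('a))"
  have "\<exists>N. \<forall>x. ennreal \<bar>\<eta> x\<bar> \<le>
     1 + ennreal (C * (2 ^ k) ^ DIM('a)) * (\<integral>\<^sup>+y. ennreal (norm (gradient \<eta> y)) \<partial>lborel)
     + (\<Sum>j<N. ennreal (C / 2 ^ (k + j)) * cube_average (k + j) (\<lambda>y. ennreal (norm (gradient \<eta> y))) x)"
    if \<eta>: "\<eta> \<in> test_functions \<Omega>" for \<eta> k
  proof -
    obtain M where M: "0 < M" and lip: "\<And>x y. \<bar>\<eta> x - \<eta> y\<bar> \<le> M * norm (x - y)"
      using test_functions_lipschitz[OF \<eta>] by blast
    obtain N where N: "M * real DIM('a) < 2 ^ N"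
      using real_arch_pow[of 2] by auto
    have osc: "\<bar>\<eta> x\<bar> \<le> 1 + \<bar>\<eta> y\<bar>" if "y \<in> cube (k + N) x" for x y
    proof -
      have "\<bar>\<eta> x - \<eta> y\<bar> \<le> M * norm (x - y)" by (rule lip)
      also have "\<dots> \<le> M * (real DIM('a) / 2 ^ (k + N))"
        using M that by (intro mult_left_mono cube_diameter[of _ _ x]) (auto simp: cube_self)
      also have "\<dots> \<le> 1"
      proof -
        have "M * real DIM('a) \<le> 2 ^ k * 2 ^ N"
        proof -
          have "(2::real) ^ N \<le> 2 ^ (k + N)" by (intro power_increasing) auto
          with N have "M * real DIM('a) \<le> 2 ^ (k + N)" by linarith
          then show ?thesis by (simp only: power_add)
        qed
        then show ?thesis by (simp add: power_add field_simps)
      qed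
      finally show ?thesis by linarith
    qed
    have [measurable]: "\<eta> \<in> borel_measurable borel"
      using test_functions_continuous[OF \<eta>] by (rule borel_measurable_continuous_onI)
    have "ennreal \<bar>\<eta> x\<bar> \<le>
     1 + ennreal (C * (2 ^ k) ^ DIM('a)) * (\<integral>\<^sup>+y. ennreal (norm (gradient \<eta> y)) \<partial>lborel)
     + (\<Sum>j<N. ennreal (C / 2 ^ (k + j)) * cube_average (k + j) (\<lambda>y. ennreal (norm (gradient \<eta> y))) x)" for x
    proof -
      have "ennreal \<bar>\<eta> x\<bar> = cube_average (k + N) (\<lambda>_. ennreal \<bar>\<eta> x\<bar>) x"
        by (simp add: cube_average_const)
      also have "\<dots> \<le> cube_average (k + N) (\<lambda>y. 1 + ennreal \<bar>\<eta> y\<bar>) x"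
      proof -
        have "ennreal \<bar>\<eta> x\<bar> \<le> 1 + ennreal \<bar>\<eta> y\<bar>" if "y \<in> cube (k + N) x" for y
          using ennreal_leI[OF osc[OF that]] by simp
        then show ?thesis
          unfolding cube_average_def
          by (intro mult_left_mono nn_integral_mono) (auto simp: indicator_def)
      qed
      also have "\<dots> = cube_average (k + N) (\<lambda>_. 1) x + cube_average (k + N) (\<lambda>y. ennreal \<bar>\<eta> y\<bar>) x"
        unfolding cube_average_def by (simp add: distrib_right nn_integral_add distrib_left)
      also have "cube_average (k + N) (\<lambda>_. 1) x = 1" by (rule cube_average_const)
      also have "cube_average (k + N) (\<lambda>y. ennreal \<bar>\<eta> y\<bar>) x \<le> cube_average k (\<lambda>y. ennreal \<bar>\<eta> y\<bar>) x
        + (\<Sum>j<N. ennreal (real DIM('a) * 4 ^ DIM('a) / 2 ^ (k + j)) * cube_average (k + j) (\<lambda>y. ennreal (norm (gradient \<eta> y))) x)"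
        by (rule cube_average_telescope[OF test_functions_has_derivative[OF \<eta>] test_functions_continuous_gradient[OF \<eta>]])
      also have "\<dots> \<le> ennreal (C * (2 ^ k) ^ DIM('a)) * (\<integral>\<^sup>+y. ennreal (norm (gradient \<eta> y)) \<partial>lborel)
         + (\<Sum>j<N. ennreal (C / 2 ^ (k + j)) * cube_average (k + j) (\<lambda>y. ennreal (norm (gradient \<eta> y))) x)"
      proof (intro add_mono sum_mono mult_right_mono ennreal_leI divide_right_mono)
        have "cube_average k (\<lambda>y. ennreal \<bar>\<eta> y\<bar>) x \<le> ennreal ((2 ^ k) ^ DIM('a)) * (\<integral>\<^sup>+y. ennreal \<bar>\<eta> y\<bar> \<partial>lborel)"
          unfolding cube_average_def by (intro mult_left_mono nn_integral_mono) (auto simp: indicator_def)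
        also have "\<dots> \<le> ennreal ((2 ^ k) ^ DIM('a)) * (ennreal C * (\<integral>\<^sup>+x. ennreal (norm (gradient \<eta> x)) \<partial>lborel))"
          by (intro mult_left_mono order_trans[OF C1(2)[OF \<eta>]] mult_right_mono ennreal_leI) (auto simp: C_def)
        also have "\<dots> = ennreal (C * (2 ^ k) ^ DIM('a)) * (\<integral>\<^sup>+x. ennreal (norm (gradient \<eta> x)) \<partial>lborel)"
          using C1 by (simp add: ennreal_mult' C_def max_def mult_ac)
        finally show "cube_average k (\<lambda>y. ennreal \<bar>\<eta> y\<bar>) x \<le> \<dots>" .
      qed (auto simp: C_def)
      finally show ?thesis by (simp add: add.assoc add_left_mono)
    qed
    then show ?thesis by blast
  qed
  moreover have "0 < C" using C1 by (simp add: C_def)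
  ultimately show ?thesis by blast
qed

subsection \<open>The modular of a generalized Orlicz space\<close>

lemma locally_integrable_on_imp_measurable:
  fixes f :: "'a::euclidean_space \<Rightarrow> 'b::euclidean_space"
  assumes \<Omega>: "open \<Omega>" and f: "f locally_integrable_on \<Omega>"
  shows "f \<in> borel_measurable (lebesgue_on \<Omega>)"
proof -
  obtain C where C: "\<And>n. compact (C n)" "\<And>n. C n \<subseteq> \<Omega>" "\<And>n. C n \<subseteq> interior (C (Suc n))" "\<Union>(range C) = \<Omega>"
    using open_Union_compact_subsets[OF \<Omega>] by metis
  have mono: "mono C"
    using C(3) interior_subset by (intro mono_iff_le_Suc[THEN iffD2]) blast
  have "(\<lambda>x. indicator \<Omega> x *\<^sub>R f x) \<in> borel_measurable lebesgue"
  proof (rule borel_measurable_LIMSEQ_metric)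
    fix n
    have "integrable lebesgue (\<lambda>x. indicator (C n) x *\<^sub>R f x)"
      using f C by (auto simp: locally_integrable_on_def set_integrable_def)
    then show "(\<lambda>x. indicator (C n) x *\<^sub>R f x) \<in> borel_measurable lebesgue"
      by (rule borel_measurable_integrable)
  next
    fix x
    show "(\<lambda>n. indicator (C n) x *\<^sub>R f x) \<longlonglongrightarrow> indicator \<Omega> x *\<^sub>R f x"
    proof (cases "x \<in> \<Omega>")
      case True
      then obtain n where n: "x \<in> C n" using C(4) by blast
      have "\<forall>\<^sub>F m in sequentially. indicator \<Omega> x *\<^sub>R f x = indicator (C m) x *\<^sub>R f x"
        using eventually_ge_at_top[of n]
      proof eventually_elim
        case (elim m)
        then have "x \<in> C m" using n monoD[OF mono elim] by blast
        then show ?case using True by simp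
      qed
      then show ?thesis by (rule Lim_transform_eventually[OF tendsto_const])
    next
      case False
      then have "x \<notin> C n" for n using C(2) by blast
      then show ?thesis using False by simp
    qed
  qed
  then show ?thesis
    using \<Omega> by (subst borel_measurable_restrict_space_iff) auto
qed

locale Phi_weight =
  fixes \<Omega> :: "'a::euclidean_space set" and p q L :: real
    and \<omega> :: "'a \<Rightarrow> real" and \<phi> :: "'a \<Rightarrow> real \<Rightarrow> ennreal"
  assumes open_Omega: "open \<Omega>" and bounded_Omega: "bounded \<Omega>"
    and p: "1 < p" and pq: "p \<le> q" and L: "1 \<le> L"
    and weight: "weight \<omega>" and Phi: "\<phi> \<in> Phi_convex \<Omega>"
    and inc: "\<And>x. x \<in> \<Omega> \<Longrightarrow> almost_increasing_on {0<..} L (\<lambda>t. ennreal (t powr (- p)) * \<phi> x t)"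
    and dec: "\<And>x. x \<in> \<Omega> \<Longrightarrow> almost_decreasing_on {0<..} L (\<lambda>t. ennreal (t powr (- q)) * \<phi> x t)"
begin

abbreviation M :: "'a measure" where "M \<equiv> lebesgue_on \<Omega>"

lemma Omega_sets[measurable, simp]: "\<Omega> \<in> sets lebesgue"
  using open_Omega by auto

lemma q: "1 < q" using p pq by simp

lemma weight_nonneg: "0 \<le> \<omega> x"
  using weight by (simp add: weight_def)

lemma phi_mono: "x \<in> \<Omega> \<Longrightarrow> 0 \<le> s \<Longrightarrow> s \<le> t \<Longrightarrow> \<phi> x s \<le> \<phi> x t"
  using Phi by (auto simp: Phi_convex_def Phi_prefunctions_def dest!: bspec[of _ _ x] intro: mono_onD)

lemma phi_0: "x \<in> \<Omega> \<Longrightarrow> \<phi> x 0 = 0"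
  using Phi by (auto simp: Phi_convex_def Phi_prefunctions_def)

lemma phi_tendsto_0: "x \<in> \<Omega> \<Longrightarrow> (\<phi> x \<longlongrightarrow> 0) (at_right 0)"
  using Phi by (auto simp: Phi_convex_def Phi_prefunctions_def)

lemma phi_tendsto_top: "x \<in> \<Omega> \<Longrightarrow> (\<phi> x \<longlongrightarrow> \<infinity>) at_top"
  using Phi by (auto simp: Phi_convex_def Phi_prefunctions_def)

lemma phi_left_continuous: "x \<in> \<Omega> \<Longrightarrow> 0 < t \<Longrightarrow> continuous (at_left t) (\<phi> x)"
  using Phi by (auto simp: Phi_convex_def)

lemma phi_measurable:
  "f \<in> borel_measurable M \<Longrightarrow> (\<lambda>x. \<phi> x \<bar>f x\<bar>) \<in> borel_measurable M"
  using Phi by (auto simp: Phi_convex_def Phi_prefunctions_def)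

lemma phi_convex:
  "x \<in> \<Omega> \<Longrightarrow> 0 \<le> s \<Longrightarrow> 0 \<le> t \<Longrightarrow> 0 \<le> a \<Longrightarrow> a \<le> 1 \<Longrightarrow>
   \<phi> x (a * s + (1 - a) * t) \<le> ennreal a * \<phi> x s + ennreal (1 - a) * \<phi> x t"
  using Phi by (auto simp: Phi_convex_def)

lemma phi_scale_le:
  "x \<in> \<Omega> \<Longrightarrow> 0 \<le> t \<Longrightarrow> 0 \<le> a \<Longrightarrow> a \<le> 1 \<Longrightarrow> \<phi> x (a * t) \<le> ennreal a * \<phi> x t"
  using phi_convex[of x t 0 a] phi_0[of x] by simp

lemma phi_scale_ge:
  assumes x: "x \<in> \<Omega>" and t: "0 \<le> t" and a: "1 \<le> a"
  shows "\<phi> x (a * t) \<le> ennreal (L * a powr q) * \<phi> x t"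
proof (cases "t = 0")
  case True
  then show ?thesis using phi_0[OF x] by simp
next
  case False
  with t have t: "0 < t" by simp
  have "\<phi> x (a * t) = ennreal ((a * t) powr q) * (ennreal ((a * t) powr (- q)) * \<phi> x (a * t))"
    using a t by (simp add: mult.assoc[symmetric] powr_add[symmetric] flip: ennreal_mult')
  also have "\<dots> \<le> ennreal ((a * t) powr q) * (ennreal L * (ennreal (t powr (- q)) * \<phi> x t))"
    using dec[OF x] a t by (intro mult_left_mono) (auto simp: almost_decreasing_on_def)
  also have "\<dots> = ennreal ((a * t) powr q * (L * t powr (- q))) * \<phi> x t"
    using L by (simp add: ennreal_mult' mult.assoc)
  also have "(a * t) powr q * (L * t powr (- q)) = L * a powr q"
    using a t by (simp add: powr_mult powr_minus field_simps)
  finally show ?thesis .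
qed

lemma phi_increase:
  assumes x: "x \<in> \<Omega>" and t: "0 < t" and a: "1 \<le> a"
  shows "ennreal (a powr p) * \<phi> x t \<le> ennreal L * \<phi> x (a * t)"
proof -
  have eq: "(a * t) powr p * t powr (- p) = a powr p"
    using a t by (simp add: powr_mult powr_minus)
  have "ennreal (a powr p) * \<phi> x t = ennreal ((a * t) powr p) * (ennreal (t powr (- p)) * \<phi> x t)"
    unfolding eq[symmetric] by (simp add: ennreal_mult' mult.assoc)
  also have "\<dots> \<le> ennreal ((a * t) powr p) * (ennreal L * (ennreal ((a * t) powr (- p)) * \<phi> x (a * t)))"
    using inc[OF x] a t by (intro mult_left_mono) (auto simp: almost_increasing_on_def)
  also have "\<dots> = ennreal L * (ennreal ((a * t) powr p * (a * t) powr (- p)) * \<phi> x (a * t))"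
    by (simp add: ennreal_mult' mult_ac)
  also have "(a * t) powr p * (a * t) powr (- p) = 1"
    using a t by (simp flip: powr_add)
  finally show ?thesis by simp
qed

text \<open>\<phi> is below 1 near 0, where it tends to 0, and (aDec) propagates finiteness to all
  t.\<close>

lemma phi_finite:
  assumes x: "x \<in> \<Omega>" and t: "0 \<le> t"
  shows "\<phi> x t < \<infinity>"
proof -
  have "\<forall>\<^sub>F s in at_right 0. \<phi> x s < 1"
    using phi_tendsto_0[OF x] by (rule order_tendstoD) simp
  then obtain b where b: "0 < b" "\<And>s. 0 < s \<Longrightarrow> s < b \<Longrightarrow> \<phi> x s < 1"
    by (auto simp: eventually_at_right_field)
  define s where "s = b / 2"
  have s: "0 < s" "\<phi> x s < 1" using b by (auto simp: s_def)
  have "\<phi> x t \<le> \<phi> x (max 1 (t / s) * s)"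
    using s t by (intro phi_mono[OF x]) (auto simp: max_def field_simps)
  also have "\<dots> \<le> ennreal (L * max 1 (t / s) powr q) * \<phi> x s"
    using s by (intro phi_scale_ge[OF x]) auto
  also have "\<dots> < \<infinity>" using s(2) by (simp add: ennreal_mult_less_top less_trans[OF _ ennreal_one_less_top])
  finally show ?thesis .
qed

text \<open>The doubling constant of \<phi>, that is \<open>phi_scale_ge\<close> for the factor 2.
  It is the price of every use of the triangle inequality inside the modular.\<close>

definition D :: real where "D = L * 2 powr q"

lemma D_ge_1: "1 \<le> D"
  unfolding D_def using L q mult_mono[of 1 L 1 "2 powr q"] ge_one_powr_ge_zero[of 2 q] by simp

lemma phi_add:
  assumes x: "x \<in> \<Omega>" and st: "0 \<le> s" "0 \<le> t"
  shows "\<phi> x (s + t) \<le> ennreal D * (\<phi> x s + \<phi> x t)"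
proof -
  have "\<phi> x (s + t) \<le> \<phi> x (2 * max s t)" using st by (intro phi_mono[OF x]) auto
  also have "\<dots> \<le> ennreal D * \<phi> x (max s t)"
    unfolding D_def using st by (intro phi_scale_ge[OF x]) auto
  also have "\<dots> \<le> ennreal D * (\<phi> x s + \<phi> x t)"
    by (intro mult_left_mono) (auto simp: max_def)
  finally show ?thesis .
qed

text \<open>For s < t eventually s < f n, so monotonicity puts \<phi> x s below the liminf; left
  continuity then lets s tend to t.\<close>

lemma phi_lower_semicontinuous:
  assumes x: "x \<in> \<Omega>" and f: "f \<longlonglongrightarrow> t" "0 \<le> t"
  shows "\<phi> x t \<le> liminf (\<lambda>n. \<phi> x \<bar>f n\<bar>)"
proof (cases "t = 0")
  case True
  then show ?thesis using phi_0[OF x] by simp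
next
  case False
  with f have t: "0 < t" by simp
  have "(\<phi> x \<longlongrightarrow> \<phi> x t) (at_left t)"
    using phi_left_continuous[OF x t] by (simp add: continuous_within)
  moreover have "\<forall>\<^sub>F s in at_left t. \<phi> x s \<le> liminf (\<lambda>n. \<phi> x \<bar>f n\<bar>)"
  proof (rule eventually_at_leftI)
    fix s assume s: "s \<in> {0<..<t}"
    have "\<forall>\<^sub>F n in sequentially. s < f n" using f s by (auto intro: order_tendstoD)
    then have "\<forall>\<^sub>F n in sequentially. \<phi> x s \<le> \<phi> x \<bar>f n\<bar>"
      using s by (elim eventually_mono) (auto intro!: phi_mono[OF x])
    then show "\<phi> x s \<le> liminf (\<lambda>n. \<phi> x \<bar>f n\<bar>)" by (rule Liminf_bounded)
  qed (rule t)
  ultimately show ?thesis by (intro tendsto_upperbound) auto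
qed

definition modular :: "('a \<Rightarrow> real) \<Rightarrow> ennreal"
  where "modular f = (\<integral>\<^sup>+x. \<phi> x \<bar>f x\<bar> * ennreal (\<omega> x) \<partial>M)"

lemma weight_measurable_lebesgue: "\<omega> \<in> borel_measurable lebesgue"
  using weight locally_integrable_on_imp_measurable[of UNIV \<omega>]
  by (simp add: weight_def lebesgue_on_UNIV_eq)

lemma weight_measurable[measurable]: "\<omega> \<in> borel_measurable M"
  using weight_measurable_lebesgue by (rule measurable_restrict_space1)

lemma modular_integrand_measurable[measurable]:
  assumes "f \<in> borel_measurable M"
  shows "(\<lambda>x. \<phi> x \<bar>f x\<bar> * ennreal (\<omega> x)) \<in> borel_measurable M"
  using phi_measurable[OF assms] by measurable

lemma modular_mono_AE:
  assumes "AE x in M. \<bar>f x\<bar> \<le> \<bar>g x\<bar>"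
  shows "modular f \<le> modular g"
  unfolding modular_def
  using assms AE_space[of M]
  by (intro nn_integral_mono_AE, eventually_elim) (auto intro!: mult_right_mono phi_mono)

lemma modular_cong_AE:
  assumes "AE x in M. \<bar>f x\<bar> = \<bar>g x\<bar>"
  shows "modular f = modular g"
  using assms by (intro antisym modular_mono_AE) (auto elim: AE_mp)

lemma modular_add:
  assumes f: "f \<in> borel_measurable M" and g: "g \<in> borel_measurable M"
    and h: "AE x in M. \<bar>h x\<bar> \<le> \<bar>f x\<bar> + \<bar>g x\<bar>"
  shows "modular h \<le> ennreal D * (modular f + modular g)"
proof -
  have "modular h \<le> (\<integral>\<^sup>+x. ennreal D * (\<phi> x \<bar>f x\<bar> * ennreal (\<omega> x) + \<phi> x \<bar>g x\<bar> * ennreal (\<omega> x)) \<partial>M)"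
    unfolding modular_def using h AE_space[of M]
  proof (intro nn_integral_mono_AE, eventually_elim)
    case (elim x)
    then have "\<phi> x \<bar>h x\<bar> \<le> \<phi> x (\<bar>f x\<bar> + \<bar>g x\<bar>)" by (intro phi_mono) auto
    also have "\<dots> \<le> ennreal D * (\<phi> x \<bar>f x\<bar> + \<phi> x \<bar>g x\<bar>)" using elim by (intro phi_add) auto
    finally have "\<phi> x \<bar>h x\<bar> * ennreal (\<omega> x) \<le> ennreal D * (\<phi> x \<bar>f x\<bar> + \<phi> x \<bar>g x\<bar>) * ennreal (\<omega> x)"
      by (rule mult_right_mono) simp
    then show ?case by (simp add: distrib_left distrib_right mult.assoc)
  qed
  also have "\<dots> = ennreal D * (modular f + modular g)"
    unfolding modular_def using f g by (simp add: nn_integral_cmult nn_integral_add)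
  finally show ?thesis .
qed

lemma modular_scale_le:
  assumes f: "f \<in> borel_measurable M" and a: "0 \<le> a" "a \<le> 1"
  shows "modular (\<lambda>x. a * f x) \<le> ennreal a * modular f"
proof -
  have "modular (\<lambda>x. a * f x) \<le> (\<integral>\<^sup>+x. ennreal a * (\<phi> x \<bar>f x\<bar> * ennreal (\<omega> x)) \<partial>M)"
    unfolding modular_def
  proof (rule nn_integral_mono)
    fix x assume "x \<in> space M"
    then have "\<phi> x \<bar>a * f x\<bar> * ennreal (\<omega> x) \<le> ennreal a * \<phi> x \<bar>f x\<bar> * ennreal (\<omega> x)"
      using a phi_scale_le[of x "\<bar>f x\<bar>" a] by (intro mult_right_mono) (auto simp: abs_mult)
    then show "\<phi> x \<bar>a * f x\<bar> * ennreal (\<omega> x) \<le> ennreal a * (\<phi> x \<bar>f x\<bar> * ennreal (\<omega> x))"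
      by (simp add: mult.assoc)
  qed
  also have "\<dots> = ennreal a * modular f"
    unfolding modular_def using f by (simp add: nn_integral_cmult)
  finally show ?thesis .
qed

lemma modular_scale_ge:
  assumes f: "f \<in> borel_measurable M" and a: "1 \<le> a"
  shows "modular (\<lambda>x. a * f x) \<le> ennreal (L * a powr q) * modular f"
proof -
  have "modular (\<lambda>x. a * f x) \<le> (\<integral>\<^sup>+x. ennreal (L * a powr q) * (\<phi> x \<bar>f x\<bar> * ennreal (\<omega> x)) \<partial>M)"
    unfolding modular_def
  proof (rule nn_integral_mono)
    fix x assume "x \<in> space M"
    then have "\<phi> x \<bar>a * f x\<bar> * ennreal (\<omega> x) \<le> ennreal (L * a powr q) * \<phi> x \<bar>f x\<bar> * ennreal (\<omega> x)"
      using a phi_scale_ge[of x "\<bar>f x\<bar>" a] by (intro mult_right_mono) (auto simp: abs_mult)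
    then show "\<phi> x \<bar>a * f x\<bar> * ennreal (\<omega> x) \<le> ennreal (L * a powr q) * (\<phi> x \<bar>f x\<bar> * ennreal (\<omega> x))"
      by (simp add: mult.assoc)
  qed
  also have "\<dots> = ennreal (L * a powr q) * modular f"
    unfolding modular_def using f by (simp add: nn_integral_cmult)
  finally show ?thesis .
qed

lemma modular_scale_finite:
  assumes f: "f \<in> borel_measurable M" and fin: "modular f < \<infinity>"
  shows "modular (\<lambda>x. c * f x) < \<infinity>"
proof -
  define a where "a = max 1 \<bar>c\<bar>"
  have "modular (\<lambda>x. c * f x) \<le> modular (\<lambda>x. a * f x)"
    by (rule modular_mono_AE) (auto simp: a_def abs_mult intro!: mult_right_mono)
  also have "\<dots> \<le> ennreal (L * a powr q) * modular f"
    by (rule modular_scale_ge[OF f]) (simp add: a_def)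
  also have "\<dots> < \<infinity>" using fin by (simp add: ennreal_mult_less_top)
  finally show ?thesis .
qed

lemma modular_Fatou:
  assumes f: "\<And>k. f k \<in> borel_measurable M" and lim: "AE x in M. (\<lambda>k. \<bar>f k x\<bar>) \<longlonglongrightarrow> \<bar>g x\<bar>"
  shows "modular g \<le> liminf (\<lambda>k. modular (f k))"
proof -
  have "modular g \<le> (\<integral>\<^sup>+x. liminf (\<lambda>k. \<phi> x \<bar>f k x\<bar> * ennreal (\<omega> x)) \<partial>M)"
    unfolding modular_def using lim AE_space[of M]
  proof (intro nn_integral_mono_AE, eventually_elim)
    case (elim x)
    have "\<phi> x \<bar>g x\<bar> \<le> liminf (\<lambda>k. \<phi> x \<bar>\<bar>f k x\<bar>\<bar>)"
      using elim by (intro phi_lower_semicontinuous) auto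
    then have "\<phi> x \<bar>g x\<bar> * ennreal (\<omega> x) \<le> liminf (\<lambda>k. \<phi> x \<bar>f k x\<bar>) * ennreal (\<omega> x)"
      by (intro mult_right_mono) auto
    also have "\<dots> = ennreal (\<omega> x) * liminf (\<lambda>k. \<phi> x \<bar>f k x\<bar>)" by (rule mult.commute)
    also have "\<dots> = liminf (\<lambda>k. ennreal (\<omega> x) * \<phi> x \<bar>f k x\<bar>)"
      by (rule Liminf_compose_continuous_mono[symmetric])
         (auto intro!: monoI mult_left_mono ennreal_continuous_on_cmult)
    finally show ?case by (simp add: mult.commute)
  qed
  also have "\<dots> \<le> liminf (\<lambda>k. modular (f k))"
    unfolding modular_def using f by (intro nn_integral_liminf) measurable
  finally show ?thesis .
qed

section \<open>The Luxemburg norm and the modular measure the same smallness\<close>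

lemma luxemburg_norm_modular:
  "luxemburg_norm \<Omega> (\<lambda>x t. \<phi> x t * ennreal (\<omega> x)) f = Inf {ennreal l |l. 0 < l \<and> modular (\<lambda>x. (1 / l) * f x) \<le> 1}"
proof -
  have "(\<integral>\<^sup>+x\<in>\<Omega>. \<phi> x (\<bar>f x\<bar> / l) * ennreal (\<omega> x) \<partial>lebesgue) = modular (\<lambda>x. (1 / l) * f x)" if "0 < l" for l
    unfolding modular_def using that
    by (subst nn_integral_restrict_space) (auto simp: abs_mult)
  then show ?thesis
    unfolding luxemburg_norm_def by (intro arg_cong[where f = Inf]) auto
qed

lemma modular_le_if_luxemburg_less:
  assumes f: "f \<in> borel_measurable M" and less: "luxemburg_norm \<Omega> (\<lambda>x t. \<phi> x t * ennreal (\<omega> x)) f < ennreal \<epsilon>" and \<epsilon>: "\<epsilon> \<le> 1"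
  shows "modular f \<le> ennreal \<epsilon>"
proof -
  obtain l where l: "0 < l" "ennreal l < ennreal \<epsilon>" "modular (\<lambda>x. (1 / l) * f x) \<le> 1"
    using less unfolding luxemburg_norm_modular Inf_less_iff by auto
  then have l\<epsilon>: "l < \<epsilon>" by (simp add: ennreal_less_iff)
  have "modular f = modular (\<lambda>x. l * ((1 / l) * f x))" using l by simp
  also have "\<dots> \<le> ennreal l * modular (\<lambda>x. (1 / l) * f x)"
    using f l l\<epsilon> \<epsilon> by (intro modular_scale_le) auto
  also have "\<dots> \<le> ennreal l * 1" using l by (intro mult_left_mono) auto
  also have "\<dots> \<le> ennreal \<epsilon>" using l\<epsilon> by (simp add: ennreal_leI)
  finally show ?thesis .
qed

text \<open>The converse of the preceding estimate, which rests on convexity: here (aDec) bounds the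
  modular of f/\<epsilon>, and the threshold is chosen to bring it to at most 1. Together they allow
  the norm to be replaced by the modular in all limits.\<close>

lemma luxemburg_le_if_modular_le:
  assumes f: "f \<in> borel_measurable M" and \<epsilon>: "0 < \<epsilon>" "\<epsilon> \<le> 1"
    and le: "modular f \<le> ennreal (1 / (L * (1 / \<epsilon>) powr q))"
  shows "luxemburg_norm \<Omega> (\<lambda>x t. \<phi> x t * ennreal (\<omega> x)) f \<le> ennreal \<epsilon>"
proof -
  define c where "c = L * (1 / \<epsilon>) powr q"
  have pos: "0 < c" using L \<epsilon> by (simp add: c_def)
  have "modular (\<lambda>x. (1 / \<epsilon>) * f x) \<le> ennreal c * modular f"
    unfolding c_def using \<epsilon> by (intro modular_scale_ge[OF f]) auto
  also have "\<dots> \<le> ennreal c * ennreal (1 / c)"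
    using le by (intro mult_left_mono) (simp_all add: c_def)
  also have "\<dots> = 1" using pos by (simp flip: ennreal_mult')
  finally show ?thesis
    unfolding luxemburg_norm_modular using \<epsilon> by (intro Inf_lower) auto
qed

lemma luxemburg_finite_iff:
  assumes f: "f \<in> borel_measurable M"
  shows "luxemburg_norm \<Omega> (\<lambda>x t. \<phi> x t * ennreal (\<omega> x)) f < \<infinity> \<longleftrightarrow> modular f < \<infinity>"
proof
  assume "luxemburg_norm \<Omega> (\<lambda>x t. \<phi> x t * ennreal (\<omega> x)) f < \<infinity>"
  then obtain l where l: "0 < l" "modular (\<lambda>x. (1 / l) * f x) \<le> 1"
    unfolding luxemburg_norm_modular Inf_less_iff by auto
  then have "modular (\<lambda>x. l * ((1 / l) * f x)) < \<infinity>"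
    using f by (intro modular_scale_finite order.strict_trans1[OF l(2)]) simp_all
  then show "modular f < \<infinity>" using l by simp
next
  assume fin: "modular f < \<infinity>"
  then obtain m where m: "modular f = ennreal m" "0 \<le> m" by (metis ennreal_cases infinity_ennreal_def less_irrefl)
  define l where "l = max 1 m"
  have "modular (\<lambda>x. (1 / l) * f x) \<le> ennreal (1 / l) * modular f"
    by (rule modular_scale_le[OF f]) (auto simp: l_def)
  also have "\<dots> \<le> 1"
    using m by (simp add: l_def field_simps flip: ennreal_mult' ennreal_1)
  finally have "luxemburg_norm \<Omega> (\<lambda>x t. \<phi> x t * ennreal (\<omega> x)) f \<le> ennreal l"
    unfolding luxemburg_norm_modular by (intro Inf_lower) (auto simp: l_def)
  then show "luxemburg_norm \<Omega> (\<lambda>x t. \<phi> x t * ennreal (\<omega> x)) f < \<infinity>"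
    by (rule order.strict_trans1) simp
qed

end

subsection \<open>Muckenhoupt weights\<close>

lemma ennreal_positive_finiteE:
  assumes "x \<noteq> 0" "x \<noteq> \<infinity>"
  obtains s where "0 < s" "x = ennreal s"
proof (cases x)
  case (real r)
  then show thesis using assms(1) that[of r] by (cases "r = 0") auto
next
  case top
  then show thesis using assms(2) by simp
qed

lemma weight_measure_finite:
  assumes \<omega>: "weight \<omega>" and E: "bounded E"
  shows "weight_measure \<omega> E < \<infinity>"
proof -
  obtain c r where "E \<subseteq> cball c r" using E by (meson bounded_subset_cball)
  have "integrable lebesgue (\<lambda>x. indicator (cball c r) x *\<^sub>R \<omega> x)"
    using \<omega> by (auto simp: weight_def locally_integrable_on_def set_integrable_def)
  then have "(\<integral>\<^sup>+x. ennreal (norm (indicator (cball c r) x *\<^sub>R \<omega> x)) \<partial>lebesgue) < \<infinity>"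
    unfolding integrable_iff_bounded by simp
  moreover have "weight_measure \<omega> E \<le> (\<integral>\<^sup>+x. ennreal (norm (indicator (cball c r) x *\<^sub>R \<omega> x)) \<partial>lebesgue)"
    unfolding weight_measure_def using \<open>E \<subseteq> cball c r\<close> \<omega>
    by (intro nn_integral_mono) (auto simp: indicator_def weight_def)
  ultimately show ?thesis by (rule order.strict_trans1[rotated])
qed

lemma weight_measurable_UNIV: "weight \<omega> \<Longrightarrow> \<omega> \<in> borel_measurable lebesgue"
  using locally_integrable_on_imp_measurable[of UNIV \<omega>]
  by (simp add: weight_def lebesgue_on_UNIV_eq)

lemma emeasure_lebesgue_ball_pos:
  fixes c :: "'a::euclidean_space"
  assumes "0 < r"
  obtains v where "0 < v" "emeasure lebesgue (ball c r) = ennreal v"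
proof -
  have "emeasure lebesgue (ball c r) = emeasure lborel (ball c r)" by simp
  moreover have "emeasure lborel (ball c r) \<noteq> 0"
  proof
    assume "emeasure lborel (ball c r) = 0"
    then have "negligible (ball c r)" by (simp add: negligible_iff_emeasure0)
    then show False using open_not_negligible[of "ball c r"] assms by simp
  qed
  moreover have "emeasure lborel (ball c r) < \<infinity>" by (rule emeasure_lborel_ball_finite)
  ultimately show thesis using that
    by (metis ennreal_0 ennreal_cases infinity_ennreal_def less_irrefl order_le_less)
qed

lemma average_eq_infinity_if_not_AE_finite:
  fixes c :: "'a::euclidean_space"
  assumes r: "0 < r" and g[measurable]: "g \<in> borel_measurable lebesgue"
    and nn: "\<not> (AE x in lebesgue. x \<in> ball c r \<longrightarrow> g x \<noteq> \<infinity>)"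
  shows "average (ball c r) g = \<infinity>"
proof -
  obtain v where v: "0 < v" "emeasure lebesgue (ball c r) = ennreal v"
    using emeasure_lebesgue_ball_pos[OF r] by blast
  have "(\<integral>\<^sup>+x\<in>ball c r. g x \<partial>lebesgue) = \<infinity>"
  proof (rule ccontr)
    assume "(\<integral>\<^sup>+x\<in>ball c r. g x \<partial>lebesgue) \<noteq> \<infinity>"
    then have "AE x in lebesgue. g x * indicator (ball c r) x \<noteq> \<infinity>"
      by (intro nn_integral_PInf_AE borel_measurable_times_ennreal borel_measurable_indicator g) auto
    then have "AE x in lebesgue. x \<in> ball c r \<longrightarrow> g x \<noteq> \<infinity>"
      by eventually_elim (auto simp: indicator_def)
    with nn show False by simp
  qed
  then show ?thesis using v by (simp add: average_def ennreal_top_divide)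
qed

lemma ennpowr_measurable:
  assumes [measurable]: "\<omega> \<in> borel_measurable M"
  shows "(\<lambda>x. ennpowr (ennreal (\<omega> x)) a) \<in> borel_measurable M"
  unfolding ennpowr_def by measurable

text \<open>If neither alternative holds, one large ball sees both failures: the dual average is
  infinite there while the average of \<omega> is not 0, so the product is infinite. Only the
  convention that 0 times infinity is 0 admits the null weight.\<close>

lemma Muckenhoupt_zero_or_positive:
  assumes \<omega>: "\<omega> \<in> Muckenhoupt p" and p: "1 < p"
  shows "(AE x in lebesgue. \<omega> x = 0) \<or> (AE x in lebesgue. 0 < \<omega> x)"
proof (rule ccontr)
  assume "\<not> ?thesis"
  then have nz: "\<not> (AE x in lebesgue. \<omega> x = 0)" and np: "\<not> (AE x in lebesgue. 0 < \<omega> x)" by auto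
  have w: "weight \<omega>" and fin: "Muckenhoupt_const p \<omega> < \<infinity>"
    using \<omega> by (auto simp: Muckenhoupt_def)
  have [measurable]: "\<omega> \<in> borel_measurable lebesgue" by (rule weight_measurable_UNIV[OF w])
  have nonneg: "0 \<le> \<omega> x" for x using w by (simp add: weight_def)
  have ball: "\<exists>n::nat. \<not> (AE x in lebesgue. x \<in> ball 0 (real (Suc n)) \<longrightarrow> P x)"
    if "\<not> (AE x in lebesgue. P x)" for P :: "'a \<Rightarrow> bool"
  proof (rule ccontr)
    assume "\<not> ?thesis"
    then have "AE x in lebesgue. \<forall>n::nat. x \<in> ball 0 (real (Suc n)) \<longrightarrow> P x"
      unfolding AE_all_countable by blast
    then have "AE x in lebesgue. P x"
    proof eventually_elim
      case (elim x)
      obtain n :: nat where "norm x < real n" using reals_Archimedean2 by blast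
      then have "x \<in> ball 0 (real (Suc n))" by simp
      with elim show ?case by blast
    qed
    with that show False by simp
  qed
  obtain n1 :: nat where n1: "\<not> (AE x in lebesgue. x \<in> ball 0 (real (Suc n1)) \<longrightarrow> \<omega> x = 0)"
    using ball[OF nz] by blast
  obtain n2 :: nat where n2: "\<not> (AE x in lebesgue. x \<in> ball 0 (real (Suc n2)) \<longrightarrow> 0 < \<omega> x)"
    using ball[OF np] by blast
  define r where "r = real (Suc (max n1 n2))"
  have r: "0 < r" by (simp add: r_def)
  have sub: "ball 0 (real (Suc n1)) \<subseteq> ball (0::'a) r" "ball 0 (real (Suc n2)) \<subseteq> ball (0::'a) r"
    by (auto simp: r_def)
  let ?B = "ball (0::'a) r"
  have nz': "\<not> (AE x in lebesgue. x \<in> ?B \<longrightarrow> \<omega> x = 0)"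
  proof
    assume "AE x in lebesgue. x \<in> ?B \<longrightarrow> \<omega> x = 0"
    then have "AE x in lebesgue. x \<in> ball 0 (real (Suc n1)) \<longrightarrow> \<omega> x = 0"
      by (rule eventually_mono) (use sub(1) in blast)
    with n1 show False by simp
  qed
  have np': "\<not> (AE x in lebesgue. x \<in> ?B \<longrightarrow> ennpowr (ennreal (\<omega> x)) (- 1 / (p - 1)) \<noteq> \<infinity>)"
  proof
    assume "AE x in lebesgue. x \<in> ?B \<longrightarrow> ennpowr (ennreal (\<omega> x)) (- 1 / (p - 1)) \<noteq> \<infinity>"
    then have "AE x in lebesgue. x \<in> ball 0 (real (Suc n2)) \<longrightarrow> 0 < \<omega> x"
    proof eventually_elim
      case (elim x)
      show ?case
      proof
        assume "x \<in> ball 0 (real (Suc n2))"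
        with sub(2) elim have "ennpowr (ennreal (\<omega> x)) (- 1 / (p - 1)) \<noteq> \<infinity>" by blast
        then have "\<omega> x \<noteq> 0" using p by (auto simp: ennpowr_def)
        with nonneg[of x] show "0 < \<omega> x" by simp
      qed
    qed
    with n2 show False by simp
  qed
  have "average ?B (\<lambda>x. ennpowr (ennreal (\<omega> x)) (- 1 / (p - 1))) = \<infinity>"
    using ennpowr_measurable[of \<omega> lebesgue] by (intro average_eq_infinity_if_not_AE_finite[OF r _ np']) auto
  then have 2: "ennpowr (average ?B (\<lambda>x. ennpowr (ennreal (\<omega> x)) (- 1 / (p - 1)))) (p - 1) = \<infinity>"
    using p by (simp add: ennpowr_def)
  obtain v where v: "0 < v" "emeasure lebesgue ?B = ennreal v"
    using emeasure_lebesgue_ball_pos[OF r] by blast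
  have 1: "average ?B (\<lambda>x. ennreal (\<omega> x)) \<noteq> 0"
  proof
    assume "average ?B (\<lambda>x. ennreal (\<omega> x)) = 0"
    then have "(\<integral>\<^sup>+x\<in>?B. ennreal (\<omega> x) \<partial>lebesgue) = 0"
      using v by (simp add: average_def ennreal_divide_eq_0_iff)
    then have "AE x in lebesgue. ennreal (\<omega> x) * indicator ?B x = 0"
      by (subst (asm) nn_integral_0_iff_AE)
        (auto intro!: borel_measurable_times_ennreal borel_measurable_indicator)
    then have "AE x in lebesgue. x \<in> ?B \<longrightarrow> \<omega> x = 0"
      by eventually_elim (use nonneg in \<open>auto simp: indicator_def ennreal_eq_0_iff intro: antisym\<close>)
    with nz' show False by simp
  qed
  have "average ?B (\<lambda>x. ennreal (\<omega> x)) *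
       ennpowr (average ?B (\<lambda>x. ennpowr (ennreal (\<omega> x)) (- 1 / (p - 1)))) (p - 1) \<le> Muckenhoupt_const p \<omega>"
    unfolding Muckenhoupt_const_def by (rule SUP_upper) (use r in auto)
  then have "Muckenhoupt_const p \<omega> = \<infinity>"
    unfolding 2 using 1 by (simp add: ennreal_mult_top top_unique)
  with fin show False by simp
qed

text \<open>Real form of the \<open>Muckenhoupt_const\<close> bound. Since \<omega> is positive
  almost everywhere, \<open>ennpowr\<close> may be replaced by \<open>powr\<close>, and all three
  integrals are positive; an infinite dual integral would make the constant infinite.\<close>

lemma Muckenhoupt_ball_bound:
  fixes \<omega> :: "'a::euclidean_space \<Rightarrow> real"
  assumes \<omega>: "\<omega> \<in> Muckenhoupt p" and p: "1 < p" and pos: "AE x in lebesgue. 0 < \<omega> x"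
  obtains K where "0 \<le> K" "\<And>c r. 0 < r \<Longrightarrow> \<exists>w s v. 0 < w \<and> 0 < s \<and> 0 < v \<and>
     weight_measure \<omega> (ball c r) = ennreal w \<and>
     (\<integral>\<^sup>+x\<in>ball c r. ennreal (\<omega> x powr (- 1 / (p - 1))) \<partial>lebesgue) = ennreal s \<and>
     emeasure lebesgue (ball c r) = ennreal v \<and> (w / v) * (s / v) powr (p - 1) \<le> K"
proof -
  have w: "weight \<omega>" and fin: "Muckenhoupt_const p \<omega> < \<infinity>"
    using \<omega> by (auto simp: Muckenhoupt_def)
  have [measurable]: "\<omega> \<in> borel_measurable lebesgue" by (rule weight_measurable_UNIV[OF w])
  obtain K where K: "0 \<le> K" "Muckenhoupt_const p \<omega> = ennreal K"
    using fin by (metis ennreal_cases infinity_ennreal_def less_irrefl)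
  have "\<exists>w s v. 0 < w \<and> 0 < s \<and> 0 < v \<and>
     weight_measure \<omega> (ball c r) = ennreal w \<and>
     (\<integral>\<^sup>+x\<in>ball c r. ennreal (\<omega> x powr (- 1 / (p - 1))) \<partial>lebesgue) = ennreal s \<and>
     emeasure lebesgue (ball c r) = ennreal v \<and> (w / v) * (s / v) powr (p - 1) \<le> K" if r: "0 < r" for c r
  proof -
    let ?B = "ball c r"
    let ?W = "weight_measure \<omega> ?B"
    let ?S = "\<integral>\<^sup>+x\<in>?B. ennreal (\<omega> x powr (- 1 / (p - 1))) \<partial>lebesgue"
    obtain v where v: "0 < v" "emeasure lebesgue ?B = ennreal v"
      using emeasure_lebesgue_ball_pos[OF r] by blast
    have nonnull: "\<not> (AE x in lebesgue. x \<notin> ?B)"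
    proof
      assume "AE x in lebesgue. x \<notin> ?B"
      then have "emeasure lebesgue ?B = 0"
        by (subst (asm) AE_iff_measurable[of ?B]) auto
      with v show False by simp
    qed
    have ge0: "(\<integral>\<^sup>+x\<in>?B. ennreal (g x) \<partial>lebesgue) \<noteq> 0"
      if "g \<in> borel_measurable lebesgue" "AE x in lebesgue. 0 < g x" for g
    proof
      assume "(\<integral>\<^sup>+x\<in>?B. ennreal (g x) \<partial>lebesgue) = 0"
      then have "AE x in lebesgue. ennreal (g x) * indicator ?B x = 0"
        using that(1)
        by (subst (asm) nn_integral_0_iff_AE)
          (auto intro!: borel_measurable_times_ennreal borel_measurable_indicator)
      with that(2) have "AE x in lebesgue. x \<notin> ?B"
        by eventually_elim (auto simp: indicator_def ennreal_eq_0_iff)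
      with nonnull show False by simp
    qed
    have W0: "?W \<noteq> 0" unfolding weight_measure_def by (rule ge0[OF _ pos]) simp
    have "?W < \<infinity>" by (rule weight_measure_finite[OF w bounded_ball])
    then have "?W \<noteq> \<infinity>" by simp
    then obtain a where a: "0 < a" "?W = ennreal a"
      using ennreal_positive_finiteE[OF W0] by blast
    have S0: "?S \<noteq> 0"
      using pos by (intro ge0) (auto elim: AE_mp)
    have Seq: "?S = (\<integral>\<^sup>+x\<in>?B. ennpowr (ennreal (\<omega> x)) (- 1 / (p - 1)) \<partial>lebesgue)"
      using pos by (intro nn_integral_cong_AE, eventually_elim) (auto simp: ennpowr_def ennreal_eq_0_iff)
    have le: "average ?B (\<lambda>x. ennreal (\<omega> x)) *
       ennpowr (average ?B (\<lambda>x. ennpowr (ennreal (\<omega> x)) (- 1 / (p - 1)))) (p - 1) \<le> Muckenhoupt_const p \<omega>"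
      unfolding Muckenhoupt_const_def by (rule SUP_upper) (use r in auto)
    have av1: "average ?B (\<lambda>x. ennreal (\<omega> x)) = ennreal (a / v)"
      using a v by (simp add: average_def weight_measure_def[symmetric] divide_ennreal)
    have av2: "average ?B (\<lambda>x. ennpowr (ennreal (\<omega> x)) (- 1 / (p - 1))) = ?S / ennreal v"
      by (simp only: average_def Seq v(2))
    have "?S \<noteq> \<infinity>"
    proof
      assume "?S = \<infinity>"
      then have "?S / ennreal v = \<infinity>" using v by (simp add: ennreal_top_divide)
      moreover have "ennpowr \<infinity> (p - 1) = \<infinity>" using p by (simp add: ennpowr_def)
      ultimately have "ennpowr (average ?B (\<lambda>x. ennpowr (ennreal (\<omega> x)) (- 1 / (p - 1)))) (p - 1) = \<infinity>"
        by (simp only: av2)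
      then have "Muckenhoupt_const p \<omega> = \<infinity>"
        using le a v unfolding av1 by (simp add: ennreal_mult_top top_unique)
      with fin show False by simp
    qed
    then obtain s where s: "0 < s" "?S = ennreal s"
      using ennreal_positive_finiteE[OF S0] by blast
    have "?S / ennreal v = ennreal (s / v)"
      unfolding s(2) using s(1) v by (simp add: divide_ennreal)
    moreover have "ennpowr (ennreal (s / v)) (p - 1) = ennreal ((s / v) powr (p - 1))"
    proof -
      have "0 < s / v" using s(1) v(1) by simp
      then show ?thesis by (simp add: ennpowr_def ennreal_eq_0_iff not_le)
    qed
    ultimately have "ennreal (a / v) * ennreal ((s / v) powr (p - 1)) \<le> ennreal K"
      using le unfolding av1 av2 K(2) by (simp only:)
    then have "(a / v) * (s / v) powr (p - 1) \<le> K"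
      using a v K by (simp flip: ennreal_mult')
    with a s v show ?thesis by blast
  qed
  with K(1) that show thesis by blast
qed

text \<open>Young's inequality for the exponents \<open>p\<close> and \<open>p / (p - 1)\<close>, with the weight \<open>c\<close> chosen at will.\<close>

lemma powr_inverse_le_weighted:
  fixes u c p :: real
  assumes u: "0 \<le> u" and c: "0 < c" and p: "1 < p"
  shows "u powr (1 / p) \<le> c * u + c powr (- 1 / (p - 1))"
proof (cases "u powr (1 / p) \<le> c * u")
  case True
  then show ?thesis by (simp add: add_increasing2)
next
  case False
  then have u0: "0 < u" using u by (cases "u = 0") auto
  have "u = u powr (1 / p) * u powr ((p - 1) / p)"
    using u0 p by (simp flip: powr_add add: diff_divide_distrib)
  then have "c * (u powr (1 / p) * u powr ((p - 1) / p)) < u powr (1 / p)"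
    using False by simp
  then have "c * u powr ((p - 1) / p) < 1"
    using u0 by (simp add: mult.left_commute)
  then have "u powr ((p - 1) / p) \<le> 1 / c"
    using c by (simp add: field_simps)
  then have "(u powr ((p - 1) / p)) powr (1 / (p - 1)) \<le> (1 / c) powr (1 / (p - 1))"
    using p by (intro powr_mono2) auto
  also have "(1 / c) powr (1 / (p - 1)) = c powr (- 1 / (p - 1))"
    using c by (simp add: powr_divide powr_minus_divide)
  finally have "u powr (1 / p) \<le> c powr (- 1 / (p - 1))"
    using p by (simp add: powr_powr)
  then show ?thesis using c u by (simp add: add_increasing)
qed

section \<open>Condition (A1) as a comparison of \<phi> with a single threshold\<close>

text \<open>m is the essential infimum of I. For almost every x the number \<beta> I x is an
  essential lower bound, hence at most m. The gain is one exceptional set instead of a null set of y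
  for each x. The essential infimum is finite because the measure is not zero.\<close>

lemma AE_swap_comparison:
  fixes I :: "'a::euclidean_space \<Rightarrow> real"
  assumes nonnull: "\<not> (AE x in N. False)" and I: "AE x in N. 0 < I x" and \<beta>: "0 < \<beta>"
    and AE2: "AE x in N. AE y in N. \<beta> * I x \<le> I y"
  obtains m where "0 < m" "AE x in N. m \<le> I x \<and> I x \<le> m / \<beta>"
proof -
  define S where "S = {c. AE y in N. c \<le> I y}"
  have "\<exists>x. 0 < I x \<and> (AE y in N. \<beta> * I x \<le> I y)"
  proof (rule ccontr)
    assume "\<not> ?thesis"
    have "AE x in N. 0 < I x \<and> (AE y in N. \<beta> * I x \<le> I y)"
      using I AE2 by (rule AE_conjI)
    then have "AE x in N. False"
      by (rule eventually_mono) (use \<open>\<nexists>x. 0 < I x \<and> (AE y in N. \<beta> * I x \<le> I y)\<close> in blast)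
    with nonnull show False by simp
  qed
  then obtain x0 where x0: "0 < I x0" "\<beta> * I x0 \<in> S" by (auto simp: S_def)
  have bdd: "bdd_above S"
  proof (rule ccontr)
    assume unb: "\<not> bdd_above S"
    have "AE y in N. real n \<le> I y" for n
    proof -
      obtain c where "c \<in> S" "real n < c" using unb by (auto simp: bdd_above_def not_le)
      then show ?thesis by (auto simp: S_def elim!: eventually_mono)
    qed
    then have "AE y in N. \<forall>n. real n \<le> I y" by (simp add: AE_all_countable)
    then have "AE y in N. False"
    proof (rule eventually_mono)
      fix y assume le: "\<forall>n. real n \<le> I y"
      obtain n :: nat where "I y < real n" using reals_Archimedean2 by blast
      with le show False by (meson not_le)
    qed
    with nonnull show False by simp
  qed
  define m where "m = Sup S"
  have m_upper: "c \<le> m" if "c \<in> S" for c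
    unfolding m_def using that bdd by (rule cSup_upper)
  have "0 < m" using m_upper[OF x0(2)] x0(1) \<beta> by (meson less_le_trans mult_pos_pos)
  moreover have "AE y in N. \<forall>n. m - 1 / real (Suc n) \<le> I y"
    unfolding AE_all_countable
  proof
    fix n
    have "m - 1 / real (Suc n) < Sup S" by (simp add: m_def)
    then obtain c where "c \<in> S" "m - 1 / real (Suc n) < c"
      using less_cSupE x0(2) by (metis empty_iff)
    then show "AE y in N. m - 1 / real (Suc n) \<le> I y"
      by (auto simp: S_def elim!: eventually_mono)
  qed
  then have "AE x in N. m \<le> I x"
  proof eventually_elim
    case (elim y)
    show "m \<le> I y"
    proof (rule ccontr)
      assume "\<not> m \<le> I y"
      then obtain n where "inverse (real (Suc n)) < m - I y"
        using reals_Archimedean[of "m - I y"] by auto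
      then have "\<not> m - 1 / real (Suc n) \<le> I y" by (simp add: inverse_eq_divide)
      with elim show False by blast
    qed
  qed
  moreover have "AE x in N. I x \<le> m / \<beta>"
    using AE2
  proof eventually_elim
    case (elim x)
    then have "\<beta> * I x \<le> m" by (intro m_upper) (simp add: S_def)
    then show ?case using \<beta> by (simp add: field_simps)
  qed
  ultimately show thesis
    by (intro that[of m]) auto
qed

locale Phi_A1 = Phi_weight +
  fixes \<beta> K :: real
  assumes weight_pos: "AE x in lebesgue. 0 < \<omega> x"
    and K_nonneg: "0 \<le> K"
    and A_p: "\<And>c r. 0 < r \<Longrightarrow> \<exists>w s v. 0 < w \<and> 0 < s \<and> 0 < v \<and>
     weight_measure \<omega> (ball c r) = ennreal w \<and>
     (\<integral>\<^sup>+x\<in>ball c r. ennreal (\<omega> x powr (- 1 / (p - 1))) \<partial>lebesgue) = ennreal s \<and>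
     emeasure lebesgue (ball c r) = ennreal v \<and> (w / v) * (s / v) powr (p - 1) \<le> K"
    and \<beta>: "0 < \<beta>" "\<beta> \<le> 1"
    and A1: "\<And>c r t. 0 < r \<Longrightarrow> weight_measure \<omega> (ball c r) \<le> 1 \<Longrightarrow> 1 \<le> t \<Longrightarrow>
      ennreal t \<le> 1 / weight_measure \<omega> (ball c r) \<Longrightarrow>
      AE x in lebesgue_on (ball c r \<inter> \<Omega>). AE y in lebesgue_on (ball c r \<inter> \<Omega>).
        \<beta> * left_inverse \<phi> x t \<le> left_inverse \<phi> y t"
begin

lemma weight_pos_M: "AE x in M. 0 < \<omega> x"
  using weight_pos by (simp add: AE_restrict_space_iff) (auto elim: AE_mp)

text \<open>The infimum that defines the inverse need not be attained, so both comparisons are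
  claimed strictly off it. It is positive because \<phi> x is below 1 near 0 while the level s is at
  least 1.\<close>

lemma left_inverse_pos:
  assumes x: "x \<in> \<Omega>" and s: "1 \<le> s"
  shows "0 < left_inverse \<phi> x s"
    and "\<And>t. 0 \<le> t \<Longrightarrow> t < left_inverse \<phi> x s \<Longrightarrow> \<phi> x t \<le> ennreal s"
    and "\<And>t. left_inverse \<phi> x s < t \<Longrightarrow> ennreal s \<le> \<phi> x t"
proof -
  define A where "A = {\<tau>. 0 \<le> \<tau> \<and> ennreal s \<le> \<phi> x \<tau>}"
  have bdd: "bdd_below A" by (auto simp: A_def intro!: bdd_belowI[of _ 0])
  have "\<forall>\<^sub>F t in at_top. ennreal s < \<phi> x t"
    using phi_tendsto_top[OF x] by (rule order_tendstoD) simp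
  then obtain t0 where "\<And>t. t0 \<le> t \<Longrightarrow> ennreal s < \<phi> x t" by (auto simp: eventually_at_top_linorder)
  then have "max 0 t0 \<in> A" by (auto simp: A_def intro: less_imp_le)
  then have ne: "A \<noteq> {}" by blast
  have inv: "left_inverse \<phi> x s = Inf A" by (simp add: left_inverse_def A_def)
  have "\<forall>\<^sub>F t in at_right 0. \<phi> x t < 1"
    using phi_tendsto_0[OF x] by (rule order_tendstoD) simp
  then obtain b where b: "0 < b" "\<And>t. 0 < t \<Longrightarrow> t < b \<Longrightarrow> \<phi> x t < 1"
    by (auto simp: eventually_at_right_field)
  have "b \<le> Inf A"
  proof (rule cInf_greatest[OF ne])
    fix t assume t: "t \<in> A"
    have "ennreal 1 \<le> ennreal s" by (intro ennreal_leI s)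
    also have "\<dots> \<le> \<phi> x t" using t by (simp add: A_def)
    finally have "1 \<le> \<phi> x t" by simp
    then have "t \<noteq> 0" using phi_0[OF x] by auto
    then show "b \<le> t" using b(2)[of t] t \<open>1 \<le> \<phi> x t\<close> by (force simp: A_def not_less[symmetric])
  qed
  with b show "0 < left_inverse \<phi> x s" by (simp add: inv)
  show "\<phi> x t \<le> ennreal s" if "0 \<le> t" "t < left_inverse \<phi> x s" for t
  proof (rule ccontr)
    assume "\<not> ?thesis"
    then have "t \<in> A" using that by (simp add: A_def)
    then have "Inf A \<le> t" using bdd by (rule cInf_lower)
    with that show False by (simp add: inv)
  qed
  show "ennreal s \<le> \<phi> x t" if t: "left_inverse \<phi> x s < t" for t
  proof -
    obtain \<tau> where "\<tau> \<in> A" "\<tau> < t" using cInf_lessD[OF ne, of t] t by (auto simp: inv)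
    then show ?thesis using phi_mono[OF x, of \<tau> t] by (auto simp: A_def)
  qed
qed

text \<open>m is the essential infimum over the ball of the inverses at level s. Below m all \<phi>
  x are at most s, above m/\<beta> at least s; the exceptional set depends on s but not on
  t.\<close>

lemma A1_uniform:
  assumes r: "0 < r" and W: "weight_measure \<omega> (ball c r) \<le> 1"
    and s: "1 \<le> s" "ennreal s \<le> 1 / weight_measure \<omega> (ball c r)"
  obtains m where "0 < m"
    "AE x in M. x \<in> ball c r \<longrightarrow> (\<forall>t. 0 \<le> t \<and> t < m \<longrightarrow> \<phi> x t \<le> ennreal s) \<and> (\<forall>t>m / \<beta>. ennreal s \<le> \<phi> x t)"
proof (cases "ball c r \<inter> \<Omega> = {}")
  case True
  show thesis
    by (rule that[of 1], simp, rule AE_I2) (use True in auto)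
next
  case False
  let ?N = "lebesgue_on (ball c r \<inter> \<Omega>)"
  have nonnull: "\<not> (AE x in ?N. False)"
  proof
    assume "AE x in ?N. False"
    then have "AE x in lebesgue. x \<notin> ball c r \<inter> \<Omega>"
      by (subst (asm) AE_restrict_space_iff) auto
    then have "ball c r \<inter> \<Omega> \<in> null_sets lebesgue"
      by (subst (asm) AE_iff_null_sets[symmetric]) auto
    then have "negligible (ball c r \<inter> \<Omega>)" by (simp add: negligible_iff_null_sets)
    then show False using open_not_negligible[of "ball c r \<inter> \<Omega>"] False open_Omega by blast
  qed
  have "AE x in ?N. 0 < left_inverse \<phi> x s"
    by (rule AE_I2) (auto simp: space_restrict_space intro: left_inverse_pos(1)[OF _ s(1)])
  then obtain m where m: "0 < m" "AE x in ?N. m \<le> left_inverse \<phi> x s \<and> left_inverse \<phi> x s \<le> m / \<beta>"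
    using AE_swap_comparison[OF nonnull _ \<beta>(1) A1[OF r W s]] by blast
  have "AE x in lebesgue. x \<in> ball c r \<inter> \<Omega> \<longrightarrow> m \<le> left_inverse \<phi> x s \<and> left_inverse \<phi> x s \<le> m / \<beta>"
    using m(2) by (subst (asm) AE_restrict_space_iff) auto
  then have "AE x in M. x \<in> ball c r \<longrightarrow> (\<forall>t. 0 \<le> t \<and> t < m \<longrightarrow> \<phi> x t \<le> ennreal s) \<and> (\<forall>t>m / \<beta>. ennreal s \<le> \<phi> x t)"
    by (subst AE_restrict_space_iff, simp, eventually_elim)
      (auto intro: left_inverse_pos(2,3)[OF _ s(1)])
  with m(1) that show thesis by blast
qed

end

subsection \<open>Boundedness of averaging operators\<close>

text \<open>(A1) and the A_p condition speak of balls, so cubes are compared with balls of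
  proportional volume. Taking n + 1 in place of the diameter bound n makes the open ball contain the
  cube.\<close>

lemma cube_subset_ball:
  fixes x :: "'a::euclidean_space"
  shows "cube k x \<subseteq> ball x ((real DIM('a) + 1) / 2 ^ k)"
proof
  fix y assume "y \<in> cube k x"
  then have "norm (x - y) \<le> real DIM('a) / 2 ^ k" by (intro cube_diameter[of _ k x] cube_self)
  also have "\<dots> < (real DIM('a) + 1) / 2 ^ k" by (simp add: divide_strict_right_mono)
  finally show "y \<in> ball x ((real DIM('a) + 1) / 2 ^ k)" by (simp add: dist_norm)
qed

lemma emeasure_ball_le_cube:
  fixes x :: "'a::euclidean_space"
  shows "emeasure lborel (ball x ((real DIM('a) + 1) / 2 ^ k)) \<le> ennreal ((2 * (real DIM('a) + 1)) ^ DIM('a)) * emeasure lborel (cube k x)"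
proof -
  define r where "r = (real DIM('a) + 1) / 2 ^ k"
  have r: "0 < r" by (simp add: r_def add_nonneg_pos)
  have "ball x r \<subseteq> cbox (x - r *\<^sub>R One) (x + r *\<^sub>R One)"
  proof
    fix y assume y: "y \<in> ball x r"
    have "\<bar>(x - y) \<bullet> i\<bar> \<le> r" if "i \<in> Basis" for i
      using Basis_le_norm[OF that, of "x - y"] y by (simp add: dist_norm)
    then show "y \<in> cbox (x - r *\<^sub>R One) (x + r *\<^sub>R One)"
      by (auto simp: mem_box inner_diff_left inner_add_left abs_le_iff algebra_simps)
  qed
  then have "emeasure lborel (ball x r) \<le> emeasure lborel (cbox (x - r *\<^sub>R One) (x + r *\<^sub>R One))"
    by (intro emeasure_mono) auto
  also have "\<dots> = ennreal ((2 * r) ^ DIM('a))"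
    using r by (simp add: emeasure_lborel_cbox_eq inner_diff_left inner_add_left algebra_simps)
  also have "(2 * r) ^ DIM('a) = (2 * (real DIM('a) + 1)) ^ DIM('a) * (1 / 2 ^ k) ^ DIM('a)"
    by (simp add: r_def flip: power_mult_distrib)
  finally show ?thesis by (simp add: r_def emeasure_cube ennreal_mult')
qed

lemma countable_cubes: "countable (cube k ` (A :: 'a::euclidean_space set))"
proof -
  let ?g = "\<lambda>f :: 'a \<Rightarrow> int. cube k (\<Sum>i\<in>Basis. (of_int (f i) / 2 ^ k) *\<^sub>R i :: 'a)"
  have "cube k ` A \<subseteq> ?g ` (Basis \<rightarrow>\<^sub>E UNIV)"
  proof
    fix Q assume "Q \<in> cube k ` A"
    then obtain x where x: "Q = cube k x" by blast
    define f where "f = restrict (\<lambda>i. \<lfloor>2 ^ k * (x \<bullet> i)\<rfloor>) Basis"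
    have "Q = ?g f"
      unfolding x by (auto simp: cube_def f_def inner_sum_left_Basis)
    moreover have "f \<in> Basis \<rightarrow>\<^sub>E UNIV" by (simp add: f_def)
    ultimately show "Q \<in> ?g ` (Basis \<rightarrow>\<^sub>E UNIV)" by blast
  qed
  moreover have "countable (?g ` (Basis \<rightarrow>\<^sub>E UNIV))"
    by (intro countable_image countable_PiE) auto
  ultimately show ?thesis by (rule countable_subset)
qed

text \<open>The cubes of one generation partition the space. Writing the sum over them as an
  integral for \<open>count_space\<close> lets it be exchanged with the integral over x, where a
  single cube contributes.\<close>

lemma nn_integral_sum_cubes:
  fixes h :: "'a::euclidean_space \<Rightarrow> ennreal"
  assumes h[measurable]: "h \<in> borel_measurable N" and N: "space N = A" "sets N = sets (lebesgue_on A)"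
  shows "(\<integral>\<^sup>+Q. (\<integral>\<^sup>+x\<in>Q. h x \<partial>N) \<partial>count_space (cube k ` A)) = (\<integral>\<^sup>+x. h x \<partial>N)"
proof -
  have ind: "(indicator Q :: 'a \<Rightarrow> ennreal) \<in> borel_measurable N" if "Q \<in> cube k ` A" for Q
  proof -
    have "Q \<in> sets lebesgue" using that cube_measurable by auto
    then have "(indicator Q :: 'a \<Rightarrow> ennreal) \<in> borel_measurable (lebesgue_on A)"
      by (intro measurable_restrict_space1 borel_measurable_indicator)
    then show ?thesis using N(2) by (simp cong: measurable_cong_sets)
  qed
  have "(\<integral>\<^sup>+Q. (\<integral>\<^sup>+x\<in>Q. h x \<partial>N) \<partial>count_space (cube k ` A)) =
    (\<integral>\<^sup>+x. (\<integral>\<^sup>+Q. h x * indicator Q x \<partial>count_space (cube k ` A)) \<partial>N)"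
    using ind by (intro nn_integral_count_space_nn_integral[symmetric] countable_cubes) auto
  also have "\<dots> = (\<integral>\<^sup>+x. h x \<partial>N)"
  proof (rule nn_integral_cong)
    fix x assume "x \<in> space N"
    then have x: "x \<in> A" using N by simp
    have "(\<integral>\<^sup>+Q. h x * indicator Q x \<partial>count_space (cube k ` A)) =
      (\<integral>\<^sup>+Q. h x * indicator {cube k x} Q \<partial>count_space (cube k ` A))"
    proof (rule nn_integral_cong)
      fix Q assume "Q \<in> space (count_space (cube k ` A))"
      then obtain y where y: "Q = cube k y" by auto
      then have "x \<in> Q \<longleftrightarrow> Q = cube k x" using cube_eq cube_self by metis
      then show "h x * indicator Q x = h x * indicator {cube k x} Q" by (simp add: indicator_def)
    qed
    also have "\<dots> = h x * emeasure (count_space (cube k ` A)) {cube k x}"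
      using x by (subst nn_integral_cmult_indicator) auto
    also have "\<dots> = h x" using x by simp
    finally show "(\<integral>\<^sup>+Q. h x * indicator Q x \<partial>count_space (cube k ` A)) = h x" .
  qed
  finally show ?thesis .
qed

lemma cube_average_measurable[measurable]:
  assumes [measurable]: "g \<in> borel_measurable borel"
  shows "cube_average k g \<in> borel_measurable borel"
proof -
  have "(\<lambda>x. \<integral>\<^sup>+y. g y * indicator {z. \<forall>i\<in>Basis. \<lfloor>2 ^ k * (fst z \<bullet> i)\<rfloor> = \<lfloor>2 ^ k * (snd z \<bullet> i)\<rfloor>} (y, x) \<partial>lborel) \<in> borel_measurable borel"
    by measurable
  also have "(\<lambda>x. \<integral>\<^sup>+y. g y * indicator {z. \<forall>i\<in>Basis. \<lfloor>2 ^ k * (fst z \<bullet> i)\<rfloor> = \<lfloor>2 ^ k * (snd z \<bullet> i)\<rfloor>} (y, x) \<partial>lborel)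
    = (\<lambda>x. \<integral>\<^sup>+y\<in>cube k x. g y \<partial>lborel)"
    by (intro ext nn_integral_cong) (auto simp: cube_def indicator_def)
  finally show ?thesis unfolding cube_average_def[abs_def] by measurable
qed

context Phi_weight
begin

text \<open>Peeling off the first term with weight 1/2 leaves half of a sum of the same shape, so
  midpoint convexity suffices at each step. The weights sum to less than 1, and the missing mass is
  absorbed by \<phi>(x,0) = 0.\<close>

lemma phi_dyadic_convex:
  assumes x: "x \<in> \<Omega>"
  shows "(\<And>j. j < N \<Longrightarrow> 0 \<le> a j) \<Longrightarrow>
    \<phi> x (\<Sum>j<N. a j / 2 ^ Suc j) \<le> (\<Sum>j<N. ennreal (1 / 2 ^ Suc j) * \<phi> x (a j))"
proof (induction N arbitrary: a)
  case 0
  then show ?case using phi_0[OF x] by simp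
next
  case (Suc N)
  let ?S = "\<Sum>j<N. a (Suc j) / 2 ^ Suc j"
  have nn: "0 \<le> a 0" "\<And>j. j < N \<Longrightarrow> 0 \<le> a (Suc j)" using Suc.prems by auto
  have "0 \<le> ?S" by (intro sum_nonneg divide_nonneg_nonneg nn) auto
  have "(\<Sum>j<Suc N. a j / 2 ^ Suc j) = (1 / 2) * a 0 + (1 - 1 / 2) * ?S"
    by (subst sum.lessThan_Suc_shift) (simp add: sum_divide_distrib)
  then have "\<phi> x (\<Sum>j<Suc N. a j / 2 ^ Suc j) \<le> ennreal (1 / 2) * \<phi> x (a 0) + ennreal (1 - 1 / 2) * \<phi> x ?S"
    using phi_convex[OF x nn(1) \<open>0 \<le> ?S\<close>, of "1 / 2"] by simp
  also have "\<dots> \<le> ennreal (1 / 2) * \<phi> x (a 0) + ennreal (1 - 1 / 2) * (\<Sum>j<N. ennreal (1 / 2 ^ Suc j) * \<phi> x (a (Suc j)))"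
    by (intro add_left_mono mult_left_mono Suc.IH nn) auto
  also have "\<dots> = (\<Sum>j<Suc N. ennreal (1 / 2 ^ Suc j) * \<phi> x (a j))"
  proof -
    have "ennreal (1 - 1 / 2) * ennreal (1 / 2 ^ Suc j) = ennreal (1 / 2 ^ Suc (Suc j))" for j
      by (subst ennreal_mult'[symmetric]) simp_all
    then have "ennreal (1 - 1 / 2) * (ennreal (1 / 2 ^ Suc j) * c) = ennreal (1 / 2 ^ Suc (Suc j)) * c" for j c
      by (simp only: mult.assoc[symmetric])
    then show ?thesis
      by (subst sum.lessThan_Suc_shift) (simp only: sum_distrib_left power_0 power_Suc0_right)
  qed
  finally show ?case .
qed

text \<open>Splits \<open>t\<close> at \<open>T\<close>; above \<open>T\<close> the growth of order \<open>p\<close> together with Young's inequality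
  replaces Jensen's inequality for the convex function \<open>\<phi>\<^sup>1\<^sup>/\<^sup>p\<close>.\<close>

lemma split_at_threshold:
  assumes x: "x \<in> \<Omega>" and t: "0 \<le> t" and T: "0 < T" and s: "0 < s" "ennreal s \<le> \<phi> x T"
    and \<omega>: "0 < \<omega> x" and \<theta>: "0 < \<theta>"
  shows "ennreal t \<le> ennreal T + ennreal (T * L powr (1 / p) * (\<theta> / s)) * (\<phi> x t * ennreal (\<omega> x))
     + ennreal (T * L powr (1 / p) * \<theta> powr (- 1 / (p - 1))) * ennreal (\<omega> x powr (- 1 / (p - 1)))"
proof (cases "t \<le> T")
  case True
  then have "ennreal t \<le> ennreal T" by (rule ennreal_leI)
  then show ?thesis by (simp add: add_increasing2 add.assoc)
next
  case False
  define u where "u = enn2real (\<phi> x t)"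
  have u: "\<phi> x t = ennreal u" "0 \<le> u" using phi_finite[OF x t] by (simp_all add: u_def)
  have "ennreal ((t / T) powr p * s) \<le> ennreal ((t / T) powr p) * \<phi> x T"
    using s by (simp add: ennreal_mult' mult_left_mono)
  also have "\<dots> \<le> ennreal L * \<phi> x ((t / T) * T)"
    using False T by (intro phi_increase[OF x T]) simp
  also have "\<dots> = ennreal (L * u)" using T L u by (simp add: ennreal_mult')
  finally have "(t / T) powr p * s \<le> L * u"
    using L u by (simp add: ennreal_le_iff)
  then have "(t / T) powr p \<le> L * (u / s)" using s by (simp add: field_simps)
  then have "((t / T) powr p) powr (1 / p) \<le> (L * (u / s)) powr (1 / p)"
    using p by (intro powr_mono2) auto
  also have "((t / T) powr p) powr (1 / p) = t / T"
    using p t T by (simp add: powr_powr)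
  also have "(L * (u / s)) powr (1 / p) = L powr (1 / p) * (u / s) powr (1 / p)"
    by (rule powr_mult)
  finally have "t / T \<le> L powr (1 / p) * (u / s) powr (1 / p)" .
  \<comment> \<open>Young's inequality for \<phi>(x,t)/s with the weight \<theta> \<omega>(x), so
    that one term integrates to the modular and the other to the dual weight.\<close>
  also have "L powr (1 / p) * (u / s) powr (1 / p) \<le> L powr (1 / p) * ((\<theta> * \<omega> x) * (u / s) + (\<theta> * \<omega> x) powr (- 1 / (p - 1)))"
    using u s \<theta> \<omega> p by (intro mult_left_mono powr_inverse_le_weighted) auto
  also have "(\<theta> * \<omega> x) powr (- 1 / (p - 1)) = \<theta> powr (- 1 / (p - 1)) * \<omega> x powr (- 1 / (p - 1))"
    using \<theta> \<omega> by (simp add: powr_mult)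
  finally have "t \<le> T * (L powr (1 / p) * ((\<theta> * \<omega> x) * (u / s) + \<theta> powr (- 1 / (p - 1)) * \<omega> x powr (- 1 / (p - 1))))"
    using T by (simp add: field_simps)
  also have "\<dots> = (T * L powr (1 / p) * (\<theta> / s)) * (u * \<omega> x) + (T * L powr (1 / p) * \<theta> powr (- 1 / (p - 1))) * \<omega> x powr (- 1 / (p - 1))"
    by (simp add: algebra_simps)
  finally have "ennreal t \<le> ennreal \<dots>" by (rule ennreal_leI)
  also have "\<dots> = ennreal (T * L powr (1 / p) * (\<theta> / s)) * (\<phi> x t * ennreal (\<omega> x))
     + ennreal (T * L powr (1 / p) * \<theta> powr (- 1 / (p - 1))) * ennreal (\<omega> x powr (- 1 / (p - 1)))"
  proof -
    have e: "ennreal (A * (u * \<omega> x) + B * \<sigma>) = ennreal A * (ennreal u * ennreal (\<omega> x)) + ennreal B * ennreal \<sigma>"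
      if "0 \<le> A" "0 \<le> B" "0 \<le> \<sigma>" for A B \<sigma>
      using that u \<omega> by (simp add: ennreal_mult')
    show ?thesis unfolding u(1) by (rule e) (use T s \<theta> in auto)
  qed
  finally show ?thesis by (simp add: add_increasing add.assoc)
qed

end

context Phi_A1
begin

text \<open>Otherwise the centres of arbitrarily small balls of weight above 1 accumulate at some c,
  and such balls end up inside every ball around c. The weights of balls shrinking to c tend to the
  weight of {c}, which is 0.\<close>

lemma small_balls:
  "\<exists>k0. \<forall>k\<ge>k0. \<forall>x\<in>\<Omega>. weight_measure \<omega> (ball x ((real DIM('a) + 1) / 2 ^ k)) \<le> 1"
proof (rule ccontr)
  define rad where "rad k = (real DIM('a) + 1) / 2 ^ k" for k :: nat
  have rad_mono: "rad k \<le> rad j" if "j \<le> k" for j k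
    unfolding rad_def using that by (intro divide_left_mono power_increasing) auto
  have rad_0: "rad \<longlonglongrightarrow> 0"
  proof -
    have "(\<lambda>k. (real DIM('a) + 1) * (1 / 2) ^ k) \<longlonglongrightarrow> (real DIM('a) + 1) * 0"
      by (intro tendsto_intros LIMSEQ_realpow_zero) auto
    moreover have "rad = (\<lambda>k. (real DIM('a) + 1) * (1 / 2) ^ k)"
      by (auto simp: rad_def power_one_over)
    ultimately show ?thesis by simp
  qed
  have wm: "weight_measure \<omega> A \<le> weight_measure \<omega> B" if "A \<subseteq> B" for A B
    unfolding weight_measure_def using that by (intro nn_integral_mono) (auto simp: indicator_def)
  assume neg: "\<not> ?thesis"
  have "\<exists>x\<in>\<Omega>. 1 < weight_measure \<omega> (ball x (rad j))" for j
  proof -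
    have "\<not> (\<forall>k\<ge>j. \<forall>x\<in>\<Omega>. weight_measure \<omega> (ball x (rad k)) \<le> 1)"
      using neg unfolding rad_def by blast
    then obtain k x where kx: "j \<le> k" "x \<in> \<Omega>" "1 < weight_measure \<omega> (ball x (rad k))"
      by (auto simp: not_le)
    have "weight_measure \<omega> (ball x (rad k)) \<le> weight_measure \<omega> (ball x (rad j))"
      using rad_mono[OF kx(1)] by (intro wm subset_ball)
    with kx show ?thesis by (blast intro: less_le_trans)
  qed
  then obtain X where X: "\<And>j. X j \<in> \<Omega>" "\<And>j. 1 < weight_measure \<omega> (ball (X j) (rad j))" by metis
  have "compact (closure \<Omega>)" using bounded_Omega by simp
  moreover have "\<forall>j. X j \<in> closure \<Omega>" using X(1) closure_subset by blast
  ultimately obtain c \<rho> where c: "strict_mono \<rho>" "(X \<circ> \<rho>) \<longlonglongrightarrow> c"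
    by (metis compact_imp_seq_compact seq_compactE)
  define N where "N = density lebesgue (\<lambda>x. ennreal (\<omega> x))"
  have [measurable]: "\<omega> \<in> borel_measurable lebesgue" by (rule weight_measurable_lebesgue)
  have N: "emeasure N A = weight_measure \<omega> A" if "A \<in> sets lebesgue" for A
    using that by (simp add: N_def emeasure_density weight_measure_def)
  have sN: "sets N = sets lebesgue" by (simp add: N_def)
  define B where "B i = ball c (inverse (real (Suc i)))" for i
  have "(\<lambda>i. emeasure N (B i)) \<longlonglongrightarrow> emeasure N (\<Inter>i. B i)"
  proof (rule Lim_emeasure_decseq)
    show "range B \<subseteq> sets N" by (auto simp: sN B_def)
    show "decseq B" unfolding B_def by (auto simp: decseq_def intro!: subset_ball le_imp_inverse_le)
    show "emeasure N (B i) \<noteq> \<infinity>" for i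
      using weight_measure_finite[OF weight, of "B i"] by (subst N) (auto simp: B_def)
  qed
  moreover have "(\<Inter>i. B i) = {c}"
  proof -
    have "y = c" if "\<And>i. y \<in> B i" for y
    proof (rule ccontr)
      assume "y \<noteq> c"
      then obtain i where "inverse (real (Suc i)) < dist c y"
        using reals_Archimedean[of "dist c y"] by auto
      then show False using that[of i] by (simp add: B_def)
    qed
    moreover have "c \<in> B i" for i by (simp add: B_def)
    ultimately show ?thesis by blast
  qed
  moreover have "emeasure N {c} = 0"
  proof -
    have "{c} \<in> null_sets lebesgue" using negligible_sing[of c] by (simp add: negligible_iff_null_sets)
    then have "weight_measure \<omega> {c} = 0"
      unfolding weight_measure_def by (rule nn_integral_null_set)
    moreover have "{c} \<in> sets lebesgue" using \<open>{c} \<in> null_sets lebesgue\<close> by auto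
    ultimately show ?thesis by (simp add: N)
  qed
  ultimately have "(\<lambda>i. emeasure N (B i)) \<longlonglongrightarrow> 0" by simp
  then have "\<forall>\<^sub>F i in sequentially. emeasure N (B i) < 1" by (rule order_tendstoD) simp
  then obtain i where i: "emeasure N (B i) < 1" by (auto simp: eventually_sequentially)
  define \<epsilon> where "\<epsilon> = inverse (real (Suc i))"
  have \<epsilon>: "0 < \<epsilon>" by (simp add: \<epsilon>_def)
  have "\<forall>\<^sub>F j in sequentially. dist (X (\<rho> j)) c < \<epsilon> / 2"
    using c(2) \<epsilon> by (auto simp: o_def dest!: tendstoD[of _ _ _ "\<epsilon> / 2"])
  moreover have "\<forall>\<^sub>F j in sequentially. rad j < \<epsilon> / 2"
    using rad_0 \<epsilon> by (intro order_tendstoD) auto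
  ultimately have "\<forall>\<^sub>F j in sequentially. dist (X (\<rho> j)) c < \<epsilon> / 2 \<and> rad j < \<epsilon> / 2"
    by (rule eventually_conj)
  then obtain j where j: "dist (X (\<rho> j)) c < \<epsilon> / 2" "rad j < \<epsilon> / 2"
    by (auto simp: eventually_sequentially)
  have "rad (\<rho> j) \<le> rad j" by (rule rad_mono[OF seq_suble[OF c(1)]])
  then have "ball (X (\<rho> j)) (rad (\<rho> j)) \<subseteq> B i"
  proof (intro subsetI)
    fix z assume "z \<in> ball (X (\<rho> j)) (rad (\<rho> j))"
    then have "dist (X (\<rho> j)) z < rad (\<rho> j)" by simp
    moreover have "dist c z \<le> dist (X (\<rho> j)) c + dist (X (\<rho> j)) z" by (metis dist_commute dist_triangle)
    ultimately show "z \<in> B i" using j \<open>rad (\<rho> j) \<le> rad j\<close> by (simp only: B_def \<epsilon>_def[symmetric] mem_ball)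
  qed
  then have "weight_measure \<omega> (ball (X (\<rho> j)) (rad (\<rho> j))) \<le> emeasure N (B i)"
    by (subst N) (auto simp: B_def intro: wm)
  with i X(2)[of "\<rho> j"] show False by (meson less_le_trans not_less_iff_gr_or_eq order.strict_trans)
qed

definition dual_weight :: "'a \<Rightarrow> ennreal"
  where "dual_weight x = ennreal (\<omega> x powr (- 1 / (p - 1)))"

lemma dual_weight_measurable[measurable]: "dual_weight \<in> borel_measurable M"
  unfolding dual_weight_def by measurable

lemma nn_integral_M_le: "(\<integral>\<^sup>+x\<in>A. g x \<partial>M) \<le> (\<integral>\<^sup>+x\<in>A. g x \<partial>lebesgue)"
  by (subst nn_integral_restrict_space) (auto intro!: nn_integral_mono simp: indicator_def)

text \<open>2/\<beta> is the ratio of the threshold T in \<open>phi_average_le\<close> to m. The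
  summands 1, L^(1/p) \<kappa> and L^(1/p) \<kappa> K^(1/(p-1)) come from the three terms of
  \<open>split_at_threshold\<close>, where \<kappa> bounds the volume of the ball by that of the
  cube.\<close>

definition average_const :: "real \<Rightarrow> real"
  where "average_const \<kappa> = 2 / \<beta> * (1 + L powr (1 / p) * \<kappa> * (1 + K powr (1 / (p - 1))))"

lemma average_const_pos: "0 \<le> \<kappa> \<Longrightarrow> 0 < average_const \<kappa>"
  unfolding average_const_def using \<beta> by (intro mult_pos_pos add_pos_nonneg) auto

text \<open>The point where (A1) enters: at the level \<open>s = max 1 (\<alpha> / w)\<close> the inverses of \<open>\<phi>\<close> at all
  points of the ball are comparable, and the \<open>A\<^sub>p\<close> condition bounds the average of \<open>f\<close> by them.\<close>

lemma phi_average_le: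
  fixes f :: "'a \<Rightarrow> real"
  assumes f: "f \<in> borel_measurable M" "\<And>x. 0 \<le> f x" and mod: "modular f \<le> 1"
    and Q: "Q \<in> sets lebesgue" "Q \<subseteq> ball c r" and r: "0 < r" and W: "weight_measure \<omega> (ball c r) \<le> 1"
    and \<kappa>: "0 \<le> \<kappa>" "emeasure lebesgue (ball c r) \<le> ennreal \<kappa> * emeasure lebesgue Q"
  shows "AE x in M. x \<in> ball c r \<longrightarrow> (\<forall>a\<ge>0. ennreal a * emeasure lebesgue Q \<le> (\<integral>\<^sup>+y\<in>Q. f y \<partial>M) \<longrightarrow>
     \<phi> x (a / (2 * average_const \<kappa>)) \<le>
       1 + (\<integral>\<^sup>+y\<in>Q. \<phi> y \<bar>f y\<bar> * ennreal (\<omega> y) \<partial>M) / weight_measure \<omega> (ball c r))"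
proof -
  let ?B = "ball c r"
  obtain w \<sigma> v where wsv: "0 < w" "0 < \<sigma>" "0 < v" "weight_measure \<omega> ?B = ennreal w"
     "(\<integral>\<^sup>+x\<in>?B. dual_weight x \<partial>lebesgue) = ennreal \<sigma>"
     "emeasure lebesgue ?B = ennreal v" "(w / v) * (\<sigma> / v) powr (p - 1) \<le> K"
    using A_p[OF r] unfolding dual_weight_def by blast
  have w1: "w \<le> 1" using W wsv by simp
  have indQ: "(indicator Q :: 'a \<Rightarrow> ennreal) \<in> borel_measurable M"
    using Q by (intro measurable_restrict_space1 borel_measurable_indicator)
  have "emeasure lebesgue Q \<le> ennreal v"
    using emeasure_mono[OF Q(2), of lebesgue] wsv by simp
  then obtain b where b: "emeasure lebesgue Q = ennreal b" "0 \<le> b"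
    by (metis ennreal_cases ennreal_less_top less_irrefl order.strict_trans1)
  have vb: "v \<le> \<kappa> * b"
    using \<kappa> b wsv(6) by (simp flip: ennreal_mult')
  have bpos: "0 < b" using vb wsv(3) b(2) by (cases "b = 0") auto
  define A where "A = (\<integral>\<^sup>+y\<in>Q. \<phi> y \<bar>f y\<bar> * ennreal (\<omega> y) \<partial>M)"
  have "A \<le> modular f"
    unfolding A_def modular_def by (intro nn_integral_mono) (auto simp: indicator_def)
  then have "A \<le> ennreal 1" using mod by simp
  then obtain \<alpha> where \<alpha>: "A = ennreal \<alpha>" "0 \<le> \<alpha>" "\<alpha> \<le> 1"
    by (cases A) (auto simp: top_unique)
  define s where "s = max 1 (\<alpha> / w)"
  have s: "1 \<le> s" "\<alpha> \<le> s * w" using wsv by (auto simp: s_def field_simps max_def)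
  \<comment> \<open>Both normalisations enter here: the modular bound gives \<alpha> \<le> 1 and the
    bound on the ball gives w \<le> 1, so s is a level at which (A1) may be used.\<close>
  have "s \<le> 1 / w" using \<alpha> wsv w1 by (auto simp: s_def field_simps max_def)
  then have "ennreal s \<le> ennreal 1 / ennreal w"
    using wsv by (subst divide_ennreal) (auto intro: ennreal_leI)
  then have s': "ennreal s \<le> 1 / weight_measure \<omega> ?B" using wsv by simp
  obtain m where m: "0 < m"
    "AE x in M. x \<in> ?B \<longrightarrow> (\<forall>t. 0 \<le> t \<and> t < m \<longrightarrow> \<phi> x t \<le> ennreal s) \<and> (\<forall>t>m / \<beta>. ennreal s \<le> \<phi> x t)"
    using A1_uniform[OF r W s(1) s'] by blast
  \<comment> \<open>The factor 2 puts T strictly above m/\<beta>, where \<phi> is known to be at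
    least s.\<close>
  define T where "T = 2 * m / \<beta>"
  have T: "0 < T" "m / \<beta> < T" using m \<beta> by (auto simp: T_def divide_strict_right_mono)
  \<comment> \<open>The choice \<theta> = v/w balances the two Young terms: \<theta> \<alpha>/s
    \<le> v because \<alpha> \<le> s w, and \<theta>' \<sigma> \<le> v K' is the A_p bound raised to
    the power 1/(p-1).\<close>
  define L' K' \<theta> where "L' = L powr (1 / p)" and "K' = K powr (1 / (p - 1))" and "\<theta> = v / w"
  have \<theta>: "0 < \<theta>" using wsv by (simp add: \<theta>_def)
  have LK: "0 \<le> L'" "0 \<le> K'" by (simp_all add: L'_def K'_def)
  define \<theta>' where "\<theta>' = \<theta> powr (- 1 / (p - 1))"
  have \<theta>'\<sigma>: "\<theta>' * \<sigma> \<le> v * K'"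
  proof -
    have "((w / v) * (\<sigma> / v) powr (p - 1)) powr (1 / (p - 1)) \<le> K'"
      unfolding K'_def using wsv p by (intro powr_mono2) auto
    also have "((w / v) * (\<sigma> / v) powr (p - 1)) powr (1 / (p - 1)) = (w / v) powr (1 / (p - 1)) * (\<sigma> / v)"
      using wsv p by (subst powr_mult) (simp add: powr_powr)
    also have "(w / v) powr (1 / (p - 1)) = \<theta>'"
      using wsv by (simp add: \<theta>'_def \<theta>_def powr_divide powr_minus_divide)
    finally show ?thesis using wsv by (simp add: field_simps)
  qed
  have "AE y in M. ennreal (f y) * indicator Q y \<le> (ennreal T * indicator Q y
     + ennreal (T * L' * (\<theta> / s)) * (\<phi> y \<bar>f y\<bar> * ennreal (\<omega> y) * indicator Q y))
     + ennreal (T * L' * \<theta>') * (dual_weight y * indicator Q y)"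
    using m(2) weight_pos_M AE_space[of M]
  proof eventually_elim
    case (elim y)
    show ?case
    proof (cases "y \<in> Q")
      case True
      then have "ennreal s \<le> \<phi> y T" using elim T Q by blast
      then have "ennreal (f y) \<le> ennreal T + ennreal (T * L powr (1 / p) * (\<theta> / s)) * (\<phi> y (f y) * ennreal (\<omega> y))
       + ennreal (T * L powr (1 / p) * \<theta> powr (- 1 / (p - 1))) * ennreal (\<omega> y powr (- 1 / (p - 1)))"
        using elim T s \<theta> f by (intro split_at_threshold) auto
      with True f show ?thesis by (simp add: L'_def \<theta>'_def dual_weight_def)
    next
      case False
      then show ?thesis by simp
    qed
  qed
  then have "(\<integral>\<^sup>+y\<in>Q. f y \<partial>M) \<le> (\<integral>\<^sup>+y. (ennreal T * indicator Q y
     + ennreal (T * L' * (\<theta> / s)) * (\<phi> y \<bar>f y\<bar> * ennreal (\<omega> y) * indicator Q y))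
     + ennreal (T * L' * \<theta>') * (dual_weight y * indicator Q y) \<partial>M)"
    by (rule nn_integral_mono_AE)
  also have "\<dots> = ennreal T * (\<integral>\<^sup>+y. indicator Q y \<partial>M) + ennreal (T * L' * (\<theta> / s)) * A
     + ennreal (T * L' * \<theta>') * (\<integral>\<^sup>+y\<in>Q. dual_weight y \<partial>M)"
    unfolding A_def using f(1) indQ
    by (simp add: nn_integral_add nn_integral_cmult)
  also have "\<dots> \<le> ennreal T * ennreal b + ennreal (T * L' * (\<theta> / s)) * ennreal \<alpha>
     + ennreal (T * L' * \<theta>') * ennreal \<sigma>"
  proof (intro add_mono mult_left_mono)
    have "(\<integral>\<^sup>+y. indicator Q y \<partial>M) \<le> (\<integral>\<^sup>+y. indicator Q y \<partial>lebesgue)"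
      using nn_integral_M_le[of "\<lambda>_. 1" Q] by simp
    then show "(\<integral>\<^sup>+y. indicator Q y \<partial>M) \<le> ennreal b" using Q b by simp
    have "(\<integral>\<^sup>+y\<in>Q. dual_weight y \<partial>M) \<le> (\<integral>\<^sup>+y\<in>Q. dual_weight y \<partial>lebesgue)" by (rule nn_integral_M_le)
    also have "\<dots> \<le> (\<integral>\<^sup>+y\<in>?B. dual_weight y \<partial>lebesgue)"
      using Q by (intro nn_integral_mono) (auto simp: indicator_def)
    finally show "(\<integral>\<^sup>+y\<in>Q. dual_weight y \<partial>M) \<le> ennreal \<sigma>" using wsv by simp
  qed (simp_all add: \<alpha>)
  also have "\<dots> = ennreal (T * b + T * L' * ((\<theta> / s) * \<alpha>) + T * L' * (\<theta>' * \<sigma>))"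
  proof -
    have "0 \<le> T * b" "0 \<le> T * L' * (\<theta> / s) * \<alpha>" "0 \<le> T * L' * \<theta>' * \<sigma>"
      using T LK \<theta> s b \<alpha> wsv by (simp_all add: \<theta>'_def)
    then show ?thesis
      using T LK \<theta> s b \<alpha> wsv by (simp add: ennreal_mult'[symmetric] mult.assoc \<theta>'_def)
  qed
  also have "\<dots> \<le> ennreal (average_const \<kappa> * m * b)"
  proof (rule ennreal_leI)
    have "(\<theta> / s) * \<alpha> \<le> v"
    proof -
      have "v * \<alpha> \<le> v * (s * w)" using s wsv by (intro mult_left_mono) auto
      then show ?thesis using s wsv by (simp add: \<theta>_def field_simps)
    qed
    then have "T * L' * ((\<theta> / s) * \<alpha>) + T * L' * (\<theta>' * \<sigma>) \<le> T * L' * v + T * L' * (v * K')"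
      using T LK \<theta>'\<sigma> by (intro add_mono mult_left_mono) auto
    also have "\<dots> = T * L' * (1 + K') * v" by (simp add: algebra_simps)
    also have "\<dots> \<le> T * L' * (1 + K') * (\<kappa> * b)"
      using T LK by (intro mult_left_mono vb) auto
    finally have "T * L' * ((\<theta> / s) * \<alpha>) + T * L' * (\<theta>' * \<sigma>) \<le> T * L' * (1 + K') * (\<kappa> * b)" .
    moreover have "average_const \<kappa> * m * b = T * b + T * L' * (1 + K') * (\<kappa> * b)"
      by (simp add: average_const_def T_def L'_def K'_def algebra_simps add_divide_distrib)
    ultimately show "T * b + T * L' * ((\<theta> / s) * \<alpha>) + T * L' * (\<theta>' * \<sigma>) \<le> average_const \<kappa> * m * b"
      by linarith
  qed
  finally have int: "(\<integral>\<^sup>+y\<in>Q. f y \<partial>M) \<le> ennreal (average_const \<kappa> * m * b)" .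
  show ?thesis
    using m(2) AE_space[of M]
  proof eventually_elim
    case (elim x)
    show ?case
    proof (intro impI allI)
      fix a :: real assume x: "x \<in> ?B" and a: "0 \<le> a" "ennreal a * emeasure lebesgue Q \<le> (\<integral>\<^sup>+y\<in>Q. f y \<partial>M)"
      have "ennreal (a * b) \<le> ennreal (average_const \<kappa> * m * b)"
        using order_trans[OF a(2) int] a b by (simp add: ennreal_mult')
      then have "a * b \<le> average_const \<kappa> * m * b"
        using average_const_pos[OF \<kappa>(1)] m b by (subst (asm) ennreal_le_iff) auto
      then have "a \<le> average_const \<kappa> * m" using bpos by simp
      moreover have "0 < average_const \<kappa> * m" using average_const_pos[OF \<kappa>(1)] m(1) by simp
      \<comment> \<open>The factor 2 makes the inequality strict, as the bound by s holds only below
        m.\<close>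
      ultimately have "a < m * (2 * average_const \<kappa>)" by (simp add: mult_ac)
      then have "a / (2 * average_const \<kappa>) < m"
        using average_const_pos[OF \<kappa>(1)] by (simp add: pos_divide_less_eq)
      moreover have "0 \<le> a / (2 * average_const \<kappa>)" using a average_const_pos[OF \<kappa>(1)] by simp
      ultimately have "\<phi> x (a / (2 * average_const \<kappa>)) \<le> ennreal s" using elim x by blast
      also have "\<dots> \<le> ennreal (1 + \<alpha> / w)" using \<alpha> wsv by (intro ennreal_leI) (auto simp: s_def)
      also have "\<dots> = 1 + A / weight_measure \<omega> ?B"
        using \<alpha> wsv by (simp add: divide_ennreal)
      finally show "\<phi> x (a / (2 * average_const \<kappa>)) \<le> 1 + (\<integral>\<^sup>+y\<in>Q. \<phi> y \<bar>f y\<bar> * ennreal (\<omega> y) \<partial>M) / weight_measure \<omega> ?B"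
        unfolding A_def .
    qed
  qed
qed

lemma nn_integral_lborel_eq_M:
  fixes g :: "'a \<Rightarrow> ennreal"
  assumes "\<And>x. x \<notin> \<Omega> \<Longrightarrow> g x = 0"
  shows "(\<integral>\<^sup>+x\<in>A. g x \<partial>lborel) = (\<integral>\<^sup>+x\<in>A. g x \<partial>M)"
proof -
  have "(\<integral>\<^sup>+x\<in>A. g x \<partial>M) = (\<integral>\<^sup>+x\<in>A. g x \<partial>lebesgue)"
    using assms by (subst nn_integral_restrict_space) (auto intro!: nn_integral_cong simp: indicator_def)
  then show ?thesis by (simp add: nn_integral_completion)
qed

text \<open>On a cube Q in a ball B, \<open>phi_average_le\<close> is multiplied by \<omega> and
  integrated. The summand 1 yields the weight of Q; the other yields the modular over Q times the
  ratio of the weights of Q and B, which is at most 1. Summing over the cubes gives a bound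
  independent of k. Because f vanishes outside \<Omega>, cubes that stick out do no harm.\<close>

lemma modular_cube_average_le:
  fixes f :: "'a \<Rightarrow> real"
  assumes f: "f \<in> borel_measurable borel" "\<And>x. 0 \<le> f x" "\<And>x. x \<notin> \<Omega> \<Longrightarrow> f x = 0" and mod: "modular f \<le> 1"
    and k: "\<And>x. x \<in> \<Omega> \<Longrightarrow> weight_measure \<omega> (ball x ((real DIM('a) + 1) / 2 ^ k)) \<le> 1"
  shows "modular (\<lambda>x. enn2real (cube_average k (\<lambda>y. ennreal (f y)) x) / (2 * average_const ((2 * (real DIM('a) + 1)) ^ DIM('a)))) \<le> weight_measure \<omega> \<Omega> + modular f"
proof -
  define a where "a x = enn2real (cube_average k (\<lambda>y. ennreal (f y)) x)" for x
  have zero_le_kappa: "0 \<le> (2 * (real DIM('a) + 1)) ^ DIM('a)" by simp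
  define C where "C = 2 * average_const ((2 * (real DIM('a) + 1)) ^ DIM('a))"
  have C: "0 < C" unfolding C_def using average_const_pos[OF zero_le_kappa] by simp
  have a0: "0 \<le> a x" for x by (simp add: a_def)
  have fM: "f \<in> borel_measurable M"
    using f(1) by (intro measurable_restrict_space1 measurable_completion) simp
  have aM: "(\<lambda>x. a x / C) \<in> borel_measurable M"
  proof -
    have "(\<lambda>x. a x / C) \<in> borel_measurable borel" unfolding a_def using f(1) by measurable
    then show ?thesis by (intro measurable_restrict_space1 measurable_completion) simp
  qed
  have cubeM: "(indicator (cube k x) :: 'a \<Rightarrow> ennreal) \<in> borel_measurable M" for x
    by (intro measurable_restrict_space1 borel_measurable_indicator) auto
  let ?g = "\<lambda>x. \<phi> x \<bar>f x\<bar> * ennreal (\<omega> x)"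
  have gM: "?g \<in> borel_measurable M" using fM by measurable
  have hM: "(\<lambda>x. \<phi> x \<bar>a x / C\<bar> * ennreal (\<omega> x)) \<in> borel_measurable M" using aM by measurable
  have wM: "(\<lambda>x. ennreal (\<omega> x)) \<in> borel_measurable M" by measurable
  have cube: "(\<integral>\<^sup>+x\<in>cube k x0. \<phi> x \<bar>a x / C\<bar> * ennreal (\<omega> x) \<partial>M) \<le>
      (\<integral>\<^sup>+x\<in>cube k x0. ennreal (\<omega> x) \<partial>M) + (\<integral>\<^sup>+x\<in>cube k x0. ?g x \<partial>M)" if x0: "x0 \<in> \<Omega>" for x0
  proof -
    let ?Q = "cube k x0" and ?B = "ball x0 ((real DIM('a) + 1) / 2 ^ k)"
    let ?A = "\<integral>\<^sup>+x\<in>?Q. ?g x \<partial>M"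
    let ?W = "weight_measure \<omega> ?B"
    have r: "0 < (real DIM('a) + 1) / 2 ^ k" by (simp add: add_nonneg_pos)
    obtain w where w: "0 < w" "?W = ennreal w" using A_p[OF r, of x0] by blast
    have Q: "?Q \<in> sets lebesgue" by simp
    have "emeasure lebesgue ?B \<le> ennreal ((2 * (real DIM('a) + 1)) ^ DIM('a)) * emeasure lebesgue ?Q"
      using emeasure_ball_le_cube[of x0 k] by simp
    from phi_average_le[OF fM f(2) mod Q cube_subset_ball r k[OF x0] zero_le_kappa this]
    have AE: "AE x in M. x \<in> ?B \<longrightarrow> (\<forall>a\<ge>0. ennreal a * emeasure lebesgue ?Q \<le> (\<integral>\<^sup>+y\<in>?Q. f y \<partial>M) \<longrightarrow>
       \<phi> x (a / C) \<le> 1 + ?A / ?W)" unfolding C_def .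
    have "(\<integral>\<^sup>+x\<in>?Q. \<phi> x \<bar>a x / C\<bar> * ennreal (\<omega> x) \<partial>M) \<le> (\<integral>\<^sup>+x. ennreal (\<omega> x) * indicator ?Q x + ?A / ?W * (ennreal (\<omega> x) * indicator ?Q x) \<partial>M)"
    proof (rule nn_integral_mono_AE)
      show "AE x in M. \<phi> x \<bar>a x / C\<bar> * ennreal (\<omega> x) * indicator ?Q x \<le> ennreal (\<omega> x) * indicator ?Q x + ?A / ?W * (ennreal (\<omega> x) * indicator ?Q x)"
        using AE
      proof eventually_elim
        case (elim x)
        show ?case
        proof (cases "x \<in> ?Q")
          case True
          then have eq: "cube k x = ?Q" by (rule cube_eq)
          let ?c = "cube_average k (\<lambda>y. ennreal (f y)) x"
          \<comment> \<open>An infinite average is sent to 0 by \<open>enn2real\<close>, so the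
            inequality holds in every case.\<close>
          have "ennreal (a x) \<le> ?c" unfolding a_def by (cases ?c) auto
          then have "ennreal (a x) * emeasure lebesgue ?Q \<le> ?c * emeasure lebesgue ?Q" by (rule mult_right_mono) simp
          also have "?c * emeasure lebesgue ?Q = ennreal ((2 ^ k) ^ DIM('a)) * ennreal ((1 / 2 ^ k) ^ DIM('a)) * (\<integral>\<^sup>+y\<in>?Q. ennreal (f y) \<partial>lborel)"
            by (simp add: cube_average_def eq emeasure_cube mult_ac)
          also have "\<dots> = (\<integral>\<^sup>+y\<in>?Q. ennreal (f y) \<partial>lborel)"
            by (subst ennreal_power_mult_inverse_power) auto
          also have "\<dots> = (\<integral>\<^sup>+y\<in>?Q. f y \<partial>M)" by (rule nn_integral_lborel_eq_M) (simp add: f)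
          finally have "\<phi> x (a x / C) \<le> 1 + ?A / ?W"
            using elim a0[of x] True cube_subset_ball by blast
          then have "\<phi> x \<bar>a x / C\<bar> * ennreal (\<omega> x) \<le> (1 + ?A / ?W) * ennreal (\<omega> x)"
            using a0[of x] C by (intro mult_right_mono) auto
          then show ?thesis using True by (simp add: distrib_right)
        qed simp
      qed
    qed
    also have "\<dots> = (\<integral>\<^sup>+x\<in>?Q. ennreal (\<omega> x) \<partial>M) + ?A / ?W * (\<integral>\<^sup>+x\<in>?Q. ennreal (\<omega> x) \<partial>M)"
      using wM cubeM by (simp add: nn_integral_add nn_integral_cmult)
    also have "?A / ?W * (\<integral>\<^sup>+x\<in>?Q. ennreal (\<omega> x) \<partial>M) \<le> ?A / ?W * ?W"
    proof (rule mult_left_mono)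
      have "(\<integral>\<^sup>+x\<in>?Q. ennreal (\<omega> x) \<partial>M) \<le> (\<integral>\<^sup>+x\<in>?Q. ennreal (\<omega> x) \<partial>lebesgue)" by (rule nn_integral_M_le)
      also have "\<dots> \<le> ?W" unfolding weight_measure_def
        using cube_subset_ball[of k x0] by (intro nn_integral_mono) (auto simp: indicator_def)
      finally show "(\<integral>\<^sup>+x\<in>?Q. ennreal (\<omega> x) \<partial>M) \<le> ?W" .
    qed simp
    also have "?A / ?W * ?W = ?A" using w by (simp add: ennreal_divide_times ennreal_mult_divide_eq)
    finally show ?thesis by (simp add: add_left_mono)
  qed
  have "modular (\<lambda>x. a x / C) = (\<integral>\<^sup>+Q. (\<integral>\<^sup>+x\<in>Q. \<phi> x \<bar>a x / C\<bar> * ennreal (\<omega> x) \<partial>M) \<partial>count_space (cube k ` \<Omega>))"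
    unfolding modular_def by (rule nn_integral_sum_cubes[symmetric, OF hM]) simp_all
  also have "\<dots> \<le> (\<integral>\<^sup>+Q. (\<integral>\<^sup>+x\<in>Q. ennreal (\<omega> x) \<partial>M) + (\<integral>\<^sup>+x\<in>Q. ?g x \<partial>M) \<partial>count_space (cube k ` \<Omega>))"
    using cube by (intro nn_integral_mono) auto
  also have "\<dots> = (\<integral>\<^sup>+x. ennreal (\<omega> x) \<partial>M) + (\<integral>\<^sup>+x. ?g x \<partial>M)"
    by (subst nn_integral_add) (simp_all add: nn_integral_sum_cubes[OF wM] nn_integral_sum_cubes[OF gM])
  also have "(\<integral>\<^sup>+x. ennreal (\<omega> x) \<partial>M) = weight_measure \<omega> \<Omega>"
    unfolding weight_measure_def by (subst nn_integral_restrict_space) auto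
  finally show ?thesis unfolding modular_def a_def C_def .
qed

text \<open>This is the condition known as (A0), derived from (A1) at level 1: finitely many balls
  of weight at most 1 cover the bounded set \<Omega>, and the constants of these balls are combined
  by minimum and maximum.\<close>

lemma phi_unit_bounds:
  obtains c C where "0 < c" "0 < C" "AE x in M. \<phi> x c \<le> 1 \<and> 1 \<le> \<phi> x C"
proof -
  obtain k where k: "\<And>x. x \<in> \<Omega> \<Longrightarrow> weight_measure \<omega> (ball x ((real DIM('a) + 1) / 2 ^ k)) \<le> 1"
    using small_balls by blast
  define r where "r = (real DIM('a) + 1) / 2 ^ k"
  have r: "0 < r" unfolding r_def by (simp add: add_nonneg_pos)
  have fin: "\<exists>c C. 0 < c \<and> 0 < C \<and> (AE x in M. x \<in> (\<Union>y\<in>F. ball y r) \<longrightarrow> \<phi> x c \<le> 1 \<and> 1 \<le> \<phi> x C)"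
    if "finite F" "F \<subseteq> \<Omega>" for F
    using that
  proof (induction rule: finite_induct)
    case empty
    show ?case by (intro exI[of _ 1]) simp
  next
    case (insert y F)
    then obtain c C where cC: "0 < c" "0 < C" "AE x in M. x \<in> (\<Union>y\<in>F. ball y r) \<longrightarrow> \<phi> x c \<le> 1 \<and> 1 \<le> \<phi> x C"
      by auto
    have W: "weight_measure \<omega> (ball y r) \<le> 1" using insert k by (simp add: r_def)
    obtain w where w: "0 < w" "weight_measure \<omega> (ball y r) = ennreal w" using A_p[OF r, of y] by blast
    then have "w \<le> 1" using W by simp
    then have "ennreal 1 \<le> ennreal 1 / ennreal w"
      using w by (subst divide_ennreal) (auto intro!: ennreal_leI simp: field_simps)
    then have 1: "ennreal 1 \<le> 1 / weight_measure \<omega> (ball y r)" using w by simp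
    obtain m where m: "0 < m" "AE x in M. x \<in> ball y r \<longrightarrow> (\<forall>t. 0 \<le> t \<and> t < m \<longrightarrow> \<phi> x t \<le> ennreal 1) \<and> (\<forall>t>m / \<beta>. ennreal 1 \<le> \<phi> x t)"
      using A1_uniform[OF r W order_refl 1] by blast
    define c' C' where "c' = min c (m / 2)" and "C' = max C (2 * m / \<beta>)"
    have c': "0 < c'" "c' \<le> c" "c' < m" using cC m by (auto simp: c'_def)
    have "m / \<beta> < 2 * m / \<beta>" using m \<beta> by (simp add: divide_strict_right_mono)
    then have C': "0 < C'" "C \<le> C'" "m / \<beta> < C'" using cC by (auto simp: C'_def)
    have "AE x in M. x \<in> (\<Union>y\<in>insert y F. ball y r) \<longrightarrow> \<phi> x c' \<le> 1 \<and> 1 \<le> \<phi> x C'"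
      using cC(3) m(2) AE_space[of M]
    proof eventually_elim
      case (elim x)
      show ?case
      proof
        assume x: "x \<in> (\<Union>y\<in>insert y F. ball y r)"
        have x\<Omega>: "x \<in> \<Omega>" using elim by simp
        show "\<phi> x c' \<le> 1 \<and> 1 \<le> \<phi> x C'"
        proof (cases "x \<in> ball y r")
          case True
          with elim c' C' show ?thesis by auto
        next
          case False
          then have "\<phi> x c \<le> 1" "1 \<le> \<phi> x C" using x elim by auto
          moreover have "\<phi> x c' \<le> \<phi> x c" "\<phi> x C \<le> \<phi> x C'"
            using c' C' cC by (intro phi_mono[OF x\<Omega>]; simp)+
          ultimately show ?thesis by (meson order_trans)
        qed
      qed
    qed
    with c'(1) C'(1) show ?case by blast
  qed
  \<comment> \<open>The centres have to lie in \<Omega>, since only there are the weights of the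
    balls controlled, while compactness is a matter of the closure.\<close>
  have "closure \<Omega> \<subseteq> (\<Union>y\<in>\<Omega>. ball y r)"
  proof
    fix x assume "x \<in> closure \<Omega>"
    then obtain y where "y \<in> \<Omega>" "dist y x < r" using r by (auto simp: closure_approachable)
    then show "x \<in> (\<Union>y\<in>\<Omega>. ball y r)" by auto
  qed
  moreover have "compact (closure \<Omega>)" using bounded_Omega by simp
  ultimately obtain F where F: "F \<subseteq> \<Omega>" "finite F" "closure \<Omega> \<subseteq> (\<Union>y\<in>F. ball y r)"
    using compactE_image[of "closure \<Omega>" \<Omega> "\<lambda>y. ball y r"] by blast
  obtain c C where cC: "0 < c" "0 < C" "AE x in M. x \<in> (\<Union>y\<in>F. ball y r) \<longrightarrow> \<phi> x c \<le> 1 \<and> 1 \<le> \<phi> x C"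
    using fin[OF F(2,1)] by blast
  have "AE x in M. \<phi> x c \<le> 1 \<and> 1 \<le> \<phi> x C"
    using cC(3) AE_space[of M]
    by eventually_elim (use F(3) closure_subset[of \<Omega>] in auto)
  with cC(1,2) that show thesis by blast
qed

subsection \<open>The Poincare inequality for the modular\<close>

lemma weight_Omega_finite: "weight_measure \<omega> \<Omega> < \<infinity>"
  by (rule weight_measure_finite[OF weight bounded_Omega])

text \<open>\<open>split_at_threshold\<close> with T = C0 and s = \<theta> = 1, integrated over
  \<Omega>. The dual weight is integrable there because the A_p condition makes it integrable over a
  ball containing \<Omega>.\<close>

lemma L1_bound:
  obtains C where "0 < C"
    "\<And>f. f \<in> borel_measurable M \<Longrightarrow> (\<integral>\<^sup>+x. ennreal \<bar>f x\<bar> \<partial>M) \<le> ennreal C * (1 + modular f)"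
proof -
  obtain c0 C0 where C0: "0 < C0" "AE x in M. \<phi> x c0 \<le> 1 \<and> 1 \<le> \<phi> x C0"
    using phi_unit_bounds by metis
  obtain R where R: "0 < R" "\<Omega> \<subseteq> ball 0 R"
    using bounded_Omega by (metis bounded_subset_ballD)
  obtain s where s: "(\<integral>\<^sup>+x\<in>ball 0 R. dual_weight x \<partial>lebesgue) = ennreal s" "0 < s"
    using A_p[OF R(1), of 0] unfolding dual_weight_def by blast
  have S: "(\<integral>\<^sup>+x. dual_weight x \<partial>M) \<le> ennreal s"
  proof -
    have "(\<integral>\<^sup>+x. dual_weight x \<partial>M) = (\<integral>\<^sup>+x\<in>\<Omega>. dual_weight x \<partial>lebesgue)"
      by (subst nn_integral_restrict_space) auto
    also have "\<dots> \<le> (\<integral>\<^sup>+x\<in>ball 0 R. dual_weight x \<partial>lebesgue)"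
      using R(2) by (intro nn_integral_mono) (auto simp: indicator_def)
    finally show ?thesis using s by simp
  qed
  have "emeasure lebesgue \<Omega> \<le> emeasure lebesgue (ball (0::'a) R)" using R(2) by (intro emeasure_mono) auto
  also have "\<dots> < \<infinity>" using emeasure_lborel_ball_finite[of "0::'a" R] by simp
  finally have "emeasure M \<Omega> < \<infinity>" by (simp add: emeasure_restrict_space)
  then obtain v where v: "emeasure M \<Omega> = ennreal v" "0 \<le> v"
    by (metis ennreal_cases infinity_ennreal_def less_irrefl)
  define L' where "L' = C0 * L powr (1 / p)"
  have L': "0 \<le> L'" using C0 by (simp add: L'_def)
  define C where "C = C0 * v + L' * s + L' + 1"
  have "(\<integral>\<^sup>+x. ennreal \<bar>f x\<bar> \<partial>M) \<le> ennreal C * (1 + modular f)" if f: "f \<in> borel_measurable M" for f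
  proof -
    have "AE x in M. ennreal \<bar>f x\<bar> \<le> (ennreal C0 + ennreal L' * (\<phi> x \<bar>f x\<bar> * ennreal (\<omega> x))) + ennreal L' * dual_weight x"
      using C0(2) weight_pos_M AE_space[of M]
    proof eventually_elim
      case (elim x)
      then show ?case
        using split_at_threshold[of x "\<bar>f x\<bar>" C0 1 1] C0(1) p by (simp add: L'_def dual_weight_def)
    qed
    then have "(\<integral>\<^sup>+x. ennreal \<bar>f x\<bar> \<partial>M) \<le> (\<integral>\<^sup>+x. (ennreal C0 + ennreal L' * (\<phi> x \<bar>f x\<bar> * ennreal (\<omega> x))) + ennreal L' * dual_weight x \<partial>M)"
      by (rule nn_integral_mono_AE)
    also have "\<dots> = ennreal C0 * emeasure M \<Omega> + ennreal L' * modular f + ennreal L' * (\<integral>\<^sup>+x. dual_weight x \<partial>M)"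
      unfolding modular_def using f by (simp add: nn_integral_add nn_integral_cmult)
    also have "\<dots> \<le> ennreal C0 * ennreal v + ennreal L' * modular f + ennreal L' * ennreal s"
      unfolding v by (intro add_mono mult_left_mono S order_refl) simp_all
    also have "\<dots> = ennreal (C0 * v + L' * s) * 1 + ennreal L' * modular f"
      using C0 v L' s by (simp add: ennreal_mult' algebra_simps)
    also have "\<dots> \<le> ennreal C * 1 + ennreal C * modular f"
      using C0 v L' s by (intro add_mono mult_right_mono ennreal_leI) (simp_all add: C_def)
    finally show ?thesis by (simp add: distrib_left)
  qed
  moreover have "0 < C" using C0 v L' s by (simp add: C_def add_nonneg_pos)
  ultimately show thesis using that by blast
qed

text \<open>The additive 1 in \<open>L1_bound\<close> is beaten by scaling: if the modular of f is
  small enough, (aDec) keeps the modular of A f at most 1, and division by A makes the L^1 norm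
  small.\<close>

lemma modular_small_imp_L1_small:
  assumes "0 < \<epsilon>"
  obtains \<delta> where "0 < \<delta>"
    "\<And>f. f \<in> borel_measurable M \<Longrightarrow> modular f \<le> ennreal \<delta> \<Longrightarrow> (\<integral>\<^sup>+x. ennreal \<bar>f x\<bar> \<partial>M) \<le> ennreal \<epsilon>"
proof -
  obtain C where C: "0 < C" "\<And>f. f \<in> borel_measurable M \<Longrightarrow> (\<integral>\<^sup>+x. ennreal \<bar>f x\<bar> \<partial>M) \<le> ennreal C * (1 + modular f)"
    using L1_bound by metis
  define A where "A = max 1 (2 * C / \<epsilon>)"
  have A: "1 \<le> A" "2 * C / A \<le> \<epsilon>" using assms C by (auto simp: A_def max_def field_simps)
  define c where "c = L * A powr q"
  have c: "0 < c" using L A by (simp add: c_def)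
  have "(\<integral>\<^sup>+x. ennreal \<bar>f x\<bar> \<partial>M) \<le> ennreal \<epsilon>" if f: "f \<in> borel_measurable M" "modular f \<le> ennreal (1 / c)" for f
  proof -
    have "modular (\<lambda>x. A * f x) \<le> ennreal c * modular f"
      unfolding c_def by (rule modular_scale_ge[OF f(1) A(1)])
    also have "\<dots> \<le> ennreal c * ennreal (1 / c)" using f(2) by (rule mult_left_mono) simp
    also have "\<dots> = 1" using c by (simp flip: ennreal_mult')
    finally have mA: "modular (\<lambda>x. A * f x) \<le> 1" .
    have "(\<integral>\<^sup>+x. ennreal \<bar>f x\<bar> \<partial>M) = (\<integral>\<^sup>+x. ennreal (1 / A) * ennreal \<bar>A * f x\<bar> \<partial>M)"
      using A by (intro nn_integral_cong) (simp add: abs_mult flip: ennreal_mult')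
    also have "\<dots> = ennreal (1 / A) * (\<integral>\<^sup>+x. ennreal \<bar>A * f x\<bar> \<partial>M)"
      using f(1) by (intro nn_integral_cmult) measurable
    also have "\<dots> \<le> ennreal (1 / A) * (ennreal C * (1 + modular (\<lambda>x. A * f x)))"
      using f(1) by (intro mult_left_mono C(2)) auto
    also have "\<dots> \<le> ennreal (1 / A) * (ennreal C * (1 + 1))"
      by (intro mult_left_mono add_left_mono mA) auto
    also have "\<dots> = ennreal (2 * C / A)"
    proof -
      have e: "(1 + 1 :: ennreal) = ennreal 2" by simp
      show ?thesis
        unfolding e
        by (subst ennreal_mult'[symmetric], use C in simp, subst ennreal_mult'[symmetric], use A in simp)
          (simp add: mult.commute)
    qed
    also have "\<dots> \<le> ennreal \<epsilon>" using A(2) by (rule ennreal_leI)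
    finally show ?thesis .
  qed
  moreover have "0 < 1 / c" using c by simp
  ultimately show thesis using that by blast
qed

lemma test_functions_measurable:
  assumes "\<eta> \<in> test_functions \<Omega>"
  shows "\<eta> \<in> borel_measurable M" "(\<lambda>x. norm (gradient \<eta> x)) \<in> borel_measurable M" "gradient \<eta> \<in> borel_measurable M"
proof -
  have "\<eta> \<in> borel_measurable borel" "gradient \<eta> \<in> borel_measurable borel"
    using test_functions_continuous[OF assms] test_functions_continuous_gradient[OF assms]
    by (auto intro: borel_measurable_continuous_onI)
  then show "\<eta> \<in> borel_measurable M" "gradient \<eta> \<in> borel_measurable M"
    by (auto intro!: measurable_restrict_space1 measurable_completion)
  then show "(\<lambda>x. norm (gradient \<eta> x)) \<in> borel_measurable M" by measurable
qed

text \<open>The pointwise bound is read as a dyadic convex combination: its constant part takes the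
  first slot of weight 1/2, and the factors 2^(-(k+j)) from the telescoping pay for the weights of
  the averages. Each slot has modular at most \<omega>(\<Omega>) + 1, and the weights sum to less
  than 1, so the number N of terms, which depends on \<eta>, disappears.\<close>

lemma modular_Poincare_bounded:
  obtains c C where "0 < c" "0 < C"
    "\<And>\<eta>. \<eta> \<in> test_functions \<Omega> \<Longrightarrow> modular (\<lambda>x. norm (gradient \<eta> x)) \<le> 1 \<Longrightarrow> modular (\<lambda>x. c * \<eta> x) \<le> ennreal C"
proof -
  obtain c0 C0 where c0: "0 < c0" "AE x in M. \<phi> x c0 \<le> 1 \<and> 1 \<le> \<phi> x C0"
    using phi_unit_bounds by metis
  obtain k where k: "\<And>j x. k \<le> j \<Longrightarrow> x \<in> \<Omega> \<Longrightarrow> weight_measure \<omega> (ball x ((real DIM('a) + 1) / 2 ^ j)) \<le> 1"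
    using small_balls by blast
  obtain CL where CL: "0 < CL" "\<And>f. f \<in> borel_measurable M \<Longrightarrow> (\<integral>\<^sup>+x. ennreal \<bar>f x\<bar> \<partial>M) \<le> ennreal CL * (1 + modular f)"
    using L1_bound by metis
  obtain Cp where Cp: "0 < Cp" "\<And>\<eta> k. \<eta> \<in> test_functions \<Omega> \<Longrightarrow> \<exists>N. \<forall>x. ennreal \<bar>\<eta> x\<bar> \<le>
     1 + ennreal (Cp * (2 ^ k) ^ DIM('a)) * (\<integral>\<^sup>+y. ennreal (norm (gradient \<eta> y)) \<partial>lborel)
     + (\<Sum>j<N. ennreal (Cp / 2 ^ (k + j)) * cube_average (k + j) (\<lambda>y. ennreal (norm (gradient \<eta> y))) x)"
    using test_functions_pointwise_bound[OF bounded_Omega] by blast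
  define V where "V = Cp * (2 ^ k) ^ DIM('a)"
  have V: "0 \<le> V" using Cp by (simp add: V_def)
  \<comment> \<open>The oscillation bound 1 plus the coarse term, in which CL * 2 bounds the L^1
    norm of a gradient of modular at most 1.\<close>
  define B0 where "B0 = 1 + V * (CL * 2)"
  have B0: "0 < B0" using V CL by (simp add: B0_def add_pos_nonneg)
  define CA where "CA = 2 * average_const ((2 * (real DIM('a) + 1)) ^ DIM('a))"
  have CA: "0 < CA" unfolding CA_def using average_const_pos[of "(2 * (real DIM('a) + 1)) ^ DIM('a)"] by simp
  \<comment> \<open>The first entry fits c B0 into the slot of weight 1/2 with value c0, where
    \<phi> is at most 1; the second matches c Cp/2^(k+j) with the weight 2^(-(j+2)) and the constant
    CA of the averaging bound.\<close>
  define c where "c = min (c0 / (2 * B0)) (1 / (4 * Cp * CA))"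
  have c: "0 < c" "c * B0 \<le> c0 / 2" "c * Cp \<le> 1 / (4 * CA)"
  proof -
    show "0 < c" using c0 B0 Cp CA by (simp add: c_def)
    have "c * B0 \<le> c0 / (2 * B0) * B0" using B0 by (intro mult_right_mono) (auto simp: c_def)
    then show "c * B0 \<le> c0 / 2" using B0 by simp
    have "c * Cp \<le> 1 / (4 * Cp * CA) * Cp" using Cp by (intro mult_right_mono) (auto simp: c_def)
    then show "c * Cp \<le> 1 / (4 * CA)" using Cp by simp
  qed
  obtain w where w: "weight_measure \<omega> \<Omega> = ennreal w" "0 \<le> w"
    using weight_Omega_finite by (metis ennreal_cases infinity_ennreal_def less_irrefl)
  have "modular (\<lambda>x. c * \<eta> x) \<le> ennreal (w + 1)"
    if \<eta>: "\<eta> \<in> test_functions \<Omega>" and mod: "modular (\<lambda>x. norm (gradient \<eta> x)) \<le> 1" for \<eta>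
  proof -
    define f where "f y = norm (gradient \<eta> y)" for y
    obtain S where S: "S \<subseteq> \<Omega>" "\<And>x i. x \<notin> S \<Longrightarrow> partial_deriv i \<eta> x = 0"
      using \<eta> by (rule test_functions_supportE) blast
    have f: "f \<in> borel_measurable borel" "\<And>x. 0 \<le> f x" "\<And>x. x \<notin> \<Omega> \<Longrightarrow> f x = 0"
    proof -
      have "gradient \<eta> \<in> borel_measurable borel"
        using test_functions_continuous_gradient[OF \<eta>] by (rule borel_measurable_continuous_onI)
      then show "f \<in> borel_measurable borel" unfolding f_def by measurable
      show "f x = 0" if "x \<notin> \<Omega>" for x
      proof -
        have "x \<notin> S" using that S by blast
        then show ?thesis by (simp add: f_def gradient_def S(2))
      qed
    qed (simp add: f_def)
    have fM: "f \<in> borel_measurable M" unfolding f_def by (rule test_functions_measurable(2)[OF \<eta>])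
    have modf: "modular f \<le> 1" using mod by (simp add: f_def[abs_def])
    obtain N where N: "\<And>x. ennreal \<bar>\<eta> x\<bar> \<le> 1 + ennreal V * (\<integral>\<^sup>+y. ennreal (f y) \<partial>lborel)
       + (\<Sum>j<N. ennreal (Cp / 2 ^ (k + j)) * cube_average (k + j) (\<lambda>y. ennreal (f y)) x)"
      using Cp(2)[OF \<eta>, of k] unfolding f_def V_def by blast
    have I: "(\<integral>\<^sup>+y. ennreal (f y) \<partial>lborel) \<le> ennreal (CL * 2)"
    proof -
      have "(\<integral>\<^sup>+y. ennreal (f y) \<partial>lborel) = (\<integral>\<^sup>+y. ennreal \<bar>f y\<bar> \<partial>M)"
        using nn_integral_lborel_eq_M[of "\<lambda>y. ennreal (f y)" UNIV] f by simp
      also have "\<dots> \<le> ennreal CL * (1 + modular f)" by (rule CL(2)[OF fM])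
      also have "\<dots> \<le> ennreal CL * (1 + 1)" by (intro mult_left_mono add_left_mono modf) auto
      also have "(1 + 1 :: ennreal) = ennreal 2" by simp
      finally show ?thesis using CL by (simp add: ennreal_mult')
    qed
    define \<tau> where "\<tau> j x = enn2real (cube_average (k + j) (\<lambda>y. ennreal (f y)) x)" for j x
    have \<tau>0: "0 \<le> \<tau> j x" for j x by (simp add: \<tau>_def)
    have \<tau>: "cube_average (k + j) (\<lambda>y. ennreal (f y)) x = ennreal (\<tau> j x)" for j x
    proof -
      have "cube_average (k + j) (\<lambda>y. ennreal (f y)) x \<le> ennreal ((2 ^ (k + j)) ^ DIM('a)) * (\<integral>\<^sup>+y. ennreal (f y) \<partial>lborel)"
        unfolding cube_average_def by (intro mult_left_mono nn_integral_mono) (auto simp: indicator_def)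
      also have "\<dots> \<le> ennreal ((2 ^ (k + j)) ^ DIM('a)) * ennreal (CL * 2)" by (intro mult_left_mono I) simp
      also have "\<dots> < top" by (simp add: ennreal_mult_less_top)
      finally show ?thesis by (simp add: \<tau>_def)
    qed
    have \<tau>M: "(\<lambda>x. \<tau> j x / CA) \<in> borel_measurable M" for j
    proof -
      have "(\<lambda>x. \<tau> j x / CA) \<in> borel_measurable borel" unfolding \<tau>_def using f(1) by measurable
      then show ?thesis by (intro measurable_restrict_space1 measurable_completion) simp
    qed
    have \<eta>le: "\<bar>\<eta> x\<bar> \<le> B0 + (\<Sum>j<N. Cp / 2 ^ (k + j) * \<tau> j x)" for x
    proof -
      have "ennreal \<bar>\<eta> x\<bar> \<le> 1 + ennreal V * (\<integral>\<^sup>+y. ennreal (f y) \<partial>lborel)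
         + (\<Sum>j<N. ennreal (Cp / 2 ^ (k + j)) * cube_average (k + j) (\<lambda>y. ennreal (f y)) x)" by (rule N)
      also have "\<dots> \<le> 1 + ennreal V * ennreal (CL * 2) + (\<Sum>j<N. ennreal (Cp / 2 ^ (k + j)) * ennreal (\<tau> j x))"
        unfolding \<tau> by (intro add_mono mult_left_mono I order_refl) auto
      also have "\<dots> = ennreal B0 + ennreal (\<Sum>j<N. Cp / 2 ^ (k + j) * \<tau> j x)"
      proof -
        have "ennreal V * ennreal (CL * 2) = ennreal (V * (CL * 2))" using V by (simp add: ennreal_mult')
        moreover have "1 + ennreal (V * (CL * 2)) = ennreal B0" using V CL by (simp add: B0_def)
        moreover have "(\<Sum>j<N. ennreal (Cp / 2 ^ (k + j)) * ennreal (\<tau> j x)) = ennreal (\<Sum>j<N. Cp / 2 ^ (k + j) * \<tau> j x)"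
        proof -
          have e: "ennreal (Cp / 2 ^ (k + j)) * ennreal (\<tau> j x) = ennreal (Cp / 2 ^ (k + j) * \<tau> j x)" for j
            using Cp(1) by (intro ennreal_mult'[symmetric]) simp
          show ?thesis unfolding e using Cp(1) \<tau>0 by (intro sum_ennreal) simp
        qed
        ultimately show ?thesis by simp
      qed
      also have "\<dots> = ennreal (B0 + (\<Sum>j<N. Cp / 2 ^ (k + j) * \<tau> j x))"
        using B0 Cp \<tau>0 by (intro ennreal_plus[symmetric] sum_nonneg) auto
      finally show ?thesis
        using B0 Cp \<tau>0 by (subst (asm) ennreal_le_iff) (auto intro!: add_nonneg_nonneg sum_nonneg)
    qed
    \<comment> \<open>Slot 0 holds the constant and slot j + 1 the average of generation k + j; this
      shift turns the weight 2^(-(j+1)) into 2^(-(j+2)).\<close>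
    define a where "a j x = (case j of 0 \<Rightarrow> c0 | Suc i \<Rightarrow> \<tau> i x / CA)" for j x
    have a0: "0 \<le> a j x" for j x using c0 \<tau>0 CA by (auto simp: a_def split: nat.split)
    have aM: "a j \<in> borel_measurable M" for j
      using \<tau>M by (cases j) (simp_all add: a_def[abs_def])
    have \<eta>a: "\<bar>c * \<eta> x\<bar> \<le> (\<Sum>j<Suc N. a j x / 2 ^ Suc j)" for x
    proof -
      have "\<bar>c * \<eta> x\<bar> = c * \<bar>\<eta> x\<bar>" using c by (simp add: abs_mult)
      also have "\<dots> \<le> c * (B0 + (\<Sum>j<N. Cp / 2 ^ (k + j) * \<tau> j x))" using c \<eta>le by (intro mult_left_mono) auto
      also have "\<dots> = c * B0 + (\<Sum>j<N. c * Cp / 2 ^ (k + j) * \<tau> j x)"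
        by (simp add: distrib_left sum_distrib_left mult.assoc)
      also have "\<dots> \<le> c0 / 2 + (\<Sum>j<N. \<tau> j x / CA / 2 ^ Suc (Suc j))"
      proof (intro add_mono c(2) sum_mono)
        fix j
        have "c * Cp / 2 ^ (k + j) \<le> 1 / (4 * CA) / 2 ^ j"
          using c Cp CA by (intro frac_le power_increasing) auto
        then have "c * Cp / 2 ^ (k + j) * \<tau> j x \<le> 1 / (4 * CA) / 2 ^ j * \<tau> j x"
          by (rule mult_right_mono[OF _ \<tau>0])
        then show "c * Cp / 2 ^ (k + j) * \<tau> j x \<le> \<tau> j x / CA / 2 ^ Suc (Suc j)"
          by (simp add: mult_ac)
      qed
      also have "\<dots> = (\<Sum>j<Suc N. a j x / 2 ^ Suc j)"
        by (subst sum.lessThan_Suc_shift) (simp add: a_def)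
      finally show ?thesis .
    qed
    have moda: "modular (a j) \<le> ennreal (w + 1)" for j
    proof (cases j)
      case 0
      have "modular (a j) \<le> (\<integral>\<^sup>+x. ennreal (\<omega> x) \<partial>M)"
        unfolding modular_def
      proof (rule nn_integral_mono_AE)
        show "AE x in M. \<phi> x \<bar>a j x\<bar> * ennreal (\<omega> x) \<le> ennreal (\<omega> x)"
          using c0(2)
        proof eventually_elim
          case (elim x)
          then have "\<phi> x \<bar>a j x\<bar> * ennreal (\<omega> x) \<le> 1 * ennreal (\<omega> x)"
            using c0(1) 0 by (intro mult_right_mono) (auto simp: a_def)
          then show ?case by simp
        qed
      qed
      also have "\<dots> = weight_measure \<omega> \<Omega>"
        unfolding weight_measure_def by (subst nn_integral_restrict_space) auto
      finally show ?thesis using w by (auto intro: order_trans ennreal_leI)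
    next
      case (Suc i)
      have "modular (\<lambda>x. enn2real (cube_average (k + i) (\<lambda>y. ennreal (f y)) x) / (2 * average_const ((2 * (real DIM('a) + 1)) ^ DIM('a))))
         \<le> weight_measure \<omega> \<Omega> + modular f"
        using k by (intro modular_cube_average_le f modf) auto
      also have "\<dots> \<le> ennreal w + 1" unfolding w(1) by (intro add_left_mono modf)
      also have "\<dots> = ennreal (w + 1)" using w by simp
      finally show ?thesis unfolding Suc a_def \<tau>_def CA_def by simp
    qed
    have "modular (\<lambda>x. c * \<eta> x) \<le> (\<integral>\<^sup>+x. (\<Sum>j<Suc N. ennreal (1 / 2 ^ Suc j) * (\<phi> x \<bar>a j x\<bar> * ennreal (\<omega> x))) \<partial>M)"
      unfolding modular_def
    proof (rule nn_integral_mono)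
      fix x assume "x \<in> space M"
      then have x: "x \<in> \<Omega>" by simp
      have "\<phi> x \<bar>c * \<eta> x\<bar> \<le> \<phi> x (\<Sum>j<Suc N. a j x / 2 ^ Suc j)"
        using \<eta>a[of x] by (intro phi_mono[OF x]) auto
      also have "\<dots> \<le> (\<Sum>j<Suc N. ennreal (1 / 2 ^ Suc j) * \<phi> x (a j x))"
        by (rule phi_dyadic_convex[OF x]) (rule a0)
      finally have "\<phi> x \<bar>c * \<eta> x\<bar> * ennreal (\<omega> x) \<le> (\<Sum>j<Suc N. ennreal (1 / 2 ^ Suc j) * \<phi> x (a j x)) * ennreal (\<omega> x)"
        by (rule mult_right_mono) simp
      then show "\<phi> x \<bar>c * \<eta> x\<bar> * ennreal (\<omega> x) \<le> (\<Sum>j<Suc N. ennreal (1 / 2 ^ Suc j) * (\<phi> x \<bar>a j x\<bar> * ennreal (\<omega> x)))"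
        using a0 by (simp only: sum_distrib_right mult.assoc abs_of_nonneg)
    qed
    also have "\<dots> = (\<Sum>j<Suc N. ennreal (1 / 2 ^ Suc j) * modular (a j))"
    proof -
      have m: "(\<lambda>x. \<phi> x \<bar>a j x\<bar> * ennreal (\<omega> x)) \<in> borel_measurable M" for j
        using aM by measurable
      have e: "(\<integral>\<^sup>+x. ennreal (1 / 2 ^ Suc j) * (\<phi> x \<bar>a j x\<bar> * ennreal (\<omega> x)) \<partial>M)
        = ennreal (1 / 2 ^ Suc j) * (\<integral>\<^sup>+x. \<phi> x \<bar>a j x\<bar> * ennreal (\<omega> x) \<partial>M)" for j
        using m by (rule nn_integral_cmult)
      show ?thesis
        unfolding modular_def e[symmetric] by (rule nn_integral_sum) (use m in measurable)
    qed
    also have "\<dots> \<le> (\<Sum>j<Suc N. ennreal (1 / 2 ^ Suc j) * ennreal (w + 1))"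
      by (intro sum_mono mult_left_mono moda) auto
    also have "\<dots> = ennreal ((\<Sum>j<Suc N. 1 / 2 ^ Suc j) * (w + 1))"
      using w by (simp only: sum_distrib_right[symmetric] ennreal_mult'' add_nonneg_nonneg zero_le_one)
        (subst sum_ennreal, simp_all)
    also have "\<dots> \<le> ennreal (w + 1)"
    proof (rule ennreal_leI)
      have sum: "(\<Sum>j<N. 1 / 2 ^ Suc j) = (1 - 1 / 2 ^ N :: real)" for N
        by (induction N) (simp_all add: field_simps)
      have "(\<Sum>j<Suc N. 1 / 2 ^ Suc j) \<le> (1::real)" unfolding sum by simp
      then have "(\<Sum>j<Suc N. 1 / 2 ^ Suc j) * (w + 1) \<le> 1 * (w + 1)" using w by (intro mult_right_mono) auto
      then show "(\<Sum>j<Suc N. 1 / 2 ^ Suc j) * (w + 1) \<le> w + 1" by simp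
    qed
    finally show ?thesis .
  qed
  moreover have "0 < w + 1" using w by simp
  ultimately show thesis using that[OF c(1)] by blast
qed

lemma modular_Poincare:
  assumes "0 < \<epsilon>"
  obtains \<delta> where "0 < \<delta>"
    "\<And>\<eta>. \<eta> \<in> test_functions \<Omega> \<Longrightarrow> modular (\<lambda>x. norm (gradient \<eta> x)) \<le> ennreal \<delta> \<Longrightarrow> modular \<eta> \<le> ennreal \<epsilon>"
proof -
  obtain c C where cC: "0 < c" "0 < C"
    "\<And>\<eta>. \<eta> \<in> test_functions \<Omega> \<Longrightarrow> modular (\<lambda>x. norm (gradient \<eta> x)) \<le> 1 \<Longrightarrow> modular (\<lambda>x. c * \<eta> x) \<le> ennreal C"
    using modular_Poincare_bounded by metis
  \<comment> \<open>The three lower bounds serve scaling up by (aDec), scaling back by a factor at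
    most 1, and the final size C/(c A).\<close>
  define A where "A = max 1 (max (1 / c) (C / (c * \<epsilon>)))"
  have A: "1 \<le> A" "1 / (c * A) \<le> 1" "C / (c * A) \<le> \<epsilon>"
  proof -
    show A1: "1 \<le> A" by (simp add: A_def)
    have "1 / c \<le> A" by (simp add: A_def)
    then show "1 / (c * A) \<le> 1" using cC A1 by (simp add: field_simps)
    have "C / (c * \<epsilon>) \<le> A" by (simp add: A_def)
    then show "C / (c * A) \<le> \<epsilon>" using cC A1 assms by (simp add: field_simps)
  qed
  define B where "B = L * A powr q"
  have B: "0 < B" using L A by (simp add: B_def)
  have "modular \<eta> \<le> ennreal \<epsilon>" if \<eta>: "\<eta> \<in> test_functions \<Omega>" and le: "modular (\<lambda>x. norm (gradient \<eta> x)) \<le> ennreal (1 / B)" for \<eta>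
  proof -
    have A\<eta>: "(\<lambda>x. A * \<eta> x) \<in> test_functions \<Omega>" by (rule test_functions_scale[OF \<eta>])
    have "modular (\<lambda>x. norm (gradient (\<lambda>x. A * \<eta> x) x)) = modular (\<lambda>x. A * norm (gradient \<eta> x))"
      using A by (simp add: gradient_scale[OF \<eta>])
    also have "\<dots> \<le> ennreal B * modular (\<lambda>x. norm (gradient \<eta> x))"
      unfolding B_def by (intro modular_scale_ge test_functions_measurable[OF \<eta>] A)
    also have "\<dots> \<le> ennreal B * ennreal (1 / B)" by (intro mult_left_mono le) simp
    also have "\<dots> = 1" using B by (simp flip: ennreal_mult')
    finally have "modular (\<lambda>x. c * (A * \<eta> x)) \<le> ennreal C" by (rule cC(3)[OF A\<eta>])
    moreover have "modular \<eta> = modular (\<lambda>x. (1 / (c * A)) * (c * (A * \<eta> x)))"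
      using cC A by simp
    moreover have "\<dots> \<le> ennreal (1 / (c * A)) * modular (\<lambda>x. c * (A * \<eta> x))"
      using A cC test_functions_measurable(1)[OF \<eta>] by (intro modular_scale_le) auto
    ultimately have "modular \<eta> \<le> ennreal (1 / (c * A)) * ennreal C"
      by (metis mult_left_mono order_trans zero_le)
    also have "\<dots> = ennreal (C / (c * A))" using cC A by (simp flip: ennreal_mult')
    also have "\<dots> \<le> ennreal \<epsilon>" by (intro ennreal_leI A)
    finally show ?thesis .
  qed
  moreover have "0 < 1 / B" using B by simp
  ultimately show thesis using that by blast
qed

end

subsection \<open>Uniform convexity\<close>

lemma powr_midpoint_less:
  fixes s t p :: real
  assumes "1 < p" "0 \<le> s" "s < t"
  shows "((s + t) / 2) powr p < (s powr p + t powr p) / 2"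
proof -
  let ?m = "(s + t) / 2"
  have MV: "\<exists>z. a < z \<and> z < b \<and> b powr p - a powr p = (b - a) * (p * z powr (p - 1))"
    if "0 \<le> a" "a < b" for a b :: real
  proof -
    have der: "((\<lambda>z. z powr p) has_real_derivative p * z powr (p - 1)) (at z)" if "0 < z" for z
      using that assms(1) by (auto intro!: derivative_eq_intros)
    have "\<exists>l z. a < z \<and> z < b \<and> ((\<lambda>z. z powr p) has_real_derivative l) (at z) \<and> b powr p - a powr p = (b - a) * l"
    proof (rule MVT[OF that(2)])
      show "continuous_on {a..b} (\<lambda>z. z powr p)"
        using that assms(1) by (intro continuous_on_powr' continuous_intros) auto
      show "(\<lambda>z. z powr p) differentiable (at z)" if "a < z" "z < b" for z
        using der[of z] that \<open>0 \<le> a\<close> by (auto simp: real_differentiable_def)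
    qed
    then obtain l z where lz: "a < z" "z < b" "((\<lambda>z. z powr p) has_real_derivative l) (at z)" "b powr p - a powr p = (b - a) * l"
      by blast
    moreover have "l = p * z powr (p - 1)"
      using DERIV_unique[OF lz(3) der] lz that by simp
    ultimately show ?thesis by blast
  qed
  obtain z1 where z1: "s < z1" "z1 < ?m" "?m powr p - s powr p = (?m - s) * (p * z1 powr (p - 1))"
    using MV[of s ?m] assms by auto
  obtain z2 where z2: "?m < z2" "z2 < t" "t powr p - ?m powr p = (t - ?m) * (p * z2 powr (p - 1))"
    using MV[of ?m t] assms by auto
  have eq: "?m - s = t - ?m" by (simp add: field_simps)
  have "z1 powr (p - 1) < z2 powr (p - 1)"
    using z1 z2 assms by (intro powr_less_mono2) auto
  then have "(t - ?m) * (p * z1 powr (p - 1)) < (t - ?m) * (p * z2 powr (p - 1))"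
    using assms by (intro mult_strict_left_mono) auto
  then have "?m powr p - s powr p < t powr p - ?m powr p"
    by (simp only: z1(3) z2(3) eq)
  then show ?thesis by simp
qed

lemma powr_midpoint_le:
  fixes s t p :: real
  assumes "1 < p" "0 \<le> s" "0 \<le> t"
  shows "((s + t) / 2) powr p \<le> (s powr p + t powr p) / 2"
proof -
  consider "s < t" | "s = t" | "t < s" by linarith
  then show ?thesis
  proof cases
    case 1 then show ?thesis using powr_midpoint_less[of p s t] assms by simp
  next
    case 2 then show ?thesis by simp
  next
    case 3 then show ?thesis using powr_midpoint_less[of p t s] assms by (simp add: add.commute)
  qed
qed

text \<open>By homogeneity only the ratio b/a in [0, 1 - e] matters. The gap in the midpoint
  inequality is continuous and positive on this compact interval, and its minimum is
  \<delta>.\<close>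

lemma powr_uniformly_convex:
  fixes p e :: real
  assumes p: "1 < p" and e: "0 < e" "e \<le> 1"
  obtains \<delta> where "0 < \<delta>"
    "\<And>a b. 0 \<le> a \<Longrightarrow> 0 \<le> b \<Longrightarrow> b \<le> (1 - e) * a \<Longrightarrow> ((a + b) / 2) powr p \<le> (1 - \<delta>) * ((a powr p + b powr p) / 2)"
proof -
  define g where "g s = (1 + s powr p) / 2 - ((1 + s) / 2) powr p" for s :: real
  have "continuous_on {0..1 - e} g"
    unfolding g_def using p by (intro continuous_intros continuous_on_powr') auto
  then obtain s0 where s0: "s0 \<in> {0..1 - e}" "\<And>s. s \<in> {0..1 - e} \<Longrightarrow> g s0 \<le> g s"
    using continuous_attains_inf[of "{0..1 - e}" g] e by auto
  have "0 < g s0"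
    using powr_midpoint_less[OF p, of s0 1] s0(1) e by (simp add: g_def add.commute)
  moreover have "((a + b) / 2) powr p \<le> (1 - g s0) * ((a powr p + b powr p) / 2)"
    if "0 \<le> a" "0 \<le> b" "b \<le> (1 - e) * a" for a b
  proof (cases "a = 0")
    case True
    then have "b = 0" using that by simp
    with True show ?thesis by simp
  next
    case False
    then have a: "0 < a" using that by simp
    define s where "s = b / a"
    have b: "b = s * a" using a by (simp add: s_def)
    have s: "s \<in> {0..1 - e}" using that a by (simp add: s_def field_simps)
    have "((a + b) / 2) powr p = a powr p * ((1 + s) / 2) powr p"
      using a s by (simp add: b powr_mult[symmetric] field_simps)
    also have "\<dots> = a powr p * ((1 + s powr p) / 2) - a powr p * g s"
      by (simp add: g_def right_diff_distrib)
    also have "\<dots> \<le> a powr p * ((1 + s powr p) / 2) - g s0 * (a powr p * ((1 + s powr p) / 2))"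
    proof -
      \<comment> \<open>Since (1 + s^p)/2 is at most 1, the additive gap can be rewritten as a
        factor.\<close>
      have "s powr p \<le> 1" using s e p by (intro powr_le1) auto
      then have "(1 + s powr p) / 2 * g s0 \<le> 1 * g s"
        using s0(2)[OF s] \<open>0 < g s0\<close> by (intro mult_mono) auto
      then have "a powr p * ((1 + s powr p) / 2 * g s0) \<le> a powr p * (1 * g s)"
        by (rule mult_left_mono) simp
      then show ?thesis by (simp add: mult_ac)
    qed
    also have "\<dots> = (1 - g s0) * ((a powr p + b powr p) / 2)"
    proof -
      have "b powr p = s powr p * a powr p" using a s by (simp add: b powr_mult)
      then show ?thesis by (simp add: field_simps)
    qed
    finally show ?thesis .
  qed
  ultimately show thesis using that by blast
qed

text \<open>The parallelogram law gives the factor 1 - \<epsilon>^2/4 for squared norms, and this is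
  at most the square of 1 - \<epsilon>^2/8.\<close>

lemma norm_midpoint_le:
  fixes F G :: "'b::real_inner"
  assumes GF: "norm G \<le> norm F" and far: "\<epsilon> * norm F \<le> norm (F - G)" and \<epsilon>: "0 \<le> \<epsilon>" "\<epsilon> \<le> 1"
  shows "norm ((1 / 2) *\<^sub>R (F + G)) \<le> (1 - \<epsilon>\<^sup>2 / 8) * norm F"
proof (rule power2_le_imp_le)
  have e2: "\<epsilon>\<^sup>2 \<le> 1" using \<epsilon> by (simp add: power_le_one)
  have "(norm (F + G))\<^sup>2 + (norm (F - G))\<^sup>2 = 2 * (norm F)\<^sup>2 + 2 * (norm G)\<^sup>2"
    by (simp add: power2_norm_eq_inner inner_simps algebra_simps inner_commute)
  moreover have "(\<epsilon> * norm F)\<^sup>2 \<le> (norm (F - G))\<^sup>2"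
    using far \<epsilon> by (intro power_mono) auto
  moreover have "(norm G)\<^sup>2 \<le> (norm F)\<^sup>2" using GF by (intro power_mono) auto
  ultimately have "(norm (F + G))\<^sup>2 \<le> (4 - \<epsilon>\<^sup>2) * (norm F)\<^sup>2"
    unfolding power_mult_distrib left_diff_distrib by linarith
  then have "(norm ((1 / 2) *\<^sub>R (F + G)))\<^sup>2 \<le> (1 - \<epsilon>\<^sup>2 / 4) * (norm F)\<^sup>2"
    by (simp add: power_divide left_diff_distrib)
  also have "\<dots> \<le> (1 - \<epsilon>\<^sup>2 / 8)\<^sup>2 * (norm F)\<^sup>2"
    using \<epsilon> by (intro mult_right_mono) (simp_all add: power2_eq_square algebra_simps)
  finally show "(norm ((1 / 2) *\<^sub>R (F + G)))\<^sup>2 \<le> ((1 - \<epsilon>\<^sup>2 / 8) * norm F)\<^sup>2"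
    by (simp add: power_mult_distrib)
  show "0 \<le> (1 - \<epsilon>\<^sup>2 / 8) * norm F" using e2 by simp
qed

section \<open>Uniform convexity of p-th powers of convex functions\<close>

text \<open>Midpoint convexity and the scaling bound are the only forms of convexity used, and both
  pass to suprema, as \<open>root_convex\<close> requires.\<close>

definition convex_gauge :: "(real \<Rightarrow> real) \<Rightarrow> bool"
  where "convex_gauge H \<longleftrightarrow> (\<forall>t\<ge>0. 0 \<le> H t) \<and> (\<forall>s\<ge>0. \<forall>t\<ge>s. H s \<le> H t) \<and>
    (\<forall>s\<ge>0. \<forall>t\<ge>0. H ((s + t) / 2) \<le> (H s + H t) / 2) \<and>
    (\<forall>a\<in>{0..1}. \<forall>t\<ge>0. H (a * t) \<le> a * H t)"

lemma convex_gaugeD: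
  assumes "convex_gauge H"
  shows "\<And>t. 0 \<le> t \<Longrightarrow> 0 \<le> H t" "\<And>s t. 0 \<le> s \<Longrightarrow> s \<le> t \<Longrightarrow> H s \<le> H t"
    "\<And>s t. 0 \<le> s \<Longrightarrow> 0 \<le> t \<Longrightarrow> H ((s + t) / 2) \<le> (H s + H t) / 2"
    "\<And>a t. 0 \<le> a \<Longrightarrow> a \<le> 1 \<Longrightarrow> 0 \<le> t \<Longrightarrow> H (a * t) \<le> a * H t"
  using assms unfolding convex_gauge_def by auto

text \<open>H may have affine pieces, so the gap comes from one of two sources. If the lengths of F
  and G differ by a definite factor, it comes from the strict convexity of the p-th power; if they
  are nearly equal, F and G differ in direction and the parallelogram law shortens the midpoint. The
  constant does not depend on H, which later varies with x.\<close>

lemma powr_of_convex_uniformly_convex: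
  fixes p \<epsilon> :: real
  assumes p: "1 < p" and \<epsilon>: "0 < \<epsilon>" "\<epsilon> \<le> 1"
  obtains \<delta> where "0 < \<delta>"
    "\<And>(H :: real \<Rightarrow> real) (F :: 'b::real_inner) G.
      convex_gauge H \<Longrightarrow>
      \<epsilon> * max (norm F) (norm G) \<le> norm (F - G) \<Longrightarrow>
      H (norm ((1 / 2) *\<^sub>R (F + G))) powr p \<le> (1 - \<delta>) * ((H (norm F) powr p + H (norm G) powr p) / 2)"
proof -
  define e where "e = \<epsilon>\<^sup>2 / 8"
  have e: "0 < e" "e \<le> 1"
    using \<epsilon> power_le_one[of \<epsilon> 2] by (auto simp: e_def)
  obtain \<delta>1 where \<delta>1: "0 < \<delta>1"
    "\<And>a b. 0 \<le> a \<Longrightarrow> 0 \<le> b \<Longrightarrow> b \<le> (1 - e) * a \<Longrightarrow> ((a + b) / 2) powr p \<le> (1 - \<delta>1) * ((a powr p + b powr p) / 2)"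
    using powr_uniformly_convex[OF p e] by blast
  define \<delta> where "\<delta> = min \<delta>1 (e / 2)"
  have \<delta>: "0 < \<delta>" using \<delta>1 e by (simp add: \<delta>_def)
  have *: "H (norm ((1 / 2) *\<^sub>R (F + G))) powr p \<le> (1 - \<delta>) * ((H (norm F) powr p + H (norm G) powr p) / 2)"
    if gauge: "convex_gauge H"
      and far: "\<epsilon> * norm F \<le> norm (F - G)" and GF: "norm G \<le> norm F"
    for H :: "real \<Rightarrow> real" and F G :: 'b
  proof -
    note H = convex_gaugeD[OF gauge]
    let ?a = "H (norm F)" and ?b = "H (norm G)" and ?m = "norm ((1 / 2) *\<^sub>R (F + G))"
    have ab: "0 \<le> ?a" "0 \<le> ?b" using H(1) by simp_all
    have S0: "0 \<le> (?a powr p + ?b powr p) / 2" by simp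
    show ?thesis
    proof (cases "norm G \<le> (1 - e) * norm F")
      case True
      have "?b \<le> H ((1 - e) * norm F)" using True by (intro H(2)) auto
      also have "\<dots> \<le> (1 - e) * ?a" using e by (intro H(4)) auto
      finally have b: "?b \<le> (1 - e) * ?a" .
      have "?m \<le> (norm F + norm G) / 2" using norm_triangle_ineq[of F G] by simp
      then have "H ?m \<le> H ((norm F + norm G) / 2)" by (intro H(2)) auto
      also have "\<dots> \<le> (?a + ?b) / 2" by (intro H(3)) auto
      finally have "H ?m powr p \<le> ((?a + ?b) / 2) powr p"
        using p by (intro powr_mono2) (auto simp: H(1))
      also have "\<dots> \<le> (1 - \<delta>1) * ((?a powr p + ?b powr p) / 2)"
        using ab b by (intro \<delta>1(2))
      also have "\<dots> \<le> (1 - \<delta>) * ((?a powr p + ?b powr p) / 2)"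
        by (rule mult_right_mono[OF _ S0]) (simp add: \<delta>_def)
      finally show ?thesis .
    next
      case False
      \<comment> \<open>The gain 1 - e is at most the square of 1 - e/2. One factor passes from the
        norm of F to the mean of the two norms, which are nearly equal here; the other remains as
        the gap.\<close>
      have "?m \<le> (1 - e) * norm F"
        using norm_midpoint_le[OF GF far] \<epsilon> by (simp add: e_def)
      also have "\<dots> \<le> (1 - e / 2) * ((1 - e / 2) * norm F)"
        unfolding mult.assoc[symmetric] by (intro mult_right_mono) (simp_all add: algebra_simps)
      also have "\<dots> \<le> (1 - e / 2) * ((norm F + norm G) / 2)"
        using False e by (intro mult_left_mono) (auto simp: algebra_simps)
      finally have "H ?m \<le> H ((1 - e / 2) * ((norm F + norm G) / 2))" by (intro H(2)) auto
      also have "\<dots> \<le> (1 - e / 2) * H ((norm F + norm G) / 2)" using e by (intro H(4)) auto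
      also have "\<dots> \<le> (1 - e / 2) * ((?a + ?b) / 2)" using e by (intro mult_left_mono H(3)) auto
      finally have "H ?m powr p \<le> ((1 - e / 2) * ((?a + ?b) / 2)) powr p"
        using p by (intro powr_mono2) (auto simp: H(1))
      also have "\<dots> = (1 - e / 2) powr p * ((?a + ?b) / 2) powr p"
        using e ab by (intro powr_mult)
      also have "\<dots> \<le> (1 - e / 2) * ((?a powr p + ?b powr p) / 2)"
      proof (intro mult_mono powr_midpoint_le p ab)
        have "(1 - e / 2) powr p \<le> (1 - e / 2) powr 1"
          using e p by (intro powr_mono') auto
        then show "(1 - e / 2) powr p \<le> 1 - e / 2" using e by simp
      qed (use e in auto)
      also have "\<dots> \<le> (1 - \<delta>) * ((?a powr p + ?b powr p) / 2)"
        by (rule mult_right_mono[OF _ S0]) (simp add: \<delta>_def)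
      finally show ?thesis .
    qed
  qed
  have "H (norm ((1 / 2) *\<^sub>R (F + G))) powr p \<le> (1 - \<delta>) * ((H (norm F) powr p + H (norm G) powr p) / 2)"
    if H: "convex_gauge H"
      and far: "\<epsilon> * max (norm F) (norm G) \<le> norm (F - G)"
    for H :: "real \<Rightarrow> real" and F G :: 'b
  proof (cases "norm G \<le> norm F")
    case True
    then show ?thesis using far by (intro *[OF H]) (auto simp: max_def)
  next
    case False
    then have "H (norm ((1 / 2) *\<^sub>R (G + F))) powr p \<le> (1 - \<delta>) * ((H (norm G) powr p + H (norm F) powr p) / 2)"
      using far by (intro *[OF H]) (auto simp: max_def norm_minus_commute)
    then show ?thesis by (simp add: add.commute)
  qed
  with \<delta> that show thesis by blast
qed

context Phi_weight
begin

text \<open>\<open>root_convex x\<close> is a convex function of \<open>t\<close> comparable with the \<open>p\<close>-th root of \<open>\<phi> x t\<close>. The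
  supremum runs over rational \<open>s\<close> only, to keep it measurable in \<open>x\<close>.\<close>

definition root_term :: "'a \<Rightarrow> real \<Rightarrow> real \<Rightarrow> real"
  where "root_term x s t = enn2real (\<phi> x s) powr (1 / p) * max 0 (t / s - 1)"

definition root_convex :: "'a \<Rightarrow> real \<Rightarrow> real"
  where "root_convex x t = (SUP s\<in>{s\<in>\<rat>. 0 < s}. root_term x s t)"

lemma ennreal_phi: "x \<in> \<Omega> \<Longrightarrow> 0 \<le> t \<Longrightarrow> ennreal (enn2real (\<phi> x t)) = \<phi> x t"
  using phi_finite by simp

text \<open>(aInc) says that \<phi>(x,s)^(1/p)/s is almost increasing in s, so the hinge function
  attached to s stays below the p-th root of L \<phi>(x,t).\<close>

lemma root_term_le:
  assumes x: "x \<in> \<Omega>" and t: "0 \<le> t" and s: "0 < s"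
  shows "root_term x s t \<le> (L * enn2real (\<phi> x t)) powr (1 / p)"
proof (cases "t \<le> s")
  case True
  then have "root_term x s t = 0" using s by (simp add: root_term_def max_def field_simps)
  then show ?thesis by simp
next
  case False
  have "ennreal ((t / s) powr p * enn2real (\<phi> x s)) = ennreal ((t / s) powr p) * \<phi> x s"
    using s x by (simp add: ennreal_mult' ennreal_phi)
  also have "\<dots> \<le> ennreal L * \<phi> x ((t / s) * s)"
    using False s by (intro phi_increase[OF x s]) simp
  also have "\<dots> = ennreal (L * enn2real (\<phi> x t))"
    using s L x t by (simp add: ennreal_mult' ennreal_phi)
  finally have "(t / s) powr p * enn2real (\<phi> x s) \<le> L * enn2real (\<phi> x t)"
    using L by (subst (asm) ennreal_le_iff) auto
  then have "((t / s) powr p * enn2real (\<phi> x s)) powr (1 / p) \<le> (L * enn2real (\<phi> x t)) powr (1 / p)"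
    using p by (intro powr_mono2) auto
  also have "((t / s) powr p * enn2real (\<phi> x s)) powr (1 / p) = ((t / s) powr p) powr (1 / p) * enn2real (\<phi> x s) powr (1 / p)"
    by (rule powr_mult)
  also have "((t / s) powr p) powr (1 / p) = t / s" using p s t by (simp add: powr_powr)
  finally have "t / s * enn2real (\<phi> x s) powr (1 / p) \<le> (L * enn2real (\<phi> x t)) powr (1 / p)" .
  moreover have "root_term x s t \<le> t / s * enn2real (\<phi> x s) powr (1 / p)"
    unfolding root_term_def using s t by (subst mult.commute) (intro mult_right_mono, auto)
  ultimately show ?thesis by linarith
qed

lemma root_term_le_root_convex:
  assumes x: "x \<in> \<Omega>" and t: "0 \<le> t" and s: "s \<in> \<rat>" "0 < s"
  shows "root_term x s t \<le> root_convex x t"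
  unfolding root_convex_def
  by (intro cSUP_upper bdd_aboveI2[of _ _ "(L * enn2real (\<phi> x t)) powr (1 / p)"])
    (use s root_term_le[OF x t] in auto)

lemma positive_rationals_nonempty: "{s\<in>\<rat>. 0 < s} \<noteq> ({} :: real set)"
  using Rats_1 zero_less_one by blast

lemma root_convex_least:
  assumes "\<And>s. s \<in> \<rat> \<Longrightarrow> 0 < s \<Longrightarrow> root_term x s t \<le> B"
  shows "root_convex x t \<le> B"
  unfolding root_convex_def using positive_rationals_nonempty assms by (intro cSUP_least) auto

lemma root_term_nonneg: "0 \<le> root_term x s t"
  by (simp add: root_term_def)

lemma root_convex_nonneg: "x \<in> \<Omega> \<Longrightarrow> 0 \<le> t \<Longrightarrow> 0 \<le> root_convex x t"
  using root_term_le_root_convex[of x t 1] root_term_nonneg[of x 1 t] by simp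

lemma root_convex_mono:
  assumes x: "x \<in> \<Omega>" and st: "0 \<le> s" "s \<le> t"
  shows "root_convex x s \<le> root_convex x t"
proof (rule root_convex_least)
  fix r :: real assume r: "r \<in> \<rat>" "0 < r"
  have "root_term x r s \<le> root_term x r t"
    unfolding root_term_def using st r by (intro mult_left_mono max.mono) (auto simp: divide_right_mono)
  also have "\<dots> \<le> root_convex x t" using st r by (intro root_term_le_root_convex[OF x]) auto
  finally show "root_term x r s \<le> root_convex x t" .
qed

lemma root_convex_midpoint:
  assumes x: "x \<in> \<Omega>" and st: "0 \<le> s" "0 \<le> t"
  shows "root_convex x ((s + t) / 2) \<le> (root_convex x s + root_convex x t) / 2"
proof (rule root_convex_least)
  fix r :: real assume r: "r \<in> \<rat>" "0 < r"
  have "max 0 ((s + t) / 2 / r - 1) \<le> (max 0 (s / r - 1) + max 0 (t / r - 1)) / 2"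
    by (simp add: max_def field_simps) (use r in \<open>auto simp: field_simps\<close>)
  then have "root_term x r ((s + t) / 2) \<le> enn2real (\<phi> x r) powr (1 / p) * ((max 0 (s / r - 1) + max 0 (t / r - 1)) / 2)"
    unfolding root_term_def by (rule mult_left_mono) simp
  also have "\<dots> = (root_term x r s + root_term x r t) / 2"
    by (simp add: root_term_def distrib_left)
  also have "\<dots> \<le> (root_convex x s + root_convex x t) / 2"
    using root_term_le_root_convex[OF x _ r] st by (intro divide_right_mono add_mono) auto
  finally show "root_term x r ((s + t) / 2) \<le> (root_convex x s + root_convex x t) / 2" .
qed

lemma root_convex_scale:
  assumes x: "x \<in> \<Omega>" and a: "0 \<le> a" "a \<le> 1" and t: "0 \<le> t"
  shows "root_convex x (a * t) \<le> a * root_convex x t"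
proof (rule root_convex_least)
  fix r :: real assume r: "r \<in> \<rat>" "0 < r"
  have "max 0 (a * t / r - 1) \<le> a * max 0 (t / r - 1)"
  proof (cases "t / r \<le> 1")
    case True
    then have "a * (t / r) \<le> 1" using a t r by (intro mult_le_one) auto
    then show ?thesis using True by simp
  next
    case False
    have "a * (t / r - 1) = a * t / r - a" by (simp add: right_diff_distrib)
    moreover have "0 \<le> a * (t / r - 1)" using False a by simp
    ultimately show ?thesis using False a by (simp add: max_def)
  qed
  then have "root_term x r (a * t) \<le> enn2real (\<phi> x r) powr (1 / p) * (a * max 0 (t / r - 1))"
    unfolding root_term_def by (rule mult_left_mono) simp
  also have "\<dots> = a * root_term x r t" by (simp add: root_term_def)
  also have "\<dots> \<le> a * root_convex x t"
    using root_term_le_root_convex[OF x t r] a by (intro mult_left_mono) auto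
  finally show "root_term x r (a * t) \<le> a * root_convex x t" .
qed

lemma convex_gauge_root_convex: "x \<in> \<Omega> \<Longrightarrow> convex_gauge (root_convex x)"
  unfolding convex_gauge_def
  using root_convex_nonneg[of x] root_convex_mono[of x] root_convex_midpoint[of x] root_convex_scale[of x]
  by auto

lemma root_convex_powr_le:
  assumes x: "x \<in> \<Omega>" and t: "0 \<le> t"
  shows "root_convex x t powr p \<le> L * enn2real (\<phi> x t)"
proof -
  have "root_convex x t \<le> (L * enn2real (\<phi> x t)) powr (1 / p)"
    by (rule root_convex_least) (rule root_term_le[OF x t])
  then have "root_convex x t powr p \<le> ((L * enn2real (\<phi> x t)) powr (1 / p)) powr p"
    using p root_convex_nonneg[OF x t] by (intro powr_mono2) auto
  also have "\<dots> = L * enn2real (\<phi> x t)" using p L by (simp add: powr_powr)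
  finally show ?thesis .
qed

text \<open>For a rational s between t/4 and t/2 the hinge factor t/s - 1 is at least 1, so the
  supremum dominates \<phi>(x,t/4)^(1/p); (aDec) returns from t/4 to t at the cost of L 4^q.\<close>

lemma phi_le_root_convex_powr:
  assumes x: "x \<in> \<Omega>" and t: "0 \<le> t"
  shows "enn2real (\<phi> x t) \<le> L * 4 powr q * root_convex x t powr p"
proof (cases "t = 0")
  case True
  then show ?thesis using phi_0[OF x] L by simp
next
  case False
  with t have t0: "0 < t" by simp
  then obtain s where s: "s \<in> \<rat>" "t / 4 < s" "s < t / 2" using Rats_dense_in_real[of "t / 4" "t / 2"] by auto
  then have s0: "0 < s" using t0 by linarith
  have "\<phi> x t \<le> ennreal (L * 4 powr q) * \<phi> x (t / 4)"
    using phi_scale_ge[OF x, of "t / 4" 4] t by simp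
  then have "ennreal (enn2real (\<phi> x t)) \<le> ennreal (L * 4 powr q * enn2real (\<phi> x (t / 4)))"
    using x t L by (simp add: ennreal_phi ennreal_mult')
  then have 1: "enn2real (\<phi> x t) \<le> L * 4 powr q * enn2real (\<phi> x (t / 4))"
    using L by (subst (asm) ennreal_le_iff) auto
  have "\<phi> x (t / 4) \<le> \<phi> x s" using s t by (intro phi_mono[OF x]) auto
  then have "enn2real (\<phi> x (t / 4)) \<le> enn2real (\<phi> x s)"
    using phi_finite[OF x, of s] s0 by (intro enn2real_mono) auto
  then have "enn2real (\<phi> x (t / 4)) powr (1 / p) \<le> enn2real (\<phi> x s) powr (1 / p)"
    using p by (intro powr_mono2) auto
  also have "\<dots> \<le> root_term x s t"
  proof -
    have "1 \<le> t / s - 1" using s s0 by (simp add: field_simps)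
    then show ?thesis unfolding root_term_def by (simp add: mult_le_cancel_left1)
  qed
  also have "\<dots> \<le> root_convex x t" using s s0 t by (intro root_term_le_root_convex[OF x]) auto
  finally have "(enn2real (\<phi> x (t / 4)) powr (1 / p)) powr p \<le> root_convex x t powr p"
    using p by (intro powr_mono2) auto
  then have "enn2real (\<phi> x (t / 4)) \<le> root_convex x t powr p" using p by (simp add: powr_powr)
  then have "L * 4 powr q * enn2real (\<phi> x (t / 4)) \<le> L * 4 powr q * root_convex x t powr p"
    using L by (intro mult_left_mono) auto
  with 1 show ?thesis by linarith
qed

text \<open>If F - G is small relative to the larger norm, convexity bounds its \<phi> by \<epsilon>
  times the values at F and G. Otherwise the gap of uniform convexity pays for it, and C = 2
  B/\<delta> is chosen so that C \<delta>/2 covers the constant B of the doubling and comparison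
  estimates.\<close>

lemma uniform_convexity_pointwise:
  assumes \<epsilon>: "0 < \<epsilon>" "\<epsilon> \<le> 1"
  obtains C where "0 \<le> C"
    "\<And>x (F :: 'b::real_inner) G. x \<in> \<Omega> \<Longrightarrow>
      enn2real (\<phi> x (norm (F - G))) + C * root_convex x (norm ((1 / 2) *\<^sub>R (F + G))) powr p \<le>
      \<epsilon> * (enn2real (\<phi> x (norm F)) + enn2real (\<phi> x (norm G))) +
      C * ((root_convex x (norm F) powr p + root_convex x (norm G) powr p) / 2)"
proof -
  obtain \<delta> where \<delta>: "0 < \<delta>"
    and uc: "\<And>(H :: real \<Rightarrow> real) (F :: 'b) G.
      convex_gauge H \<Longrightarrow>
      \<epsilon> * max (norm F) (norm G) \<le> norm (F - G) \<Longrightarrow>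
      H (norm ((1 / 2) *\<^sub>R (F + G))) powr p \<le> (1 - \<delta>) * ((H (norm F) powr p + H (norm G) powr p) / 2)"
    using powr_of_convex_uniformly_convex[OF p \<epsilon>] by blast
  define B where "B = D * (L * 4 powr q)"
  have B: "0 \<le> B" using D_ge_1 L by (simp add: B_def)
  define C where "C = 2 * B / \<delta>"
  have C: "0 \<le> C" using B \<delta> by (simp add: C_def)
  have "enn2real (\<phi> x (norm (F - G))) + C * root_convex x (norm ((1 / 2) *\<^sub>R (F + G))) powr p \<le>
      \<epsilon> * (enn2real (\<phi> x (norm F)) + enn2real (\<phi> x (norm G))) +
      C * ((root_convex x (norm F) powr p + root_convex x (norm G) powr p) / 2)"
    if x: "x \<in> \<Omega>" for x and F G :: 'b
  proof -
    let ?H = "root_convex x" and ?m = "(1 / 2) *\<^sub>R (F + G)" and ?M = "max (norm F) (norm G)"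
    let ?f = "\<lambda>t. enn2real (\<phi> x t)"
    have f0: "0 \<le> ?f t" for t by simp
    have fmax: "?f ?M \<le> ?f (norm F) + ?f (norm G)" by (simp add: max_def)
    show ?thesis
    proof (cases "\<epsilon> * ?M \<le> norm (F - G)")
      case True
      have h: "?H (norm ?m) powr p \<le> (1 - \<delta>) * ((?H (norm F) powr p + ?H (norm G) powr p) / 2)"
        by (rule uc[OF convex_gauge_root_convex[OF x] True])
      have "norm (F - G) \<le> 2 * ?M" using norm_triangle_ineq4[of F G] by linarith
      then have "\<phi> x (norm (F - G)) \<le> \<phi> x (2 * ?M)" by (intro phi_mono[OF x]) auto
      also have "\<dots> \<le> ennreal D * \<phi> x ?M"
        unfolding D_def by (intro phi_scale_ge[OF x]) (auto simp: max_def)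
      also have "\<dots> = ennreal (D * ?f ?M)"
        using D_ge_1 x by (simp add: ennreal_mult' ennreal_phi max_def)
      finally have "ennreal (?f (norm (F - G))) \<le> ennreal (D * ?f ?M)" using x by (simp add: ennreal_phi)
      then have "?f (norm (F - G)) \<le> D * ?f ?M" using D_ge_1 by (subst (asm) ennreal_le_iff) auto
      also have "\<dots> \<le> D * (L * 4 powr q * (?H (norm F) powr p + ?H (norm G) powr p))"
      proof (rule mult_left_mono)
        have "?f ?M \<le> L * 4 powr q * ?H ?M powr p"
          by (rule phi_le_root_convex_powr[OF x]) (simp add: max_def)
        also have "\<dots> \<le> L * 4 powr q * (?H (norm F) powr p + ?H (norm G) powr p)"
          using L by (intro mult_left_mono) (auto simp: max_def)
        finally show "?f ?M \<le> L * 4 powr q * (?H (norm F) powr p + ?H (norm G) powr p)" .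
      qed (use D_ge_1 in simp)
      also have "\<dots> = C * \<delta> * ((?H (norm F) powr p + ?H (norm G) powr p) / 2)"
        using \<delta> by (simp add: C_def B_def)
      finally have "?f (norm (F - G)) \<le> C * \<delta> * ((?H (norm F) powr p + ?H (norm G) powr p) / 2)" .
      moreover have "C * ?H (norm ?m) powr p \<le> C * ((1 - \<delta>) * ((?H (norm F) powr p + ?H (norm G) powr p) / 2))"
        using C h by (rule mult_left_mono[rotated])
      moreover have "0 \<le> \<epsilon> * (?f (norm F) + ?f (norm G))" using \<epsilon> f0 by simp
      moreover have "C * ((1 - \<delta>) * S) = C * S - C * \<delta> * S" for S
        by (simp add: algebra_simps)
      ultimately show ?thesis by smt
    next
      case False
      have "norm ?m \<le> (norm F + norm G) / 2" using norm_triangle_ineq[of F G] by simp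
      then have "?H (norm ?m) \<le> ?H ((norm F + norm G) / 2)" by (intro root_convex_mono[OF x]) auto
      also have "\<dots> \<le> (?H (norm F) + ?H (norm G)) / 2" by (intro root_convex_midpoint[OF x]) auto
      finally have "?H (norm ?m) powr p \<le> ((?H (norm F) + ?H (norm G)) / 2) powr p"
        using p root_convex_nonneg[OF x] by (intro powr_mono2) auto
      also have "\<dots> \<le> (?H (norm F) powr p + ?H (norm G) powr p) / 2"
        using root_convex_nonneg[OF x] by (intro powr_midpoint_le p) auto
      finally have "C * ?H (norm ?m) powr p \<le> C * ((?H (norm F) powr p + ?H (norm G) powr p) / 2)"
        using C by (rule mult_left_mono)
      moreover have "?f (norm (F - G)) \<le> \<epsilon> * (?f (norm F) + ?f (norm G))"
      proof -
        have "\<phi> x (norm (F - G)) \<le> \<phi> x (\<epsilon> * ?M)" using False by (intro phi_mono[OF x]) auto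
        also have "\<dots> \<le> ennreal \<epsilon> * \<phi> x ?M" using \<epsilon> by (intro phi_scale_le[OF x]) (auto simp: max_def)
        also have "\<dots> = ennreal (\<epsilon> * ?f ?M)"
          using \<epsilon> x by (simp add: ennreal_mult' ennreal_phi max_def)
        finally have "ennreal (?f (norm (F - G))) \<le> ennreal (\<epsilon> * ?f ?M)" using x by (simp add: ennreal_phi)
        then have "?f (norm (F - G)) \<le> \<epsilon> * ?f ?M" using \<epsilon> by (subst (asm) ennreal_le_iff) auto
        also have "\<dots> \<le> \<epsilon> * (?f (norm F) + ?f (norm G))" using \<epsilon> fmax by (intro mult_left_mono) auto
        finally show ?thesis .
      qed
      ultimately show ?thesis by linarith
    qed
  qed
  with C that show thesis by blast
qed

lemma root_convex_measurable:
  assumes f[measurable]: "f \<in> borel_measurable M" and nonneg: "\<And>x. 0 \<le> f x"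
  shows "(\<lambda>x. root_convex x (f x)) \<in> borel_measurable M"
  unfolding root_convex_def
proof (rule borel_measurable_cSUP)
  show "countable {s\<in>\<rat>. 0 < (s::real)}"
    by (rule countable_subset[OF _ countable_rat]) auto
  show "(\<lambda>x. root_term x s (f x)) \<in> borel_measurable M" if "s \<in> {s\<in>\<rat>. 0 < s}" for s
  proof -
    have "(\<lambda>x. \<phi> x \<bar>s\<bar>) \<in> borel_measurable M" by (rule phi_measurable) simp
    then have [measurable]: "(\<lambda>x. \<phi> x s) \<in> borel_measurable M" using that by simp
    show ?thesis unfolding root_term_def by measurable
  qed
  show "bdd_above ((\<lambda>s. root_term x s (f x)) ` {s\<in>\<rat>. 0 < s})" if "x \<in> space M" for x
    using that root_term_le[of x "f x"] nonneg[of x]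
    by (intro bdd_aboveI2[of _ _ "(L * enn2real (\<phi> x (f x))) powr (1 / p)"]) auto
qed

section \<open>Uniform convexity for integrals of vector fields\<close>

definition convex_modular :: "('a \<Rightarrow> 'b::euclidean_space) \<Rightarrow> ennreal"
  where "convex_modular F = (\<integral>\<^sup>+x. ennreal (root_convex x (norm (F x)) powr p) * ennreal (\<omega> x) \<partial>M)"

lemma convex_modular_measurable:
  fixes F :: "'a \<Rightarrow> 'b::euclidean_space"
  assumes [measurable]: "F \<in> borel_measurable M"
  shows "(\<lambda>x. ennreal (root_convex x (norm (F x)) powr p) * ennreal (\<omega> x)) \<in> borel_measurable M"
proof -
  have [measurable]: "(\<lambda>x. root_convex x (norm (F x))) \<in> borel_measurable M"
    by (rule root_convex_measurable) simp_all
  show ?thesis by measurable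
qed

lemma convex_modular_le:
  fixes F :: "'a \<Rightarrow> 'b::euclidean_space"
  assumes F: "F \<in> borel_measurable M"
  shows "convex_modular F \<le> ennreal L * modular (\<lambda>x. norm (F x))"
proof -
  have "convex_modular F \<le> (\<integral>\<^sup>+x. ennreal L * (\<phi> x \<bar>norm (F x)\<bar> * ennreal (\<omega> x)) \<partial>M)"
    unfolding convex_modular_def
  proof (rule nn_integral_mono)
    fix x assume "x \<in> space M"
    then have x: "x \<in> \<Omega>" by simp
    have "ennreal (root_convex x (norm (F x)) powr p) \<le> ennreal (L * enn2real (\<phi> x (norm (F x))))"
      by (intro ennreal_leI root_convex_powr_le[OF x]) simp
    also have "\<dots> = ennreal L * \<phi> x (norm (F x))" using L x by (simp add: ennreal_mult' ennreal_phi)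
    finally have "ennreal (root_convex x (norm (F x)) powr p) * ennreal (\<omega> x) \<le> ennreal L * \<phi> x (norm (F x)) * ennreal (\<omega> x)"
      by (rule mult_right_mono) simp
    then show "ennreal (root_convex x (norm (F x)) powr p) * ennreal (\<omega> x) \<le> ennreal L * (\<phi> x \<bar>norm (F x)\<bar> * ennreal (\<omega> x))"
      by (simp add: mult.assoc)
  qed
  also have "\<dots> = ennreal L * modular (\<lambda>x. norm (F x))"
    unfolding modular_def by (rule nn_integral_cmult, rule modular_integrand_measurable) (use F in measurable)
  finally show ?thesis .
qed

text \<open>The pointwise inequality, integrated. It is kept in additive form because the terms may
  be infinite and cannot be subtracted.\<close>

lemma uniform_convexity_modular:
  assumes \<epsilon>: "0 < \<epsilon>" "\<epsilon> \<le> 1"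
  obtains C where "0 \<le> C"
    "\<And>F G :: 'a \<Rightarrow> 'b::euclidean_space. F \<in> borel_measurable M \<Longrightarrow> G \<in> borel_measurable M \<Longrightarrow>
      modular (\<lambda>x. norm (F x - G x)) + ennreal C * convex_modular (\<lambda>x. (1 / 2) *\<^sub>R (F x + G x)) \<le>
      ennreal \<epsilon> * (modular (\<lambda>x. norm (F x)) + modular (\<lambda>x. norm (G x))) +
      ennreal (C / 2) * (convex_modular F + convex_modular G)"
proof -
  obtain C where C: "0 \<le> C"
    and uc: "\<And>x (F :: 'b) G. x \<in> \<Omega> \<Longrightarrow>
      enn2real (\<phi> x (norm (F - G))) + C * root_convex x (norm ((1 / 2) *\<^sub>R (F + G))) powr p \<le>
      \<epsilon> * (enn2real (\<phi> x (norm F)) + enn2real (\<phi> x (norm G))) +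
      C * ((root_convex x (norm F) powr p + root_convex x (norm G) powr p) / 2)"
    using uniform_convexity_pointwise[OF \<epsilon>] by blast
  have "modular (\<lambda>x. norm (F x - G x)) + ennreal C * convex_modular (\<lambda>x. (1 / 2) *\<^sub>R (F x + G x)) \<le>
      ennreal \<epsilon> * (modular (\<lambda>x. norm (F x)) + modular (\<lambda>x. norm (G x))) +
      ennreal (C / 2) * (convex_modular F + convex_modular G)"
    if FG[measurable]: "F \<in> borel_measurable M" "G \<in> borel_measurable M" for F G :: "'a \<Rightarrow> 'b"
  proof -
    let ?h = "\<lambda>F x. ennreal (root_convex x (norm (F x)) powr p) * ennreal (\<omega> x)"
    let ?f = "\<lambda>F x. \<phi> x \<bar>norm (F x)\<bar> * ennreal (\<omega> x)"
    let ?m = "\<lambda>x. (1 / 2) *\<^sub>R (F x + G x)" and ?d = "\<lambda>x. F x - G x"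
    have fm: "?f F \<in> borel_measurable M" if "F \<in> borel_measurable M" for F :: "'a \<Rightarrow> 'b"
      by (rule modular_integrand_measurable) (use that in measurable)
    have dm: "?d \<in> borel_measurable M" "?m \<in> borel_measurable M" by measurable
    note mm = fm[OF FG(1)] fm[OF FG(2)] fm[OF dm(1)] convex_modular_measurable[OF FG(1)]
      convex_modular_measurable[OF FG(2)] convex_modular_measurable[OF dm(2)]
    have "(\<integral>\<^sup>+x. ?f ?d x + ennreal C * ?h ?m x \<partial>M) \<le>
      (\<integral>\<^sup>+x. ennreal \<epsilon> * (?f F x + ?f G x) + ennreal (C / 2) * (?h F x + ?h G x) \<partial>M)"
    proof (rule nn_integral_mono)
      fix x assume "x \<in> space M"
      then have x: "x \<in> \<Omega>" by simp
      define w a b d u v m where "w = \<omega> x" and "a = enn2real (\<phi> x (norm (F x)))" and "b = enn2real (\<phi> x (norm (G x)))"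
        and "d = enn2real (\<phi> x (norm (F x - G x)))" and "u = root_convex x (norm (F x)) powr p"
        and "v = root_convex x (norm (G x)) powr p" and "m = root_convex x (norm ((1 / 2) *\<^sub>R (F x + G x))) powr p"
      have nn: "0 \<le> w" "0 \<le> a" "0 \<le> b" "0 \<le> d" "0 \<le> u" "0 \<le> v" "0 \<le> m"
        using weight_nonneg by (simp_all add: w_def a_def b_def d_def u_def v_def m_def)
      have e: "\<phi> x (norm (F x)) = ennreal a" "\<phi> x (norm (G x)) = ennreal b" "\<phi> x (norm (F x - G x)) = ennreal d"
        using x by (simp_all add: a_def b_def d_def ennreal_phi)
      have "d + C * m \<le> \<epsilon> * (a + b) + C * ((u + v) / 2)"
        using uc[OF x, of "F x" "G x"] by (simp add: a_def b_def d_def u_def v_def m_def)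
      then have "(d + C * m) * w \<le> (\<epsilon> * (a + b) + C * ((u + v) / 2)) * w"
        using nn by (intro mult_right_mono) auto
      then have "ennreal (d * w + C * (m * w)) \<le> ennreal (\<epsilon> * (a * w + b * w) + C / 2 * (u * w + v * w))"
        by (intro ennreal_leI) (simp add: algebra_simps add_divide_distrib)
      also have "ennreal (d * w + C * (m * w)) = ennreal d * ennreal w + ennreal C * (ennreal m * ennreal w)"
        using nn C by (simp add: ennreal_mult')
      also have "ennreal (\<epsilon> * (a * w + b * w) + C / 2 * (u * w + v * w)) =
         ennreal \<epsilon> * (ennreal a * ennreal w + ennreal b * ennreal w) + ennreal (C / 2) * (ennreal u * ennreal w + ennreal v * ennreal w)"
      proof -
        have e: "ennreal (s * (a * w + b * w)) = ennreal s * (ennreal a * ennreal w + ennreal b * ennreal w)"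
          if "0 \<le> s" "0 \<le> a" "0 \<le> b" for s a b
          using that nn(1) by (simp add: ennreal_mult')
        have "ennreal (\<epsilon> * (a * w + b * w) + C / 2 * (u * w + v * w)) =
          ennreal (\<epsilon> * (a * w + b * w)) + ennreal (C / 2 * (u * w + v * w))"
          using nn C \<epsilon> by (intro ennreal_plus) auto
        with e[of \<epsilon> a b] e[of "C / 2" u v] nn C \<epsilon> show ?thesis by simp
      qed
      finally show "?f ?d x + ennreal C * ?h ?m x \<le> ennreal \<epsilon> * (?f F x + ?f G x) + ennreal (C / 2) * (?h F x + ?h G x)"
        by (simp add: e w_def u_def v_def m_def)
    qed
    then show ?thesis
      unfolding modular_def convex_modular_def using mm
      by (simp add: nn_integral_add nn_integral_cmult)
  qed
  with C that show thesis by blast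
qed

lemma modular_midpoint:
  fixes F G :: "'a \<Rightarrow> 'b::euclidean_space"
  assumes [measurable]: "F \<in> borel_measurable M" "G \<in> borel_measurable M"
  shows "modular (\<lambda>x. norm ((1 / 2) *\<^sub>R (F x + G x))) \<le> ennreal (1 / 2) * (modular (\<lambda>x. norm (F x)) + modular (\<lambda>x. norm (G x)))"
proof -
  let ?f = "\<lambda>F x. \<phi> x \<bar>norm (F x)\<bar> * ennreal (\<omega> x)"
  have fm: "?f F \<in> borel_measurable M" if "F \<in> borel_measurable M" for F :: "'a \<Rightarrow> 'b"
    by (rule modular_integrand_measurable) (use that in measurable)
  have "modular (\<lambda>x. norm ((1 / 2) *\<^sub>R (F x + G x))) \<le> (\<integral>\<^sup>+x. ennreal (1 / 2) * (?f F x + ?f G x) \<partial>M)"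
    unfolding modular_def
  proof (rule nn_integral_mono)
    fix x assume "x \<in> space M"
    then have x: "x \<in> \<Omega>" by simp
    have "norm ((1 / 2) *\<^sub>R (F x + G x)) \<le> (1 / 2) * norm (F x) + (1 - 1 / 2) * norm (G x)"
      using norm_triangle_ineq[of "F x" "G x"] by simp
    then have "\<phi> x (norm ((1 / 2) *\<^sub>R (F x + G x))) \<le> \<phi> x ((1 / 2) * norm (F x) + (1 - 1 / 2) * norm (G x))"
      by (intro phi_mono[OF x]) auto
    also have "\<dots> \<le> ennreal (1 / 2) * \<phi> x (norm (F x)) + ennreal (1 - 1 / 2) * \<phi> x (norm (G x))"
      by (intro phi_convex[OF x]) auto
    finally have "\<phi> x (norm ((1 / 2) *\<^sub>R (F x + G x))) * ennreal (\<omega> x) \<le> (ennreal (1 / 2) * \<phi> x (norm (F x)) + ennreal (1 - 1 / 2) * \<phi> x (norm (G x))) * ennreal (\<omega> x)"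
      by (rule mult_right_mono) simp
    also have "\<dots> = ennreal (1 / 2) * (?f F x + ?f G x)"
      by (simp add: distrib_left distrib_right mult.assoc)
    finally show "?f (\<lambda>x. (1 / 2) *\<^sub>R (F x + G x)) x \<le> ennreal (1 / 2) * (?f F x + ?f G x)"
      by simp
  qed
  also have "\<dots> = ennreal (1 / 2) * (modular (\<lambda>x. norm (F x)) + modular (\<lambda>x. norm (G x)))"
    unfolding modular_def using fm[of F] fm[of G] by (simp add: nn_integral_add nn_integral_cmult)
  finally show ?thesis .
qed

end

subsection \<open>Sobolev spaces in terms of the modular\<close>

lemma AE_convergent_if_L1_summable:
  fixes f :: "nat \<Rightarrow> 'a \<Rightarrow> 'b::euclidean_space"
  assumes f[measurable]: "\<And>k. f k \<in> borel_measurable N"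
    and le: "\<And>k. (\<integral>\<^sup>+x. ennreal (norm (f (Suc k) x - f k x)) \<partial>N) \<le> ennreal ((1 / 2) ^ k)"
  shows "AE x in N. convergent (\<lambda>k. f k x)"
proof -
  have "(\<integral>\<^sup>+x. (\<Sum>k. ennreal (norm (f (Suc k) x - f k x))) \<partial>N) = (\<Sum>k. \<integral>\<^sup>+x. ennreal (norm (f (Suc k) x - f k x)) \<partial>N)"
    by (rule nn_integral_suminf) measurable
  also have "\<dots> \<le> (\<Sum>k. ennreal ((1 / 2) ^ k))" by (intro suminf_le le) auto
  also have "\<dots> = ennreal (\<Sum>k. (1 / 2) ^ k)" by (intro suminf_ennreal2 summable_geometric) auto
  finally have "(\<integral>\<^sup>+x. (\<Sum>k. ennreal (norm (f (Suc k) x - f k x))) \<partial>N) \<noteq> \<infinity>" by (auto simp: top_unique)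
  then have "AE x in N. (\<Sum>k. ennreal (norm (f (Suc k) x - f k x))) \<noteq> \<infinity>"
    by (intro nn_integral_PInf_AE) auto
  then show ?thesis
  proof eventually_elim
    case (elim x)
    then have "summable (\<lambda>k. norm (f (Suc k) x - f k x))"
      by (intro summable_suminf_not_top) auto
    then have "summable (\<lambda>k. f (Suc k) x - f k x)" by (rule summable_norm_cancel)
    then have "convergent (\<lambda>n. \<Sum>k<n. f (Suc k) x - f k x)" by (simp add: summable_iff_convergent)
    then have "convergent (\<lambda>n. f n x - f 0 x)" by (simp only: sum_lessThan_telescope[of "\<lambda>k. f k x"])
    then have "convergent (\<lambda>n. (f n x - f 0 x) + f 0 x)" by (intro convergent_add convergent_const)
    then show ?case by simp
  qed
qed

lemma ennreal_mult_double:
  "0 \<le> b \<Longrightarrow> 0 \<le> r \<Longrightarrow> ennreal b * (ennreal r + ennreal r) = ennreal (b * (r + r))"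
  by (simp add: ennreal_mult' ennreal_plus[symmetric] del: ennreal_plus)

lemma has_weak_gradient_spec:
  "has_weak_gradient \<Omega> f G \<Longrightarrow> has_weak_gradient \<Omega> f (weak_gradient \<Omega> f)"
  using someI[of "has_weak_gradient \<Omega> f" G] by (simp add: weak_gradient_def)

lemma set_integral_eq_lebesgue_on:
  fixes f :: "'a::euclidean_space \<Rightarrow> 'b::euclidean_space"
  assumes "\<Omega> \<in> sets lebesgue"
  shows "(LINT x:\<Omega>|lebesgue. f x) = (LINT x|lebesgue_on \<Omega>. f x)"
  using assms by (simp add: set_lebesgue_integral_def integral_restrict_space)

context Phi_A1
begin

abbreviation psi :: "'a \<Rightarrow> real \<Rightarrow> ennreal" where "psi \<equiv> \<lambda>x t. \<phi> x t * ennreal (\<omega> x)"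

lemma weak_gradient_AE:
  assumes "has_weak_gradient \<Omega> f G"
  shows "AE x in M. weak_gradient \<Omega> f x = G x"
  using has_weak_gradient_unique[OF open_Omega has_weak_gradient_spec[OF assms] assms]
  by (simp add: AE_restrict_space_iff)

lemma has_weak_gradient_measurable:
  "has_weak_gradient \<Omega> f G \<Longrightarrow> G \<in> borel_measurable M"
  unfolding has_weak_gradient_def using locally_integrable_on_imp_measurable[OF open_Omega] by blast

lemma finite_modular_integrable:
  fixes F :: "'a \<Rightarrow> 'b::euclidean_space"
  assumes F: "F \<in> borel_measurable M" and fin: "modular (\<lambda>x. norm (F x)) < \<infinity>"
  shows "integrable M F"
proof -
  obtain C where C: "\<And>f. f \<in> borel_measurable M \<Longrightarrow> (\<integral>\<^sup>+x. ennreal \<bar>f x\<bar> \<partial>M) \<le> ennreal C * (1 + modular f)"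
    using L1_bound by metis
  have "(\<integral>\<^sup>+x. ennreal (norm (F x)) \<partial>M) \<le> ennreal C * (1 + modular (\<lambda>x. norm (F x)))"
    using C[of "\<lambda>x. norm (F x)"] F by simp
  also have "\<dots> < \<infinity>" using fin by (simp add: ennreal_mult_less_top)
  finally show ?thesis using F by (simp add: integrable_iff_bounded)
qed

lemma finite_modular_locally_integrable:
  fixes F :: "'a \<Rightarrow> 'b::euclidean_space"
  assumes "F \<in> borel_measurable M" "modular (\<lambda>x. norm (F x)) < \<infinity>"
  shows "F locally_integrable_on \<Omega>"
proof -
  have "set_integrable lebesgue \<Omega> F"
    using finite_modular_integrable[OF assms] by (simp add: integrable_restrict_space set_integrable_def)
  moreover have "K \<in> sets lebesgue" if "compact K" for K :: "'a set"
    using borel_compact[OF that] by simp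
  ultimately show ?thesis
    unfolding locally_integrable_on_def by (blast intro: set_integrable_subset)
qed

text \<open>A bound B exceeds the level c of \<open>phi_unit_bounds\<close> by a fixed factor, which
  (aDec) controls; the weight of \<Omega> is finite. Hence every test function lies in the Sobolev
  space.\<close>

lemma modular_bounded_finite:
  assumes f: "\<And>x. \<bar>f x\<bar> \<le> B"
  shows "modular f < \<infinity>"
proof -
  obtain c C where c: "0 < c" "AE x in M. \<phi> x c \<le> 1 \<and> 1 \<le> \<phi> x C"
    using phi_unit_bounds by metis
  define a where "a = max 1 (B / c)"
  have a: "1 \<le> a" "B \<le> a * c" using c by (auto simp: a_def max_def field_simps)
  have "modular f \<le> (\<integral>\<^sup>+x. ennreal (L * a powr q) * ennreal (\<omega> x) \<partial>M)"
    unfolding modular_def using c(2) AE_space[of M]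
  proof (intro nn_integral_mono_AE, eventually_elim)
    case (elim x)
    then have x: "x \<in> \<Omega>" by simp
    have "\<phi> x \<bar>f x\<bar> \<le> \<phi> x (a * c)" using f[of x] a by (intro phi_mono[OF x]) auto
    also have "\<dots> \<le> ennreal (L * a powr q) * \<phi> x c" using a c by (intro phi_scale_ge[OF x]) auto
    also have "\<dots> \<le> ennreal (L * a powr q) * 1" using elim by (intro mult_left_mono) auto
    finally show ?case by (intro mult_right_mono) auto
  qed
  also have "\<dots> = ennreal (L * a powr q) * (\<integral>\<^sup>+x. ennreal (\<omega> x) \<partial>M)"
    by (rule nn_integral_cmult) measurable
  also have "(\<integral>\<^sup>+x. ennreal (\<omega> x) \<partial>M) = weight_measure \<omega> \<Omega>"
    unfolding weight_measure_def by (subst nn_integral_restrict_space) auto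
  also have "ennreal (L * a powr q) * weight_measure \<omega> \<Omega> < \<infinity>"
    using weight_Omega_finite by (simp add: ennreal_mult_less_top)
  finally show ?thesis .
qed

section \<open>Sobolev functions paired with a weak gradient\<close>

text \<open>\<open>weak_gradient\<close> is a choice determined only up to null sets, so it is
  linear only almost everywhere. Carrying a gradient G along gives exact linear
  combinations.\<close>

definition W_pair :: "('a \<Rightarrow> real) \<Rightarrow> ('a \<Rightarrow> 'a) \<Rightarrow> bool"
  where "W_pair f G \<longleftrightarrow> f \<in> borel_measurable M \<and> modular f < \<infinity> \<and>
    has_weak_gradient \<Omega> f G \<and> modular (\<lambda>x. norm (G x)) < \<infinity>"

text \<open>The closure of the test functions, expressed by the modular. Its agreement with the norm
  closure is the content of \<open>W0_pair_imp_sobolev_space_0\<close> and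
  \<open>sobolev_space_0_imp_W0_pair\<close>.\<close>

definition W0_pair :: "('a \<Rightarrow> real) \<Rightarrow> ('a \<Rightarrow> 'a) \<Rightarrow> bool"
  where "W0_pair f G \<longleftrightarrow> W_pair f G \<and> (\<forall>\<epsilon>>0. \<exists>\<eta>\<in>test_functions \<Omega>.
    modular (\<lambda>x. f x - \<eta> x) \<le> ennreal \<epsilon> \<and> modular (\<lambda>x. norm (G x - gradient \<eta> x)) \<le> ennreal \<epsilon>)"

lemma W_pairD:
  assumes "W_pair f G"
  shows "f \<in> borel_measurable M" "modular f < \<infinity>" "has_weak_gradient \<Omega> f G"
    "modular (\<lambda>x. norm (G x)) < \<infinity>" "G \<in> borel_measurable M" "f locally_integrable_on \<Omega>"
proof -
  show f: "f \<in> borel_measurable M" and m: "modular f < \<infinity>" and G: "has_weak_gradient \<Omega> f G"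
    and "modular (\<lambda>x. norm (G x)) < \<infinity>"
    using assms by (auto simp: W_pair_def)
  show "G \<in> borel_measurable M" by (rule has_weak_gradient_measurable[OF G])
  have "modular (\<lambda>x. norm (f x)) = modular f" by (rule modular_cong_AE) simp
  then show "f locally_integrable_on \<Omega>"
    using m by (intro finite_modular_locally_integrable f) simp
qed

lemma modular_weak_gradient:
  assumes "has_weak_gradient \<Omega> f G"
  shows "modular (\<lambda>x. norm (weak_gradient \<Omega> f x)) = modular (\<lambda>x. norm (G x))"
  using weak_gradient_AE[OF assms] by (intro modular_cong_AE) (auto elim: eventually_mono)

lemma sobolev_space_iff: "f \<in> sobolev_space \<Omega> psi \<longleftrightarrow> (\<exists>G. W_pair f G)"
proof
  assume f: "f \<in> sobolev_space \<Omega> psi"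
  define G where "G = weak_gradient \<Omega> f"
  have fm: "f \<in> borel_measurable M" and lf: "luxemburg_norm \<Omega> psi f < \<infinity>"
    and sn: "sobolev_norm \<Omega> psi f < \<infinity>" and "\<exists>G. has_weak_gradient \<Omega> f G"
    using f by (auto simp: sobolev_space_def orlicz_space_def)
  then have G: "has_weak_gradient \<Omega> f G" unfolding G_def using has_weak_gradient_spec by blast
  have Gm: "(\<lambda>x. norm (G x)) \<in> borel_measurable M" using has_weak_gradient_measurable[OF G] by measurable
  have "luxemburg_norm \<Omega> psi (\<lambda>x. norm (G x)) < \<infinity>"
    using sn by (simp add: sobolev_norm_def G_def)
  then have "W_pair f G"
    using fm lf G Gm by (simp add: W_pair_def luxemburg_finite_iff[unfolded infinity_ennreal_def] )
  then show "\<exists>G. W_pair f G" by blast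
next
  assume "\<exists>G. W_pair f G"
  then obtain G where W: "W_pair f G" by blast
  note G = W_pairD[OF W]
  have "weak_gradient \<Omega> f \<in> borel_measurable M"
    by (rule has_weak_gradient_measurable[OF has_weak_gradient_spec[OF G(3)]])
  then have m: "(\<lambda>x. norm (weak_gradient \<Omega> f x)) \<in> borel_measurable M" by measurable
  have "luxemburg_norm \<Omega> psi f < \<infinity>" using luxemburg_finite_iff[OF G(1)] G(2) by simp
  moreover have "luxemburg_norm \<Omega> psi (\<lambda>x. norm (weak_gradient \<Omega> f x)) < \<infinity>"
    using luxemburg_finite_iff[OF m] modular_weak_gradient[OF G(3)] G(4) by simp
  ultimately show "f \<in> sobolev_space \<Omega> psi"
    using G by (auto simp: sobolev_space_def orlicz_space_def sobolev_norm_def)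
qed

lemma W_pair_test_function:
  assumes \<eta>: "\<eta> \<in> test_functions \<Omega>"
  shows "W_pair \<eta> (gradient \<eta>)"
proof -
  obtain B where "\<And>x. \<bar>\<eta> x\<bar> \<le> B" using test_functions_bounded[OF \<eta>] by blast
  then have "modular \<eta> < \<infinity>" by (rule modular_bounded_finite)
  moreover obtain B' where "\<And>x. norm (gradient \<eta> x) \<le> B'" using test_functions_bounded_gradient[OF \<eta>] by blast
  then have "modular (\<lambda>x. norm (gradient \<eta> x)) < \<infinity>" by (intro modular_bounded_finite[of _ B']) simp
  ultimately show ?thesis
    using \<eta> by (simp add: W_pair_def test_functions_measurable has_weak_gradient_test_function)
qed

lemma modular_linear_combination:
  fixes F G :: "'a \<Rightarrow> 'b::euclidean_space"
  assumes [measurable]: "F \<in> borel_measurable M" "G \<in> borel_measurable M"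
  shows "modular (\<lambda>x. norm (a *\<^sub>R F x + b *\<^sub>R G x)) \<le>
    ennreal (D * (L * max 1 (max \<bar>a\<bar> \<bar>b\<bar>) powr q)) * (modular (\<lambda>x. norm (F x)) + modular (\<lambda>x. norm (G x)))"
proof -
  let ?m = "max 1 (max \<bar>a\<bar> \<bar>b\<bar>)"
  have "modular (\<lambda>x. norm (a *\<^sub>R F x + b *\<^sub>R G x)) \<le>
     ennreal D * (modular (\<lambda>x. ?m * norm (F x)) + modular (\<lambda>x. ?m * norm (G x)))"
  proof (rule modular_add)
    show "AE x in M. \<bar>norm (a *\<^sub>R F x + b *\<^sub>R G x)\<bar> \<le> \<bar>?m * norm (F x)\<bar> + \<bar>?m * norm (G x)\<bar>"
    proof (rule AE_I2)
      fix x
      have "norm (a *\<^sub>R F x + b *\<^sub>R G x) \<le> \<bar>a\<bar> * norm (F x) + \<bar>b\<bar> * norm (G x)"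
        using norm_triangle_ineq[of "a *\<^sub>R F x" "b *\<^sub>R G x"] by simp
      also have "\<dots> \<le> ?m * norm (F x) + ?m * norm (G x)"
        by (intro add_mono mult_right_mono) auto
      moreover have "\<bar>?m * norm y\<bar> = ?m * norm y" for y :: 'b
        by (intro abs_of_nonneg mult_nonneg_nonneg) auto
      ultimately show "\<bar>norm (a *\<^sub>R F x + b *\<^sub>R G x)\<bar> \<le> \<bar>?m * norm (F x)\<bar> + \<bar>?m * norm (G x)\<bar>"
        by (simp only: abs_norm_cancel)
    qed
  qed measurable
  also have "\<dots> \<le> ennreal D * (ennreal (L * ?m powr q) * modular (\<lambda>x. norm (F x)) + ennreal (L * ?m powr q) * modular (\<lambda>x. norm (G x)))"
    by (intro mult_left_mono add_mono modular_scale_ge) auto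
  also have "\<dots> = ennreal (D * (L * ?m powr q)) * (modular (\<lambda>x. norm (F x)) + modular (\<lambda>x. norm (G x)))"
    using D_ge_1 L by (simp add: ennreal_mult' distrib_left mult.assoc)
  finally show ?thesis .
qed

lemma modular_norm_real: "modular (\<lambda>x. norm (f x :: real)) = modular f" "modular (\<lambda>x. \<bar>f x\<bar>) = modular f"
  by (rule modular_cong_AE, simp)+

lemma has_weak_gradient_linear_combination:
  assumes f: "has_weak_gradient \<Omega> f F" "f locally_integrable_on \<Omega>"
    and g: "has_weak_gradient \<Omega> g G" "g locally_integrable_on \<Omega>"
  shows "has_weak_gradient \<Omega> (\<lambda>x. a * f x + b * g x) (\<lambda>x. a *\<^sub>R F x + b *\<^sub>R G x)"
  unfolding has_weak_gradient_def
proof (intro conjI ballI)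
  have FG: "F locally_integrable_on \<Omega>" "G locally_integrable_on \<Omega>"
    using f g by (auto simp: has_weak_gradient_def)
  then show "(\<lambda>x. a *\<^sub>R F x + b *\<^sub>R G x) locally_integrable_on \<Omega>"
    by (intro locally_integrable_on_add locally_integrable_on_scaleR)
  fix \<eta> :: "'a \<Rightarrow> real" and i :: 'a assume \<eta>: "\<eta> \<in> test_functions \<Omega>" and i: "i \<in> Basis"
  obtain S where S: "compact S" "S \<subseteq> \<Omega>" "\<And>x. x \<notin> S \<Longrightarrow> \<eta> x = 0" "\<And>x i. x \<notin> S \<Longrightarrow> partial_deriv i \<eta> x = 0"
    using \<eta> by (rule test_functions_supportE) blast
  have d: "set_integrable lebesgue \<Omega> (\<lambda>x. h x * partial_deriv i \<eta> x)" if "h locally_integrable_on \<Omega>" for h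
    by (rule locally_integrable_on_mult_compact_support[OF that test_functions_continuous_partial[OF \<eta> i] S(1,2,4)])
  have e: "set_integrable lebesgue \<Omega> (\<lambda>x. h x * \<eta> x)" if "h locally_integrable_on \<Omega>" for h
    by (rule locally_integrable_on_mult_compact_support[OF that test_functions_continuous[OF \<eta>] S(1,2,3)])
  have lin: "(LINT x:\<Omega>|lebesgue. a * u x + b * v x) = a * (LINT x:\<Omega>|lebesgue. u x) + b * (LINT x:\<Omega>|lebesgue. v x)"
    if "set_integrable lebesgue \<Omega> u" "set_integrable lebesgue \<Omega> v" for u v :: "'a \<Rightarrow> real"
    using that by (subst set_integral_add) simp_all
  have "(LINT x:\<Omega>|lebesgue. (a * f x + b * g x) * partial_deriv i \<eta> x) =
     (LINT x:\<Omega>|lebesgue. a * (f x * partial_deriv i \<eta> x) + b * (g x * partial_deriv i \<eta> x))"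
    by (simp add: distrib_right mult.assoc)
  also have "\<dots> = a * (LINT x:\<Omega>|lebesgue. f x * partial_deriv i \<eta> x) + b * (LINT x:\<Omega>|lebesgue. g x * partial_deriv i \<eta> x)"
    by (intro lin d f g)
  also have "\<dots> = a * (- (LINT x:\<Omega>|lebesgue. (F x \<bullet> i) * \<eta> x)) + b * (- (LINT x:\<Omega>|lebesgue. (G x \<bullet> i) * \<eta> x))"
    using f(1) g(1) \<eta> i by (simp add: has_weak_gradient_def)
  also have "\<dots> = - (LINT x:\<Omega>|lebesgue. a * ((F x \<bullet> i) * \<eta> x) + b * ((G x \<bullet> i) * \<eta> x))"
    by (subst lin) (auto intro!: e locally_integrable_on_inner FG)
  also have "\<dots> = - (LINT x:\<Omega>|lebesgue. (a *\<^sub>R F x + b *\<^sub>R G x) \<bullet> i * \<eta> x)"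
    by (simp add: inner_add_left distrib_right mult.assoc)
  finally show "(LINT x:\<Omega>|lebesgue. (a * f x + b * g x) * partial_deriv i \<eta> x) =
     - (LINT x:\<Omega>|lebesgue. (a *\<^sub>R F x + b *\<^sub>R G x) \<bullet> i * \<eta> x)" .
qed

lemma W_pair_linear_combination:
  assumes f: "W_pair f F" and g: "W_pair g G"
  shows "W_pair (\<lambda>x. a * f x + b * g x) (\<lambda>x. a *\<^sub>R F x + b *\<^sub>R G x)"
proof -
  note F = W_pairD[OF f] and G = W_pairD[OF g]
  have "modular (\<lambda>x. norm (a *\<^sub>R f x + b *\<^sub>R g x)) < \<infinity>"
    using F G by (intro order.strict_trans1[OF modular_linear_combination]) (auto simp: modular_norm_real ennreal_mult_less_top)
  then have "modular (\<lambda>x. a * f x + b * g x) < \<infinity>" by (simp only: modular_norm_real real_scaleR_def)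
  moreover have "modular (\<lambda>x. norm (a *\<^sub>R F x + b *\<^sub>R G x)) < \<infinity>"
    using F G by (intro order.strict_trans1[OF modular_linear_combination]) (auto simp: ennreal_mult_less_top)
  moreover have "has_weak_gradient \<Omega> (\<lambda>x. a * f x + b * g x) (\<lambda>x. a *\<^sub>R F x + b *\<^sub>R G x)"
    by (intro has_weak_gradient_linear_combination F G)
  moreover have "(\<lambda>x. a * f x + b * g x) \<in> borel_measurable M" using F(1) G(1) by measurable
  ultimately show ?thesis by (simp add: W_pair_def)
qed

lemma W0_pair_linear_combination:
  assumes f: "W0_pair f F" and g: "W0_pair g G"
  shows "W0_pair (\<lambda>x. a * f x + b * g x) (\<lambda>x. a *\<^sub>R F x + b *\<^sub>R G x)"
  unfolding W0_pair_def
proof (intro conjI allI impI)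
  have fW: "W_pair f F" and gW: "W_pair g G" using f g by (auto simp: W0_pair_def)
  show "W_pair (\<lambda>x. a * f x + b * g x) (\<lambda>x. a *\<^sub>R F x + b *\<^sub>R G x)"
    by (rule W_pair_linear_combination[OF fW gW])
  fix \<epsilon> :: real assume \<epsilon>: "0 < \<epsilon>"
  define B where "B = D * (L * max 1 (max \<bar>a\<bar> \<bar>b\<bar>) powr q)"
  have B: "0 < B" using D_ge_1 L by (simp add: B_def)
  define \<mu> where "\<mu> = \<epsilon> / (2 * B)"
  have \<mu>: "0 < \<mu>" using \<epsilon> B by (simp add: \<mu>_def)
  obtain \<eta> where \<eta>: "\<eta> \<in> test_functions \<Omega>" "modular (\<lambda>x. f x - \<eta> x) \<le> ennreal \<mu>" "modular (\<lambda>x. norm (F x - gradient \<eta> x)) \<le> ennreal \<mu>"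
    using f \<mu> unfolding W0_pair_def by blast
  obtain \<theta> where \<theta>: "\<theta> \<in> test_functions \<Omega>" "modular (\<lambda>x. g x - \<theta> x) \<le> ennreal \<mu>" "modular (\<lambda>x. norm (G x - gradient \<theta> x)) \<le> ennreal \<mu>"
    using g \<mu> unfolding W0_pair_def by blast
  have sum: "ennreal B * (u + v) \<le> ennreal \<epsilon>" if "u \<le> ennreal \<mu>" "v \<le> ennreal \<mu>" for u v
  proof -
    have "ennreal B * (u + v) \<le> ennreal B * (ennreal \<mu> + ennreal \<mu>)" by (intro mult_left_mono add_mono that) auto
    also have "\<dots> = ennreal (B * (\<mu> + \<mu>))" using B \<mu> by (intro ennreal_mult_double) auto
    also have "B * (\<mu> + \<mu>) = \<epsilon>" using B by (simp add: \<mu>_def)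
    finally show ?thesis .
  qed
  note m = W_pairD(1,5)[OF fW] W_pairD(1,5)[OF gW] test_functions_measurable[OF \<eta>(1)] test_functions_measurable[OF \<theta>(1)]
  define \<zeta> where "\<zeta> = (\<lambda>x. a * \<eta> x + b * \<theta> x)"
  have a\<eta>: "(\<lambda>x. a * \<eta> x) \<in> test_functions \<Omega>" "(\<lambda>x. b * \<theta> x) \<in> test_functions \<Omega>"
    using \<eta> \<theta> by (auto intro: test_functions_scale)
  have \<zeta>: "\<zeta> \<in> test_functions \<Omega>" unfolding \<zeta>_def by (intro test_functions_add a\<eta>)
  have g\<zeta>: "gradient \<zeta> x = a *\<^sub>R gradient \<eta> x + b *\<^sub>R gradient \<theta> x" for x
    unfolding \<zeta>_def by (simp add: gradient_add[OF a\<eta>] gradient_scale[OF \<eta>(1)] gradient_scale[OF \<theta>(1)])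
  have "modular (\<lambda>x. norm (a *\<^sub>R (f x - \<eta> x) + b *\<^sub>R (g x - \<theta> x))) \<le> ennreal \<epsilon>"
    using m \<eta>(2) \<theta>(2) unfolding B_def[symmetric]
    by (intro order_trans[OF modular_linear_combination[of "\<lambda>x. f x - \<eta> x" "\<lambda>x. g x - \<theta> x" a b, folded B_def] sum])
       (auto simp: modular_norm_real)
  moreover have "norm (a *\<^sub>R (f x - \<eta> x) + b *\<^sub>R (g x - \<theta> x)) = norm (a * f x + b * g x - \<zeta> x)" for x
    by (simp add: \<zeta>_def algebra_simps)
  ultimately have 1: "modular (\<lambda>x. a * f x + b * g x - \<zeta> x) \<le> ennreal \<epsilon>" by (simp only: modular_norm_real)
  have "modular (\<lambda>x. norm (a *\<^sub>R (F x - gradient \<eta> x) + b *\<^sub>R (G x - gradient \<theta> x))) \<le> ennreal \<epsilon>"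
    using m \<eta>(3) \<theta>(3)
    by (intro order_trans[OF modular_linear_combination[of "\<lambda>x. F x - gradient \<eta> x" "\<lambda>x. G x - gradient \<theta> x" a b, folded B_def] sum])
       auto
  moreover have "a *\<^sub>R (F x - gradient \<eta> x) + b *\<^sub>R (G x - gradient \<theta> x) = a *\<^sub>R F x + b *\<^sub>R G x - gradient \<zeta> x" for x
    by (simp add: g\<zeta> algebra_simps)
  ultimately have 2: "modular (\<lambda>x. norm (a *\<^sub>R F x + b *\<^sub>R G x - gradient \<zeta> x)) \<le> ennreal \<epsilon>" by (simp only:)
  show "\<exists>\<eta>\<in>test_functions \<Omega>. modular (\<lambda>x. a * f x + b * g x - \<eta> x) \<le> ennreal \<epsilon> \<and>
      modular (\<lambda>x. norm (a *\<^sub>R F x + b *\<^sub>R G x - gradient \<eta> x)) \<le> ennreal \<epsilon>"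
    using 1 2 \<zeta> by blast
qed

lemma W0_pair_zero: "W0_pair (\<lambda>x. 0) (\<lambda>x. 0)"
proof -
  have "partial_deriv i (\<lambda>x::'a. 0) x = 0" for i x
    by (rule partial_deriv_eq[OF has_derivative_const])
  then have g: "gradient (\<lambda>x. 0) = (\<lambda>x. 0::'a)"
    by (simp add: gradient_def fun_eq_iff)
  have "W_pair (\<lambda>x. 0) (\<lambda>x. 0)"
    using W_pair_test_function[OF test_functions_zero] by (simp add: g)
  moreover have "modular (\<lambda>x. 0) = 0"
    unfolding modular_def by (subst nn_integral_cong[of _ _ "\<lambda>_. 0"]) (simp_all add: phi_0)
  ultimately show ?thesis
    unfolding W0_pair_def using test_functions_zero[of \<Omega>] g by (auto intro!: bexI[of _ "\<lambda>x. 0"])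
qed

lemma W0_pair_imp_sobolev_space_0:
  assumes W0: "W0_pair f G"
  shows "f \<in> sobolev_space_0 \<Omega> psi"
  unfolding sobolev_space_0_def
proof (intro CollectI conjI allI impI)
  have W: "W_pair f G" using W0 by (simp add: W0_pair_def)
  then show "f \<in> sobolev_space \<Omega> psi" by (auto simp: sobolev_space_iff)
  fix \<epsilon> :: ennreal assume \<epsilon>: "0 < \<epsilon>"
  obtain e where e: "0 < e" "e \<le> 1" "ennreal (e + e) < \<epsilon>"
  proof -
    obtain y where y: "0 < y" "y < \<epsilon>" using dense[OF \<epsilon>] by blast
    then have "y \<noteq> 0" "y \<noteq> \<infinity>" by (auto simp: top.extremum_strict)
    then obtain r where r: "0 < r" "y = ennreal r" using ennreal_positive_finiteE by blast
    define e where "e = min 1 (r / 2)"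
    have "e + e \<le> r" by (simp add: e_def)
    then have "ennreal (e + e) \<le> y" unfolding r(2) by (rule ennreal_leI)
    then have "ennreal (e + e) < \<epsilon>" using y(2) by (rule le_less_trans)
    then show thesis using that[of e] r(1) by (simp add: e_def)
  qed
  define \<mu> where "\<mu> = 1 / (L * (1 / e) powr q)"
  have \<mu>: "0 < \<mu>" using L e by (simp add: \<mu>_def)
  obtain \<eta> where \<eta>: "\<eta> \<in> test_functions \<Omega>" "modular (\<lambda>x. f x - \<eta> x) \<le> ennreal \<mu>" "modular (\<lambda>x. norm (G x - gradient \<eta> x)) \<le> ennreal \<mu>"
    using W0 \<mu> unfolding W0_pair_def by blast
  have "W_pair (\<lambda>x. 1 * f x + (- 1) * \<eta> x) (\<lambda>x. 1 *\<^sub>R G x + (- 1) *\<^sub>R gradient \<eta> x)"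
    by (rule W_pair_linear_combination[OF W W_pair_test_function[OF \<eta>(1)]])
  then have D: "W_pair (\<lambda>x. f x - \<eta> x) (\<lambda>x. G x - gradient \<eta> x)" by simp
  note D = W_pairD[OF D]
  have "luxemburg_norm \<Omega> psi (\<lambda>x. f x - \<eta> x) \<le> ennreal e"
    using \<eta>(2) e unfolding \<mu>_def by (intro luxemburg_le_if_modular_le D)
  moreover have "luxemburg_norm \<Omega> psi (\<lambda>x. norm (weak_gradient \<Omega> (\<lambda>x. f x - \<eta> x) x)) \<le> ennreal e"
  proof (rule luxemburg_le_if_modular_le[OF _ e(1,2)])
    have "weak_gradient \<Omega> (\<lambda>x. f x - \<eta> x) \<in> borel_measurable M"
      by (rule has_weak_gradient_measurable[OF has_weak_gradient_spec[OF D(3)]])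
    then show "(\<lambda>x. norm (weak_gradient \<Omega> (\<lambda>x. f x - \<eta> x) x)) \<in> borel_measurable M" by measurable
    show "modular (\<lambda>x. norm (weak_gradient \<Omega> (\<lambda>x. f x - \<eta> x) x)) \<le> ennreal (1 / (L * (1 / e) powr q))"
      using \<eta>(3) by (simp add: modular_weak_gradient[OF D(3)] \<mu>_def)
  qed
  ultimately have "sobolev_norm \<Omega> psi (\<lambda>x. f x - \<eta> x) \<le> ennreal e + ennreal e"
    unfolding sobolev_norm_def by (rule add_mono)
  also have "\<dots> = ennreal (e + e)" using e by (intro ennreal_plus[symmetric]) auto
  also have "\<dots> < \<epsilon>" by (rule e)
  finally have "sobolev_norm \<Omega> psi (\<lambda>x. f x - \<eta> x) < \<epsilon>" .
  moreover have "\<eta> \<in> sobolev_space \<Omega> psi"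
    using W_pair_test_function[OF \<eta>(1)] by (auto simp: sobolev_space_iff)
  ultimately show "\<exists>\<eta>\<in>test_functions \<Omega> \<inter> sobolev_space \<Omega> psi. sobolev_norm \<Omega> psi (\<lambda>x. f x - \<eta> x) < \<epsilon>"
    using \<eta>(1) by blast
qed

lemma sobolev_space_0_imp_W0_pair:
  assumes f: "f \<in> sobolev_space_0 \<Omega> psi"
  obtains G where "W0_pair f G"
proof -
  have "f \<in> sobolev_space \<Omega> psi" using f by (simp add: sobolev_space_0_def)
  then obtain G where W: "W_pair f G" by (auto simp: sobolev_space_iff)
  have "\<exists>\<eta>\<in>test_functions \<Omega>. modular (\<lambda>x. f x - \<eta> x) \<le> ennreal \<epsilon> \<and> modular (\<lambda>x. norm (G x - gradient \<eta> x)) \<le> ennreal \<epsilon>"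
    if \<epsilon>: "0 < \<epsilon>" for \<epsilon>
  proof -
    define e where "e = min 1 \<epsilon>"
    have e: "0 < ennreal e" "e \<le> 1" "e \<le> \<epsilon>" using \<epsilon> by (auto simp: e_def)
    obtain \<eta> where \<eta>: "\<eta> \<in> test_functions \<Omega>" "sobolev_norm \<Omega> psi (\<lambda>x. f x - \<eta> x) < ennreal e"
      using f e(1) unfolding sobolev_space_0_def by blast
    have "W_pair (\<lambda>x. 1 * f x + (- 1) * \<eta> x) (\<lambda>x. 1 *\<^sub>R G x + (- 1) *\<^sub>R gradient \<eta> x)"
      by (rule W_pair_linear_combination[OF W W_pair_test_function[OF \<eta>(1)]])
    then have D: "W_pair (\<lambda>x. f x - \<eta> x) (\<lambda>x. G x - gradient \<eta> x)" by simp
    note D = W_pairD[OF D]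
    have "luxemburg_norm \<Omega> psi (\<lambda>x. f x - \<eta> x) \<le> sobolev_norm \<Omega> psi (\<lambda>x. f x - \<eta> x)"
      by (simp add: sobolev_norm_def)
    then have "modular (\<lambda>x. f x - \<eta> x) \<le> ennreal e"
      using \<eta>(2) by (intro modular_le_if_luxemburg_less D e) (rule le_less_trans)
    moreover have "modular (\<lambda>x. norm (weak_gradient \<Omega> (\<lambda>x. f x - \<eta> x) x)) \<le> ennreal e"
    proof (rule modular_le_if_luxemburg_less[OF _ _ e(2)])
      have "weak_gradient \<Omega> (\<lambda>x. f x - \<eta> x) \<in> borel_measurable M"
        by (rule has_weak_gradient_measurable[OF has_weak_gradient_spec[OF D(3)]])
      then show "(\<lambda>x. norm (weak_gradient \<Omega> (\<lambda>x. f x - \<eta> x) x)) \<in> borel_measurable M" by measurable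
      have "luxemburg_norm \<Omega> psi (\<lambda>x. norm (weak_gradient \<Omega> (\<lambda>x. f x - \<eta> x) x)) \<le> sobolev_norm \<Omega> psi (\<lambda>x. f x - \<eta> x)"
        by (simp add: sobolev_norm_def)
      then show "luxemburg_norm \<Omega> psi (\<lambda>x. norm (weak_gradient \<Omega> (\<lambda>x. f x - \<eta> x) x)) < ennreal e"
        using \<eta>(2) by (rule le_less_trans)
    qed
    ultimately show ?thesis
      using \<eta>(1) ennreal_leI[OF e(3)] modular_weak_gradient[OF D(3)] by (metis order_trans)
  qed
  with W have "W0_pair f G" by (simp add: W0_pair_def)
  with that show thesis .
qed

text \<open>Density extends the inequality from test functions. Both the passage from G to the
  gradient of \<eta> and the return from \<eta> to f cost a factor D on two summands, hence the
  divisors 2 D.\<close>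

lemma W0_pair_Poincare:
  assumes \<epsilon>: "0 < \<epsilon>"
  obtains \<delta> where "0 < \<delta>"
    "\<And>f G. W0_pair f G \<Longrightarrow> modular (\<lambda>x. norm (G x)) \<le> ennreal \<delta> \<Longrightarrow> modular f \<le> ennreal \<epsilon>"
proof -
  define \<epsilon>1 where "\<epsilon>1 = \<epsilon> / (2 * D)"
  have \<epsilon>1: "0 < \<epsilon>1" using \<epsilon> D_ge_1 by (simp add: \<epsilon>1_def)
  obtain \<delta>1 where \<delta>1: "0 < \<delta>1"
    "\<And>\<eta>. \<eta> \<in> test_functions \<Omega> \<Longrightarrow> modular (\<lambda>x. norm (gradient \<eta> x)) \<le> ennreal \<delta>1 \<Longrightarrow> modular \<eta> \<le> ennreal \<epsilon>1"
    using modular_Poincare[OF \<epsilon>1] by blast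
  define \<delta> where "\<delta> = \<delta>1 / (2 * D)"
  have \<delta>: "0 < \<delta>" using \<delta>1 D_ge_1 by (simp add: \<delta>_def)
  have double: "ennreal D * (ennreal (r / (2 * D)) + ennreal (r / (2 * D))) = ennreal r" if "0 < r" for r
  proof -
    have "ennreal D * (ennreal (r / (2 * D)) + ennreal (r / (2 * D))) = ennreal (D * (r / (2 * D) + r / (2 * D)))"
      using that D_ge_1 by (intro ennreal_mult_double) auto
    also have "D * (r / (2 * D) + r / (2 * D)) = r" using D_ge_1 by (simp add: field_simps)
    finally show ?thesis .
  qed
  have "modular f \<le> ennreal \<epsilon>" if W0: "W0_pair f G" and le: "modular (\<lambda>x. norm (G x)) \<le> ennreal \<delta>" for f G
  proof -
    have "0 < min \<delta> \<epsilon>1" using \<delta> \<epsilon>1 by simp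
    then obtain \<eta> where \<eta>: "\<eta> \<in> test_functions \<Omega>" "modular (\<lambda>x. f x - \<eta> x) \<le> ennreal (min \<delta> \<epsilon>1)"
        "modular (\<lambda>x. norm (G x - gradient \<eta> x)) \<le> ennreal (min \<delta> \<epsilon>1)"
      using W0 unfolding W0_pair_def by blast
    have \<eta>': "modular (\<lambda>x. f x - \<eta> x) \<le> ennreal \<epsilon>1" "modular (\<lambda>x. norm (G x - gradient \<eta> x)) \<le> ennreal \<delta>"
      by (rule order_trans[OF \<eta>(2) ennreal_leI], simp) (rule order_trans[OF \<eta>(3) ennreal_leI], simp)
    have "W_pair f G" using W0 by (simp add: W0_pair_def)
    note m[measurable] = W_pairD(1,5)[OF this] test_functions_measurable(1,3)[OF \<eta>(1)]
    have "modular (\<lambda>x. norm (gradient \<eta> x)) \<le> ennreal D * (modular (\<lambda>x. norm (G x)) + modular (\<lambda>x. norm (G x - gradient \<eta> x)))"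
    proof (rule modular_add)
      show "AE x in M. \<bar>norm (gradient \<eta> x)\<bar> \<le> \<bar>norm (G x)\<bar> + \<bar>norm (G x - gradient \<eta> x)\<bar>"
      proof (rule AE_I2)
        fix x
        show "\<bar>norm (gradient \<eta> x)\<bar> \<le> \<bar>norm (G x)\<bar> + \<bar>norm (G x - gradient \<eta> x)\<bar>"
          using norm_triangle_ineq4[of "G x" "G x - gradient \<eta> x"] by simp
      qed
    qed measurable
    also have "\<dots> \<le> ennreal D * (ennreal \<delta> + ennreal \<delta>)"
      by (intro mult_left_mono add_mono le \<eta>') simp
    also have "\<dots> = ennreal \<delta>1" unfolding \<delta>_def by (rule double[OF \<delta>1(1)])
    finally have "modular \<eta> \<le> ennreal \<epsilon>1" by (rule \<delta>1(2)[OF \<eta>(1)])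
    have "modular f \<le> ennreal D * (modular (\<lambda>x. f x - \<eta> x) + modular \<eta>)"
      by (rule modular_add) auto
    also have "\<dots> \<le> ennreal D * (ennreal \<epsilon>1 + ennreal \<epsilon>1)"
      by (intro mult_left_mono add_mono \<eta>' \<open>modular \<eta> \<le> ennreal \<epsilon>1\<close>) simp
    also have "\<dots> = ennreal \<epsilon>" unfolding \<epsilon>1_def by (rule double[OF \<epsilon>])
    finally show ?thesis .
  qed
  with \<delta> that show thesis by blast
qed

section \<open>Closedness under convergence in the modular\<close>

text \<open>Small modular implies small L^1 norm, and the defect in the integration by parts formula
  is continuous in L^1 because \<eta> and its derivatives are bounded. It vanishes for the
  approximating pairs.\<close>

lemma has_weak_gradient_limit:
  assumes f: "f \<in> borel_measurable M" "modular f < \<infinity>" and G: "G \<in> borel_measurable M" "modular (\<lambda>x. norm (G x)) < \<infinity>"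
    and approx: "\<And>\<epsilon>. 0 < \<epsilon> \<Longrightarrow> \<exists>g H. W_pair g H \<and> modular (\<lambda>x. f x - g x) \<le> ennreal \<epsilon> \<and> modular (\<lambda>x. norm (G x - H x)) \<le> ennreal \<epsilon>"
  shows "has_weak_gradient \<Omega> f G"
  unfolding has_weak_gradient_def
proof (intro conjI ballI)
  show "G locally_integrable_on \<Omega>" by (rule finite_modular_locally_integrable[OF G])
  fix \<eta> :: "'a \<Rightarrow> real" and i :: 'a assume \<eta>: "\<eta> \<in> test_functions \<Omega>" and i: "i \<in> Basis"
  obtain B1 where B1: "0 < B1" "\<And>x. \<bar>\<eta> x\<bar> \<le> B1" using test_functions_bounded[OF \<eta>] by blast
  obtain B2 where B2: "0 < B2" "\<And>x. norm (gradient \<eta> x) \<le> B2" using test_functions_bounded_gradient[OF \<eta>] by blast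
  define B where "B = max B1 B2"
  have B: "0 < B" "\<And>x. \<bar>\<eta> x\<bar> \<le> B" "\<And>x. \<bar>partial_deriv i \<eta> x\<bar> \<le> B"
  proof -
    show "0 < B" using B1 by (simp add: B_def)
    show "\<bar>\<eta> x\<bar> \<le> B" for x using B1(2)[of x] by (simp add: B_def)
    show "\<bar>partial_deriv i \<eta> x\<bar> \<le> B" for x
      using Basis_le_norm[OF i, of "gradient \<eta> x"] B2(2)[of x] by (simp add: gradient_inner[OF i] B_def)
  qed
  have [measurable]: "\<eta> \<in> borel_measurable M" "gradient \<eta> \<in> borel_measurable M"
    by (rule test_functions_measurable[OF \<eta>])+
  then have "(\<lambda>x. gradient \<eta> x \<bullet> i) \<in> borel_measurable M" by measurable
  then have [measurable]: "partial_deriv i \<eta> \<in> borel_measurable M" by (simp add: gradient_inner[OF i])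
  have int: "integrable M (\<lambda>x. u x * v x)"
    if "integrable M u" "v \<in> borel_measurable M" "\<And>x. \<bar>v x\<bar> \<le> B" for u v :: "'a \<Rightarrow> real"
  proof (rule Bochner_Integration.integrable_bound)
    show "integrable M (\<lambda>x. B * u x)" using that(1) by simp
    show "(\<lambda>x. u x * v x) \<in> borel_measurable M" using that by measurable
    show "AE x in M. norm (u x * v x) \<le> norm (B * u x)"
    proof (rule AE_I2)
      fix x
      have "\<bar>u x\<bar> * \<bar>v x\<bar> \<le> \<bar>u x\<bar> * B" by (intro mult_left_mono that) simp
      then show "norm (u x * v x) \<le> norm (B * u x)" using B(1) by (simp add: abs_mult mult.commute)
    qed
  qed
  have bound: "ennreal \<bar>LINT x|M. u x * v x\<bar> \<le> ennreal B * (\<integral>\<^sup>+x. ennreal \<bar>u x\<bar> \<partial>M)"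
    if "integrable M u" "v \<in> borel_measurable M" "\<And>x. \<bar>v x\<bar> \<le> B" for u v :: "'a \<Rightarrow> real"
  proof -
    have "ennreal (norm (LINT x|M. u x * v x)) \<le> (\<integral>\<^sup>+x. ennreal (norm (u x * v x)) \<partial>M)"
      by (rule integral_norm_bound_ennreal[OF int[OF that]])
    also have "\<dots> \<le> (\<integral>\<^sup>+x. ennreal B * ennreal \<bar>u x\<bar> \<partial>M)"
    proof (rule nn_integral_mono)
      fix x
      have "\<bar>u x\<bar> * \<bar>v x\<bar> \<le> \<bar>u x\<bar> * B" by (intro mult_left_mono that) simp
      then have "\<bar>u x * v x\<bar> \<le> B * \<bar>u x\<bar>" by (simp add: abs_mult mult.commute[of B])
      then show "ennreal (norm (u x * v x)) \<le> ennreal B * ennreal \<bar>u x\<bar>"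
        using B(1) by (simp add: ennreal_leI flip: ennreal_mult')
    qed
    also have "\<dots> = ennreal B * (\<integral>\<^sup>+x. ennreal \<bar>u x\<bar> \<partial>M)"
      using borel_measurable_integrable[OF that(1)] by (intro nn_integral_cmult) measurable
    finally show ?thesis by simp
  qed
  have fi: "integrable M f" using finite_modular_integrable[of f] f by (simp add: modular_norm_real)
  have Gi: "integrable M G" by (rule finite_modular_integrable[OF G])
  \<comment> \<open>The defect in the formula; it is shown to be at most a constant multiple of
    every positive number.\<close>
  define X where "X = (LINT x|M. f x * partial_deriv i \<eta> x) + (LINT x|M. (G x \<bullet> i) * \<eta> x)"
  have "\<bar>X\<bar> \<le> 2 * B * \<epsilon>" if \<epsilon>: "0 < \<epsilon>" for \<epsilon>
  proof -
    obtain \<delta> where \<delta>: "0 < \<delta>" "\<And>f. f \<in> borel_measurable M \<Longrightarrow> modular f \<le> ennreal \<delta> \<Longrightarrow> (\<integral>\<^sup>+x. ennreal \<bar>f x\<bar> \<partial>M) \<le> ennreal \<epsilon>"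
      using modular_small_imp_L1_small[OF \<epsilon>] by blast
    obtain g H where gH: "W_pair g H" "modular (\<lambda>x. f x - g x) \<le> ennreal \<delta>" "modular (\<lambda>x. norm (G x - H x)) \<le> ennreal \<delta>"
      using approx[OF \<delta>(1)] by blast
    note W = W_pairD[OF gH(1)]
    have gi: "integrable M g" using finite_modular_integrable[of g] W by (simp add: modular_norm_real)
    have Hi: "integrable M H" by (rule finite_modular_integrable[OF W(5,4)])
    have "(LINT x:\<Omega>|lebesgue. g x * partial_deriv i \<eta> x) = - (LINT x:\<Omega>|lebesgue. (H x \<bullet> i) * \<eta> x)"
      using W(3) \<eta> i by (simp add: has_weak_gradient_def)
    then have 0: "(LINT x|M. g x * partial_deriv i \<eta> x) + (LINT x|M. (H x \<bullet> i) * \<eta> x) = 0"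
      by (simp add: set_integral_eq_lebesgue_on)
    have d1: "(LINT x|M. (f x - g x) * partial_deriv i \<eta> x) = (LINT x|M. f x * partial_deriv i \<eta> x) - (LINT x|M. g x * partial_deriv i \<eta> x)"
      unfolding left_diff_distrib using fi gi B by (intro Bochner_Integration.integral_diff int) auto
    have d2: "(LINT x|M. ((G x - H x) \<bullet> i) * \<eta> x) = (LINT x|M. (G x \<bullet> i) * \<eta> x) - (LINT x|M. (H x \<bullet> i) * \<eta> x)"
      unfolding left_diff_distrib inner_diff_left using Gi Hi B by (intro Bochner_Integration.integral_diff int) auto
    have X: "X = (LINT x|M. (f x - g x) * partial_deriv i \<eta> x) + (LINT x|M. ((G x - H x) \<bullet> i) * \<eta> x)"
      using 0 unfolding X_def d1 d2 by simp
    have "ennreal \<bar>LINT x|M. (f x - g x) * partial_deriv i \<eta> x\<bar> \<le> ennreal B * (\<integral>\<^sup>+x. ennreal \<bar>f x - g x\<bar> \<partial>M)"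
      using fi gi B by (intro bound) auto
    also have "\<dots> \<le> ennreal B * ennreal \<epsilon>"
      using f W gH by (intro mult_left_mono \<delta>(2)) auto
    finally have "ennreal \<bar>LINT x|M. (f x - g x) * partial_deriv i \<eta> x\<bar> \<le> ennreal (B * \<epsilon>)"
      using B by (simp add: ennreal_mult')
    then have 1: "\<bar>LINT x|M. (f x - g x) * partial_deriv i \<eta> x\<bar> \<le> B * \<epsilon>"
      using B \<epsilon> by (subst (asm) ennreal_le_iff) auto
    have "ennreal \<bar>LINT x|M. ((G x - H x) \<bullet> i) * \<eta> x\<bar> \<le> ennreal B * (\<integral>\<^sup>+x. ennreal \<bar>(G x - H x) \<bullet> i\<bar> \<partial>M)"
      using Gi Hi B by (intro bound) auto
    also have "\<dots> \<le> ennreal B * (\<integral>\<^sup>+x. ennreal \<bar>norm (G x - H x)\<bar> \<partial>M)"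
      using Basis_le_norm[OF i] by (intro mult_left_mono nn_integral_mono ennreal_leI) auto
    also have "\<dots> \<le> ennreal B * ennreal \<epsilon>"
    proof (intro mult_left_mono \<delta>(2))
      show "(\<lambda>x. norm (G x - H x)) \<in> borel_measurable M" using G(1) W(5) by measurable
    qed (use gH in auto)
    finally have "ennreal \<bar>LINT x|M. ((G x - H x) \<bullet> i) * \<eta> x\<bar> \<le> ennreal (B * \<epsilon>)"
      using B by (simp add: ennreal_mult')
    then have 2: "\<bar>LINT x|M. ((G x - H x) \<bullet> i) * \<eta> x\<bar> \<le> B * \<epsilon>"
      using B \<epsilon> by (subst (asm) ennreal_le_iff) auto
    show ?thesis using 1 2 unfolding X by linarith
  qed
  then have "\<bar>X\<bar> \<le> \<epsilon>" if "0 < \<epsilon>" for \<epsilon>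
    using that B(1) by (metis (no_types) divide_pos_pos mult_pos_pos nonzero_mult_div_cancel_left times_divide_eq_right zero_less_numeral less_irrefl)
  then have "X = 0" by (metis abs_le_zero_iff field_le_epsilon add_0)
  then show "(LINT x:\<Omega>|lebesgue. f x * partial_deriv i \<eta> x) = - (LINT x:\<Omega>|lebesgue. (G x \<bullet> i) * \<eta> x)"
    by (simp add: set_integral_eq_lebesgue_on X_def)
qed

text \<open>The finiteness of both modulars is not assumed: it follows by comparison with an
  approximating pair at distance 1.\<close>

lemma W0_pair_limit:
  assumes f: "f \<in> borel_measurable M" and G: "G \<in> borel_measurable M"
    and approx: "\<And>\<epsilon>. 0 < \<epsilon> \<Longrightarrow> \<exists>g H. W0_pair g H \<and> modular (\<lambda>x. f x - g x) \<le> ennreal \<epsilon> \<and> modular (\<lambda>x. norm (G x - H x)) \<le> ennreal \<epsilon>"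
  shows "W0_pair f G"
proof -
  have tri: "modular (\<lambda>x. norm (F x - K x)) \<le> ennreal D * (modular (\<lambda>x. norm (F x - H x)) + modular (\<lambda>x. norm (H x - K x)))"
    if [measurable]: "F \<in> borel_measurable M" "H \<in> borel_measurable M" "K \<in> borel_measurable M"
    for F H K :: "'a \<Rightarrow> 'c::euclidean_space"
  proof (rule modular_add)
    show "AE x in M. \<bar>norm (F x - K x)\<bar> \<le> \<bar>norm (F x - H x)\<bar> + \<bar>norm (H x - K x)\<bar>"
      using norm_triangle_ineq[of "F x - H x" "H x - K x" for x] by (intro AE_I2) simp
  qed measurable
  obtain g H where gH: "W0_pair g H" "modular (\<lambda>x. f x - g x) \<le> ennreal 1" "modular (\<lambda>x. norm (G x - H x)) \<le> ennreal 1"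
    using approx[of 1] by auto
  have "W_pair g H" using gH by (simp add: W0_pair_def)
  note W = W_pairD[OF this]
  have "modular (\<lambda>x. norm (f x - 0)) \<le> ennreal D * (modular (\<lambda>x. norm (f x - g x)) + modular (\<lambda>x. norm (g x - 0)))"
    by (rule tri) (use f W in auto)
  also have "\<dots> < \<infinity>"
    using W le_less_trans[OF gH(2) ennreal_less_top] by (simp add: modular_norm_real ennreal_mult_less_top)
  finally have fm: "modular f < \<infinity>" by (simp add: modular_norm_real)
  have "modular (\<lambda>x. norm (G x - 0)) \<le> ennreal D * (modular (\<lambda>x. norm (G x - H x)) + modular (\<lambda>x. norm (H x - 0)))"
    by (rule tri) (use G W in auto)
  also have "\<dots> < \<infinity>"
    using W le_less_trans[OF gH(3) ennreal_less_top] by (simp add: ennreal_mult_less_top)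
  finally have Gm: "modular (\<lambda>x. norm (G x)) < \<infinity>" by simp
  have "has_weak_gradient \<Omega> f G"
    using approx by (intro has_weak_gradient_limit[OF f fm G Gm]) (auto simp: W0_pair_def, blast)
  then have WfG: "W_pair f G" using f fm Gm by (simp add: W_pair_def)
  have "\<exists>\<eta>\<in>test_functions \<Omega>. modular (\<lambda>x. f x - \<eta> x) \<le> ennreal \<epsilon> \<and> modular (\<lambda>x. norm (G x - gradient \<eta> x)) \<le> ennreal \<epsilon>"
    if \<epsilon>: "0 < \<epsilon>" for \<epsilon>
  proof -
    define \<mu> where "\<mu> = \<epsilon> / (2 * D)"
    have \<mu>: "0 < \<mu>" using \<epsilon> D_ge_1 by (simp add: \<mu>_def)
    have double: "ennreal D * (ennreal \<mu> + ennreal \<mu>) = ennreal \<epsilon>"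
    proof -
      have "ennreal D * (ennreal \<mu> + ennreal \<mu>) = ennreal (D * (\<mu> + \<mu>))"
        using D_ge_1 \<mu> by (intro ennreal_mult_double) auto
      also have "D * (\<mu> + \<mu>) = \<epsilon>" using D_ge_1 by (simp add: \<mu>_def field_simps)
      finally show ?thesis .
    qed
    obtain g H where gH: "W0_pair g H" "modular (\<lambda>x. f x - g x) \<le> ennreal \<mu>" "modular (\<lambda>x. norm (G x - H x)) \<le> ennreal \<mu>"
      using approx[OF \<mu>] by blast
    have "W_pair g H" using gH by (simp add: W0_pair_def)
    note W = W_pairD[OF this]
    obtain \<eta> where \<eta>: "\<eta> \<in> test_functions \<Omega>" "modular (\<lambda>x. g x - \<eta> x) \<le> ennreal \<mu>" "modular (\<lambda>x. norm (H x - gradient \<eta> x)) \<le> ennreal \<mu>"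
      using gH(1) \<mu> unfolding W0_pair_def by blast
    note m = test_functions_measurable[OF \<eta>(1)]
    have "modular (\<lambda>x. norm (f x - \<eta> x)) \<le> ennreal D * (modular (\<lambda>x. norm (f x - g x)) + modular (\<lambda>x. norm (g x - \<eta> x)))"
      by (rule tri) (use f W m in auto)
    also have "\<dots> \<le> ennreal D * (ennreal \<mu> + ennreal \<mu>)"
      unfolding modular_norm_real by (intro mult_left_mono add_mono gH \<eta>) simp
    finally have 1: "modular (\<lambda>x. f x - \<eta> x) \<le> ennreal \<epsilon>" unfolding modular_norm_real double .
    have "modular (\<lambda>x. norm (G x - gradient \<eta> x)) \<le> ennreal D * (modular (\<lambda>x. norm (G x - H x)) + modular (\<lambda>x. norm (H x - gradient \<eta> x)))"
      by (rule tri) (use G W m in auto)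
    also have "\<dots> \<le> ennreal D * (ennreal \<mu> + ennreal \<mu>)"
      by (intro mult_left_mono add_mono gH \<eta>) simp
    finally have 2: "modular (\<lambda>x. norm (G x - gradient \<eta> x)) \<le> ennreal \<epsilon>" unfolding double .
    show ?thesis using 1 2 \<eta>(1) by blast
  qed
  with WfG show ?thesis by (simp add: W0_pair_def)
qed

subsection \<open>Existence of minimizers\<close>

lemma energy_eq_modular:
  assumes "has_weak_gradient \<Omega> v G"
  shows "energy \<Omega> psi v = modular (\<lambda>x. norm (G x))"
proof -
  have "energy \<Omega> psi v = modular (\<lambda>x. norm (weak_gradient \<Omega> v x))"
    unfolding energy_def modular_def by (subst nn_integral_restrict_space) auto
  then show ?thesis by (simp add: modular_weak_gradient[OF assms])
qed

text \<open>Among the almost minimizers of the energy, those that almost minimize the uniformly convex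
  functional form a Cauchy sequence.\<close>

lemma Cauchy_minimizing_sequence:
  assumes Gz: "Gz \<in> borel_measurable M" "modular (\<lambda>x. norm (Gz x)) < \<infinity>"
    and \<mu>: "0 \<le> \<mu>" "(INF a\<in>{(w, G). W0_pair w G}. modular (\<lambda>x. norm (Gz x + snd a x))) = ennreal \<mu>"
  obtains w G where "\<And>j. W0_pair (w j) (G j)"
    "\<And>j. modular (\<lambda>x. norm (Gz x + G j x)) \<le> ennreal (\<mu> + inverse (real (Suc j)))"
    "\<And>\<epsilon>. 0 < \<epsilon> \<Longrightarrow> \<exists>N. \<forall>i\<ge>N. \<forall>j\<ge>N. modular (\<lambda>x. norm (G i x - G j x)) \<le> ennreal \<epsilon>"
proof -
  define S where "S = {(w, G). W0_pair w G}"
  define E where "E G = modular (\<lambda>x. norm (Gz x + G x))" for G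
  define H where "H G = convex_modular (\<lambda>x. Gz x + G x)" for G :: "'a \<Rightarrow> 'a"
  define t where "t j = inverse (real (Suc j))" for j
  have t: "0 < t j" "t j \<le> 1" for j by (auto simp: t_def field_simps)
  have t_mono: "t k \<le> t j" if "j \<le> k" for j k
    unfolding t_def using that by (intro le_imp_inverse_le) auto
  define Sj where "Sj j = {a\<in>S. E (snd a) \<le> ennreal (\<mu> + t j)}" for j
  have Gm: "(\<lambda>x. Gz x + G x) \<in> borel_measurable M" if "W0_pair w G" for w G
    using Gz(1) W_pairD(5)[of w G] that by (simp add: W0_pair_def borel_measurable_add)
  have Sj_ne: "Sj j \<noteq> {}" for j
  proof -
    have "(INF a\<in>S. E (snd a)) < ennreal (\<mu> + t j)"
      using \<mu> t[of j] by (simp add: S_def E_def ennreal_less_iff)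
    then obtain a where "a \<in> S" "E (snd a) < ennreal (\<mu> + t j)" unfolding INF_less_iff by blast
    then have "a \<in> Sj j" by (simp add: Sj_def)
    then show ?thesis by blast
  qed
  have Sj_mono: "Sj k \<subseteq> Sj j" if "j \<le> k" for j k
  proof -
    have "ennreal (\<mu> + t k) \<le> ennreal (\<mu> + t j)" using t_mono[OF that] by (intro ennreal_leI) simp
    then show ?thesis unfolding Sj_def by (auto intro: order_trans)
  qed
  define d where "d j = (INF a\<in>Sj j. H (snd a))" for j
  define B where "B = L * (\<mu> + 1)"
  have B: "0 \<le> B" using L \<mu> by (simp add: B_def)
  have H_le: "H (snd a) \<le> ennreal B" if "a \<in> Sj j" for a j
  proof -
    have "H (snd a) \<le> ennreal L * E (snd a)"
      unfolding H_def E_def using that Gm by (intro convex_modular_le) (auto simp: Sj_def S_def)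
    also have "\<dots> \<le> ennreal L * ennreal (\<mu> + t j)"
      using that by (intro mult_left_mono) (auto simp: Sj_def)
    also have "\<dots> \<le> ennreal B"
    proof -
      have "ennreal L * ennreal (\<mu> + t j) = ennreal (L * (\<mu> + t j))"
        using L by (intro ennreal_mult'[symmetric]) simp
      moreover have "L * (\<mu> + t j) \<le> B" unfolding B_def using L t[of j] by (intro mult_left_mono) auto
      ultimately show ?thesis by (simp only: ennreal_leI)
    qed
    finally show ?thesis .
  qed
  have d_le: "d j \<le> ennreal B" for j
  proof -
    obtain a where a: "a \<in> Sj j" using Sj_ne by blast
    then have "d j \<le> H (snd a)" unfolding d_def by (rule INF_lower)
    with H_le[OF a] show ?thesis by (rule order_trans[rotated])
  qed
  define \<delta> where "\<delta> j = enn2real (d j)" for j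
  have \<delta>: "d j = ennreal (\<delta> j)" "0 \<le> \<delta> j" "\<delta> j \<le> B" for j
  proof -
    have "d j < top" using d_le[of j] by (rule le_less_trans) simp
    then show "d j = ennreal (\<delta> j)" by (simp add: \<delta>_def)
    show "0 \<le> \<delta> j" by (simp add: \<delta>_def)
    show "\<delta> j \<le> B" using d_le[of j] B unfolding \<open>d j = ennreal (\<delta> j)\<close> by (subst (asm) ennreal_le_iff) auto
  qed
  have d_mono: "\<delta> j \<le> \<delta> k" if "j \<le> k" for j k
  proof -
    have "d j \<le> d k" unfolding d_def using Sj_mono[OF that] by (rule INF_superset_mono) auto
    then show ?thesis using \<delta> by simp
  qed
  have "\<exists>a\<in>Sj j. H (snd a) < ennreal (\<delta> j + t j)" for j
  proof -
    have "d j < ennreal (\<delta> j + t j)" using \<delta>[of j] t[of j] by (simp add: ennreal_less_iff)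
    then show ?thesis by (simp add: d_def INF_less_iff)
  qed
  then obtain a where a: "\<And>j. a j \<in> Sj j" "\<And>j. H (snd (a j)) < ennreal (\<delta> j + t j)" by metis
  define w G where "w j = fst (a j)" and "G j = snd (a j)" for j
  have W0: "W0_pair (w j) (G j)" and En: "E (G j) \<le> ennreal (\<mu> + t j)" for j
    using a(1)[of j] by (auto simp: Sj_def S_def w_def G_def)
  \<comment> \<open>The sets \<open>Sj j\<close> shrink, so the infima increase; they are bounded
    because the convex functional is at most L times the energy.\<close>
  have "convergent \<delta>"
  proof -
    have "incseq \<delta>" using d_mono by (auto simp: incseq_def)
    then obtain l where "\<delta> \<longlonglongrightarrow> l" using incseq_convergent[of \<delta> B] \<delta>(3) by metis
    then show ?thesis by (auto simp: convergent_def)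
  qed
  then have Cauchy: "Cauchy \<delta>" by (simp add: Cauchy_convergent_iff)
  have step: "\<exists>N. \<forall>j\<ge>N. \<forall>k\<ge>j. modular (\<lambda>x. norm (G j x - G k x)) \<le> ennreal \<epsilon>" if \<epsilon>: "0 < \<epsilon>" for \<epsilon>
  proof -
    define e where "e = min 1 (\<epsilon> / (4 * (\<mu> + 1)))"
    have e: "0 < e" "e \<le> 1" "e * (2 * (\<mu> + 1)) \<le> \<epsilon> / 2"
    proof -
      show "0 < e" "e \<le> 1" using \<epsilon> \<mu> by (auto simp: e_def)
      have "e * (2 * (\<mu> + 1)) \<le> \<epsilon> / (4 * (\<mu> + 1)) * (2 * (\<mu> + 1))"
        using \<mu> by (intro mult_right_mono) (auto simp: e_def)
      also have "\<dots> = \<epsilon> / 2" using \<mu> by (simp add: field_simps)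
      finally show "e * (2 * (\<mu> + 1)) \<le> \<epsilon> / 2" .
    qed
    obtain C where C: "0 \<le> C"
      "\<And>F K :: 'a \<Rightarrow> 'a. F \<in> borel_measurable M \<Longrightarrow> K \<in> borel_measurable M \<Longrightarrow>
      modular (\<lambda>x. norm (F x - K x)) + ennreal C * convex_modular (\<lambda>x. (1 / 2) *\<^sub>R (F x + K x)) \<le>
      ennreal e * (modular (\<lambda>x. norm (F x)) + modular (\<lambda>x. norm (K x))) +
      ennreal (C / 2) * (convex_modular F + convex_modular K)"
      using uniform_convexity_modular[OF e(1,2), where 'b = 'a] by blast
    \<comment> \<open>The quantity estimated by 4 \<epsilon>' is (\<delta> k - \<delta> j) + 2 t j,
      which stays below 3 \<epsilon>'. Dividing by C + 1 avoids the case C = 0.\<close>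
    define \<epsilon>' where "\<epsilon>' = \<epsilon> / (4 * (C + 1))"
    have \<epsilon>': "0 < \<epsilon>'" "C / 2 * (4 * \<epsilon>') \<le> \<epsilon> / 2"
    proof -
      show "0 < \<epsilon>'" using \<epsilon> C by (simp add: \<epsilon>'_def)
      have "C * \<epsilon> \<le> (C + 1) * \<epsilon>" using \<epsilon> by simp
      then show "C / 2 * (4 * \<epsilon>') \<le> \<epsilon> / 2" using C by (simp add: \<epsilon>'_def field_simps)
    qed
    obtain N1 where N1: "\<And>j k. N1 \<le> j \<Longrightarrow> N1 \<le> k \<Longrightarrow> dist (\<delta> j) (\<delta> k) < \<epsilon>'"
      using Cauchy \<epsilon>'(1) unfolding Cauchy_def by blast
    obtain N2 where N2: "t N2 < \<epsilon>'" unfolding t_def using reals_Archimedean[OF \<epsilon>'(1)] by auto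
    have "modular (\<lambda>x. norm (G j x - G k x)) \<le> ennreal \<epsilon>" if jN: "max N1 N2 \<le> j" and jk: "j \<le> k" for j k
    proof -
      \<comment> \<open>Convexity of the energy keeps the midpoint in the larger set
        \<open>Sj j\<close>, so the convex functional at the midpoint is at least \<delta>
        j.\<close>
      define K where "K = (\<lambda>x. (1 / 2) *\<^sub>R G j x + (1 / 2) *\<^sub>R G k x)"
      have mid: "(1 / 2) *\<^sub>R ((Gz x + G j x) + (Gz x + G k x)) = Gz x + K x" for x
      proof -
        have "(1 / 2) *\<^sub>R Gz x + (1 / 2) *\<^sub>R Gz x = Gz x" by (simp flip: scaleR_left.add)
        then show ?thesis unfolding K_def by (simp add: scaleR_add_right add_ac)
      qed
      have diff: "(Gz x + G j x) - (Gz x + G k x) = G j x - G k x" for x by simp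
      have W0K: "W0_pair (\<lambda>x. 1 / 2 * w j x + 1 / 2 * w k x) K"
        unfolding K_def by (rule W0_pair_linear_combination[OF W0 W0])
      have tkj: "t k \<le> t j" by (rule t_mono[OF jk])
      have Ek: "E (G k) \<le> ennreal (\<mu> + t j)" 
        by (rule order_trans[OF En ennreal_leI]) (use tkj in simp)
      have "E K \<le> ennreal (1 / 2) * (E (G j) + E (G k))"
        using modular_midpoint[OF Gm[OF W0[of j]] Gm[OF W0[of k]]] unfolding mid by (simp add: E_def)
      also have "\<dots> \<le> ennreal (1 / 2) * (ennreal (\<mu> + t j) + ennreal (\<mu> + t j))"
        by (intro mult_left_mono add_mono En Ek) simp
      also have "\<dots> = ennreal (1 / 2 * ((\<mu> + t j) + (\<mu> + t j)))"
        using \<mu> t[of j] by (intro ennreal_mult_double) auto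
      also have "1 / 2 * ((\<mu> + t j) + (\<mu> + t j)) = \<mu> + t j" by simp
      finally have "(\<lambda>x. 1 / 2 * w j x + 1 / 2 * w k x, K) \<in> Sj j"
        using W0K by (simp add: Sj_def S_def)
      then have "d j \<le> H K" unfolding d_def by (rule INF_lower2) simp
      define X where "X = modular (\<lambda>x. norm (G j x - G k x))"
      have "X + ennreal C * d j \<le> X + ennreal C * H K" by (intro add_left_mono mult_left_mono \<open>d j \<le> H K\<close>) simp
      also have "\<dots> \<le> ennreal e * (E (G j) + E (G k)) + ennreal (C / 2) * (H (G j) + H (G k))"
        using C(2)[OF Gm[OF W0[of j]] Gm[OF W0[of k]]] unfolding mid diff by (simp add: E_def H_def X_def)
      also have "\<dots> \<le> ennreal e * (ennreal (\<mu> + 1) + ennreal (\<mu> + 1)) + ennreal (C / 2) * (ennreal (\<delta> j + t j) + ennreal (\<delta> k + t j))"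
      proof (intro add_mono mult_left_mono)
        have "ennreal (\<mu> + t j) \<le> ennreal (\<mu> + 1)" using t[of j] by (intro ennreal_leI) simp
        then show "E (G j) \<le> ennreal (\<mu> + 1)" "E (G k) \<le> ennreal (\<mu> + 1)" using En[of j] Ek by (auto intro: order_trans)
        show "H (G j) \<le> ennreal (\<delta> j + t j)" using a(2)[of j] by (simp add: G_def less_imp_le)
        have "ennreal (\<delta> k + t k) \<le> ennreal (\<delta> k + t j)" using tkj by (intro ennreal_leI) simp
        then show "H (G k) \<le> ennreal (\<delta> k + t j)" using a(2)[of k] by (simp add: G_def)
      qed simp_all
      also have "\<dots> = ennreal (e * (2 * (\<mu> + 1)) + C / 2 * (\<delta> j + \<delta> k + 2 * t j))"
      proof -
        have 1: "ennreal e * (ennreal (\<mu> + 1) + ennreal (\<mu> + 1)) = ennreal (e * (2 * (\<mu> + 1)))"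
        proof -
          have "ennreal e * (ennreal (\<mu> + 1) + ennreal (\<mu> + 1)) = ennreal (e * ((\<mu> + 1) + (\<mu> + 1)))"
            using e \<mu> by (intro ennreal_mult_double) auto
          also have "(\<mu> + 1) + (\<mu> + 1) = 2 * (\<mu> + 1)" by simp
          finally show ?thesis .
        qed
        have "ennreal (\<delta> j + t j) + ennreal (\<delta> k + t j) = ennreal (\<delta> j + \<delta> k + 2 * t j)"
          using \<delta>(2) t[of j] by (subst ennreal_plus[symmetric]) (auto simp: algebra_simps add_nonneg_nonneg less_imp_le)
        then have 2: "ennreal (C / 2) * (ennreal (\<delta> j + t j) + ennreal (\<delta> k + t j)) = ennreal (C / 2 * (\<delta> j + \<delta> k + 2 * t j))"
          using C by (simp add: ennreal_mult'[symmetric])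
        have n1: "0 \<le> e * (2 * (\<mu> + 1))" and n2: "0 \<le> C / 2 * (\<delta> j + \<delta> k + 2 * t j)"
          using e \<mu> C \<delta>(2) t[of j] by (simp_all add: add_nonneg_nonneg less_imp_le)
        show ?thesis unfolding 1 2 by (rule ennreal_plus[symmetric, OF n1 n2])
      qed
      finally have le: "X + ennreal (C * \<delta> j) \<le> ennreal (e * (2 * (\<mu> + 1)) + C / 2 * (\<delta> j + \<delta> k + 2 * t j))"
        using C by (simp add: \<delta>(1) ennreal_mult')
      then have "X \<noteq> top" by (auto simp: top_unique)
      then obtain x where x: "X = ennreal x" "0 \<le> x" by (cases X) auto
      have "ennreal (x + C * \<delta> j) \<le> ennreal (e * (2 * (\<mu> + 1)) + C / 2 * (\<delta> j + \<delta> k + 2 * t j))"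
        using le x C \<delta>(2)[of j] by (subst ennreal_plus) auto
      then have "x + C * \<delta> j \<le> e * (2 * (\<mu> + 1)) + C / 2 * (\<delta> j + \<delta> k + 2 * t j)"
        using e \<mu> C \<delta>(2) t[of j] by (subst (asm) ennreal_le_iff) (auto intro!: add_nonneg_nonneg mult_nonneg_nonneg less_imp_le)
      \<comment> \<open>The terms of size C \<delta> j cancel; what remains is the increment of the
        infima and the slack t j.\<close>
      then have "x \<le> e * (2 * (\<mu> + 1)) + C / 2 * ((\<delta> k - \<delta> j) + 2 * t j)"
        by (simp add: algebra_simps add_divide_distrib diff_divide_distrib)
      also have "\<dots> \<le> \<epsilon> / 2 + C / 2 * (4 * \<epsilon>')"
      proof (intro add_mono e(3) mult_left_mono)
        have "\<delta> k - \<delta> j < \<epsilon>'" using N1[of j k] jN jk by (simp add: dist_real_def)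
        moreover have "t j < \<epsilon>'" using N2 t_mono[of N2 j] jN by simp
        ultimately show "(\<delta> k - \<delta> j) + 2 * t j \<le> 4 * \<epsilon>'" using \<epsilon>'(1) by linarith
      qed (use C in simp)
      also have "\<dots> \<le> \<epsilon>" using \<epsilon>'(2) by simp
      finally show ?thesis unfolding X_def[symmetric] x(1) by (rule ennreal_leI)
    qed
    then show ?thesis by blast
  qed
  have "\<exists>N. \<forall>i\<ge>N. \<forall>j\<ge>N. modular (\<lambda>x. norm (G i x - G j x)) \<le> ennreal \<epsilon>" if "0 < \<epsilon>" for \<epsilon>
  proof -
    obtain N where N: "\<And>j k. N \<le> j \<Longrightarrow> j \<le> k \<Longrightarrow> modular (\<lambda>x. norm (G j x - G k x)) \<le> ennreal \<epsilon>"
      using step[OF \<open>0 < \<epsilon>\<close>] by blast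
    have "modular (\<lambda>x. norm (G i x - G j x)) \<le> ennreal \<epsilon>" if "N \<le> i" "N \<le> j" for i j
      using N[of i j] N[of j i] that by (cases "i \<le> j") (auto simp: norm_minus_commute)
    then show ?thesis by blast
  qed
  with W0 En show thesis using that[of w G] unfolding E_def t_def by blast
qed

text \<open>Completeness by hand: the Poincare inequality makes the functions Cauchy together with
  their gradients, a fast L^1-Cauchy subsequence converges almost everywhere, and Fatou's lemma
  upgrades this to convergence in the modular.\<close>

lemma W0_pair_Cauchy_limit:
  assumes W0: "\<And>j. W0_pair (w j) (G j)"
    and Cauchy: "\<And>\<epsilon>. 0 < \<epsilon> \<Longrightarrow> \<exists>N. \<forall>i\<ge>N. \<forall>j\<ge>N. modular (\<lambda>x. norm (G i x - G j x)) \<le> ennreal \<epsilon>"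
  obtains r u F where "\<And>k. k \<le> r k" "W0_pair u F" "AE x in M. (\<lambda>k. G (r k) x) \<longlonglongrightarrow> F x"
proof -
  have W: "W_pair (w j) (G j)" for j using W0[of j] by (simp add: W0_pair_def)
  note m[measurable] = W_pairD(1,5)[OF W]
  have W0_diff: "W0_pair (\<lambda>x. w i x - w j x) (\<lambda>x. G i x - G j x)" for i j
    using W0_pair_linear_combination[OF W0[of i] W0[of j], of 1 "-1"] by simp
  define P where "P \<epsilon> i j \<longleftrightarrow> modular (\<lambda>x. norm (G i x - G j x)) \<le> ennreal \<epsilon> \<and> modular (\<lambda>x. w i x - w j x) \<le> ennreal \<epsilon> \<and>
     (\<integral>\<^sup>+x. ennreal (norm (G i x - G j x)) \<partial>M) \<le> ennreal \<epsilon> \<and> (\<integral>\<^sup>+x. ennreal (norm (w i x - w j x)) \<partial>M) \<le> ennreal \<epsilon>" for \<epsilon> i j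
  have "\<exists>N. \<forall>i\<ge>N. \<forall>j\<ge>N. P \<epsilon> i j" if \<epsilon>: "0 < \<epsilon>" for \<epsilon>
  proof -
    obtain \<delta>1 where \<delta>1: "0 < \<delta>1" "\<And>f. f \<in> borel_measurable M \<Longrightarrow> modular f \<le> ennreal \<delta>1 \<Longrightarrow> (\<integral>\<^sup>+x. ennreal \<bar>f x\<bar> \<partial>M) \<le> ennreal \<epsilon>"
      using modular_small_imp_L1_small[OF \<epsilon>] by blast
    define \<epsilon>1 where "\<epsilon>1 = min \<epsilon> \<delta>1"
    have \<epsilon>1: "0 < \<epsilon>1" using \<epsilon> \<delta>1 by (simp add: \<epsilon>1_def)
    obtain \<delta>2 where \<delta>2: "0 < \<delta>2" "\<And>f G. W0_pair f G \<Longrightarrow> modular (\<lambda>x. norm (G x)) \<le> ennreal \<delta>2 \<Longrightarrow> modular f \<le> ennreal \<epsilon>1"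
      using W0_pair_Poincare[OF \<epsilon>1] by blast
    define \<delta> where "\<delta> = min \<epsilon>1 \<delta>2"
    have "0 < \<delta>" using \<epsilon>1 \<delta>2 by (simp add: \<delta>_def)
    then obtain N where N: "\<And>i j. N \<le> i \<Longrightarrow> N \<le> j \<Longrightarrow> modular (\<lambda>x. norm (G i x - G j x)) \<le> ennreal \<delta>"
      using Cauchy by blast
    have le: "ennreal \<delta> \<le> ennreal \<delta>2" "ennreal \<delta> \<le> ennreal \<epsilon>1" "ennreal \<epsilon>1 \<le> ennreal \<epsilon>" "ennreal \<epsilon>1 \<le> ennreal \<delta>1"
      by (auto simp: \<delta>_def \<epsilon>1_def intro!: ennreal_leI)
    have "P \<epsilon> i j"
      if ij: "N \<le> i" "N \<le> j" for i j
    proof -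
      have g: "modular (\<lambda>x. norm (G i x - G j x)) \<le> ennreal \<epsilon>1" using N[OF ij] le(2) by (rule order_trans)
      have f: "modular (\<lambda>x. w i x - w j x) \<le> ennreal \<epsilon>1"
        by (rule \<delta>2(2)[OF W0_diff]) (rule order_trans[OF N[OF ij] le(1)])
      have "(\<integral>\<^sup>+x. ennreal \<bar>norm (G i x - G j x)\<bar> \<partial>M) \<le> ennreal \<epsilon>"
        by (rule \<delta>1(2)) (measurable, rule order_trans[OF g le(4)])
      moreover have "(\<integral>\<^sup>+x. ennreal \<bar>w i x - w j x\<bar> \<partial>M) \<le> ennreal \<epsilon>"
        by (rule \<delta>1(2)) (measurable, rule order_trans[OF f le(4)])
      ultimately show ?thesis using order_trans[OF g le(3)] order_trans[OF f le(3)] by (simp add: P_def)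
    qed
    then show ?thesis by blast
  qed
  then have "\<forall>k. \<exists>N. \<forall>i\<ge>N. \<forall>j\<ge>N. P ((1 / 2) ^ k) i j" by simp
  then obtain N where N: "\<And>k i j. N k \<le> i \<Longrightarrow> N k \<le> j \<Longrightarrow> P ((1 / 2) ^ k) i j"
    using choice[of "\<lambda>k N. \<forall>i\<ge>N. \<forall>j\<ge>N. P ((1 / 2) ^ k) i j"] by blast
  \<comment> \<open>The sum makes r i at least N k for all k \<le> i; the summand k gives k \<le> r
    k, by which energy bounds along the subsequence are read off.\<close>
  define r where "r k = k + (\<Sum>i\<le>k. N i)" for k
  have rk: "k \<le> r k" for k by (simp add: r_def)
  have rN: "N k \<le> r i" if "k \<le> i" for k i
    using that member_le_sum[of k "{..i}" N] by (simp add: r_def)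
  define f H where "f k = w (r k)" and "H k = G (r k)" for k
  have fH: "modular (\<lambda>x. norm (H i x - H j x)) \<le> ennreal ((1 / 2) ^ k)" "modular (\<lambda>x. f i x - f j x) \<le> ennreal ((1 / 2) ^ k)"
     "(\<integral>\<^sup>+x. ennreal (norm (H i x - H j x)) \<partial>M) \<le> ennreal ((1 / 2) ^ k)" "(\<integral>\<^sup>+x. ennreal (norm (f i x - f j x)) \<partial>M) \<le> ennreal ((1 / 2) ^ k)"
    if "k \<le> i" "k \<le> j" for i j k
    using N[OF rN[OF that(1)] rN[OF that(2)]] by (simp_all add: f_def H_def P_def)
  have fm[measurable]: "f k \<in> borel_measurable M" "H k \<in> borel_measurable M" for k by (simp_all add: f_def H_def m)
  have cH: "AE x in M. convergent (\<lambda>k. H k x)"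
    by (rule AE_convergent_if_L1_summable) (use fH in auto)
  have cf: "AE x in M. convergent (\<lambda>k. f k x)"
    by (rule AE_convergent_if_L1_summable) (use fH in auto)
  define u F where "u x = lim (\<lambda>k. f k x)" and "F x = lim (\<lambda>k. H k x)" for x
  have um[measurable]: "u \<in> borel_measurable M" and Fm[measurable]: "F \<in> borel_measurable M"
    unfolding u_def[abs_def] F_def[abs_def] by (rule borel_measurable_lim_metric, rule fm)+
  have lf: "AE x in M. (\<lambda>k. f k x) \<longlonglongrightarrow> u x"
    using cf by eventually_elim (simp add: u_def convergent_LIMSEQ_iff)
  have lH: "AE x in M. (\<lambda>k. H k x) \<longlonglongrightarrow> F x"
    using cH by eventually_elim (simp add: F_def convergent_LIMSEQ_iff)
  have liminf_le: "liminf g \<le> c" if "\<And>i. k \<le> i \<Longrightarrow> g i \<le> c" for g :: "nat \<Rightarrow> ennreal" and c k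
  proof -
    have "liminf g \<le> limsup g" by (rule Liminf_le_Limsup) simp
    also have "\<dots> \<le> c" by (intro Limsup_bounded eventually_sequentiallyI[of k] that)
    finally show ?thesis .
  qed
  have du: "modular (\<lambda>x. u x - f k x) \<le> ennreal ((1 / 2) ^ k)" for k
  proof -
    \<comment> \<open>Fatou's lemma in i with k fixed: the Cauchy bound survives in the limit as a
      rate of convergence.\<close>
    have "modular (\<lambda>x. u x - f k x) \<le> liminf (\<lambda>i. modular (\<lambda>x. f i x - f k x))"
    proof (rule modular_Fatou)
      show "AE x in M. (\<lambda>i. \<bar>f i x - f k x\<bar>) \<longlonglongrightarrow> \<bar>u x - f k x\<bar>"
        using lf by eventually_elim (intro tendsto_intros)
    qed measurable
    also have "\<dots> \<le> ennreal ((1 / 2) ^ k)" by (rule liminf_le[of k]) (rule fH, auto)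
    finally show ?thesis .
  qed
  have dF: "modular (\<lambda>x. norm (F x - H k x)) \<le> ennreal ((1 / 2) ^ k)" for k
  proof -
    have "modular (\<lambda>x. norm (F x - H k x)) \<le> liminf (\<lambda>i. modular (\<lambda>x. norm (H i x - H k x)))"
    proof (rule modular_Fatou)
      show "AE x in M. (\<lambda>i. \<bar>norm (H i x - H k x)\<bar>) \<longlonglongrightarrow> \<bar>norm (F x - H k x)\<bar>"
        using lH by eventually_elim (intro tendsto_intros)
    qed measurable
    also have "\<dots> \<le> ennreal ((1 / 2) ^ k)" by (rule liminf_le[of k]) (rule fH, auto)
    finally show ?thesis .
  qed
  have "W0_pair u F"
  proof (rule W0_pair_limit[OF um Fm])
    fix \<epsilon> :: real assume "0 < \<epsilon>"
    then obtain k where k: "(1 / 2) ^ k < \<epsilon>" using real_arch_pow_inv[of \<epsilon> "1 / 2"] by auto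
    then have "ennreal ((1 / 2) ^ k) \<le> ennreal \<epsilon>" by (intro ennreal_leI) simp
    then have "modular (\<lambda>x. u x - f k x) \<le> ennreal \<epsilon>" "modular (\<lambda>x. norm (F x - H k x)) \<le> ennreal \<epsilon>"
      using du[of k] dF[of k] by (auto intro: order_trans)
    moreover have "W0_pair (f k) (H k)" by (simp add: f_def H_def W0)
    ultimately show "\<exists>g H. W0_pair g H \<and> modular (\<lambda>x. u x - g x) \<le> ennreal \<epsilon> \<and> modular (\<lambda>x. norm (F x - H x)) \<le> ennreal \<epsilon>"
      by blast
  qed
  with rk lH show thesis using that[of r u F] by (simp add: H_def)
qed

lemma W0_pair_minimizer:
  assumes Gz: "Gz \<in> borel_measurable M" "modular (\<lambda>x. norm (Gz x)) < \<infinity>"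
  obtains u F where "W0_pair u F"
    "\<And>w G. W0_pair w G \<Longrightarrow> modular (\<lambda>x. norm (Gz x + F x)) \<le> modular (\<lambda>x. norm (Gz x + G x))"
proof -
  define m where "m = (INF a\<in>{(w, G). W0_pair w G}. modular (\<lambda>x. norm (Gz x + snd a x)))"
  have m_le: "m \<le> modular (\<lambda>x. norm (Gz x + G x))" if "W0_pair w G" for w G
    unfolding m_def by (rule INF_lower2[of "(w, G)"]) (use that in auto)
  \<comment> \<open>The competitor w = 0 shows that the infimum is finite.\<close>
  have "m \<le> modular (\<lambda>x. norm (Gz x))" using m_le[OF W0_pair_zero] by simp
  then have "m < \<infinity>" using Gz(2) by (rule le_less_trans)
  then obtain \<mu> where \<mu>: "m = ennreal \<mu>" "0 \<le> \<mu>" by (cases m) auto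
  obtain w G where wG: "\<And>j. W0_pair (w j) (G j)"
    "\<And>j. modular (\<lambda>x. norm (Gz x + G j x)) \<le> ennreal (\<mu> + inverse (real (Suc j)))"
    "\<And>\<epsilon>. 0 < \<epsilon> \<Longrightarrow> \<exists>N. \<forall>i\<ge>N. \<forall>j\<ge>N. modular (\<lambda>x. norm (G i x - G j x)) \<le> ennreal \<epsilon>"
    using Cauchy_minimizing_sequence[OF Gz \<mu>(2) \<mu>(1)[unfolded m_def]] by blast
  obtain r u F where u: "\<And>k. k \<le> r k" "W0_pair u F" "AE x in M. (\<lambda>k. G (r k) x) \<longlonglongrightarrow> F x"
    using W0_pair_Cauchy_limit[OF wG(1,3)] by blast
  have Gm: "G j \<in> borel_measurable M" for j using W_pairD(5)[of "w j" "G j"] wG(1)[of j] by (simp add: W0_pair_def)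
  have "modular (\<lambda>x. norm (Gz x + F x)) \<le> liminf (\<lambda>k. modular (\<lambda>x. norm (Gz x + G (r k) x)))"
  proof (rule modular_Fatou)
    show "(\<lambda>x. norm (Gz x + G (r k) x)) \<in> borel_measurable M" for k using Gz(1) Gm by measurable
    show "AE x in M. (\<lambda>k. \<bar>norm (Gz x + G (r k) x)\<bar>) \<longlonglongrightarrow> \<bar>norm (Gz x + F x)\<bar>"
      using u(3) by eventually_elim (intro tendsto_intros)
  qed
  also have "\<dots> \<le> liminf (\<lambda>k. ennreal (\<mu> + inverse (real (Suc k))))"
  proof (intro Liminf_mono always_eventually allI)
    fix k
    \<comment> \<open>Passing to the subsequence only improves the energy bound.\<close>
    have "inverse (real (Suc (r k))) \<le> inverse (real (Suc k))" using u(1)[of k] by (intro le_imp_inverse_le) auto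
    then show "modular (\<lambda>x. norm (Gz x + G (r k) x)) \<le> ennreal (\<mu> + inverse (real (Suc k)))"
      by (intro order_trans[OF wG(2)] ennreal_leI) simp
  qed
  also have "\<dots> = ennreal \<mu>"
  proof (rule lim_imp_Liminf)
    have "(\<lambda>k. \<mu> + inverse (real (Suc k))) \<longlonglongrightarrow> \<mu> + 0"
      by (intro tendsto_add tendsto_const LIMSEQ_inverse_real_of_nat)
    then show "(\<lambda>k. ennreal (\<mu> + inverse (real (Suc k)))) \<longlonglongrightarrow> ennreal \<mu>" by (intro tendsto_ennrealI) simp
  qed simp
  finally have "modular (\<lambda>x. norm (Gz x + F x)) \<le> m" by (simp add: \<mu>)
  then show thesis using that[OF u(2)] m_le order_trans by blast
qed

lemma energy_minimizer_exists:
  assumes z: "z \<in> sobolev_space \<Omega> psi"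
  shows "\<exists>u \<in> dirichlet_class \<Omega> psi z. energy \<Omega> psi u = (INF v \<in> dirichlet_class \<Omega> psi z. energy \<Omega> psi v)"
proof -
  obtain Gz where Wz: "W_pair z Gz" using z by (auto simp: sobolev_space_iff)
  note Z = W_pairD[OF Wz]
  have en: "energy \<Omega> psi (\<lambda>x. z x + w x) = modular (\<lambda>x. norm (Gz x + G x))" if "W0_pair w G" for w G
  proof -
    have "W_pair w G" using that by (simp add: W0_pair_def)
    then have "W_pair (\<lambda>x. 1 * z x + 1 * w x) (\<lambda>x. 1 *\<^sub>R Gz x + 1 *\<^sub>R G x)"
      by (rule W_pair_linear_combination[OF Wz])
    then show ?thesis by (intro energy_eq_modular) (simp add: W_pair_def)
  qed
  obtain u F where u: "W0_pair u F"
    "\<And>w G. W0_pair w G \<Longrightarrow> modular (\<lambda>x. norm (Gz x + F x)) \<le> modular (\<lambda>x. norm (Gz x + G x))"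
    using W0_pair_minimizer[OF Z(5,4)] by blast
  have mem: "(\<lambda>x. z x + u x) \<in> dirichlet_class \<Omega> psi z"
    using W0_pair_imp_sobolev_space_0[OF u(1)] unfolding dirichlet_class_def by blast
  have "energy \<Omega> psi (\<lambda>x. z x + u x) \<le> energy \<Omega> psi v" if v: "v \<in> dirichlet_class \<Omega> psi z" for v
  proof -
    obtain w where w: "v = (\<lambda>x. z x + w x)" "w \<in> sobolev_space_0 \<Omega> psi"
      using v unfolding dirichlet_class_def by blast
    obtain G where G: "W0_pair w G" using sobolev_space_0_imp_W0_pair[OF w(2)] by blast
    show ?thesis unfolding w(1) en[OF G] en[OF u(1)] by (rule u(2)[OF G])
  qed
  then have "energy \<Omega> psi (\<lambda>x. z x + u x) = (INF v \<in> dirichlet_class \<Omega> psi z. energy \<Omega> psi v)"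
    using mem by (intro antisym INF_greatest INF_lower) auto
  with mem show ?thesis by blast
qed

end

section \<open>The degenerate weight, and the conclusion\<close>

text \<open>All Luxemburg norms vanish here. The lemma serves to make the Dirichlet class
  nonempty.\<close>

lemma zero_in_sobolev_space_0_null_weight:
  fixes \<Omega> :: "'a::euclidean_space set"
  assumes \<psi>: "AE x in lebesgue. \<forall>t. \<psi> x t = 0"
  shows "(\<lambda>x. 0) \<in> sobolev_space_0 \<Omega> \<psi>"
proof -
  have int: "(\<integral>\<^sup>+x\<in>\<Omega>. \<psi> x (g x) \<partial>lebesgue) = 0" for g
  proof -
    have "(\<integral>\<^sup>+x\<in>\<Omega>. \<psi> x (g x) \<partial>lebesgue) = (\<integral>\<^sup>+x. 0 \<partial>(lebesgue :: 'a measure))"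
      using \<psi> by (intro nn_integral_cong_AE, eventually_elim) auto
    then show ?thesis by simp
  qed
  have lux: "luxemburg_norm \<Omega> \<psi> f = 0" for f
  proof (rule ccontr)
    assume "luxemburg_norm \<Omega> \<psi> f \<noteq> 0"
    then obtain y where y: "0 < y" "y < luxemburg_norm \<Omega> \<psi> f" using dense[of 0 "luxemburg_norm \<Omega> \<psi> f"] by (auto simp: zero_less_iff_neq_zero)
    then have "y \<noteq> 0" "y \<noteq> \<infinity>" by (auto simp: top.extremum_strict)
    then obtain l where l: "0 < l" "y = ennreal l" using ennreal_positive_finiteE by blast
    then have "luxemburg_norm \<Omega> \<psi> f \<le> y"
      unfolding luxemburg_norm_def by (intro Inf_lower) (auto simp: int)
    with y show False by simp
  qed
  have t: "(\<lambda>x. 0) \<in> test_functions \<Omega>" by (rule test_functions_zero)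
  have "(\<lambda>x::'a. 0::real) locally_integrable_on \<Omega>" by (intro locally_integrable_on_continuous) auto
  then have "(\<lambda>x. 0) \<in> sobolev_space \<Omega> \<psi>"
    using has_weak_gradient_test_function[OF t] by (auto simp: sobolev_space_def orlicz_space_def sobolev_norm_def lux)
  with t show ?thesis
    unfolding sobolev_space_0_def by (auto simp: sobolev_norm_def lux intro!: bexI[of _ "\<lambda>x. 0"])
qed

theorem theorem3p11:
  fixes \<Omega> :: "(real ^ 'n) set"
    and p q :: real
    and \<omega> :: "real ^ 'n \<Rightarrow> real"
    and \<phi> \<psi> :: "real ^ 'n \<Rightarrow> real \<Rightarrow> ennreal"
    and z :: "real ^ 'n \<Rightarrow> real"
  assumes "2 \<le> CARD('n)"
    and "open \<Omega>" "connected \<Omega>" "\<Omega> \<noteq> {}" "bounded \<Omega>"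
    and "1 < p" "p \<le> q"
    and "\<omega> \<in> Muckenhoupt p"
    and "\<phi> \<in> Phi_convex \<Omega>"
    and "A1 \<Omega> \<omega> \<phi>" "aInc \<Omega> p \<phi>" "aDec \<Omega> q \<phi>"
    and \<psi>: "\<psi> = (\<lambda>x t. \<phi> x t * ennreal (\<omega> x))"
    and "z \<in> sobolev_space \<Omega> \<psi>"
  shows "\<exists>u \<in> dirichlet_class \<Omega> \<psi> z.
    energy \<Omega> \<psi> u = (INF v \<in> dirichlet_class \<Omega> \<psi> z. energy \<Omega> \<psi> v)"
proof (cases "AE x in lebesgue. \<omega> x = 0")
  case True
  then have null: "AE x in lebesgue. \<forall>t. \<psi> x t = 0"
    by eventually_elim (simp add: \<psi>)
  have energy0: "energy \<Omega> \<psi> v = 0" for v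
  proof -
    have "energy \<Omega> \<psi> v = (\<integral>\<^sup>+x. 0 \<partial>(lebesgue :: (real ^ 'n) measure))"
      unfolding energy_def using null by (intro nn_integral_cong_AE, eventually_elim) auto
    then show ?thesis by simp
  qed
  \<comment> \<open>A member is needed both as the minimizer and because the infimum over an empty
    class would be \<infinity> instead of 0.\<close>
  have mem: "(\<lambda>x. z x + 0) \<in> dirichlet_class \<Omega> \<psi> z"
    using zero_in_sobolev_space_0_null_weight[OF null, of \<Omega>]
    unfolding dirichlet_class_def by (intro CollectI exI[of _ "\<lambda>x. 0"]) auto
  then have "dirichlet_class \<Omega> \<psi> z \<noteq> {}" by blast
  then show ?thesis by (intro bexI[OF _ mem]) (simp add: energy0)
next
  case False
  then have pos: "AE x in lebesgue. 0 < \<omega> x"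
    using Muckenhoupt_zero_or_positive[OF \<open>\<omega> \<in> Muckenhoupt p\<close> \<open>1 < p\<close>] by blast
  obtain K where K: "0 \<le> K" "\<And>c r. 0 < r \<Longrightarrow> \<exists>w s v. 0 < w \<and> 0 < s \<and> 0 < v \<and>
     weight_measure \<omega> (ball c r) = ennreal w \<and>
     (\<integral>\<^sup>+x\<in>ball c r. ennreal (\<omega> x powr (- 1 / (p - 1))) \<partial>lebesgue) = ennreal s \<and>
     emeasure lebesgue (ball c r) = ennreal v \<and> (w / v) * (s / v) powr (p - 1) \<le> K"
    using Muckenhoupt_ball_bound[OF \<open>\<omega> \<in> Muckenhoupt p\<close> \<open>1 < p\<close> pos] by blast
  obtain L1 where L1: "1 \<le> L1" "\<And>x. x \<in> \<Omega> \<Longrightarrow> almost_increasing_on {0<..} L1 (\<lambda>t. ennreal (t powr (- p)) * \<phi> x t)"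
    using \<open>aInc \<Omega> p \<phi>\<close> by (auto simp: aInc_def)
  obtain L2 where L2: "1 \<le> L2" "\<And>x. x \<in> \<Omega> \<Longrightarrow> almost_decreasing_on {0<..} L2 (\<lambda>t. ennreal (t powr (- q)) * \<phi> x t)"
    using \<open>aDec \<Omega> q \<phi>\<close> by (auto simp: aDec_def)
  \<comment> \<open>Both growth conditions survive an enlargement of the constant, so one L serves
    for both.\<close>
  define L where "L = max L1 L2"
  have L1L: "ennreal L1 * c \<le> ennreal L * c" and L2L: "ennreal L2 * c \<le> ennreal L * c" for c
    by (auto simp: L_def intro!: mult_right_mono ennreal_leI)
  obtain \<beta> where \<beta>: "0 < \<beta>" "\<beta> \<le> 1" "\<And>c r t. 0 < r \<Longrightarrow> weight_measure \<omega> (ball c r) \<le> 1 \<Longrightarrow> 1 \<le> t \<Longrightarrow>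
      ennreal t \<le> 1 / weight_measure \<omega> (ball c r) \<Longrightarrow>
      AE x in lebesgue_on (ball c r \<inter> \<Omega>). AE y in lebesgue_on (ball c r \<inter> \<Omega>).
        \<beta> * left_inverse \<phi> x t \<le> left_inverse \<phi> y t"
    using \<open>A1 \<Omega> \<omega> \<phi>\<close> unfolding A1_def by blast
  interpret Phi_A1 \<Omega> p q L \<omega> \<phi> \<beta> K
  proof
    show "weight \<omega>" using \<open>\<omega> \<in> Muckenhoupt p\<close> by (simp add: Muckenhoupt_def)
    show "1 \<le> L" using L1 by (simp add: L_def)
    show "almost_increasing_on {0<..} L (\<lambda>t. ennreal (t powr (- p)) * \<phi> x t)" if "x \<in> \<Omega>" for x
      using L1(2)[OF that] L1L unfolding almost_increasing_on_def by (meson order_trans)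
    show "almost_decreasing_on {0<..} L (\<lambda>t. ennreal (t powr (- q)) * \<phi> x t)" if "x \<in> \<Omega>" for x
      using L2(2)[OF that] L2L unfolding almost_decreasing_on_def by (meson order_trans)
  qed (use assms pos K \<beta> in \<open>blast+\<close>)
  show ?thesis using energy_minimizer_exists[of z] assms(14) unfolding \<psi> by blast
qed

end
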